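(* Let $k$ be a field and let $V$ be a complex of $k$-vector spaces with $\sum_i\dim_k V^i<\infty$. For any DG $k$-algebras $R$ and $S$ and any commutative DG $k$-algebra $B$, there are canonical isomorphisms (a) $\mathrm{Hom}_{\mathrm{DGA}}(\sqrt[V]{R},S)\cong\mathrm{Hom}_{\mathrm{DGA}}(R,S\otimes\mathrm{End}\,V)$, (b) $\mathrm{Hom}_{\mathrm{CommDGA}}(R_V,B)\cong\mathrm{Hom}_{\mathrm{DGA}}(R,B\otimes\mathrm{End}\,V)$.
   Context: DG algebras are associative, unital and $\mathbb{Z}$-graded over $k$, with differential of degree $+1$; commutators and commutativity are in the graded sense. $\mathrm{Hom}_{\mathrm{DGA}}$ and $\mathrm{Hom}_{\mathrm{CommDGA}}$ denote sets of morphisms in the categories of DG $k$-algebras and of commutative DG $k$-algebras; $\otimes=\otimes_k$. $\mathrm{End}\,V$ is the graded endomorphism ring of $V$, naturally a DG algebra. For a DG algebra $R$, $R*_k\mathrm{End}\,V$ is the coproduct in the category of DG $k$-algebras, and $$\sqrt[V]{R}:=(R*_k\mathrm{End}\,V)^{\mathrm{End}\,V}=\{w\in R*_k\mathrm{End}\,V:[w,m]=0\ \text{for all } m\in\mathrm{End}\,V\}.$$ For a DG algebra $S$, $S_\natural:=S/S[S,S]S$ is its abelianization (quotient by the two-sided ideal generated by graded commutators), and $R_V:=(\sqrt[V]{R})_\natural$.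
   Formalization: The complex V is assumed nonzero; for V = 0 the claim fails for unital algebras, since then the V-th root of R is 0 and Hom(0,S) is empty for S ≠ 0, while Hom(R, S⊗End V) = Hom(R,0) is one point. *)

theory Defs
  imports "HOL-Algebra.QuotRing" "Jordan_Normal_Form.Missing_VectorSpace"
begin

section \<open>Complexes and DG algebras\<close>

text \<open>A complex is represented by its total space, the internal direct sum of the subspaces
  \<open>grade V i\<close>. The same record serves for complexes and for DG algebras; the
  fields \<^const>\<open>mult\<close> and \<^const>\<open>one\<close> are ignored in the former case.\<close>

record ('k, 'a) dg = "('k, 'a) module" +
  grade :: "int \<Rightarrow> 'a set"
  diff :: "'a \<Rightarrow> 'a"

definition decomposes :: "('k, 'a) dg \<Rightarrow> 'a \<Rightarrow> (int \<Rightarrow> 'a) \<Rightarrow> bool" where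
  "decomposes V x f \<longleftrightarrow> (\<forall>i. f i \<in> grade V i) \<and> finite {i. f i \<noteq> \<zero>\<^bsub>V\<^esub>} \<and>
     x = (\<Oplus>\<^bsub>V\<^esub>i\<in>{i. f i \<noteq> \<zero>\<^bsub>V\<^esub>}. f i)"

locale cochain_complex = module K V
  for K :: "'k ring" and V :: "('k, 'a) dg" (structure) +
  assumes grade_submodule: "LinearCombinations.submodule K (grade V i) V"
    and grade_direct_sum: "x \<in> carrier V \<Longrightarrow> \<exists>!f. decomposes V x f"
    and diff_grade: "x \<in> grade V i \<Longrightarrow> diff V x \<in> grade V (i + 1)"
    and diff_linear: "diff V \<in> module_hom K V V"
    and diff_diff: "x \<in> carrier V \<Longrightarrow> diff V (diff V x) = \<zero>\<^bsub>V\<^esub>"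

definition component :: "('k, 'a) dg \<Rightarrow> 'a \<Rightarrow> int \<Rightarrow> 'a" where
  "component V x = (THE f. decomposes V x f)"

definition gsupp :: "('k, 'a) dg \<Rightarrow> 'a \<Rightarrow> int set" where
  "gsupp V x = {i. component V x i \<noteq> \<zero>\<^bsub>V\<^esub>}"

definition total_fin_dim :: "'k ring \<Rightarrow> ('k, 'v) dg \<Rightarrow> bool" where
  "total_fin_dim K V \<longleftrightarrow>
     (\<forall>i. vectorspace.fin_dim K (V\<lparr>carrier := grade V i\<rparr>)) \<and>
     finite {i. grade V i \<noteq> {\<zero>\<^bsub>V\<^esub>}}"

definition ksgn :: "('a, 'm) ring_scheme \<Rightarrow> int \<Rightarrow> 'a \<Rightarrow> 'a" where
  "ksgn A n x = (if even n then x else \<ominus>\<^bsub>A\<^esub> x)"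

locale dg_algebra = cochain_complex K A + ring A
  for K :: "'k ring" and A :: "('k, 'a) dg" (structure) +
  assumes smult_mult_left:
      "\<lbrakk>c \<in> carrier K; x \<in> carrier A; y \<in> carrier A\<rbrakk> \<Longrightarrow>
        (c \<odot>\<^bsub>A\<^esub> x) \<otimes>\<^bsub>A\<^esub> y = c \<odot>\<^bsub>A\<^esub> (x \<otimes>\<^bsub>A\<^esub> y)"
    and smult_mult_right:
      "\<lbrakk>c \<in> carrier K; x \<in> carrier A; y \<in> carrier A\<rbrakk> \<Longrightarrow>
        x \<otimes>\<^bsub>A\<^esub> (c \<odot>\<^bsub>A\<^esub> y) = c \<odot>\<^bsub>A\<^esub> (x \<otimes>\<^bsub>A\<^esub> y)"
    and one_grade: "\<one>\<^bsub>A\<^esub> \<in> grade A 0"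
    and mult_grade: "\<lbrakk>x \<in> grade A i; y \<in> grade A j\<rbrakk> \<Longrightarrow> x \<otimes>\<^bsub>A\<^esub> y \<in> grade A (i + j)"
    and leibniz: "\<lbrakk>x \<in> grade A i; y \<in> carrier A\<rbrakk> \<Longrightarrow>
        diff A (x \<otimes>\<^bsub>A\<^esub> y) = diff A x \<otimes>\<^bsub>A\<^esub> y \<oplus>\<^bsub>A\<^esub> ksgn A i (x \<otimes>\<^bsub>A\<^esub> diff A y)"

locale comm_dg_algebra = dg_algebra K A
  for K :: "'k ring" and A :: "('k, 'a) dg" (structure) +
  assumes graded_comm: "\<lbrakk>x \<in> grade A i; y \<in> grade A j\<rbrakk> \<Longrightarrow>
        x \<otimes>\<^bsub>A\<^esub> y = ksgn A (i * j) (y \<otimes>\<^bsub>A\<^esub> x)"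

text \<open>Commutative DG algebras form a full subcategory, so this is also the set of their morphisms.
  Morphisms are extensional, so that equality of maps is equality on the carrier.\<close>

definition dga_hom :: "'k ring \<Rightarrow> ('k, 'a) dg \<Rightarrow> ('k, 'b) dg \<Rightarrow> ('a \<Rightarrow> 'b) set" where
  "dga_hom K A B = {f \<in> ring_hom A B \<inter> module_hom K A B \<inter> extensional (carrier A).
     (\<forall>i. f ` grade A i \<subseteq> grade B i) \<and> (\<forall>x\<in>carrier A. f (diff A x) = diff B (f x))}"

text \<open>Bilinear extension of \<open>[x, y] = x y - (-1)\<^sup>i\<^sup>j y x\<close> for \<open>x\<close>, \<open>y\<close> of degrees \<open>i\<close>, \<open>j\<close>.\<close>

definition gcommutator :: "('k, 'a) dg \<Rightarrow> 'a \<Rightarrow> 'a \<Rightarrow> 'a" where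
  "gcommutator A x y = (\<Oplus>\<^bsub>A\<^esub>i\<in>gsupp A x. \<Oplus>\<^bsub>A\<^esub>j\<in>gsupp A y.
     component A x i \<otimes>\<^bsub>A\<^esub> component A y j
       \<ominus>\<^bsub>A\<^esub> ksgn A (i * j) (component A y j \<otimes>\<^bsub>A\<^esub> component A x i))"


section \<open>Quotients and abelianization\<close>

definition dg_quot :: "('k, 'a) dg \<Rightarrow> 'a set \<Rightarrow> ('k, 'a set) dg" where
  "dg_quot A I =
    \<lparr>carrier = carrier (A Quot I), mult = mult (A Quot I), one = one (A Quot I),
     zero = zero (A Quot I), add = add (A Quot I),
     smult = (\<lambda>c X. I <+>\<^bsub>A\<^esub> ((\<lambda>x. c \<odot>\<^bsub>A\<^esub> x) ` X)),
     grade = (\<lambda>n. (\<lambda>x. I +>\<^bsub>A\<^esub> x) ` grade A n),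
     diff = (\<lambda>X. I <+>\<^bsub>A\<^esub> (diff A ` X))\<rparr>"

definition commutator_ideal :: "('k, 'a) dg \<Rightarrow> 'a set" where
  "commutator_ideal A = Idl\<^bsub>A\<^esub> {gcommutator A x y | x y. x \<in> carrier A \<and> y \<in> carrier A}"

definition abelianization :: "('k, 'a) dg \<Rightarrow> ('k, 'a set) dg" where
  "abelianization A = dg_quot A (commutator_ideal A)"

definition ab_proj :: "('k, 'a) dg \<Rightarrow> 'a \<Rightarrow> 'a set" where
  "ab_proj A x = commutator_ideal A +>\<^bsub>A\<^esub> x"


section \<open>The graded endomorphism algebra\<close>

definition End_part :: "'k ring \<Rightarrow> ('k, 'v) dg \<Rightarrow> int \<Rightarrow> ('v \<Rightarrow> 'v) set" where
  "End_part K V n = {\<phi> \<in> module_hom K V V \<inter> extensional (carrier V).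
     \<forall>i. \<phi> ` grade V i \<subseteq> grade V (i + n)}"

text \<open>The involution acting on \<open>grade V i\<close> as \<open>(-1)\<^sup>i\<close>.\<close>

definition parity :: "('k, 'v) dg \<Rightarrow> 'v \<Rightarrow> 'v" where
  "parity V v = (\<Oplus>\<^bsub>V\<^esub>i\<in>gsupp V v. ksgn V i (component V v i))"

text \<open>For \<open>\<phi>\<close> of degree \<open>n\<close> one has \<open>parity \<circ> \<phi> \<circ> parity = (-1)\<^sup>n \<phi>\<close>, so the differential below is
  the usual \<open>d \<circ> \<phi> - (-1)\<^sup>n \<phi> \<circ> d\<close>, extended linearly.\<close>

definition End_dg :: "'k ring \<Rightarrow> ('k, 'v) dg \<Rightarrow> ('k, 'v \<Rightarrow> 'v) dg" where
  "End_dg K V =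
    \<lparr>carrier = {\<phi>. \<exists>N \<psi>. finite N \<and> (\<forall>n\<in>N. \<psi> n \<in> End_part K V n) \<and>
        \<phi> = (\<lambda>v\<in>carrier V. \<Oplus>\<^bsub>V\<^esub>n\<in>N. \<psi> n v)},
     mult = (\<lambda>\<phi> \<psi>. compose (carrier V) \<phi> \<psi>),
     one = (\<lambda>v\<in>carrier V. v),
     zero = (\<lambda>v\<in>carrier V. \<zero>\<^bsub>V\<^esub>),
     add = (\<lambda>\<phi> \<psi>. \<lambda>v\<in>carrier V. \<phi> v \<oplus>\<^bsub>V\<^esub> \<psi> v),
     smult = (\<lambda>c \<phi>. \<lambda>v\<in>carrier V. c \<odot>\<^bsub>V\<^esub> \<phi> v),
     grade = End_part K V,
     diff = (\<lambda>\<phi>. \<lambda>v\<in>carrier V.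
        diff V (\<phi> v) \<ominus>\<^bsub>V\<^esub> parity V (\<phi> (parity V (diff V v))))\<rparr>"


section \<open>Free modules with structure given on a basis\<close>

definition fsupp :: "'k ring \<Rightarrow> ('x \<Rightarrow> 'k) \<Rightarrow> 'x set" where
  "fsupp K f = {x. f x \<noteq> \<zero>\<^bsub>K\<^esub>}"

definition bvec :: "'k ring \<Rightarrow> 'x \<Rightarrow> 'x \<Rightarrow> 'k" where
  "bvec K x = (\<lambda>y. if y = x then \<one>\<^bsub>K\<^esub> else \<zero>\<^bsub>K\<^esub>)"

text \<open>The free \<open>K\<close>-module on \<open>X\<close>, with product the bilinear extension of \<open>\<mu>\<close>, unit the basis element
  \<open>e\<close>, grading induced by \<open>p\<close>, and degree one operator the linear extension of \<open>\<delta>\<close>. The operator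
  need not square to zero or satisfy other DG axioms before a quotient is taken.\<close>

definition free_dg ::
  "'k ring \<Rightarrow> 'x set \<Rightarrow> ('x \<Rightarrow> 'x \<Rightarrow> 'x \<Rightarrow> 'k) \<Rightarrow> 'x \<Rightarrow> ('x \<Rightarrow> int) \<Rightarrow> ('x \<Rightarrow> 'x \<Rightarrow> 'k)
    \<Rightarrow> ('k, 'x \<Rightarrow> 'k) dg" where
  "free_dg K X \<mu> e p \<delta> =
    (let C = {f. range f \<subseteq> carrier K \<and> finite (fsupp K f) \<and> fsupp K f \<subseteq> X} in
    \<lparr>carrier = C,
     mult = (\<lambda>f g z. \<Oplus>\<^bsub>K\<^esub>x\<in>fsupp K f. \<Oplus>\<^bsub>K\<^esub>y\<in>fsupp K g. f x \<otimes>\<^bsub>K\<^esub> g y \<otimes>\<^bsub>K\<^esub> \<mu> x y z),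
     one = bvec K e,
     zero = (\<lambda>_. \<zero>\<^bsub>K\<^esub>),
     add = (\<lambda>f g z. f z \<oplus>\<^bsub>K\<^esub> g z),
     smult = (\<lambda>c f z. c \<otimes>\<^bsub>K\<^esub> f z),
     grade = (\<lambda>n. {f \<in> C. \<forall>x\<in>fsupp K f. p x = n}),
     diff = (\<lambda>f z. \<Oplus>\<^bsub>K\<^esub>x\<in>fsupp K f. f x \<otimes>\<^bsub>K\<^esub> \<delta> x z)\<rparr>)"


section \<open>Tensor products\<close>

text \<open>The tensor product is built as the direct sum of the spaces \<open>S\<^sup>i \<otimes> T\<^sup>j\<close>: a generator
  \<open>(i, s, j, t)\<close> stands for \<open>s \<otimes> t\<close> with \<open>s\<close>, \<open>t\<close> homogeneous of degrees \<open>i\<close>, \<open>j\<close>.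
  The degrees are recorded because \<open>0\<close> lies in every degree.\<close>

definition tensor_free ::
  "'k ring \<Rightarrow> ('k, 's) dg \<Rightarrow> ('k, 't) dg \<Rightarrow> ('k, int \<times> 's \<times> int \<times> 't \<Rightarrow> 'k) dg" where
  "tensor_free K S T = free_dg K {(i, s, j, t). s \<in> grade S i \<and> t \<in> grade T j}
     (\<lambda>(i, s, j, t) (i', s', j', t') z.
        ksgn K (j * i') (bvec K (i + i', s \<otimes>\<^bsub>S\<^esub> s', j + j', t \<otimes>\<^bsub>T\<^esub> t') z))
     (0, \<one>\<^bsub>S\<^esub>, 0, \<one>\<^bsub>T\<^esub>)
     (\<lambda>(i, s, j, t). i + j)
     (\<lambda>(i, s, j, t) z.
        bvec K (i + 1, diff S s, j, t) z \<oplus>\<^bsub>K\<^esub> ksgn K i (bvec K (i, s, j + 1, diff T t) z))"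

definition tensor_rels ::
  "'k ring \<Rightarrow> ('k, 's) dg \<Rightarrow> ('k, 't) dg \<Rightarrow> (int \<times> 's \<times> int \<times> 't \<Rightarrow> 'k) set" where
  "tensor_rels K S T = (let F = tensor_free K S T in
     {bvec K (i, s \<oplus>\<^bsub>S\<^esub> s', j, t) \<ominus>\<^bsub>F\<^esub> (bvec K (i, s, j, t) \<oplus>\<^bsub>F\<^esub> bvec K (i, s', j, t)) | i s s' j t.
        s \<in> grade S i \<and> s' \<in> grade S i \<and> t \<in> grade T j} \<union>
     {bvec K (i, s, j, t \<oplus>\<^bsub>T\<^esub> t') \<ominus>\<^bsub>F\<^esub> (bvec K (i, s, j, t) \<oplus>\<^bsub>F\<^esub> bvec K (i, s, j, t')) | i s j t t'.
        s \<in> grade S i \<and> t \<in> grade T j \<and> t' \<in> grade T j} \<union>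
     {bvec K (i, c \<odot>\<^bsub>S\<^esub> s, j, t) \<ominus>\<^bsub>F\<^esub> c \<odot>\<^bsub>F\<^esub> bvec K (i, s, j, t) | c i s j t.
        c \<in> carrier K \<and> s \<in> grade S i \<and> t \<in> grade T j} \<union>
     {bvec K (i, s, j, c \<odot>\<^bsub>T\<^esub> t) \<ominus>\<^bsub>F\<^esub> c \<odot>\<^bsub>F\<^esub> bvec K (i, s, j, t) | c i s j t.
        c \<in> carrier K \<and> s \<in> grade S i \<and> t \<in> grade T j})"

definition tensor_kernel ::
  "'k ring \<Rightarrow> ('k, 's) dg \<Rightarrow> ('k, 't) dg \<Rightarrow> (int \<times> 's \<times> int \<times> 't \<Rightarrow> 'k) set" where
  "tensor_kernel K S T = module.span K (tensor_free K S T) (tensor_rels K S T)"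

definition tensor ::
  "'k ring \<Rightarrow> ('k, 's) dg \<Rightarrow> ('k, 't) dg \<Rightarrow> ('k, (int \<times> 's \<times> int \<times> 't \<Rightarrow> 'k) set) dg" where
  "tensor K S T = dg_quot (tensor_free K S T) (tensor_kernel K S T)"

definition pure_tensor ::
  "'k ring \<Rightarrow> ('k, 's) dg \<Rightarrow> ('k, 't) dg \<Rightarrow> 's \<Rightarrow> 't \<Rightarrow> (int \<times> 's \<times> int \<times> 't \<Rightarrow> 'k) set" where
  "pure_tensor K S T s t = (\<Oplus>\<^bsub>tensor K S T\<^esub>i\<in>gsupp S s. \<Oplus>\<^bsub>tensor K S T\<^esub>j\<in>gsupp T t.
     tensor_kernel K S T +>\<^bsub>tensor_free K S T\<^esub> bvec K (i, component S s i, j, component T t j))"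

text \<open>\<open>v \<otimes> id\<close>: unique because pure tensors span.\<close>

definition tensor_map ::
  "'k ring \<Rightarrow> ('k, 't) dg \<Rightarrow> ('k, 's1) dg \<Rightarrow> ('k, 's2) dg \<Rightarrow> ('s1 \<Rightarrow> 's2)
    \<Rightarrow> (int \<times> 's1 \<times> int \<times> 't \<Rightarrow> 'k) set \<Rightarrow> (int \<times> 's2 \<times> int \<times> 't \<Rightarrow> 'k) set" where
  "tensor_map K T S S' v = (THE h. h \<in> dga_hom K (tensor K S T) (tensor K S' T) \<and>
     (\<forall>s\<in>carrier S. \<forall>t\<in>carrier T. h (pure_tensor K S T s t) = pure_tensor K S' T (v s) t))"


section \<open>Coproducts\<close>

text \<open>The coproduct of \<open>A\<close> and \<open>B\<close> is the free algebra on the homogeneous elements of \<open>A\<close> and of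
  \<open>B\<close> (each tagged with its degree), with the differentials of \<open>A\<close> and \<open>B\<close> extended by the Leibniz
  rule, modulo the relations making the two inclusions morphisms of unital algebras.\<close>

type_synonym ('a, 'b) word = "(int \<times> ('a + 'b)) list"

definition word_deg :: "('a, 'b) word \<Rightarrow> int" where
  "word_deg w = sum_list (map fst w)"

definition coprod_free ::
  "'k ring \<Rightarrow> ('k, 'a) dg \<Rightarrow> ('k, 'b) dg \<Rightarrow> ('k, ('a, 'b) word \<Rightarrow> 'k) dg" where
  "coprod_free K A B = free_dg K
     (lists ({(i, Inl x) | i x. x \<in> grade A i} \<union> {(i, Inr y) | i y. y \<in> grade B i}))
     (\<lambda>u v. bvec K (u @ v))
     []
     word_deg
     (\<lambda>w z. \<Oplus>\<^bsub>K\<^esub>p\<in>{..<length w}. ksgn K (word_deg (take p w))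
        (bvec K (w[p := (fst (w ! p) + 1, map_sum (diff A) (diff B) (snd (w ! p)))]) z))"

definition letter_rels ::
  "'k ring \<Rightarrow> ('k, 'w list \<Rightarrow> 'k) dg \<Rightarrow> ('k, 'c) dg \<Rightarrow> (int \<Rightarrow> 'c \<Rightarrow> 'w) \<Rightarrow> ('w list \<Rightarrow> 'k) set" where
  "letter_rels K F A l =
     {bvec K [l i (x \<oplus>\<^bsub>A\<^esub> y)] \<ominus>\<^bsub>F\<^esub> (bvec K [l i x] \<oplus>\<^bsub>F\<^esub> bvec K [l i y]) | i x y.
        x \<in> grade A i \<and> y \<in> grade A i} \<union>
     {bvec K [l i (c \<odot>\<^bsub>A\<^esub> x)] \<ominus>\<^bsub>F\<^esub> c \<odot>\<^bsub>F\<^esub> bvec K [l i x] | c i x.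
        c \<in> carrier K \<and> x \<in> grade A i} \<union>
     {bvec K [l (i + j) (x \<otimes>\<^bsub>A\<^esub> y)] \<ominus>\<^bsub>F\<^esub> bvec K [l i x, l j y] | i j x y.
        x \<in> grade A i \<and> y \<in> grade A j} \<union>
     {bvec K [l 0 \<one>\<^bsub>A\<^esub>] \<ominus>\<^bsub>F\<^esub> bvec K []}"

definition coprod_kernel ::
  "'k ring \<Rightarrow> ('k, 'a) dg \<Rightarrow> ('k, 'b) dg \<Rightarrow> (('a, 'b) word \<Rightarrow> 'k) set" where
  "coprod_kernel K A B = (let F = coprod_free K A B in
     Idl\<^bsub>F\<^esub> (letter_rels K F A (\<lambda>i x. (i, Inl x)) \<union> letter_rels K F B (\<lambda>i y. (i, Inr y))))"

definition coprod ::
  "'k ring \<Rightarrow> ('k, 'a) dg \<Rightarrow> ('k, 'b) dg \<Rightarrow> ('k, (('a, 'b) word \<Rightarrow> 'k) set) dg" where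
  "coprod K A B = dg_quot (coprod_free K A B) (coprod_kernel K A B)"

definition coprod_inl ::
  "'k ring \<Rightarrow> ('k, 'a) dg \<Rightarrow> ('k, 'b) dg \<Rightarrow> 'a \<Rightarrow> (('a, 'b) word \<Rightarrow> 'k) set" where
  "coprod_inl K A B x = (\<Oplus>\<^bsub>coprod K A B\<^esub>i\<in>gsupp A x.
     coprod_kernel K A B +>\<^bsub>coprod_free K A B\<^esub> bvec K [(i, Inl (component A x i))])"

definition coprod_inr ::
  "'k ring \<Rightarrow> ('k, 'a) dg \<Rightarrow> ('k, 'b) dg \<Rightarrow> 'b \<Rightarrow> (('a, 'b) word \<Rightarrow> 'k) set" where
  "coprod_inr K A B y = (\<Oplus>\<^bsub>coprod K A B\<^esub>i\<in>gsupp B y.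
     coprod_kernel K A B +>\<^bsub>coprod_free K A B\<^esub> bvec K [(i, Inr (component B y i))])"

text \<open>\<open>u * id\<close>, given by the universal property of the coproduct.\<close>

definition coprod_map ::
  "'k ring \<Rightarrow> ('k, 'b) dg \<Rightarrow> ('k, 'a1) dg \<Rightarrow> ('k, 'a2) dg \<Rightarrow> ('a1 \<Rightarrow> 'a2)
    \<Rightarrow> (('a1, 'b) word \<Rightarrow> 'k) set \<Rightarrow> (('a2, 'b) word \<Rightarrow> 'k) set" where
  "coprod_map K B A A' u = (THE h. h \<in> dga_hom K (coprod K A B) (coprod K A' B) \<and>
     (\<forall>x\<in>carrier A. h (coprod_inl K A B x) = coprod_inl K A' B (u x)) \<and>
     (\<forall>y\<in>carrier B. h (coprod_inr K A B y) = coprod_inr K A' B y))"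


section \<open>The root algebra and its abelianization\<close>

definition dg_root ::
  "'k ring \<Rightarrow> ('k, 'v) dg \<Rightarrow> ('k, 'r) dg \<Rightarrow> ('k, (('r, 'v \<Rightarrow> 'v) word \<Rightarrow> 'k) set) dg" where
  "dg_root K V R = (let E = End_dg K V; P = coprod K R E;
      C = {w \<in> carrier P. \<forall>m\<in>carrier E. gcommutator P w (coprod_inr K R E m) = \<zero>\<^bsub>P\<^esub>}
    in P\<lparr>carrier := C, grade := (\<lambda>n. grade P n \<inter> C)\<rparr>)"

definition dg_rep ::
  "'k ring \<Rightarrow> ('k, 'v) dg \<Rightarrow> ('k, 'r) dg \<Rightarrow> ('k, (('r, 'v \<Rightarrow> 'v) word \<Rightarrow> 'k) set set) dg" where
  "dg_rep K V R = abelianization (dg_root K V R)"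

definition root_map ::
  "'k ring \<Rightarrow> ('k, 'v) dg \<Rightarrow> ('k, 'r1) dg \<Rightarrow> ('k, 'r2) dg \<Rightarrow> ('r1 \<Rightarrow> 'r2)
    \<Rightarrow> (('r1, 'v \<Rightarrow> 'v) word \<Rightarrow> 'k) set \<Rightarrow> (('r2, 'v \<Rightarrow> 'v) word \<Rightarrow> 'k) set" where
  "root_map K V R R' u = restrict (coprod_map K (End_dg K V) R R' u) (carrier (dg_root K V R))"

definition rep_map ::
  "'k ring \<Rightarrow> ('k, 'v) dg \<Rightarrow> ('k, 'r1) dg \<Rightarrow> ('k, 'r2) dg \<Rightarrow> ('r1 \<Rightarrow> 'r2)
    \<Rightarrow> (('r1, 'v \<Rightarrow> 'v) word \<Rightarrow> 'k) set set \<Rightarrow> (('r2, 'v \<Rightarrow> 'v) word \<Rightarrow> 'k) set set" where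
  "rep_map K V R R' u = (THE h. h \<in> dga_hom K (dg_rep K V R) (dg_rep K V R') \<and>
     (\<forall>w\<in>carrier (dg_root K V R).
        h (ab_proj (dg_root K V R) w) = ab_proj (dg_root K V R') (root_map K V R R' u w)))"


section \<open>The canonical maps\<close>

text \<open>A morphism \<open>f\<close> from the root algebra to \<open>S\<close> extends uniquely to a morphism from the coproduct
  \<open>R * End V\<close> to \<open>S \<otimes> End V\<close> that is \<open>f \<otimes> 1\<close> on the root algebra and \<open>1 \<otimes> id\<close> on \<open>End V\<close>. The
  canonical map sends \<open>f\<close> to the restriction of this extension to \<open>R\<close>. For the abelianization,
  a morphism is first pulled back along the projection.\<close>

definition root_ext ::
  "'k ring \<Rightarrow> ('k, 'v) dg \<Rightarrow> ('k, 'r) dg \<Rightarrow> ('k, 's) dg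
    \<Rightarrow> ((('r, 'v \<Rightarrow> 'v) word \<Rightarrow> 'k) set \<Rightarrow> 's)
    \<Rightarrow> (('r, 'v \<Rightarrow> 'v) word \<Rightarrow> 'k) set \<Rightarrow> (int \<times> 's \<times> int \<times> ('v \<Rightarrow> 'v) \<Rightarrow> 'k) set" where
  "root_ext K V R S f = (let E = End_dg K V in
     THE h. h \<in> dga_hom K (coprod K R E) (tensor K S E) \<and>
       (\<forall>w\<in>carrier (dg_root K V R). h w = pure_tensor K S E (f w) \<one>\<^bsub>E\<^esub>) \<and>
       (\<forall>m\<in>carrier E. h (coprod_inr K R E m) = pure_tensor K S E \<one>\<^bsub>S\<^esub> m))"

definition root_adj ::
  "'k ring \<Rightarrow> ('k, 'v) dg \<Rightarrow> ('k, 'r) dg \<Rightarrow> ('k, 's) dg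
    \<Rightarrow> ((('r, 'v \<Rightarrow> 'v) word \<Rightarrow> 'k) set \<Rightarrow> 's)
    \<Rightarrow> 'r \<Rightarrow> (int \<times> 's \<times> int \<times> ('v \<Rightarrow> 'v) \<Rightarrow> 'k) set" where
  "root_adj K V R S f = compose (carrier R) (root_ext K V R S f) (coprod_inl K R (End_dg K V))"

definition rep_adj ::
  "'k ring \<Rightarrow> ('k, 'v) dg \<Rightarrow> ('k, 'r) dg \<Rightarrow> ('k, 'b) dg
    \<Rightarrow> ((('r, 'v \<Rightarrow> 'v) word \<Rightarrow> 'k) set set \<Rightarrow> 'b)
    \<Rightarrow> 'r \<Rightarrow> (int \<times> 'b \<times> int \<times> ('v \<Rightarrow> 'v) \<Rightarrow> 'k) set" where
  "rep_adj K V R B h =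
     root_adj K V R B (compose (carrier (dg_root K V R)) h (ab_proj (dg_root K V R)))"

end

theory Submission
  imports Defs
begin

text \<open>
  Write \<open>E\<close> for \<open>End V\<close>. The theorem is the graded form of the fact that algebras over a matrix algebra are
  matrix algebras over their centralizer, combined with the universal property of the coproduct.

  A homogeneous basis of \<open>V\<close> gives homogeneous matrix units \<open>e a b\<close> of \<open>E\<close> (\<open>End_matrix_units\<close>). Suppose that
  \<open>E\<close> maps to a DG algebra \<open>P\<close>, and let \<open>C\<close> be the graded centralizer of its image. For homogeneous \<open>w\<close> in \<open>P\<close>
  the elements \<open>psi a b w\<close>, the sums over \<open>c\<close> of \<open>\<plusminus> e c a \<cdot> w \<cdot> e b c\<close> with suitable Koszul signs, lie in \<open>C\<close>
  and \<open>w\<close> is the sum of all \<open>psi a b w \<cdot> e a b\<close>. They are the coordinates of \<open>w\<close> with respect to the matrix units,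
  so multiplication \<open>C \<otimes> E \<rightarrow> P\<close> is an isomorphism of DG algebras (\<open>tensor_cent_iso\<close>). Two algebras \<open>P\<close> matter:

  \<^item> For \<open>P = R * E\<close> the centralizer is the root algebra by definition, whence \<open>R * E\<close> is canonically
    the tensor product of the root algebra with \<open>E\<close> (\<open>root_tensor_iso\<close>).

  \<^item> For \<open>P = S \<otimes> E\<close> the centralizer is \<open>S \<otimes> 1\<close> (\<open>tensor_cent\<close>), and \<open>S\<close> embeds in \<open>S \<otimes> E\<close> because, for
    \<open>V \<noteq> 0\<close>, some linear functional on \<open>E\<close> takes \<open>1\<close> to \<open>1\<close> (\<open>in1_inj\<close>).

  By the first point a morphism \<open>f\<close> from the root algebra to \<open>S\<close> has exactly one extension \<open>f \<otimes> id\<close> to \<open>R * E\<close>, so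
  that the canonical map is well defined. It is injective because a morphism on \<open>R * E\<close> is determined by its
  restrictions to \<open>R\<close> and \<open>E\<close>. It is surjective because a morphism \<open>R \<rightarrow> S \<otimes> E\<close> and the inclusion \<open>1 \<otimes> id\<close> of \<open>E\<close>
  together define a morphism \<open>R * E \<rightarrow> S \<otimes> E\<close>. This morphism respects the maps from \<open>E\<close>, hence carries centralizer to
  centralizer, and by the second point its restriction to the root algebra comes from a morphism to \<open>S\<close>
  (\<open>root_adj_bij\<close>). Naturality holds because both sides come from the same morphism on \<open>R' * E\<close>, again by uniqueness
  of extensions (\<open>root_adj_natural\<close>). Part (b) follows by composing with the universal property of the abelianization
  (\<open>abelianization_lift\<close>).

  What precedes this argument shows that the explicit models of quotients, tensor products, coproducts, endomorphism
  algebras and abelianizations are DG algebras with the expected universal properties. The recurring method is that two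
  linear maps agree, or that a linear map has values in a given submodule, once this holds on homogeneous elements, on
  basis elements of a free module, on pure tensors, or on matrix units.\<close>

section \<open>Signs and linear maps\<close>

lemma ksgn_even [simp]: "even n \<Longrightarrow> ksgn A n x = x"
  by (simp add: ksgn_def)

lemma ksgn_cong: "even m = even n \<Longrightarrow> ksgn A m x = ksgn A n x"
  by (simp add: ksgn_def)

context abelian_group
begin

lemma ksgn_closed [simp, intro]: "x \<in> carrier G \<Longrightarrow> ksgn G n x \<in> carrier G"
  by (simp add: ksgn_def)

lemma ksgn_ksgn [simp]: "x \<in> carrier G \<Longrightarrow> ksgn G m (ksgn G n x) = ksgn G (m + n) x"
  by (simp add: ksgn_def)

lemma ksgn_zero [simp]: "ksgn G n \<zero> = \<zero>"
  by (simp add: ksgn_def)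

lemma ksgn_add: "x \<in> carrier G \<Longrightarrow> y \<in> carrier G \<Longrightarrow> ksgn G n (x \<oplus> y) = ksgn G n x \<oplus> ksgn G n y"
  by (simp add: ksgn_def minus_add)

lemma ksgn_uminus: "x \<in> carrier G \<Longrightarrow> ksgn G n (\<ominus> x) = \<ominus> ksgn G n x"
  by (simp add: ksgn_def)

lemma ksgn_succ: "x \<in> carrier G \<Longrightarrow> odd m \<noteq> odd n \<Longrightarrow> ksgn G m x = \<ominus> ksgn G n x"
  by (auto simp: ksgn_def)

lemma ksgn_eq_iff [simp]: "x \<in> carrier G \<Longrightarrow> y \<in> carrier G \<Longrightarrow> ksgn G n x = ksgn G n y \<longleftrightarrow> x = y"
  by (metis ksgn_def minus_minus)

lemma minus_eq_zero_iff: "x \<in> carrier G \<Longrightarrow> y \<in> carrier G \<Longrightarrow> x \<ominus> y = \<zero> \<longleftrightarrow> x = y"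
  by (metis a_minus_def add.inv_closed minus_equality minus_minus r_neg)

end

lemma (in module) ksgn_smult [simp]:
  "c \<in> carrier R \<Longrightarrow> x \<in> carrier M \<Longrightarrow> c \<odot>\<^bsub>M\<^esub> ksgn M n x = ksgn M n (c \<odot>\<^bsub>M\<^esub> x)"
  by (simp add: ksgn_def smult_r_minus)

lemma (in module) smult_ksgn_scalar [simp]:
  "c \<in> carrier R \<Longrightarrow> x \<in> carrier M \<Longrightarrow> ksgn R n c \<odot>\<^bsub>M\<^esub> x = ksgn M n (c \<odot>\<^bsub>M\<^esub> x)"
  by (simp add: ksgn_def smult_l_minus)

lemma (in ring) ksgn_mult_left [simp]:
  "x \<in> carrier R \<Longrightarrow> y \<in> carrier R \<Longrightarrow> ksgn R n x \<otimes> y = ksgn R n (x \<otimes> y)"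
  by (simp add: ksgn_def l_minus)

lemma (in ring) ksgn_mult_right [simp]:
  "x \<in> carrier R \<Longrightarrow> y \<in> carrier R \<Longrightarrow> x \<otimes> ksgn R n y = ksgn R n (x \<otimes> y)"
  by (simp add: ksgn_def r_minus)

lemma module_homI:
  assumes "\<And>x. x \<in> carrier A \<Longrightarrow> f x \<in> carrier M"
    and "\<And>x y. x \<in> carrier A \<Longrightarrow> y \<in> carrier A \<Longrightarrow> f (x \<oplus>\<^bsub>A\<^esub> y) = f x \<oplus>\<^bsub>M\<^esub> f y"
    and "\<And>c x. c \<in> carrier K \<Longrightarrow> x \<in> carrier A \<Longrightarrow> f (c \<odot>\<^bsub>A\<^esub> x) = c \<odot>\<^bsub>M\<^esub> f x"
  shows "f \<in> module_hom K A M"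
  using assms by (auto simp: module_hom_def)

lemma module_hom_in: "f \<in> module_hom K A M \<Longrightarrow> x \<in> carrier A \<Longrightarrow> f x \<in> carrier M"
  by (auto simp: module_hom_def)

lemma module_hom_comp:
  assumes "f \<in> module_hom K A M" "g \<in> module_hom K M N"
  shows "(\<lambda>x. g (f x)) \<in> module_hom K A N"
  using assms
  by (intro module_homI) (simp_all add: module_hom_in module_hom_add[OF assms(1)] module_hom_add[OF assms(2)]
      module_hom_smult[OF assms(1)] module_hom_smult[OF assms(2)])

lemma mod_homI: "module K A \<Longrightarrow> module K M \<Longrightarrow> f \<in> module_hom K A M \<Longrightarrow> mod_hom K A M f"
  by (simp add: mod_hom_def mod_hom_axioms_def)

context mod_hom
begin

lemma f_ksgn: "x \<in> carrier M \<Longrightarrow> f (ksgn M n x) = ksgn N n (f x)"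
  by (simp add: ksgn_def)

lemma f_finsum:
  assumes "g \<in> I \<rightarrow> carrier M"
  shows "f (\<Oplus>\<^bsub>M\<^esub>i\<in>I. g i) = (\<Oplus>\<^bsub>N\<^esub>i\<in>I. f (g i))"
proof (cases "finite I")
  case True
  then show ?thesis using assms
    by (induction I) (simp_all add: Pi_def)
next
  case False
  then show ?thesis by (simp add: M.M.finsum_infinite N.M.finsum_infinite)
qed

end

lemma zero_submodule: "module K M \<Longrightarrow> LinearCombinations.submodule K {\<zero>\<^bsub>M\<^esub>} M"
proof -
  assume M: "module K M"
  interpret M: module K M by fact
  show ?thesis by (rule LinearCombinations.submodule.intro[OF M]) auto
qed

lemma module_hom_finsum:
  assumes "module K A" "module K M" "\<And>i. i \<in> I \<Longrightarrow> g i \<in> module_hom K A M"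
  shows "(\<lambda>x. \<Oplus>\<^bsub>M\<^esub>i\<in>I. g i x) \<in> module_hom K A M"
proof (cases "finite I")
  interpret A: module K A by fact
  interpret M: module K M by fact
  case True
  have c: "\<And>x. x \<in> carrier A \<Longrightarrow> (\<lambda>i. g i x) \<in> I \<rightarrow> carrier M"
    using assms by (auto intro: module_hom_in)
  show ?thesis
  proof (rule module_homI)
    fix x y assume xy: "x \<in> carrier A" "y \<in> carrier A"
    have "(\<Oplus>\<^bsub>M\<^esub>i\<in>I. g i (x \<oplus>\<^bsub>A\<^esub> y)) = (\<Oplus>\<^bsub>M\<^esub>i\<in>I. g i x \<oplus>\<^bsub>M\<^esub> g i y)"
      using xy assms(3) c[OF xy(1)] c[OF xy(2)]
      by (intro M.finsum_cong') (auto simp: module_hom_add[OF assms(3)] intro!: M.a_closed module_hom_in[OF assms(3)])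
    then show "(\<Oplus>\<^bsub>M\<^esub>i\<in>I. g i (x \<oplus>\<^bsub>A\<^esub> y)) = (\<Oplus>\<^bsub>M\<^esub>i\<in>I. g i x) \<oplus>\<^bsub>M\<^esub> (\<Oplus>\<^bsub>M\<^esub>i\<in>I. g i y)"
      using c xy by (simp add: M.finsum_addf)
  next
    fix k x assume kx: "k \<in> carrier K" "x \<in> carrier A"
    have "(\<Oplus>\<^bsub>M\<^esub>i\<in>I. g i (k \<odot>\<^bsub>A\<^esub> x)) = (\<Oplus>\<^bsub>M\<^esub>i\<in>I. k \<odot>\<^bsub>M\<^esub> g i x)"
      using kx assms(3) c[OF kx(2)]
      by (intro M.finsum_cong') (auto simp: module_hom_smult[OF assms(3)] intro!: M.smult_closed module_hom_in[OF assms(3)])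
    then show "(\<Oplus>\<^bsub>M\<^esub>i\<in>I. g i (k \<odot>\<^bsub>A\<^esub> x)) = k \<odot>\<^bsub>M\<^esub> (\<Oplus>\<^bsub>M\<^esub>i\<in>I. g i x)"
      using c kx True by (simp add: M.finsum_smult_ldistr)
  qed (use c in \<open>auto intro: M.finsum_closed\<close>)
next
  interpret M: module K M by fact
  case False
  then show ?thesis by (auto intro!: module_homI simp: M.finsum_infinite)
qed

lemma module_hom_ksgn:
  assumes "module K M" "f \<in> module_hom K A M"
  shows "(\<lambda>x. ksgn M n (f x)) \<in> module_hom K A M"
proof -
  interpret M: module K M by fact
  show ?thesis using assms(2)
    by (auto intro!: module_homI M.ksgn_closed
        simp: module_hom_add[OF assms(2)] module_hom_smult[OF assms(2)] M.ksgn_add module_hom_in)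
qed

lemma module_hom_add2:
  assumes "module K M" "f \<in> module_hom K A M" "g \<in> module_hom K A M"
  shows "(\<lambda>x. f x \<oplus>\<^bsub>M\<^esub> g x) \<in> module_hom K A M"
proof -
  interpret M: module K M by fact
  show ?thesis using assms(2,3)
    by (auto intro!: module_homI simp: module_hom_add[OF assms(2)] module_hom_smult[OF assms(2)]
        module_hom_add[OF assms(3)] module_hom_smult[OF assms(3)] module_hom_in M.smult_r_distr M.a_ac)
qed

lemma module_hom_minus2:
  assumes "module K M" "f \<in> module_hom K A M" "g \<in> module_hom K A M"
  shows "(\<lambda>x. f x \<ominus>\<^bsub>M\<^esub> g x) \<in> module_hom K A M"
proof -
  interpret M: module K M by fact
  have "(\<lambda>x. f x \<oplus>\<^bsub>M\<^esub> ksgn M 1 (g x)) \<in> module_hom K A M"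
    by (intro module_hom_add2 module_hom_ksgn assms)
  then show ?thesis by (simp add: ksgn_def a_minus_def)
qed

section \<open>Graded modules\<close>

locale graded_module = module K V
  for K :: "'k ring" and V :: "('k, 'a) dg" (structure) +
  assumes grade_submodule: "LinearCombinations.submodule K (grade V i) V"
    and grade_direct_sum: "x \<in> carrier V \<Longrightarrow> \<exists>!f. decomposes V x f"
begin

lemma module_axiom: "module K V"
  by unfold_locales

lemma grade_carrier [intro]: "x \<in> grade V i \<Longrightarrow> x \<in> carrier V"
  using LinearCombinations.submodule.subset[OF grade_submodule] by blast

lemma zero_grade [simp, intro]: "\<zero> \<in> grade V i"
  using LinearCombinations.submodule.zero_closed[OF grade_submodule] .

lemma add_grade [intro]: "x \<in> grade V i \<Longrightarrow> y \<in> grade V i \<Longrightarrow> x \<oplus> y \<in> grade V i"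
  using LinearCombinations.submodule.m_closed[OF grade_submodule] by blast

lemma smult_grade [intro]: "c \<in> carrier K \<Longrightarrow> x \<in> grade V i \<Longrightarrow> c \<odot> x \<in> grade V i"
  using LinearCombinations.submodule.smult_closed[OF grade_submodule] by blast

lemma uminus_grade [intro]: "x \<in> grade V i \<Longrightarrow> \<ominus> x \<in> grade V i"
  using smult_grade[of "\<ominus>\<^bsub>K\<^esub> \<one>\<^bsub>K\<^esub>" x i] smult_l_minus[of "\<one>\<^bsub>K\<^esub>" x] grade_carrier by auto

lemma minus_grade [intro]: "x \<in> grade V i \<Longrightarrow> y \<in> grade V i \<Longrightarrow> x \<ominus> y \<in> grade V i"
  by (auto simp: a_minus_def)

lemma ksgn_grade [intro]: "x \<in> grade V i \<Longrightarrow> ksgn V n x \<in> grade V i"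
  by (auto simp: ksgn_def)

lemma finsum_grade: "(\<And>j. j \<in> N \<Longrightarrow> f j \<in> grade V i) \<Longrightarrow> (\<Oplus>j\<in>N. f j) \<in> grade V i"
proof (induction N rule: infinite_finite_induct)
  case (insert x F)
  then show ?case by (subst finsum_insert) (auto intro: grade_carrier)
qed (auto simp: finsum_infinite)

lemma grade_module: "module K (V\<lparr>carrier := grade V i\<rparr>)"
  using submodule_is_module[OF grade_submodule] .

lemma decomposes_component: "x \<in> carrier V \<Longrightarrow> decomposes V x (component V x)"
  unfolding component_def by (rule theI'[OF grade_direct_sum])

lemma component_grade [intro]: "x \<in> carrier V \<Longrightarrow> component V x i \<in> grade V i"
  using decomposes_component by (auto simp: decomposes_def)

lemma component_closed [simp, intro]: "x \<in> carrier V \<Longrightarrow> component V x i \<in> carrier V"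
  using component_grade grade_carrier by blast

lemma finite_gsupp [simp, intro]: "x \<in> carrier V \<Longrightarrow> finite (gsupp V x)"
  using decomposes_component by (auto simp: decomposes_def gsupp_def)

lemma component_sum: "x \<in> carrier V \<Longrightarrow> (\<Oplus>i\<in>gsupp V x. component V x i) = x"
  using decomposes_component by (auto simp: decomposes_def gsupp_def)

lemma component_sum_superset:
  assumes "x \<in> carrier V" "finite N" "gsupp V x \<subseteq> N"
  shows "(\<Oplus>i\<in>N. component V x i) = x"
proof -
  have "(\<Oplus>i\<in>gsupp V x. component V x i) = (\<Oplus>i\<in>N. component V x i)"
    using assms by (intro add.finprod_mono_neutral_cong_left) (auto simp: gsupp_def)
  then show ?thesis using component_sum assms by simp
qed

lemma component_eqI:
  assumes "finite N" "\<And>i. i \<in> N \<Longrightarrow> f i \<in> grade V i"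
  shows "component V (\<Oplus>i\<in>N. f i) j = (if j \<in> N then f j else \<zero>)"
proof -
  let ?f = "\<lambda>j. if j \<in> N then f j else \<zero>"
  have "(\<Oplus>i\<in>{i. ?f i \<noteq> \<zero>}. ?f i) = (\<Oplus>i\<in>N. f i)"
    using assms by (intro add.finprod_mono_neutral_cong_left) (auto split: if_splits)
  moreover have "finite {i. ?f i \<noteq> \<zero>}"
    using assms(1) by (rule rev_finite_subset) (auto split: if_splits)
  ultimately have d: "decomposes V (\<Oplus>i\<in>N. f i) ?f"
    using assms by (auto simp: decomposes_def)
  have "(\<Oplus>i\<in>N. f i) \<in> carrier V"
    using assms by (auto intro!: finsum_closed)
  from grade_direct_sum[OF this] decomposes_component[OF this] d
  have "component V (\<Oplus>i\<in>N. f i) = ?f" by blast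
  then show ?thesis by simp
qed

lemma component_homog: "x \<in> grade V i \<Longrightarrow> component V x j = (if j = i then x else \<zero>)"
  using component_eqI[of "{i}" "\<lambda>_. x"] grade_carrier by auto

lemma component_zero [simp]: "component V \<zero> j = \<zero>"
  using component_homog[of \<zero> 0] by auto

lemma component_hom: "(\<lambda>x. component V x j) \<in> module_hom K V V"
proof (rule module_homI)
  fix x y assume xy: "x \<in> carrier V" "y \<in> carrier V"
  let ?N = "gsupp V x \<union> gsupp V y"
  have N: "finite ?N" using xy by auto
  have "(\<Oplus>i\<in>?N. component V x i \<oplus> component V y i) = x \<oplus> y"
    using xy N component_sum_superset[of x ?N] component_sum_superset[of y ?N]
    by (subst finsum_addf) (auto)
  then have "component V (x \<oplus> y) j = (if j \<in> ?N then component V x j \<oplus> component V y j else \<zero>)"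
    using component_eqI[OF N, of "\<lambda>i. component V x i \<oplus> component V y i" j] xy
    by (simp add: add_grade component_grade)
  then show "component V (x \<oplus> y) j = component V x j \<oplus> component V y j"
    using xy by (auto simp: gsupp_def)
next
  fix c x assume cx: "c \<in> carrier K" "x \<in> carrier V"
  let ?N = "gsupp V x"
  have "(\<Oplus>i\<in>?N. c \<odot> component V x i) = c \<odot> x"
    using cx component_sum[of x] finsum_smult_ldistr[of ?N c "component V x"] by auto
  then have "component V (c \<odot> x) j = (if j \<in> ?N then c \<odot> component V x j else \<zero>)"
    using component_eqI[of ?N "\<lambda>i. c \<odot> component V x i" j] cx
    by (simp add: smult_grade component_grade)
  then show "component V (c \<odot> x) j = c \<odot> component V x j"
    using cx by (auto simp: gsupp_def)
qed auto

lemmas component_add = module_hom_add[OF component_hom]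
lemmas component_smult = module_hom_smult[OF component_hom]

lemma graded_induct [consumes 1, case_names homog add]:
  assumes "x \<in> carrier V"
    and homog: "\<And>i x. x \<in> grade V i \<Longrightarrow> P x"
    and add: "\<And>x y. x \<in> carrier V \<Longrightarrow> y \<in> carrier V \<Longrightarrow> P x \<Longrightarrow> P y \<Longrightarrow> P (x \<oplus> y)"
  shows "P x"
proof -
  have "finite N \<Longrightarrow> (\<And>i. i \<in> N \<Longrightarrow> f i \<in> grade V i) \<Longrightarrow> P (\<Oplus>i\<in>N. f i)" for N and f :: "int \<Rightarrow> 'a"
  proof (induction N rule: finite_induct)
    case empty
    then show ?case using homog[of \<zero> 0] by simp
  next
    case (insert i N)
    then have "(\<Oplus>i\<in>insert i N. f i) = f i \<oplus> (\<Oplus>i\<in>N. f i)"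
      by (subst finsum_insert) auto
    moreover have "(\<Oplus>i\<in>N. f i) \<in> carrier V" using insert by (auto intro!: finsum_closed)
    moreover have "P (f i)" "P (\<Oplus>i\<in>N. f i)" "f i \<in> carrier V" using insert homog grade_carrier by blast+
    ultimately show ?case using add by simp
  qed
  from this[of "gsupp V x" "component V x"] component_sum assms(1) show ?thesis by auto
qed

lemma hom_eq_on_carrier:
  assumes "f \<in> module_hom K V M" "g \<in> module_hom K V M"
    and "\<And>i x. x \<in> grade V i \<Longrightarrow> f x = g x" and "x \<in> carrier V"
  shows "f x = g x"
  using assms(4) by (induction rule: graded_induct) (auto simp: assms module_hom_add[OF assms(1)] module_hom_add[OF assms(2)])

lemma grade_if_components_vanish:
  assumes "x \<in> carrier V" "\<And>j. j \<noteq> i \<Longrightarrow> component V x j = \<zero>"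
  shows "x \<in> grade V i"
proof -
  have "gsupp V x \<subseteq> {i}" using assms by (auto simp: gsupp_def)
  from component_sum_superset[OF assms(1) _ this] have "component V x i = x" using assms by simp
  then show ?thesis using component_grade[OF assms(1), of i] by simp
qed

end

sublocale cochain_complex \<subseteq> graded_module K V
  by (intro graded_module.intro graded_module_axioms.intro module_axioms grade_submodule grade_direct_sum)

text \<open>Uniqueness of the decomposition reduces to independence of the graded pieces: the difference
  of two decompositions is a decomposition of zero.\<close>

lemma graded_moduleI:
  fixes K :: "'k ring" and V :: "('k, 'a) dg"
  assumes "module K V"
    and sub: "\<And>i. LinearCombinations.submodule K (grade V i) V"
    and ex: "\<And>x. x \<in> carrier V \<Longrightarrow> \<exists>N f. finite N \<and> (\<forall>i\<in>N. f i \<in> grade V i) \<and> x = (\<Oplus>\<^bsub>V\<^esub>i\<in>N. f i)"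
    and indep: "\<And>N f i. finite N \<Longrightarrow> (\<And>i. i \<in> N \<Longrightarrow> f i \<in> grade V i) \<Longrightarrow> (\<Oplus>\<^bsub>V\<^esub>i\<in>N. f i) = \<zero>\<^bsub>V\<^esub> \<Longrightarrow> i \<in> N \<Longrightarrow> f i = \<zero>\<^bsub>V\<^esub>"
  shows "graded_module K V"
proof -
  interpret module K V by fact
  have gc: "x \<in> grade V i \<Longrightarrow> x \<in> carrier V" for x i
    using LinearCombinations.submodule.subset[OF sub] by blast
  have gz: "\<zero>\<^bsub>V\<^esub> \<in> grade V i" for i
    using LinearCombinations.submodule.zero_closed[OF sub] .
  have gm: "x \<ominus>\<^bsub>V\<^esub> y \<in> grade V i" if "x \<in> grade V i" "y \<in> grade V i" for x y i
  proof -
    have "x \<ominus>\<^bsub>V\<^esub> y = x \<oplus>\<^bsub>V\<^esub> (\<ominus>\<^bsub>K\<^esub> \<one>\<^bsub>K\<^esub>) \<odot>\<^bsub>V\<^esub> y"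
      using that gc smult_l_minus[of "\<one>\<^bsub>K\<^esub>" y] by (auto simp: a_minus_def)
    then show ?thesis
      using LinearCombinations.submodule.m_closed[OF sub] LinearCombinations.submodule.smult_closed[OF sub] that
      by auto
  qed
  show ?thesis
  proof (rule graded_module.intro[OF assms(1)], rule graded_module_axioms.intro)
    show "LinearCombinations.submodule K (grade V i) V" for i by (rule sub)
    fix x assume x: "x \<in> carrier V"
    show "\<exists>!f. decomposes V x f"
    proof (rule ex_ex1I)
      obtain N f where N: "finite N" "\<And>i. i \<in> N \<Longrightarrow> f i \<in> grade V i" "x = (\<Oplus>\<^bsub>V\<^esub>i\<in>N. f i)"
        using ex[OF x] by blast
      let ?f = "\<lambda>j. if j \<in> N then f j else \<zero>\<^bsub>V\<^esub>"
      have "(\<Oplus>\<^bsub>V\<^esub>i\<in>{i. ?f i \<noteq> \<zero>\<^bsub>V\<^esub>}. ?f i) = (\<Oplus>\<^bsub>V\<^esub>i\<in>N. f i)"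
        using N gc by (intro add.finprod_mono_neutral_cong_left) (auto split: if_splits)
      moreover have "finite {i. ?f i \<noteq> \<zero>\<^bsub>V\<^esub>}"
        using N(1) by (rule rev_finite_subset) (auto split: if_splits)
      ultimately have "decomposes V x ?f"
        using N gz by (auto simp: decomposes_def)
      then show "\<exists>f. decomposes V x f" by blast
    next
      fix f g assume f: "decomposes V x f" and g: "decomposes V x g"
      let ?N = "{i. f i \<noteq> \<zero>\<^bsub>V\<^esub>} \<union> {i. g i \<noteq> \<zero>\<^bsub>V\<^esub>}"
      have N: "finite ?N" using f g by (auto simp: decomposes_def)
      have c: "f i \<in> grade V i" "g i \<in> grade V i" "f i \<in> carrier V" "g i \<in> carrier V" for i
        using f g gc by (auto simp: decomposes_def)
      have "(\<Oplus>\<^bsub>V\<^esub>i\<in>{i. f i \<noteq> \<zero>\<^bsub>V\<^esub>}. f i) = (\<Oplus>\<^bsub>V\<^esub>i\<in>?N. f i)"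
        using N c by (intro add.finprod_mono_neutral_cong_left) auto
      moreover have "(\<Oplus>\<^bsub>V\<^esub>i\<in>{i. g i \<noteq> \<zero>\<^bsub>V\<^esub>}. g i) = (\<Oplus>\<^bsub>V\<^esub>i\<in>?N. g i)"
        using N c by (intro add.finprod_mono_neutral_cong_left) auto
      ultimately have e: "(\<Oplus>\<^bsub>V\<^esub>i\<in>?N. f i) = (\<Oplus>\<^bsub>V\<^esub>i\<in>?N. g i)"
        using f g by (auto simp: decomposes_def)
      have "(\<Oplus>\<^bsub>V\<^esub>i\<in>?N. f i \<ominus>\<^bsub>V\<^esub> g i) \<oplus>\<^bsub>V\<^esub> (\<Oplus>\<^bsub>V\<^esub>i\<in>?N. g i) = (\<Oplus>\<^bsub>V\<^esub>i\<in>?N. f i \<ominus>\<^bsub>V\<^esub> g i \<oplus>\<^bsub>V\<^esub> g i)"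
        using c by (intro finsum_addf[symmetric]) auto
      also have "\<dots> = (\<Oplus>\<^bsub>V\<^esub>i\<in>?N. f i)"
        using c by (intro finsum_cong') (auto simp: a_minus_def a_assoc l_neg)
      finally have "(\<Oplus>\<^bsub>V\<^esub>i\<in>?N. f i \<ominus>\<^bsub>V\<^esub> g i) = \<zero>\<^bsub>V\<^esub>"
        unfolding e using c by (subst (asm) add.r_cancel_one) (auto intro!: finsum_closed)
      from indep[OF N _ this] have "i \<in> ?N \<Longrightarrow> f i \<ominus>\<^bsub>V\<^esub> g i = \<zero>\<^bsub>V\<^esub>" for i
        using gm[OF c(1,2)] by simp
      then have "f i = g i" for i
        using c by (cases "i \<in> ?N") (auto simp: minus_eq_zero_iff)
      then show "f = g" by auto
    qed
  qed
qed

subsection \<open>Extending maps from homogeneous elements\<close>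

text \<open>The linear map that agrees with \<open>\<phi> i\<close> in degree \<open>i\<close>. The operations in the statement that are sums over
  \<^const>\<open>gsupp\<close> (parity, graded commutators, pure tensors, the inclusions into a coproduct) are all of this form.\<close>

definition gext :: "('k, 'a) dg \<Rightarrow> ('c, 'm) ring_scheme \<Rightarrow> (int \<Rightarrow> 'a \<Rightarrow> 'c) \<Rightarrow> 'a \<Rightarrow> 'c" where
  "gext A M \<phi> x = (\<Oplus>\<^bsub>M\<^esub>i\<in>gsupp A x. \<phi> i (component A x i))"

context graded_module
begin

lemma gext_superset:
  assumes "module K M" "\<And>i. \<phi> i \<in> module_hom K (V\<lparr>carrier := grade V i\<rparr>) M"
    and "x \<in> carrier V" "finite N" "gsupp V x \<subseteq> N"
  shows "gext V M \<phi> x = (\<Oplus>\<^bsub>M\<^esub>i\<in>N. \<phi> i (component V x i))"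
proof -
  interpret M: module K M by fact
  have "\<phi> i \<zero> = \<zero>\<^bsub>M\<^esub>" for i
    using mod_hom.f0_is_0[OF mod_homI[OF grade_module assms(1,2)]] by simp
  moreover have "\<phi> i (component V x i) \<in> carrier M" for i
    using module_hom_in[OF assms(2)] component_grade assms(3) by auto
  ultimately show ?thesis unfolding gext_def
    using assms by (intro M.add.finprod_mono_neutral_cong_left) (auto simp: gsupp_def)
qed

lemma gext_homog:
  assumes "module K M" "\<And>i. \<phi> i \<in> module_hom K (V\<lparr>carrier := grade V i\<rparr>) M" "x \<in> grade V i"
  shows "gext V M \<phi> x = \<phi> i x"
proof -
  interpret M: module K M by fact
  have "gext V M \<phi> x = (\<Oplus>\<^bsub>M\<^esub>i\<in>{i}. \<phi> i (component V x i))"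
    using assms(3) by (intro gext_superset assms) (auto simp: gsupp_def component_homog)
  moreover have "\<phi> i x \<in> carrier M" using module_hom_in[OF assms(2)] assms(3) by auto
  ultimately show ?thesis using component_homog[OF assms(3)] by simp
qed

lemma gext_hom:
  assumes "module K M" "\<And>i. \<phi> i \<in> module_hom K (V\<lparr>carrier := grade V i\<rparr>) M"
  shows "gext V M \<phi> \<in> module_hom K V M"
proof (rule module_homI)
  interpret M: module K M by fact
  have c: "\<phi> i (component V x i) \<in> carrier M" if "x \<in> carrier V" for i x
    using module_hom_in[OF assms(2)] component_grade that by auto
  show "gext V M \<phi> x \<in> carrier M" if "x \<in> carrier V" for x
    unfolding gext_def using c that by (auto intro!: M.finsum_closed)
  fix x y assume xy: "x \<in> carrier V" "y \<in> carrier V"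
  let ?N = "gsupp V x \<union> gsupp V y \<union> gsupp V (x \<oplus> y)"
  have N: "finite ?N" using xy by auto
  have "gext V M \<phi> (x \<oplus> y) = (\<Oplus>\<^bsub>M\<^esub>i\<in>?N. \<phi> i (component V (x \<oplus> y) i))"
    using N xy by (intro gext_superset assms) auto
  also have "\<dots> = (\<Oplus>\<^bsub>M\<^esub>i\<in>?N. \<phi> i (component V x i) \<oplus>\<^bsub>M\<^esub> \<phi> i (component V y i))"
    using xy module_hom_add[OF assms(2)] c
    by (intro M.finsum_cong') (auto simp: component_add component_grade)
  also have "\<dots> = (\<Oplus>\<^bsub>M\<^esub>i\<in>?N. \<phi> i (component V x i)) \<oplus>\<^bsub>M\<^esub> (\<Oplus>\<^bsub>M\<^esub>i\<in>?N. \<phi> i (component V y i))"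
    using xy c by (intro M.finsum_addf) auto
  also have "(\<Oplus>\<^bsub>M\<^esub>i\<in>?N. \<phi> i (component V x i)) = gext V M \<phi> x"
    by (rule gext_superset[OF assms xy(1) N, symmetric]) auto
  also have "(\<Oplus>\<^bsub>M\<^esub>i\<in>?N. \<phi> i (component V y i)) = gext V M \<phi> y"
    by (rule gext_superset[OF assms xy(2) N, symmetric]) auto
  finally show "gext V M \<phi> (x \<oplus> y) = gext V M \<phi> x \<oplus>\<^bsub>M\<^esub> gext V M \<phi> y" .
next
  interpret M: module K M by fact
  fix k x assume kx: "k \<in> carrier K" "x \<in> carrier V"
  have c: "\<phi> i (component V x i) \<in> carrier M" for i
    using module_hom_in[OF assms(2)] component_grade kx by auto
  let ?N = "gsupp V x \<union> gsupp V (k \<odot> x)"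
  have N: "finite ?N" using kx by auto
  have "gext V M \<phi> (k \<odot> x) = (\<Oplus>\<^bsub>M\<^esub>i\<in>?N. \<phi> i (component V (k \<odot> x) i))"
    using N kx by (intro gext_superset assms) auto
  also have "\<dots> = (\<Oplus>\<^bsub>M\<^esub>i\<in>?N. k \<odot>\<^bsub>M\<^esub> \<phi> i (component V x i))"
    using kx module_hom_smult[OF assms(2)] c
    by (intro M.finsum_cong') (auto simp: component_smult component_grade)
  also have "\<dots> = k \<odot>\<^bsub>M\<^esub> (\<Oplus>\<^bsub>M\<^esub>i\<in>?N. \<phi> i (component V x i))"
    using kx c N M.finsum_smult_ldistr[OF N kx(1), of "\<lambda>i. \<phi> i (component V x i)"] by auto
  also have "(\<Oplus>\<^bsub>M\<^esub>i\<in>?N. \<phi> i (component V x i)) = gext V M \<phi> x"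
    by (rule gext_superset[OF assms kx(2) N, symmetric]) auto
  finally show "gext V M \<phi> (k \<odot> x) = k \<odot>\<^bsub>M\<^esub> gext V M \<phi> x" .
qed

end

section \<open>Graded algebras with an operator of degree one\<close>

text \<open>A DG algebra except that the operator need neither square to zero nor satisfy the Leibniz rule. The free objects
  that are divided out in the construction of tensor products and coproducts are of this kind.\<close>

locale pre_dga = graded_module K A + ring A
  for K :: "'k ring" and A :: "('k, 'a) dg" (structure) +
  assumes smult_mult_left:
      "\<lbrakk>c \<in> carrier K; x \<in> carrier A; y \<in> carrier A\<rbrakk> \<Longrightarrow> (c \<odot> x) \<otimes> y = c \<odot> (x \<otimes> y)"
    and smult_mult_right:
      "\<lbrakk>c \<in> carrier K; x \<in> carrier A; y \<in> carrier A\<rbrakk> \<Longrightarrow> x \<otimes> (c \<odot> y) = c \<odot> (x \<otimes> y)"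
    and one_grade: "\<one> \<in> grade A 0"
    and mult_grade: "\<lbrakk>x \<in> grade A i; y \<in> grade A j\<rbrakk> \<Longrightarrow> x \<otimes> y \<in> grade A (i + j)"
    and diff_grade: "x \<in> grade A i \<Longrightarrow> diff A x \<in> grade A (i + 1)"
    and diff_linear: "diff A \<in> module_hom K A A"
begin

lemma diff_closed [simp, intro]: "x \<in> carrier A \<Longrightarrow> diff A x \<in> carrier A"
  by (rule module_hom_in[OF diff_linear])

lemmas diff_add = module_hom_add[OF diff_linear]
lemmas diff_smult = module_hom_smult[OF diff_linear]

lemma diff_mod_hom: "mod_hom K A A (diff A)"
  by (intro mod_homI module_axiom diff_linear)

lemma diff_zero: "diff A \<zero> = \<zero>"
  by (rule mod_hom.f0_is_0[OF diff_mod_hom])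

lemma diff_ksgn: "x \<in> carrier A \<Longrightarrow> diff A (ksgn A n x) = ksgn A n (diff A x)"
  by (rule mod_hom.f_ksgn[OF diff_mod_hom])

lemma mult_left_hom: "a \<in> carrier A \<Longrightarrow> (\<lambda>x. a \<otimes> x) \<in> module_hom K A A"
  by (rule module_homI) (simp_all add: r_distr smult_mult_right)

lemma mult_right_hom: "a \<in> carrier A \<Longrightarrow> (\<lambda>x. x \<otimes> a) \<in> module_hom K A A"
  by (rule module_homI) (simp_all add: l_distr smult_mult_left)

lemma component_mult_left:
  assumes "a \<in> grade A k" "x \<in> carrier A"
  shows "component A (a \<otimes> x) i = a \<otimes> component A x (i - k)"
proof (rule hom_eq_on_carrier[where f = "\<lambda>x. component A (a \<otimes> x) i", OF _ _ _ assms(2)])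
  have a: "a \<in> carrier A" using assms grade_carrier by auto
  show "(\<lambda>x. component A (a \<otimes> x) i) \<in> module_hom K A A"
    by (rule module_hom_comp[OF mult_left_hom[OF a] component_hom])
  show "(\<lambda>x. a \<otimes> component A x (i - k)) \<in> module_hom K A A"
    by (rule module_hom_comp[OF component_hom mult_left_hom[OF a]])
  fix j x assume x: "x \<in> grade A j"
  show "component A (a \<otimes> x) i = a \<otimes> component A x (i - k)"
    using component_homog[OF mult_grade[OF assms(1) x]] component_homog[OF x] a by auto
qed

lemma component_mult_right:
  assumes "a \<in> grade A k" "x \<in> carrier A"
  shows "component A (x \<otimes> a) i = component A x (i - k) \<otimes> a"
proof (rule hom_eq_on_carrier[where f = "\<lambda>x. component A (x \<otimes> a) i", OF _ _ _ assms(2)])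
  have a: "a \<in> carrier A" using assms grade_carrier by auto
  show "(\<lambda>x. component A (x \<otimes> a) i) \<in> module_hom K A A"
    by (rule module_hom_comp[OF mult_right_hom[OF a] component_hom])
  show "(\<lambda>x. component A x (i - k) \<otimes> a) \<in> module_hom K A A"
    by (rule module_hom_comp[OF component_hom mult_right_hom[OF a]])
  fix j x assume x: "x \<in> grade A j"
  show "component A (x \<otimes> a) i = component A x (i - k) \<otimes> a"
    using component_homog[OF mult_grade[OF x assms(1)]] component_homog[OF x] a by auto
qed

lemma dg_algebraI:
  assumes "\<And>x. x \<in> carrier A \<Longrightarrow> diff A (diff A x) = \<zero>"
    and "\<And>i x y. \<lbrakk>x \<in> grade A i; y \<in> carrier A\<rbrakk> \<Longrightarrow>
        diff A (x \<otimes> y) = diff A x \<otimes> y \<oplus> ksgn A i (x \<otimes> diff A y)"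
  shows "dg_algebra K A"
  by (intro dg_algebra.intro cochain_complex.intro cochain_complex_axioms.intro dg_algebra_axioms.intro
      module_axiom ring_axioms grade_submodule grade_direct_sum diff_grade diff_linear
      smult_mult_left smult_mult_right one_grade mult_grade assms)

end

lemma (in dg_algebra) pre_dga: "pre_dga K A"
  by (intro pre_dga.intro pre_dga_axioms.intro graded_module_axioms ring_axioms diff_grade diff_linear
      smult_mult_left smult_mult_right one_grade mult_grade)

sublocale dg_algebra \<subseteq> pre_dga K A
  by (rule pre_dga)

lemma (in dg_algebra) diff_one: "diff A \<one> = \<zero>"
proof -
  have "diff A \<one> = diff A \<one> \<oplus> diff A \<one>" using leibniz[OF one_grade one_closed] by simp
  then show ?thesis using diff_closed[OF one_closed] add.l_cancel_one by (metis one_closed)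
qed

subsection \<open>Morphisms\<close>

text \<open>Morphisms with arbitrary values outside of the carrier. They compose without restricting to carriers;
  restriction turns them into elements of \<^const>\<open>dga_hom\<close>.\<close>

definition dga_map :: "'k ring \<Rightarrow> ('k, 'a) dg \<Rightarrow> ('k, 'b) dg \<Rightarrow> ('a \<Rightarrow> 'b) \<Rightarrow> bool" where
  "dga_map K A B f \<longleftrightarrow> f \<in> ring_hom A B \<and> f \<in> module_hom K A B \<and>
     (\<forall>i. f ` grade A i \<subseteq> grade B i) \<and> (\<forall>x\<in>carrier A. f (diff A x) = diff B (f x))"

lemma dga_hom_iff: "f \<in> dga_hom K A B \<longleftrightarrow> dga_map K A B f \<and> f \<in> extensional (carrier A)"
  by (auto simp: dga_hom_def dga_map_def)

lemma dga_hom_map: "f \<in> dga_hom K A B \<Longrightarrow> dga_map K A B f"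
  by (simp add: dga_hom_iff)

lemma dga_mapI:
  assumes "f \<in> module_hom K A B"
    and "\<And>x y. x \<in> carrier A \<Longrightarrow> y \<in> carrier A \<Longrightarrow> f (x \<otimes>\<^bsub>A\<^esub> y) = f x \<otimes>\<^bsub>B\<^esub> f y"
    and "f \<one>\<^bsub>A\<^esub> = \<one>\<^bsub>B\<^esub>"
    and "\<And>i x. x \<in> grade A i \<Longrightarrow> f x \<in> grade B i"
    and "\<And>x. x \<in> carrier A \<Longrightarrow> f (diff A x) = diff B (f x)"
  shows "dga_map K A B f"
  using assms by (auto simp: dga_map_def ring_hom_def module_hom_def)

lemma dga_map_hom: "dga_map K A B f \<Longrightarrow> f \<in> module_hom K A B"
  by (simp add: dga_map_def)

lemma dga_map_closed: "dga_map K A B f \<Longrightarrow> x \<in> carrier A \<Longrightarrow> f x \<in> carrier B"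
  by (auto simp: dga_map_def intro: module_hom_in)

lemma dga_map_mult: "dga_map K A B f \<Longrightarrow> x \<in> carrier A \<Longrightarrow> y \<in> carrier A \<Longrightarrow> f (x \<otimes>\<^bsub>A\<^esub> y) = f x \<otimes>\<^bsub>B\<^esub> f y"
  by (auto simp: dga_map_def ring_hom_def)

lemma dga_map_one: "dga_map K A B f \<Longrightarrow> f \<one>\<^bsub>A\<^esub> = \<one>\<^bsub>B\<^esub>"
  by (auto simp: dga_map_def ring_hom_def)

lemma dga_map_add: "dga_map K A B f \<Longrightarrow> x \<in> carrier A \<Longrightarrow> y \<in> carrier A \<Longrightarrow> f (x \<oplus>\<^bsub>A\<^esub> y) = f x \<oplus>\<^bsub>B\<^esub> f y"
  by (auto simp: dga_map_def ring_hom_def)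

lemma dga_map_smult: "dga_map K A B f \<Longrightarrow> c \<in> carrier K \<Longrightarrow> x \<in> carrier A \<Longrightarrow> f (c \<odot>\<^bsub>A\<^esub> x) = c \<odot>\<^bsub>B\<^esub> f x"
  by (auto simp: dga_map_def module_hom_def)

lemma dga_map_diff: "dga_map K A B f \<Longrightarrow> x \<in> carrier A \<Longrightarrow> f (diff A x) = diff B (f x)"
  by (auto simp: dga_map_def)

lemma dga_map_grade: "dga_map K A B f \<Longrightarrow> x \<in> grade A i \<Longrightarrow> f x \<in> grade B i"
  by (auto simp: dga_map_def)

lemma dga_map_comp:
  assumes "dga_map K A B f" "dga_map K B C g"
  shows "dga_map K A C (\<lambda>x. g (f x))"
  by (rule dga_mapI)
    (simp_all add: module_hom_comp[OF dga_map_hom[OF assms(1)] dga_map_hom[OF assms(2)]]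
      dga_map_mult[OF assms(1)] dga_map_mult[OF assms(2)] dga_map_closed[OF assms(1)]
      dga_map_one[OF assms(1)] dga_map_one[OF assms(2)] dga_map_grade[OF assms(1)]
      dga_map_grade[OF assms(2)] dga_map_diff[OF assms(1)] dga_map_diff[OF assms(2)])

lemma dga_map_cong:
  assumes "pre_dga K A" "dga_map K A B f" "\<And>x. x \<in> carrier A \<Longrightarrow> g x = f x"
  shows "dga_map K A B g"
proof -
  interpret pre_dga K A by fact
  show ?thesis
    using assms(2) grade_carrier by (auto simp: dga_map_def ring_hom_def module_hom_def Pi_def assms(3))
qed

lemma restrict_dga_hom:
  assumes "pre_dga K A" "dga_map K A B f"
  shows "restrict f (carrier A) \<in> dga_hom K A B"
  using dga_map_cong[OF assms, of "restrict f (carrier A)"] by (simp add: dga_hom_iff)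

lemma dga_hom_eqI:
  assumes "f \<in> dga_hom K A B" "g \<in> dga_hom K A B" "\<And>x. x \<in> carrier A \<Longrightarrow> f x = g x"
  shows "f = g"
  using assms by (intro extensionalityI[of _ "carrier A"]) (auto simp: dga_hom_iff)

text \<open>Morphisms preserve degrees, hence commute with the projections to the graded pieces.\<close>

lemma dga_map_component:
  assumes "graded_module K A" "graded_module K B" "dga_map K A B f" "x \<in> carrier A"
  shows "component B (f x) i = f (component A x i)"
proof -
  interpret A: graded_module K A by fact
  interpret B: graded_module K B by fact
  have f0: "f \<zero>\<^bsub>A\<^esub> = \<zero>\<^bsub>B\<^esub>"
    by (rule mod_hom.f0_is_0[OF mod_homI[OF A.module_axiom B.module_axiom dga_map_hom[OF assms(3)]]])
  show ?thesis
  proof (rule A.hom_eq_on_carrier[where f = "\<lambda>x. component B (f x) i", OF _ _ _ assms(4)])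
    show "(\<lambda>x. component B (f x) i) \<in> module_hom K A B"
      by (rule module_hom_comp[OF dga_map_hom[OF assms(3)] B.component_hom])
    show "(\<lambda>x. f (component A x i)) \<in> module_hom K A B"
      by (rule module_hom_comp[OF A.component_hom dga_map_hom[OF assms(3)]])
    fix j x assume x: "x \<in> grade A j"
    show "component B (f x) i = f (component A x i)"
      using B.component_homog[OF dga_map_grade[OF assms(3) x]] A.component_homog[OF x] f0 by auto
  qed
qed

text \<open>The only point that is not formal is that the inverse preserves degrees: the components of \<open>g y\<close> outside of the degree
  of \<open>y\<close> map to zero under the injective \<open>f\<close>.\<close>

lemma dga_map_inverse:
  assumes "pre_dga K A" "pre_dga K B" "dga_map K A B f"
    and g: "\<And>y. y \<in> carrier B \<Longrightarrow> g y \<in> carrier A" "\<And>x. x \<in> carrier A \<Longrightarrow> g (f x) = x"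
      "\<And>y. y \<in> carrier B \<Longrightarrow> f (g y) = y"
  shows "dga_map K B A g"
proof -
  interpret A: pre_dga K A by fact
  interpret B: pre_dga K B by fact
  have inj: "f x = f y \<Longrightarrow> x \<in> carrier A \<Longrightarrow> y \<in> carrier A \<Longrightarrow> x = y" for x y
    by (metis g(2))
  note f = assms(3)
  have f0: "f \<zero>\<^bsub>A\<^esub> = \<zero>\<^bsub>B\<^esub>"
    by (rule mod_hom.f0_is_0[OF mod_homI[OF A.module_axiom B.module_axiom dga_map_hom[OF f]]])
  show ?thesis
  proof (rule dga_mapI)
    show "g \<in> module_hom K B A"
    proof (rule module_homI)
      show "g (x \<oplus>\<^bsub>B\<^esub> y) = g x \<oplus>\<^bsub>A\<^esub> g y" if "x \<in> carrier B" "y \<in> carrier B" for x y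
        using that g(1,3) by (intro inj) (simp_all add: dga_map_add[OF f])
      show "g (c \<odot>\<^bsub>B\<^esub> y) = c \<odot>\<^bsub>A\<^esub> g y" if "c \<in> carrier K" "y \<in> carrier B" for c y
        using that g(1,3) by (intro inj) (simp_all add: dga_map_smult[OF f])
    qed (rule g(1))
    show "g (x \<otimes>\<^bsub>B\<^esub> y) = g x \<otimes>\<^bsub>A\<^esub> g y" if "x \<in> carrier B" "y \<in> carrier B" for x y
      using that g(1,3) by (intro inj) (simp_all add: dga_map_mult[OF f])
    show "g \<one>\<^bsub>B\<^esub> = \<one>\<^bsub>A\<^esub>"
      using g(1,3) by (intro inj) (simp_all add: dga_map_one[OF f])
    show "g (diff B y) = diff A (g y)" if "y \<in> carrier B" for y
      using that g(1,3) by (intro inj) (simp_all add: dga_map_diff[OF f])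
    show "g y \<in> grade A i" if y: "y \<in> grade B i" for y i
    proof (rule A.grade_if_components_vanish)
      have yc: "y \<in> carrier B" using y B.grade_carrier by auto
      then show gy: "g y \<in> carrier A" by (rule g(1))
      show "component A (g y) j = \<zero>\<^bsub>A\<^esub>" if "j \<noteq> i" for j
      proof (rule inj)
        have "f (component A (g y) j) = component B (f (g y)) j"
          using dga_map_component[OF A.graded_module_axioms B.graded_module_axioms f gy] by simp
        then show "f (component A (g y) j) = f \<zero>\<^bsub>A\<^esub>"
          using that g(3)[OF yc] B.component_homog[OF y] f0 by simp
      qed (use gy in auto)
    qed
  qed
qed

section \<open>Quotients\<close>

locale alg_ideal = pre_dga K A + ideal I A
  for K :: "'k ring" and A :: "('k, 'a) dg" (structure) and I
begin

abbreviation "Q \<equiv> dg_quot A I"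
abbreviation cl :: "'a \<Rightarrow> 'a set" where "cl x \<equiv> I +> x"

lemma cl_eq: "x \<in> carrier A \<Longrightarrow> y \<in> carrier A \<Longrightarrow> cl x = cl y \<longleftrightarrow> x \<ominus> y \<in> I"
  using quotient_eq_iff_same_a_r_cos[OF ideal_axioms] by simp

lemma cl_zero: "cl \<zero> = I"
  by (rule a_coset_join2) (simp_all add: a_subgroup)

lemma cl_eq_I: "x \<in> carrier A \<Longrightarrow> cl x = I \<longleftrightarrow> x \<in> I"
  using cl_eq[of x \<zero>] cl_zero by (simp add: a_minus_def)

lemma smult_I: "c \<in> carrier K \<Longrightarrow> x \<in> I \<Longrightarrow> c \<odot> x \<in> I"
  using smult_mult_left[of c \<one> x] I_l_closed[of x "c \<odot> \<one>"] a_Hcarr by auto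

text \<open>The operations of the quotient are given in the definition of \<^const>\<open>dg_quot\<close> as images of whole cosets;
  this lemma computes them on representatives.\<close>

lemma coset_image:
  assumes h: "h \<in> module_hom K A A" and hI: "\<And>x. x \<in> I \<Longrightarrow> h x \<in> I" and x: "x \<in> carrier A"
  shows "I <+>\<^bsub>A\<^esub> (h ` cl x) = cl (h x)"
proof -
  have hc: "h y \<in> carrier A" if "y \<in> carrier A" for y using h that by (rule module_hom_in)
  have "I <+>\<^bsub>A\<^esub> (h ` cl x) \<subseteq> cl (h x)"
  proof
    fix z assume "z \<in> I <+>\<^bsub>A\<^esub> (h ` cl x)"
    then obtain a b where ab: "a \<in> I" "b \<in> I" "z = a \<oplus> h (b \<oplus> x)"
      by (auto simp: set_add_def' a_r_coset_def')
    then have "z = (a \<oplus> h b) \<oplus> h x"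
      using x hc a_Hcarr by (simp add: module_hom_add[OF h] a_assoc)
    then show "z \<in> cl (h x)" using ab hI by (auto simp: a_r_coset_def' intro!: bexI[of _ "a \<oplus> h b"])
  qed
  moreover have "cl (h x) \<subseteq> I <+>\<^bsub>A\<^esub> (h ` cl x)"
  proof
    fix z assume "z \<in> cl (h x)"
    then obtain a where a: "a \<in> I" "z = a \<oplus> h x" by (auto simp: a_r_coset_def')
    moreover have "x \<in> cl x" using x additive_subgroup.zero_closed[OF is_additive_subgroup]
      by (auto simp: a_r_coset_def' intro!: bexI[of _ \<zero>])
    ultimately show "z \<in> I <+>\<^bsub>A\<^esub> (h ` cl x)" by (auto simp: set_add_def')
  qed
  ultimately show ?thesis by auto
qed

lemma Q_carrier: "carrier Q = cl ` carrier A"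
  by (auto simp: dg_quot_def FactRing_def A_RCOSETS_def' )

lemma Q_add [simp]: "x \<in> carrier A \<Longrightarrow> y \<in> carrier A \<Longrightarrow> cl x \<oplus>\<^bsub>Q\<^esub> cl y = cl (x \<oplus> y)"
  by (simp add: dg_quot_def FactRing_def a_rcos_sum)

lemma Q_mult [simp]: "x \<in> carrier A \<Longrightarrow> y \<in> carrier A \<Longrightarrow> cl x \<otimes>\<^bsub>Q\<^esub> cl y = cl (x \<otimes> y)"
  by (simp add: dg_quot_def FactRing_def rcoset_mult_add)

lemma Q_smult [simp]: "c \<in> carrier K \<Longrightarrow> x \<in> carrier A \<Longrightarrow> c \<odot>\<^bsub>Q\<^esub> cl x = cl (c \<odot> x)"
proof -
  assume c: "c \<in> carrier K" and x: "x \<in> carrier A"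
  have "(\<lambda>x. c \<odot> x) \<in> module_hom K A A"
    using c by (intro module_homI) (auto simp: smult_r_distr R.m_comm simp flip: smult_assoc1)
  then show ?thesis using coset_image[of "\<lambda>x. c \<odot> x" x] smult_I c x by (simp add: dg_quot_def)
qed

lemma Q_zero: "\<zero>\<^bsub>Q\<^esub> = cl \<zero>"
  using cl_zero by (simp add: dg_quot_def FactRing_def)

lemma Q_one: "\<one>\<^bsub>Q\<^esub> = cl \<one>"
  by (simp add: dg_quot_def FactRing_def)

lemma Q_grade: "grade Q i = cl ` grade A i"
  by (simp add: dg_quot_def)

lemma Q_abelian_group: "abelian_group Q"
proof (rule abelian_groupI)
  fix X assume "X \<in> carrier Q"
  then obtain x where x: "x \<in> carrier A" "X = cl x" by (auto simp: Q_carrier)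
  then have "cl (\<ominus> x) \<oplus>\<^bsub>Q\<^esub> X = \<zero>\<^bsub>Q\<^esub>" by (simp add: Q_zero l_neg)
  then show "\<exists>Y\<in>carrier Q. Y \<oplus>\<^bsub>Q\<^esub> X = \<zero>\<^bsub>Q\<^esub>" using x by (auto simp: Q_carrier)
qed (auto simp: Q_carrier Q_zero a_assoc, auto simp: a_comm)

lemma Q_ring: "ring Q"
proof (rule ringI)
  show "Group.monoid Q"
    by (rule monoidI) (auto simp: Q_carrier Q_one m_assoc)
qed (auto simp: Q_abelian_group Q_carrier l_distr r_distr)

lemma Q_module: "module K Q"
  by (rule moduleI) (auto simp: Q_abelian_group R.is_cring Q_carrier smult_l_distr smult_r_distr smult_assoc1)

lemma cl_hom: "cl \<in> module_hom K A Q"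
  by (rule module_homI) (auto simp: Q_carrier)

lemma cl_mod_hom: "mod_hom K A Q cl"
  by (intro mod_homI module_axiom Q_module cl_hom)

end

text \<open>The conditions under which the quotient is a DG algebra. The last two say that the DG axioms hold modulo the ideal,
  which is weaker than requiring them of the algebra itself.\<close>

locale dg_ideal = alg_ideal +
  assumes component_I: "x \<in> I \<Longrightarrow> component A x i \<in> I"
    and diff_I: "x \<in> I \<Longrightarrow> diff A x \<in> I"
    and diff_diff_I: "x \<in> carrier A \<Longrightarrow> diff A (diff A x) \<in> I"
    and leibniz_I: "x \<in> grade A i \<Longrightarrow> y \<in> carrier A \<Longrightarrow>
        diff A (x \<otimes> y) \<ominus> (diff A x \<otimes> y \<oplus> ksgn A i (x \<otimes> diff A y)) \<in> I"
begin

lemma Q_diff [simp]: "x \<in> carrier A \<Longrightarrow> diff Q (cl x) = cl (diff A x)"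
  using coset_image[OF diff_linear diff_I] by (simp add: dg_quot_def)

lemma Q_graded: "graded_module K Q"
proof (rule graded_moduleI[OF Q_module])
  show "LinearCombinations.submodule K (grade Q i) Q" for i
  proof (rule LinearCombinations.submodule.intro[OF Q_module])
    show "grade Q i \<subseteq> carrier Q" using grade_carrier by (auto simp: Q_grade Q_carrier)
    show "\<zero>\<^bsub>Q\<^esub> \<in> grade Q i" by (auto simp: Q_zero Q_grade)
    show "v \<oplus>\<^bsub>Q\<^esub> w \<in> grade Q i" if "v \<in> grade Q i" "w \<in> grade Q i" for v w
      using that grade_carrier add_grade by (auto simp: Q_grade)
    show "c \<odot>\<^bsub>Q\<^esub> v \<in> grade Q i" if "c \<in> carrier K" "v \<in> grade Q i" for c v
      using that grade_carrier smult_grade by (auto simp: Q_grade)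
  qed
next
  fix X assume "X \<in> carrier Q"
  then obtain x where x: "x \<in> carrier A" "X = cl x" by (auto simp: Q_carrier)
  have "X = (\<Oplus>\<^bsub>Q\<^esub>i\<in>gsupp A x. cl (component A x i))"
    using mod_hom.f_finsum[OF cl_mod_hom, of "component A x" "gsupp A x"] x component_sum[OF x(1)] by auto
  moreover have "cl (component A x i) \<in> grade Q i" for i using x by (auto simp: Q_grade)
  ultimately show "\<exists>N f. finite N \<and> (\<forall>i\<in>N. f i \<in> grade Q i) \<and> X = (\<Oplus>\<^bsub>Q\<^esub>i\<in>N. f i)"
    using finite_gsupp[OF x(1)]
    by (intro exI[of _ "gsupp A x"] exI[of _ "\<lambda>i. cl (component A x i)"]) simp
next
  fix N f i assume N: "finite N" and f: "\<And>i. i \<in> N \<Longrightarrow> f i \<in> grade Q i"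
    and 0: "(\<Oplus>\<^bsub>Q\<^esub>i\<in>N. f i) = \<zero>\<^bsub>Q\<^esub>" and i: "i \<in> N"
  interpret Q: abelian_group Q by (rule Q_abelian_group)
  have "\<forall>i\<in>N. \<exists>x. x \<in> grade A i \<and> f i = cl x" using f by (auto simp: Q_grade)
  then obtain g where g: "\<And>i. i \<in> N \<Longrightarrow> g i \<in> grade A i" "\<And>i. i \<in> N \<Longrightarrow> f i = cl (g i)" by metis
  have gc: "g i \<in> carrier A" if "i \<in> N" for i using g(1)[OF that] grade_carrier by auto
  have "(\<Oplus>\<^bsub>Q\<^esub>i\<in>N. f i) = (\<Oplus>\<^bsub>Q\<^esub>i\<in>N. cl (g i))"
    using g gc by (intro Q.finsum_cong') (auto simp: Q_carrier)
  also have "\<dots> = cl (\<Oplus>i\<in>N. g i)"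
    using mod_hom.f_finsum[OF cl_mod_hom, of g N] gc by auto
  finally have "(\<Oplus>i\<in>N. g i) \<in> I"
    using 0 gc cl_zero cl_eq_I[of "\<Oplus>i\<in>N. g i"] by (auto simp: Q_zero intro: finsum_closed)
  from component_I[OF this] component_eqI[OF N g(1)] have "g i \<in> I" using i by metis
  then show "f i = \<zero>\<^bsub>Q\<^esub>" using g(2)[OF i] cl_eq_I[OF gc[OF i]] cl_zero by (simp add: Q_zero)
qed

lemma Q_pre_dga: "pre_dga K Q"
proof (intro pre_dga.intro pre_dga_axioms.intro Q_graded Q_ring)
  show "diff Q \<in> module_hom K Q Q"
    by (rule module_homI) (auto simp: Q_carrier diff_add diff_smult)
  show "\<one>\<^bsub>Q\<^esub> \<in> grade Q 0" using one_grade by (auto simp: Q_one Q_grade)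
  show "X \<otimes>\<^bsub>Q\<^esub> Y \<in> grade Q (i + j)" if "X \<in> grade Q i" "Y \<in> grade Q j" for X Y i j
    using that mult_grade grade_carrier by (auto simp: Q_grade)
  show "diff Q X \<in> grade Q (i + 1)" if "X \<in> grade Q i" for X i
    using that diff_grade grade_carrier by (auto simp: Q_grade)
qed (auto simp: Q_carrier smult_mult_left smult_mult_right)

theorem Q_dg_algebra: "dg_algebra K Q"
proof (rule pre_dga.dg_algebraI[OF Q_pre_dga])
  interpret Q: pre_dga K Q by (rule Q_pre_dga)
  show "diff Q (diff Q X) = \<zero>\<^bsub>Q\<^esub>" if "X \<in> carrier Q" for X
  proof -
    obtain x where "x \<in> carrier A" "X = cl x" using \<open>X \<in> carrier Q\<close> by (auto simp: Q_carrier)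
    then show ?thesis using diff_diff_I[of x] cl_eq_I[of "diff A (diff A x)"] cl_zero by (simp add: Q_zero)
  qed
  fix i X Y assume X: "X \<in> grade Q i" and Y: "Y \<in> carrier Q"
  obtain x where x: "x \<in> grade A i" "X = cl x" using X by (auto simp: Q_grade)
  obtain y where y: "y \<in> carrier A" "Y = cl y" using Y by (auto simp: Q_carrier)
  have xc: "x \<in> carrier A" using x grade_carrier by auto
  have k: "ksgn Q i (cl z) = cl (ksgn A i z)" if "z \<in> carrier A" for z
    using mod_hom.f_ksgn[OF cl_mod_hom that] by simp
  show "diff Q (X \<otimes>\<^bsub>Q\<^esub> Y) = diff Q X \<otimes>\<^bsub>Q\<^esub> Y \<oplus>\<^bsub>Q\<^esub> ksgn Q i (X \<otimes>\<^bsub>Q\<^esub> diff Q Y)"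
    using leibniz_I[OF x(1) y(1)] x y xc by (simp add: k cl_eq)
qed

lemma cl_map: "dga_map K A Q cl"
  by (rule dga_mapI) (auto simp: cl_hom Q_one Q_grade)

lemma quot_lift_linear:
  assumes "module K M" "f \<in> module_hom K A M" "\<And>x. x \<in> I \<Longrightarrow> f x = \<zero>\<^bsub>M\<^esub>"
  shows "\<exists>h. h \<in> module_hom K Q M \<and> (\<forall>x\<in>carrier A. h (cl x) = f x)"
proof -
  interpret M: module K M by fact
  interpret f: mod_hom K A M f by (intro mod_homI assms module_axiom)
  have eq: "f x = f y" if "x \<in> carrier A" "y \<in> carrier A" "cl x = cl y" for x y
  proof -
    have "f (x \<ominus> y) = \<zero>\<^bsub>M\<^esub>" using that assms(3) cl_eq by simp
    then show ?thesis using that M.minus_eq_zero_iff by simp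
  qed
  define h where "h X = f (SOME x. x \<in> carrier A \<and> cl x = X)" for X
  have h: "h (cl x) = f x" if x: "x \<in> carrier A" for x
  proof -
    have "(SOME y. y \<in> carrier A \<and> cl y = cl x) \<in> carrier A \<and> cl (SOME y. y \<in> carrier A \<and> cl y = cl x) = cl x"
      using x by (intro someI[of "\<lambda>y. y \<in> carrier A \<and> cl y = cl x"]) auto
    then show ?thesis unfolding h_def using x by (intro eq) auto
  qed
  have "h \<in> module_hom K Q M"
    by (rule module_homI) (auto simp: Q_carrier h)
  then show ?thesis using h by blast
qed

lemma quot_lift:
  assumes "pre_dga K B" "dga_map K A B f" "\<And>x. x \<in> I \<Longrightarrow> f x = \<zero>\<^bsub>B\<^esub>"
  shows "\<exists>h. dga_map K Q B h \<and> (\<forall>x\<in>carrier A. h (cl x) = f x)"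
proof -
  interpret B: pre_dga K B by fact
  obtain h where h: "h \<in> module_hom K Q B" "\<And>x. x \<in> carrier A \<Longrightarrow> h (cl x) = f x"
    using quot_lift_linear[OF B.module_axiom dga_map_hom[OF assms(2)] assms(3)] by blast
  have "dga_map K Q B h"
    using h(2) grade_carrier dga_map_grade[OF assms(2)]
    by (intro dga_mapI h(1))
      (auto simp: Q_carrier Q_one Q_grade dga_map_mult[OF assms(2)] dga_map_one[OF assms(2)] dga_map_diff[OF assms(2)])
  then show ?thesis using h by blast
qed

end

text \<open>By the Leibniz rule the elements whose components and the differentials of whose components stay in the ideal
  form an ideal; it contains the generators.\<close>

lemma (in pre_dga) generated_ideal_component_diff:
  assumes leibniz: "\<And>i x y. \<lbrakk>x \<in> grade A i; y \<in> carrier A\<rbrakk> \<Longrightarrow>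
        diff A (x \<otimes> y) = diff A x \<otimes> y \<oplus> ksgn A i (x \<otimes> diff A y)"
    and G: "G \<subseteq> carrier A"
      "\<And>g i. g \<in> G \<Longrightarrow> component A g i \<in> Idl G \<and> diff A (component A g i) \<in> Idl G"
    and x: "x \<in> Idl G"
  shows "component A x i \<in> Idl G" and "diff A x \<in> Idl G"
proof -
  interpret I: ideal "Idl G" A using G(1) by (rule genideal_ideal)
  define J where "J = {x \<in> Idl G. \<forall>i. component A x i \<in> Idl G \<and> diff A (component A x i) \<in> Idl G}"
  have ch: "mod_hom K A A (\<lambda>x. component A x i)" for i
    by (intro mod_homI module_axiom component_hom)
  have neg: "component A (\<ominus> x) i = \<ominus> component A x i" if "x \<in> carrier A" for x i
    using mod_hom.f_neg[OF ch that] .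
  have dneg: "diff A (\<ominus> x) = \<ominus> diff A x" if "x \<in> carrier A" for x
    using mod_hom.f_neg[OF diff_mod_hom that] .
  have Jc: "J \<subseteq> carrier A" using I.a_Hcarr by (auto simp: J_def)
  have Jadd: "x \<oplus> y \<in> J" if "x \<in> J" "y \<in> J" for x y
    using that I.a_Hcarr by (auto simp: J_def component_add diff_add)
  have ks: "ksgn A n y \<in> Idl G" if "y \<in> Idl G" for n y
    using that by (auto simp: ksgn_def)
  have left: "a \<otimes> x \<in> J" if "a \<in> carrier A" "x \<in> J" for a x
    using that(1)
  proof (induction rule: graded_induct)
    case (homog k a)
    have a: "a \<in> carrier A" using homog grade_carrier by auto
    have xc: "x \<in> carrier A" using Jc that by auto
    show ?case
      using that(2) homog a xc leibniz[OF homog] unfolding J_def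
      by (auto simp: component_mult_left intro!: I.I_l_closed ks I.a_closed)
  next
    case (add a b)
    have "x \<in> carrier A" using Jc that(2) by blast
    then show ?case using Jadd[OF add(3,4)] add(1,2) by (simp add: l_distr)
  qed
  have right: "x \<otimes> a \<in> J" if "a \<in> carrier A" "x \<in> J" for a x
    using that(1)
  proof (induction rule: graded_induct)
    case (homog k a)
    have a: "a \<in> carrier A" using homog grade_carrier by auto
    have xc: "x \<in> carrier A" using Jc that by auto
    show ?case
      using that(2) homog a xc leibniz[OF component_grade[OF xc] a] unfolding J_def
      by (auto simp: component_mult_right intro!: I.I_r_closed ks I.a_closed)
  next
    case (add a b)
    have "x \<in> carrier A" using Jc that(2) by blast
    then show ?case using Jadd[OF add(3,4)] add(1,2) by (simp add: r_distr)
  qed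
  have "ideal J A"
  proof (rule idealI[OF ring_axioms])
    show "subgroup J (add_monoid A)"
    proof (rule add.subgroupI)
      show "J \<noteq> {}" using additive_subgroup.zero_closed[OF I.is_additive_subgroup]
        by (auto simp: J_def diff_zero intro!: exI[of _ \<zero>])
      show "\<ominus> a \<in> J" if "a \<in> J" for a
        using that I.a_Hcarr by (auto simp: J_def neg dneg)
    qed (use Jc Jadd in auto)
  qed (use left right in auto)
  moreover have "G \<subseteq> J" using G genideal_self[OF G(1)] by (auto simp: J_def)
  ultimately have "Idl G \<subseteq> J" by (rule genideal_minimal)
  then have xJ: "x \<in> J" using x by auto
  then show "component A x i \<in> Idl G" by (simp add: J_def)
  have xc: "x \<in> carrier A" using xJ Jc by auto
  have "diff A x = (\<Oplus>i\<in>gsupp A x. diff A (component A x i))"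
    using mod_hom.f_finsum[OF diff_mod_hom, of "component A x" "gsupp A x"] component_sum[OF xc] xc by auto
  moreover have "(\<Oplus>i\<in>N. diff A (component A x i)) \<in> Idl G" if "finite N" for N
    using that
  proof (induction N)
    case (insert i N)
    then show ?case using xJ xc by (subst finsum_insert) (auto simp: J_def)
  qed auto
  ultimately show "diff A x \<in> Idl G" using xc by auto
qed

section \<open>Free modules and twisted monoid algebras\<close>

lemma module_hom_smult2:
  assumes "module K M" "c \<in> carrier K" "f \<in> module_hom K A M"
  shows "(\<lambda>x. c \<odot>\<^bsub>M\<^esub> f x) \<in> module_hom K A M"
proof -
  interpret M: module K M by fact
  show ?thesis using assms(2)
    by (auto intro!: module_homI simp: module_hom_add[OF assms(3)] module_hom_smult[OF assms(3)]
        module_hom_in[OF assms(3)] M.smult_r_distr M.R.m_comm simp flip: M.smult_assoc1)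
qed

text \<open>The linear extension of a map given on a basis.\<close>

definition lext :: "'k ring \<Rightarrow> ('k, 'c, 'm) module_scheme \<Rightarrow> ('x \<Rightarrow> 'c) \<Rightarrow> ('x \<Rightarrow> 'k) \<Rightarrow> 'c" where
  "lext K M \<phi> f = (\<Oplus>\<^bsub>M\<^esub>x\<in>fsupp K f. f x \<odot>\<^bsub>M\<^esub> \<phi> x)"

text \<open>The free module on a monoid \<open>X\<close>, with the monoid product twisted by signs. It covers the free objects below both
  the tensor product (with Koszul signs) and the coproduct (the free monoid of words, without signs). The cocycle
  condition on \<open>s\<close> is associativity of the twisted product.\<close>

locale free_algebra = cring K
  for K :: "'k ring" and X :: "'x set" and s :: "'x \<Rightarrow> 'x \<Rightarrow> int" and m :: "'x \<Rightarrow> 'x \<Rightarrow> 'x"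
    and e :: 'x and p :: "'x \<Rightarrow> int" and \<delta> :: "'x \<Rightarrow> 'x \<Rightarrow> 'k"
    and F :: "('k, 'x \<Rightarrow> 'k) dg" +
  assumes F_eq: "F = free_dg K X (\<lambda>x y z. ksgn K (s x y) (bvec K (m x y) z)) e p \<delta>"
    and m_X: "x \<in> X \<Longrightarrow> y \<in> X \<Longrightarrow> m x y \<in> X"
    and e_X: "e \<in> X"
    and m_assoc_X: "x \<in> X \<Longrightarrow> y \<in> X \<Longrightarrow> z \<in> X \<Longrightarrow> m (m x y) z = m x (m y z)"
    and m_e: "x \<in> X \<Longrightarrow> m e x = x" "x \<in> X \<Longrightarrow> m x e = x"
    and p_m: "x \<in> X \<Longrightarrow> y \<in> X \<Longrightarrow> p (m x y) = p x + p y"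
    and p_e: "p e = 0"
    and s_cocycle: "x \<in> X \<Longrightarrow> y \<in> X \<Longrightarrow> z \<in> X \<Longrightarrow>
        even (s x y + s (m x y) z) \<longleftrightarrow> even (s y z + s x (m y z))"
    and s_e: "x \<in> X \<Longrightarrow> even (s e x)" "x \<in> X \<Longrightarrow> even (s x e)"
    and delta: "x \<in> X \<Longrightarrow> range (\<delta> x) \<subseteq> carrier K" "x \<in> X \<Longrightarrow> finite (fsupp K (\<delta> x))"
      "x \<in> X \<Longrightarrow> fsupp K (\<delta> x) \<subseteq> X" "x \<in> X \<Longrightarrow> y \<in> fsupp K (\<delta> x) \<Longrightarrow> p y = p x + 1"
begin

lemma F_carrier: "carrier F = {f. range f \<subseteq> carrier K \<and> finite (fsupp K f) \<and> fsupp K f \<subseteq> X}"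
  and F_zero: "\<zero>\<^bsub>F\<^esub> = (\<lambda>_. \<zero>\<^bsub>K\<^esub>)"
  and F_one: "\<one>\<^bsub>F\<^esub> = bvec K e"
  and F_add: "f \<oplus>\<^bsub>F\<^esub> g = (\<lambda>z. f z \<oplus>\<^bsub>K\<^esub> g z)"
  and F_smult: "c \<odot>\<^bsub>F\<^esub> f = (\<lambda>z. c \<otimes>\<^bsub>K\<^esub> f z)"
  and F_grade: "grade F n = {f \<in> carrier F. \<forall>x\<in>fsupp K f. p x = n}"
  by (simp_all add: F_eq free_dg_def Let_def)

lemma F_in: "f \<in> carrier F \<Longrightarrow> f x \<in> carrier K"
  by (auto simp: F_carrier)

lemma F_fin: "f \<in> carrier F \<Longrightarrow> finite (fsupp K f)"
  by (auto simp: F_carrier)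

lemma F_supp: "f \<in> carrier F \<Longrightarrow> x \<in> fsupp K f \<Longrightarrow> x \<in> X"
  by (auto simp: F_carrier)

lemma F_I: "(\<And>x. f x \<in> carrier K) \<Longrightarrow> finite N \<Longrightarrow> N \<subseteq> X \<Longrightarrow> (\<And>x. x \<notin> N \<Longrightarrow> f x = \<zero>\<^bsub>K\<^esub>) \<Longrightarrow> f \<in> carrier F"
  unfolding F_carrier fsupp_def by (auto intro: finite_subset[of _ N])

lemma bvec_F: "x \<in> X \<Longrightarrow> bvec K x \<in> carrier F"
  by (rule F_I[where N = "{x}"]) (auto simp: bvec_def)

lemma F_module: "module K F"
proof (rule moduleI)
  have add: "f \<oplus>\<^bsub>F\<^esub> g \<in> carrier F" if "f \<in> carrier F" "g \<in> carrier F" for f g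
    unfolding F_add using that F_in F_fin F_supp
    by (intro F_I[where N = "fsupp K f \<union> fsupp K g"]) (auto simp: fsupp_def)
  have sm: "c \<odot>\<^bsub>F\<^esub> f \<in> carrier F" if "c \<in> carrier K" "f \<in> carrier F" for c f
    unfolding F_smult using that F_in F_fin F_supp
    by (intro F_I[where N = "fsupp K f"]) (auto simp: fsupp_def)
  show "abelian_group F"
  proof (rule abelian_groupI)
    show "\<zero>\<^bsub>F\<^esub> \<in> carrier F" unfolding F_zero by (rule F_I[where N = "{}"]) auto
    fix f assume f: "f \<in> carrier F"
    have "(\<ominus>\<^bsub>K\<^esub> \<one>\<^bsub>K\<^esub>) \<odot>\<^bsub>F\<^esub> f \<oplus>\<^bsub>F\<^esub> f = \<zero>\<^bsub>F\<^esub>"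
      using F_in[OF f] by (auto simp: F_add F_smult F_zero l_minus l_neg)
    then show "\<exists>g\<in>carrier F. g \<oplus>\<^bsub>F\<^esub> f = \<zero>\<^bsub>F\<^esub>" using sm[OF _ f] by auto
  qed (use add F_in in \<open>auto simp: F_add F_zero a_ac\<close>)
  show "c \<odot>\<^bsub>F\<^esub> f \<in> carrier F" if "c \<in> carrier K" "f \<in> carrier F" for c f
    by (rule sm[OF that])
qed (simp_all add: is_cring F_add F_smult F_in l_distr r_distr m_assoc)

lemma F_finsum:
  assumes "\<And>i. i \<in> I \<Longrightarrow> g i \<in> carrier F"
  shows "(\<Oplus>\<^bsub>F\<^esub>i\<in>I. g i) z = (\<Oplus>\<^bsub>K\<^esub>i\<in>I. g i z)"
proof -
  interpret F: module K F by (rule F_module)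
  show ?thesis using assms
  proof (induction I rule: infinite_finite_induct)
    case (insert i I)
    then have "(\<Oplus>\<^bsub>F\<^esub>i\<in>insert i I. g i) = g i \<oplus>\<^bsub>F\<^esub> (\<Oplus>\<^bsub>F\<^esub>i\<in>I. g i)"
      by (intro F.finsum_insert) auto
    moreover have "(\<Oplus>\<^bsub>K\<^esub>i\<in>insert i I. g i z) = g i z \<oplus>\<^bsub>K\<^esub> (\<Oplus>\<^bsub>K\<^esub>i\<in>I. g i z)"
      using insert F_in by (intro finsum_insert) auto
    ultimately show ?case using insert by (simp add: F_add)
  qed (auto simp: F.finsum_infinite finsum_infinite F_zero)
qed

lemma F_ksgn: "f \<in> carrier F \<Longrightarrow> ksgn F n f z = ksgn K n (f z)"
proof -
  interpret F: module K F by (rule F_module)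
  assume f: "f \<in> carrier F"
  have "\<ominus>\<^bsub>F\<^esub> f = (\<ominus>\<^bsub>K\<^esub> \<one>\<^bsub>K\<^esub>) \<odot>\<^bsub>F\<^esub> f" using f F.smult_l_minus[of "\<one>\<^bsub>K\<^esub>" f] by simp
  then have "(\<ominus>\<^bsub>F\<^esub> f) z = \<ominus>\<^bsub>K\<^esub> f z" using F_in[OF f] by (simp add: F_smult l_minus)
  then show ?thesis by (simp add: ksgn_def)
qed

lemma lext_superset:
  assumes "module K M" "\<And>x. x \<in> X \<Longrightarrow> \<phi> x \<in> carrier M" "f \<in> carrier F"
    and "finite N" "fsupp K f \<subseteq> N" "N \<subseteq> X"
  shows "lext K M \<phi> f = (\<Oplus>\<^bsub>M\<^esub>x\<in>N. f x \<odot>\<^bsub>M\<^esub> \<phi> x)"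
proof -
  interpret M: module K M by fact
  show ?thesis unfolding lext_def
    using assms F_in[OF assms(3)] by (intro M.add.finprod_mono_neutral_cong_left) (auto simp: fsupp_def subset_iff)
qed

lemma lext_bvec:
  assumes "module K M" "\<And>x. x \<in> X \<Longrightarrow> \<phi> x \<in> carrier M" "x \<in> X"
  shows "lext K M \<phi> (bvec K x) = \<phi> x"
proof -
  interpret M: module K M by fact
  have "lext K M \<phi> (bvec K x) = (\<Oplus>\<^bsub>M\<^esub>y\<in>{x}. bvec K x y \<odot>\<^bsub>M\<^esub> \<phi> y)"
    using assms(3) by (intro lext_superset assms bvec_F) (auto simp: fsupp_def bvec_def)
  then show ?thesis using assms by (simp add: bvec_def)
qed

lemma lext_hom:
  assumes "module K M" "\<And>x. x \<in> X \<Longrightarrow> \<phi> x \<in> carrier M"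
  shows "lext K M \<phi> \<in> module_hom K F M"
proof -
  interpret M: module K M by fact
  interpret F: module K F by (rule F_module)
  have t: "f x \<odot>\<^bsub>M\<^esub> \<phi> x \<in> carrier M" if "f \<in> carrier F" "x \<in> X" for f x
    using that assms(2) F_in by auto
  show ?thesis
  proof (rule module_homI)
    show "lext K M \<phi> f \<in> carrier M" if "f \<in> carrier F" for f
      unfolding lext_def using that t F_supp by (auto intro!: M.finsum_closed)
    fix f g assume fg: "f \<in> carrier F" "g \<in> carrier F"
    let ?N = "fsupp K f \<union> fsupp K g"
    have N: "finite ?N" "?N \<subseteq> X" using fg F_fin F_supp by auto
    have fgs: "fsupp K (f \<oplus>\<^bsub>F\<^esub> g) \<subseteq> ?N" by (auto simp: fsupp_def F_add)
    have "lext K M \<phi> (f \<oplus>\<^bsub>F\<^esub> g) = (\<Oplus>\<^bsub>M\<^esub>x\<in>?N. (f \<oplus>\<^bsub>F\<^esub> g) x \<odot>\<^bsub>M\<^esub> \<phi> x)"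
      by (rule lext_superset[OF assms F.a_closed[OF fg] N(1) fgs N(2)])
    also have "\<dots> = (\<Oplus>\<^bsub>M\<^esub>x\<in>?N. f x \<odot>\<^bsub>M\<^esub> \<phi> x \<oplus>\<^bsub>M\<^esub> g x \<odot>\<^bsub>M\<^esub> \<phi> x)"
      using N(2) fg t F_in assms(2) by (intro M.finsum_cong') (auto simp: F_add M.smult_l_distr subset_iff)
    also have "\<dots> = (\<Oplus>\<^bsub>M\<^esub>x\<in>?N. f x \<odot>\<^bsub>M\<^esub> \<phi> x) \<oplus>\<^bsub>M\<^esub> (\<Oplus>\<^bsub>M\<^esub>x\<in>?N. g x \<odot>\<^bsub>M\<^esub> \<phi> x)"
      using N(2) fg t by (intro M.finsum_addf) (auto simp: subset_iff)
    also have "(\<Oplus>\<^bsub>M\<^esub>x\<in>?N. f x \<odot>\<^bsub>M\<^esub> \<phi> x) = lext K M \<phi> f"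
      by (rule lext_superset[OF assms fg(1) N(1) _ N(2), symmetric]) auto
    also have "(\<Oplus>\<^bsub>M\<^esub>x\<in>?N. g x \<odot>\<^bsub>M\<^esub> \<phi> x) = lext K M \<phi> g"
      by (rule lext_superset[OF assms fg(2) N(1) _ N(2), symmetric]) auto
    finally show "lext K M \<phi> (f \<oplus>\<^bsub>F\<^esub> g) = lext K M \<phi> f \<oplus>\<^bsub>M\<^esub> lext K M \<phi> g" .
  next
    fix c f assume c: "c \<in> carrier K" and f: "f \<in> carrier F"
    have s: "fsupp K (c \<odot>\<^bsub>F\<^esub> f) \<subseteq> fsupp K f" using c by (auto simp: fsupp_def F_smult)
    have N: "fsupp K f \<subseteq> X" using f F_supp by auto
    have "lext K M \<phi> (c \<odot>\<^bsub>F\<^esub> f) = (\<Oplus>\<^bsub>M\<^esub>x\<in>fsupp K f. (c \<odot>\<^bsub>F\<^esub> f) x \<odot>\<^bsub>M\<^esub> \<phi> x)"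
      by (rule lext_superset[OF assms F.smult_closed[OF c f] F_fin[OF f] s N])
    also have "\<dots> = (\<Oplus>\<^bsub>M\<^esub>x\<in>fsupp K f. c \<odot>\<^bsub>M\<^esub> (f x \<odot>\<^bsub>M\<^esub> \<phi> x))"
      using N c f t F_in assms(2) by (intro M.finsum_cong') (auto simp: F_smult M.smult_assoc1 subset_iff)
    also have "\<dots> = c \<odot>\<^bsub>M\<^esub> lext K M \<phi> f"
      unfolding lext_def using N c f t F_fin by (intro M.finsum_smult_ldistr[symmetric]) (auto simp: subset_iff)
    finally show "lext K M \<phi> (c \<odot>\<^bsub>F\<^esub> f) = c \<odot>\<^bsub>M\<^esub> lext K M \<phi> f" .
  qed
qed

lemma F_basis_sum:
  assumes "f \<in> carrier F"
  shows "lext K F (bvec K) f = f"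
proof
  fix z
  interpret F: module K F by (rule F_module)
  have "lext K F (bvec K) f z = (\<Oplus>\<^bsub>K\<^esub>x\<in>fsupp K f. (f x \<odot>\<^bsub>F\<^esub> bvec K x) z)"
    unfolding lext_def using assms F_in F_supp bvec_F by (intro F_finsum) auto
  also have "\<dots> = (\<Oplus>\<^bsub>K\<^esub>x\<in>fsupp K f. if z = x then f x else \<zero>\<^bsub>K\<^esub>)"
    using assms F_in by (intro finsum_cong') (auto simp: F_smult bvec_def)
  also have "\<dots> = f z"
  proof (cases "z \<in> fsupp K f")
    case True
    then show ?thesis using assms F_in F_fin by (subst add.finprod_singleton) auto
  next
    case False
    then have "(\<Oplus>\<^bsub>K\<^esub>x\<in>fsupp K f. if z = x then f x else \<zero>\<^bsub>K\<^esub>) = (\<Oplus>\<^bsub>K\<^esub>x\<in>fsupp K f. \<zero>\<^bsub>K\<^esub>)"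
      by (intro finsum_cong') auto
    then show ?thesis using False by (simp add: fsupp_def)
  qed
  finally show "lext K F (bvec K) f z = f z" .
qed

lemma hom_eq_basis:
  assumes "module K M" "h \<in> module_hom K F M" "h' \<in> module_hom K F M"
    and "\<And>x. x \<in> X \<Longrightarrow> h (bvec K x) = h' (bvec K x)" and f: "f \<in> carrier F"
  shows "h f = h' f"
proof -
  interpret M: module K M by fact
  interpret F: module K F by (rule F_module)
  have c: "(\<lambda>x. f x \<odot>\<^bsub>F\<^esub> bvec K x) \<in> fsupp K f \<rightarrow> carrier F" using f F_in F_supp bvec_F by auto
  have "h f = h (lext K F (bvec K) f)" "h' f = h' (lext K F (bvec K) f)" by (simp_all add: F_basis_sum f)
  moreover have "h (lext K F (bvec K) f) = (\<Oplus>\<^bsub>M\<^esub>x\<in>fsupp K f. h (f x \<odot>\<^bsub>F\<^esub> bvec K x))"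
    unfolding lext_def by (intro mod_hom.f_finsum[OF mod_homI[OF F_module assms(1,2)] c])
  moreover have "h' (lext K F (bvec K) f) = (\<Oplus>\<^bsub>M\<^esub>x\<in>fsupp K f. h' (f x \<odot>\<^bsub>F\<^esub> bvec K x))"
    unfolding lext_def by (intro mod_hom.f_finsum[OF mod_homI[OF F_module assms(1,3)] c])
  moreover have "(\<Oplus>\<^bsub>M\<^esub>x\<in>fsupp K f. h (f x \<odot>\<^bsub>F\<^esub> bvec K x)) = (\<Oplus>\<^bsub>M\<^esub>x\<in>fsupp K f. h' (f x \<odot>\<^bsub>F\<^esub> bvec K x))"
    using f F_in F_supp bvec_F assms(4) module_hom_in[OF assms(3)]
    by (intro M.finsum_cong') (auto simp: module_hom_smult[OF assms(2)] module_hom_smult[OF assms(3)])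
  ultimately show ?thesis by simp
qed

lemma hom_into_submodule:
  assumes "module K M" "h \<in> module_hom K F M" "LinearCombinations.submodule K N M"
    and "\<And>x. x \<in> fsupp K f \<Longrightarrow> x \<in> X \<Longrightarrow> h (bvec K x) \<in> N" and f: "f \<in> carrier F"
  shows "h f \<in> N"
proof -
  interpret M: module K M by fact
  interpret F: module K F by (rule F_module)
  interpret N: LinearCombinations.submodule K N M by fact
  have c: "(\<lambda>x. f x \<odot>\<^bsub>F\<^esub> bvec K x) \<in> fsupp K f \<rightarrow> carrier F" using f F_in F_supp bvec_F by auto
  have "h (lext K F (bvec K) f) = (\<Oplus>\<^bsub>M\<^esub>x\<in>fsupp K f. h (f x \<odot>\<^bsub>F\<^esub> bvec K x))"
    unfolding lext_def by (intro mod_hom.f_finsum[OF mod_homI[OF F_module assms(1,2)] c])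
  moreover have "h (f x \<odot>\<^bsub>F\<^esub> bvec K x) \<in> N" if "x \<in> fsupp K f" for x
    using that f F_in F_supp bvec_F assms(4) by (simp add: module_hom_smult[OF assms(2)])
  moreover have "(\<Oplus>\<^bsub>M\<^esub>x\<in>J. g x) \<in> N" if "\<And>x. x \<in> J \<Longrightarrow> g x \<in> N" for J :: "'x set" and g
    using that
  proof (induction J rule: infinite_finite_induct)
    case (insert x J)
    then show ?case using N.subset by (subst M.finsum_insert) auto
  qed (auto simp: M.finsum_infinite)
  ultimately show ?thesis by (simp add: F_basis_sum f)
qed

definition "bmul x y = ksgn F (s x y) (bvec K (m x y))"

lemma bmul_F: "x \<in> X \<Longrightarrow> y \<in> X \<Longrightarrow> bmul x y \<in> carrier F"
  using F_module bvec_F m_X by (auto simp: bmul_def intro!: abelian_group.ksgn_closed module.axioms)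

lemma lext_bmul_hom: "x \<in> X \<Longrightarrow> lext K F (bmul x) \<in> module_hom K F F"
  by (rule lext_hom[OF F_module]) (simp add: bmul_F)

lemma lext_bmul_F: "x \<in> X \<Longrightarrow> g \<in> carrier F \<Longrightarrow> lext K F (bmul x) g \<in> carrier F"
  by (rule module_hom_in[OF lext_bmul_hom])

lemma F_mult:
  assumes "f \<in> carrier F" "g \<in> carrier F"
  shows "f \<otimes>\<^bsub>F\<^esub> g = lext K F (\<lambda>x. lext K F (bmul x) g) f"
proof
  fix z
  interpret F: module K F by (rule F_module)
  have "lext K F (\<lambda>x. lext K F (bmul x) g) f z = (\<Oplus>\<^bsub>K\<^esub>x\<in>fsupp K f. (f x \<odot>\<^bsub>F\<^esub> lext K F (bmul x) g) z)"
    unfolding lext_def[of K F "\<lambda>x. lext K F (bmul x) g"]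
    using assms F_in F_supp lext_bmul_F by (intro F_finsum) auto
  also have "\<dots> = (\<Oplus>\<^bsub>K\<^esub>x\<in>fsupp K f. \<Oplus>\<^bsub>K\<^esub>y\<in>fsupp K g. f x \<otimes>\<^bsub>K\<^esub> g y \<otimes>\<^bsub>K\<^esub> ksgn K (s x y) (bvec K (m x y) z))"
  proof (rule finsum_cong')
    have bK: "bvec K w z \<in> carrier K" for w by (simp add: bvec_def)
    show "(\<lambda>x. \<Oplus>\<^bsub>K\<^esub>y\<in>fsupp K g. f x \<otimes>\<^bsub>K\<^esub> g y \<otimes>\<^bsub>K\<^esub> ksgn K (s x y) (bvec K (m x y) z)) \<in> fsupp K f \<rightarrow> carrier K"
      using assms F_in bK by (auto intro!: finsum_closed)
    fix x assume x: "x \<in> fsupp K f"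
    have xX: "x \<in> X" using x assms F_supp by auto
    have "(f x \<odot>\<^bsub>F\<^esub> lext K F (bmul x) g) z = f x \<otimes>\<^bsub>K\<^esub> (\<Oplus>\<^bsub>K\<^esub>y\<in>fsupp K g. (g y \<odot>\<^bsub>F\<^esub> bmul x y) z)"
      unfolding lext_def F_smult[of "f x"] using assms F_in F_supp bmul_F xX by (subst F_finsum) auto
    also have "\<dots> = (\<Oplus>\<^bsub>K\<^esub>y\<in>fsupp K g. f x \<otimes>\<^bsub>K\<^esub> (g y \<odot>\<^bsub>F\<^esub> bmul x y) z)"
      using assms F_in F_fin F_supp bmul_F xX by (intro finsum_rdistr) (auto intro!: F_in)
    also have "\<dots> = (\<Oplus>\<^bsub>K\<^esub>y\<in>fsupp K g. f x \<otimes>\<^bsub>K\<^esub> g y \<otimes>\<^bsub>K\<^esub> ksgn K (s x y) (bvec K (m x y) z))"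
    proof (rule finsum_cong')
      fix y assume y: "y \<in> fsupp K g"
      then have "y \<in> X" using assms F_supp by auto
      then have "bmul x y z = ksgn K (s x y) (bvec K (m x y) z)"
        unfolding bmul_def using xX by (intro F_ksgn bvec_F m_X)
      then show "f x \<otimes>\<^bsub>K\<^esub> (g y \<odot>\<^bsub>F\<^esub> bmul x y) z = f x \<otimes>\<^bsub>K\<^esub> g y \<otimes>\<^bsub>K\<^esub> ksgn K (s x y) (bvec K (m x y) z)"
        using assms F_in bK by (simp add: F_smult m_assoc del: ksgn_mult_right)
    qed (use assms F_in bK in auto)
    finally show "(f x \<odot>\<^bsub>F\<^esub> lext K F (bmul x) g) z =
      (\<Oplus>\<^bsub>K\<^esub>y\<in>fsupp K g. f x \<otimes>\<^bsub>K\<^esub> g y \<otimes>\<^bsub>K\<^esub> ksgn K (s x y) (bvec K (m x y) z))" .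
  qed simp
  also have "\<dots> = (f \<otimes>\<^bsub>F\<^esub> g) z" by (simp add: F_eq free_dg_def Let_def)
  finally show "(f \<otimes>\<^bsub>F\<^esub> g) z = lext K F (\<lambda>x. lext K F (bmul x) g) f z" by simp
qed

lemma F_mult_hom_left: 
  assumes "g \<in> carrier F"
  shows "(\<lambda>f. f \<otimes>\<^bsub>F\<^esub> g) \<in> module_hom K F F"
proof -
  have h: "lext K F (\<lambda>x. lext K F (bmul x) g) \<in> module_hom K F F"
    by (rule lext_hom[OF F_module]) (simp add: lext_bmul_F assms)
  interpret F: module K F by (rule F_module)
  show ?thesis
    by (rule module_homI) (simp_all add: F_mult assms module_hom_in[OF h] module_hom_add[OF h] module_hom_smult[OF h])
qed

lemma F_mult_hom_right:
  assumes "f \<in> carrier F"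
  shows "(\<lambda>g. f \<otimes>\<^bsub>F\<^esub> g) \<in> module_hom K F F"
proof -
  interpret F: module K F by (rule F_module)
  have h: "(\<lambda>g. \<Oplus>\<^bsub>F\<^esub>x\<in>fsupp K f. f x \<odot>\<^bsub>F\<^esub> lext K F (bmul x) g) \<in> module_hom K F F"
    using F_in F_supp assms by (intro module_hom_finsum module_hom_smult2 F_module lext_bmul_hom) auto
  have eq: "f \<otimes>\<^bsub>F\<^esub> g = (\<Oplus>\<^bsub>F\<^esub>x\<in>fsupp K f. f x \<odot>\<^bsub>F\<^esub> lext K F (bmul x) g)" if "g \<in> carrier F" for g
    using F_mult[OF assms that] by (simp add: lext_def[of K F "\<lambda>x. lext K F (bmul x) g"])
  show ?thesis
    by (rule module_homI) (simp_all add: eq module_hom_in[OF h] module_hom_add[OF h] module_hom_smult[OF h])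
qed

lemma F_mult_closed: "f \<in> carrier F \<Longrightarrow> g \<in> carrier F \<Longrightarrow> f \<otimes>\<^bsub>F\<^esub> g \<in> carrier F"
  by (rule module_hom_in[OF F_mult_hom_right])

lemma bvec_mult:
  "x \<in> X \<Longrightarrow> y \<in> X \<Longrightarrow> bvec K x \<otimes>\<^bsub>F\<^esub> bvec K y = ksgn F (s x y) (bvec K (m x y))"
  by (simp add: F_mult bvec_F lext_bvec[OF F_module] lext_bmul_F bmul_F) (simp add: bmul_def)

lemma F_assoc:
  assumes "f \<in> carrier F" "g \<in> carrier F" "h \<in> carrier F"
  shows "(f \<otimes>\<^bsub>F\<^esub> g) \<otimes>\<^bsub>F\<^esub> h = f \<otimes>\<^bsub>F\<^esub> (g \<otimes>\<^bsub>F\<^esub> h)"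
proof -
  interpret F: module K F by (rule F_module)
  have kl: "ksgn F n a \<otimes>\<^bsub>F\<^esub> b = ksgn F n (a \<otimes>\<^bsub>F\<^esub> b)" if "a \<in> carrier F" "b \<in> carrier F" for a b n
    using mod_hom.f_ksgn[OF mod_homI[OF F_module F_module F_mult_hom_left[OF that(2)]] that(1)] .
  have kr: "a \<otimes>\<^bsub>F\<^esub> ksgn F n b = ksgn F n (a \<otimes>\<^bsub>F\<^esub> b)" if "a \<in> carrier F" "b \<in> carrier F" for a b n
    using mod_hom.f_ksgn[OF mod_homI[OF F_module F_module F_mult_hom_right[OF that(1)]] that(2)] .
  have 1: "(bvec K x \<otimes>\<^bsub>F\<^esub> bvec K y) \<otimes>\<^bsub>F\<^esub> bvec K z = bvec K x \<otimes>\<^bsub>F\<^esub> (bvec K y \<otimes>\<^bsub>F\<^esub> bvec K z)"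
    if "x \<in> X" "y \<in> X" "z \<in> X" for x y z
    using that s_cocycle[OF that]
    by (simp add: bvec_mult bvec_F m_X kl kr m_assoc_X) (auto intro: ksgn_cong)
  have 2: "(bvec K x \<otimes>\<^bsub>F\<^esub> bvec K y) \<otimes>\<^bsub>F\<^esub> h = bvec K x \<otimes>\<^bsub>F\<^esub> (bvec K y \<otimes>\<^bsub>F\<^esub> h)"
    if "x \<in> X" "y \<in> X" for x y
    by (rule hom_eq_basis[OF F_module, where f = h])
      (auto intro!: 1 that assms F_mult_hom_right F_mult_closed bvec_F module_hom_comp[OF F_mult_hom_right F_mult_hom_right])
  have 3: "(bvec K x \<otimes>\<^bsub>F\<^esub> g) \<otimes>\<^bsub>F\<^esub> h = bvec K x \<otimes>\<^bsub>F\<^esub> (g \<otimes>\<^bsub>F\<^esub> h)" if "x \<in> X" for x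
    by (rule hom_eq_basis[OF F_module, where f = g])
      (auto intro!: 2 that assms bvec_F module_hom_comp[OF F_mult_hom_right F_mult_hom_left]
        module_hom_comp[OF F_mult_hom_left F_mult_hom_right])
  show ?thesis
    by (rule hom_eq_basis[OF F_module, where f = f])
      (auto intro!: 3 assms F_mult_hom_left F_mult_closed module_hom_comp[OF F_mult_hom_left F_mult_hom_left])
qed

lemma F_unit:
  assumes "f \<in> carrier F"
  shows "bvec K e \<otimes>\<^bsub>F\<^esub> f = f" "f \<otimes>\<^bsub>F\<^esub> bvec K e = f"
proof -
  have id: "(\<lambda>f. f) \<in> module_hom K F F" by (rule module_homI) auto
  show "bvec K e \<otimes>\<^bsub>F\<^esub> f = f"
    by (rule hom_eq_basis[OF F_module F_mult_hom_right id _ assms])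
      (auto simp: bvec_F e_X bvec_mult s_e m_e)
  show "f \<otimes>\<^bsub>F\<^esub> bvec K e = f"
    by (rule hom_eq_basis[OF F_module F_mult_hom_left id _ assms])
      (auto simp: bvec_F e_X bvec_mult s_e m_e)
qed

lemma F_ring: "ring F"
proof -
  interpret F: module K F by (rule F_module)
  show ?thesis
  proof (rule ringI)
    show "Group.monoid F"
      by (rule monoidI) (auto simp: F_mult_closed F_one bvec_F e_X F_assoc F_unit)
  qed (auto simp: F.abelian_group_axioms module_hom_add[OF F_mult_hom_left] module_hom_add[OF F_mult_hom_right])
qed

lemma delta_F: "x \<in> X \<Longrightarrow> \<delta> x \<in> carrier F"
  using delta by (auto simp: F_carrier)

lemma F_diff: "f \<in> carrier F \<Longrightarrow> diff F f = lext K F \<delta> f"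
proof
  fix z assume f: "f \<in> carrier F"
  interpret F: module K F by (rule F_module)
  have "lext K F \<delta> f z = (\<Oplus>\<^bsub>K\<^esub>x\<in>fsupp K f. (f x \<odot>\<^bsub>F\<^esub> \<delta> x) z)"
    unfolding lext_def using f F_in F_supp delta_F by (intro F_finsum) auto
  then show "diff F f z = lext K F \<delta> f z" by (simp add: F_eq free_dg_def Let_def)
qed

lemma F_diff_bvec: "x \<in> X \<Longrightarrow> diff F (bvec K x) = \<delta> x"
  by (simp add: F_diff bvec_F lext_bvec[OF F_module] delta_F)

lemma F_diff_hom: "diff F \<in> module_hom K F F"
proof -
  interpret F: module K F by (rule F_module)
  have h: "lext K F \<delta> \<in> module_hom K F F" by (rule lext_hom[OF F_module]) (rule delta_F)
  show ?thesis
    by (rule module_homI) (simp_all add: F_diff module_hom_in[OF h] module_hom_add[OF h] module_hom_smult[OF h])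
qed

lemma F_graded: "graded_module K F"
proof (rule graded_moduleI[OF F_module])
  interpret F: module K F by (rule F_module)
  show "LinearCombinations.submodule K (grade F i) F" for i
  proof (rule LinearCombinations.submodule.intro[OF F_module])
    show "\<zero>\<^bsub>F\<^esub> \<in> grade F i" using F.M.zero_closed by (simp add: F_grade fsupp_def F_zero)
    show "f \<oplus>\<^bsub>F\<^esub> g \<in> grade F i" if "f \<in> grade F i" "g \<in> grade F i" for f g
    proof -
      have "fsupp K (f \<oplus>\<^bsub>F\<^esub> g) \<subseteq> fsupp K f \<union> fsupp K g" by (auto simp: fsupp_def F_add)
      then show ?thesis using that unfolding F_grade by auto
    qed
    show "c \<odot>\<^bsub>F\<^esub> f \<in> grade F i" if "c \<in> carrier K" "f \<in> grade F i" for c f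
    proof -
      have "fsupp K (c \<odot>\<^bsub>F\<^esub> f) \<subseteq> fsupp K f" using that(1) by (auto simp: fsupp_def F_smult)
      then show ?thesis using that unfolding F_grade by auto
    qed
  qed (auto simp: F_grade)
next
  fix f assume f: "f \<in> carrier F"
  interpret F: module K F by (rule F_module)
  define g where "g n = (\<lambda>x. if p x = n then f x else \<zero>\<^bsub>K\<^esub>)" for n
  have gF: "g n \<in> carrier F" for n
    using f F_in F_fin F_supp by (intro F_I[where N = "fsupp K f"]) (auto simp: g_def fsupp_def)
  have g: "g n \<in> grade F n" for n
    using gF unfolding F_grade by (auto simp: fsupp_def g_def split: if_splits)
  have "f = (\<Oplus>\<^bsub>F\<^esub>n\<in>p ` fsupp K f. g n)"
  proof
    fix z
    have "(\<Oplus>\<^bsub>F\<^esub>n\<in>p ` fsupp K f. g n) z = (\<Oplus>\<^bsub>K\<^esub>n\<in>p ` fsupp K f. g n z)"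
      by (rule F_finsum) (rule gF)
    also have "\<dots> = f z"
    proof (cases "z \<in> fsupp K f")
      case True
      then show ?thesis unfolding g_def using F_fin[OF f] F_in[OF f] by (subst add.finprod_singleton) auto
    next
      case False
      then have "f z = \<zero>\<^bsub>K\<^esub>" by (simp add: fsupp_def)
      then show ?thesis unfolding g_def by simp
    qed
    finally show "f z = (\<Oplus>\<^bsub>F\<^esub>n\<in>p ` fsupp K f. g n) z" by simp
  qed
  then show "\<exists>N g. finite N \<and> (\<forall>i\<in>N. g i \<in> grade F i) \<and> f = (\<Oplus>\<^bsub>F\<^esub>i\<in>N. g i)"
    using F_fin[OF f] g by (intro exI[of _ "p ` fsupp K f"] exI[of _ g]) simp
next
  fix N f i assume N: "finite N" and f: "\<And>i. i \<in> N \<Longrightarrow> f i \<in> grade F i"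
    and 0: "(\<Oplus>\<^bsub>F\<^esub>i\<in>N. f i) = \<zero>\<^bsub>F\<^esub>" and i: "i \<in> N"
  have fF: "f j \<in> carrier F" if "j \<in> N" for j using f[OF that] unfolding F_grade by auto
  have deg: "f j z = \<zero>\<^bsub>K\<^esub>" if "j \<in> N" "p z \<noteq> j" for j z
    using f[OF that(1)] that(2) unfolding F_grade by (auto simp: fsupp_def)
  show "f i = \<zero>\<^bsub>F\<^esub>"
  proof
    fix z
    show "f i z = \<zero>\<^bsub>F\<^esub> z"
    proof (cases "p z = i")
      case True
      have "\<zero>\<^bsub>K\<^esub> = (\<Oplus>\<^bsub>F\<^esub>j\<in>N. f j) z" using 0 by (simp add: F_zero)
      also have "\<dots> = (\<Oplus>\<^bsub>K\<^esub>j\<in>N. f j z)" by (rule F_finsum) (rule fF)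
      also have "\<dots> = (\<Oplus>\<^bsub>K\<^esub>j\<in>N. if i = j then f j z else \<zero>\<^bsub>K\<^esub>)"
        using True fF F_in deg by (intro finsum_cong') auto
      also have "\<dots> = f i z" using N i fF F_in by (subst add.finprod_singleton) auto
      finally show ?thesis by (simp add: F_zero)
    qed (use deg i in \<open>auto simp: F_zero\<close>)
  qed
qed

lemma bvec_grade: "x \<in> X \<Longrightarrow> bvec K x \<in> grade F (p x)"
  unfolding F_grade using bvec_F by (auto simp: fsupp_def bvec_def split: if_splits)

lemma F_pre_dga: "pre_dga K F"
proof (intro pre_dga.intro pre_dga_axioms.intro F_graded F_ring F_diff_hom)
  interpret F: graded_module K F by (rule F_graded)
  have gc: "f \<in> carrier F" if "f \<in> grade F i" for f i using F.grade_carrier that .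
  show "\<one>\<^bsub>F\<^esub> \<in> grade F 0" using bvec_grade[OF e_X] by (simp add: F_one p_e)
  show "diff F f \<in> grade F (i + 1)" if f: "f \<in> grade F i" for f i
    unfolding F_diff[OF gc[OF f]] lext_def
  proof (intro F.finsum_grade F.smult_grade F_in[OF gc[OF f]])
    fix x assume x: "x \<in> fsupp K f"
    then have "x \<in> X" "p x = i" using gc[OF f] F_supp f unfolding F_grade by auto
    then show "\<delta> x \<in> grade F (i + 1)" using delta(4) delta_F unfolding F_grade by auto
  qed
  show "f \<otimes>\<^bsub>F\<^esub> g \<in> grade F (i + j)" if f: "f \<in> grade F i" and g: "g \<in> grade F j" for f g i j
    unfolding F_mult[OF gc[OF f] gc[OF g]] lext_def bmul_def
  proof (intro F.finsum_grade F.smult_grade F_in gc[OF f] gc[OF g] F.ksgn_grade)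
    fix x y assume x: "x \<in> fsupp K f" and y: "y \<in> fsupp K g"
    have "x \<in> X" "y \<in> X" "p x = i" "p y = j"
      using gc[OF f] gc[OF g] F_supp x y f g unfolding F_grade by auto
    then show "bvec K (m x y) \<in> grade F (i + j)" using bvec_grade[OF m_X] p_m by metis
  qed
qed (simp_all add: module_hom_smult[OF F_mult_hom_left] module_hom_smult[OF F_mult_hom_right])

lemma lext_mult_bvec:
  assumes "pre_dga K B" and \<phi>c: "\<And>x. x \<in> X \<Longrightarrow> \<phi> x \<in> carrier B"
    and mul: "\<And>x y. x \<in> X \<Longrightarrow> y \<in> X \<Longrightarrow> \<phi> x \<otimes>\<^bsub>B\<^esub> \<phi> y = ksgn B (s x y) (\<phi> (m x y))"
    and x: "x \<in> X" and g: "g \<in> carrier F"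
  shows "lext K B \<phi> (bvec K x \<otimes>\<^bsub>F\<^esub> g) = \<phi> x \<otimes>\<^bsub>B\<^esub> lext K B \<phi> g"
proof -
  interpret B: pre_dga K B by fact
  have h: "lext K B \<phi> \<in> module_hom K F B" by (rule lext_hom[OF B.module_axiom \<phi>c])
  have hb: "lext K B \<phi> (bvec K x) = \<phi> x" if "x \<in> X" for x
    by (rule lext_bvec[OF B.module_axiom \<phi>c that])
  show ?thesis
    by (rule hom_eq_basis[OF B.module_axiom module_hom_comp[OF F_mult_hom_right h] module_hom_comp[OF h B.mult_left_hom] _ g])
      (auto simp: x bvec_F \<phi>c hb bvec_mult mul mod_hom.f_ksgn[OF mod_homI[OF F_module B.module_axiom h]] m_X)
qed

text \<open>A linear map out of the free module is a morphism as soon as it is compatible with the structure on basis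
  elements.\<close>

lemma lext_dga_map:
  assumes "pre_dga K B" and \<phi>: "\<And>x. x \<in> X \<Longrightarrow> \<phi> x \<in> grade B (p x)"
    and mul: "\<And>x y. x \<in> X \<Longrightarrow> y \<in> X \<Longrightarrow> \<phi> x \<otimes>\<^bsub>B\<^esub> \<phi> y = ksgn B (s x y) (\<phi> (m x y))"
    and one: "\<phi> e = \<one>\<^bsub>B\<^esub>"
    and d: "\<And>x. x \<in> X \<Longrightarrow> lext K B \<phi> (\<delta> x) = diff B (\<phi> x)"
  shows "dga_map K F B (lext K B \<phi>)"
proof -
  interpret B: pre_dga K B by fact
  interpret F: pre_dga K F by (rule F_pre_dga)
  have \<phi>c: "\<phi> x \<in> carrier B" if "x \<in> X" for x using \<phi>[OF that] B.grade_carrier by auto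
  have h: "lext K B \<phi> \<in> module_hom K F B" by (rule lext_hom[OF B.module_axiom \<phi>c])
  have hb: "lext K B \<phi> (bvec K x) = \<phi> x" if "x \<in> X" for x
    by (rule lext_bvec[OF B.module_axiom \<phi>c that])
  note hin = module_hom_in[OF h]
  note m1 = lext_mult_bvec[OF assms(1) \<phi>c mul]
  show ?thesis
  proof (rule dga_mapI[OF h])
    show "lext K B \<phi> (f \<otimes>\<^bsub>F\<^esub> g) = lext K B \<phi> f \<otimes>\<^bsub>B\<^esub> lext K B \<phi> g" if f: "f \<in> carrier F" and g: "g \<in> carrier F" for f g
      by (rule hom_eq_basis[OF B.module_axiom module_hom_comp[OF F_mult_hom_left h] module_hom_comp[OF h B.mult_right_hom] _ f])
        (auto simp: g m1 hb hin)
    show "lext K B \<phi> \<one>\<^bsub>F\<^esub> = \<one>\<^bsub>B\<^esub>" by (simp add: F_one hb e_X one)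
    show "lext K B \<phi> f \<in> grade B i" if f: "f \<in> grade F i" for f i
      unfolding lext_def
    proof (intro B.finsum_grade B.smult_grade)
      fix x assume "x \<in> fsupp K f"
      then show "f x \<in> carrier K" "\<phi> x \<in> grade B i"
        using f F_supp[of f x] F_in[of f x] \<phi>[of x] unfolding F_grade by auto
    qed
    show "lext K B \<phi> (diff F f) = diff B (lext K B \<phi> f)" if f: "f \<in> carrier F" for f
      by (rule hom_eq_basis[OF B.module_axiom module_hom_comp[OF F_diff_hom h] module_hom_comp[OF h B.diff_linear] _ f])
        (simp add: F_diff_bvec d hb)
  qed
qed

end

section \<open>Bilinear maps modulo a submodule\<close>

text \<open>Bilinearity of a map on \<open>S\<^sup>i \<times> T\<^sup>j\<close> up to errors in the submodule \<open>N\<close>. Modulo the relations this is what the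
  generators of the tensor product satisfy, and with \<open>N = {0}\<close> it is plain bilinearity.\<close>

definition bilin :: "'k ring \<Rightarrow> ('k, 'c) dg \<Rightarrow> 'c set \<Rightarrow> ('k, 's) dg \<Rightarrow> ('k, 't) dg \<Rightarrow> int \<Rightarrow> int
    \<Rightarrow> ('s \<Rightarrow> 't \<Rightarrow> 'c) \<Rightarrow> bool" where
  "bilin K M N S T i j \<phi> \<longleftrightarrow>
     (\<forall>s\<in>grade S i. \<forall>t\<in>grade T j. \<phi> s t \<in> carrier M) \<and>
     (\<forall>s\<in>grade S i. \<forall>s'\<in>grade S i. \<forall>t\<in>grade T j.
        \<phi> (s \<oplus>\<^bsub>S\<^esub> s') t \<ominus>\<^bsub>M\<^esub> (\<phi> s t \<oplus>\<^bsub>M\<^esub> \<phi> s' t) \<in> N) \<and>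
     (\<forall>s\<in>grade S i. \<forall>t\<in>grade T j. \<forall>t'\<in>grade T j.
        \<phi> s (t \<oplus>\<^bsub>T\<^esub> t') \<ominus>\<^bsub>M\<^esub> (\<phi> s t \<oplus>\<^bsub>M\<^esub> \<phi> s t') \<in> N) \<and>
     (\<forall>c\<in>carrier K. \<forall>s\<in>grade S i. \<forall>t\<in>grade T j. \<phi> (c \<odot>\<^bsub>S\<^esub> s) t \<ominus>\<^bsub>M\<^esub> c \<odot>\<^bsub>M\<^esub> \<phi> s t \<in> N) \<and>
     (\<forall>c\<in>carrier K. \<forall>s\<in>grade S i. \<forall>t\<in>grade T j. \<phi> s (c \<odot>\<^bsub>T\<^esub> t) \<ominus>\<^bsub>M\<^esub> c \<odot>\<^bsub>M\<^esub> \<phi> s t \<in> N)"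

lemma (in module) submodule_uminus:
  assumes "LinearCombinations.submodule R N M" "x \<in> N"
  shows "\<ominus>\<^bsub>M\<^esub> x \<in> N"
proof -
  interpret N: LinearCombinations.submodule R N M by fact
  have "\<ominus>\<^bsub>M\<^esub> x = (\<ominus>\<^bsub>R\<^esub> \<one>\<^bsub>R\<^esub>) \<odot>\<^bsub>M\<^esub> x"
    using assms(2) N.subset by (subst smult_l_minus) auto
  then show ?thesis using N.smult_closed[OF _ assms(2), of "\<ominus>\<^bsub>R\<^esub> \<one>\<^bsub>R\<^esub>"] by simp
qed

lemma (in module) submodule_ksgn:
  assumes "LinearCombinations.submodule R N M" "x \<in> N"
  shows "ksgn M n x \<in> N"
  using submodule_uminus assms by (simp add: ksgn_def)

lemma bilin_comp:
  assumes "bilin K M N S T i' j' \<phi>"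
    and f: "\<And>s. s \<in> grade S i \<Longrightarrow> f s \<in> grade S i'"
      "\<And>s s'. s \<in> grade S i \<Longrightarrow> s' \<in> grade S i \<Longrightarrow> f (s \<oplus>\<^bsub>S\<^esub> s') = f s \<oplus>\<^bsub>S\<^esub> f s'"
      "\<And>c s. c \<in> carrier K \<Longrightarrow> s \<in> grade S i \<Longrightarrow> f (c \<odot>\<^bsub>S\<^esub> s) = c \<odot>\<^bsub>S\<^esub> f s"
    and g: "\<And>t. t \<in> grade T j \<Longrightarrow> g t \<in> grade T j'"
      "\<And>t t'. t \<in> grade T j \<Longrightarrow> t' \<in> grade T j \<Longrightarrow> g (t \<oplus>\<^bsub>T\<^esub> t') = g t \<oplus>\<^bsub>T\<^esub> g t'"
      "\<And>c t. c \<in> carrier K \<Longrightarrow> t \<in> grade T j \<Longrightarrow> g (c \<odot>\<^bsub>T\<^esub> t) = c \<odot>\<^bsub>T\<^esub> g t"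
  shows "bilin K M N S T i j (\<lambda>s t. \<phi> (f s) (g t))"
  using assms(1) unfolding bilin_def by (simp add: f g)

lemma bilin_add:
  assumes "module K M" "LinearCombinations.submodule K N M"
    and "bilin K M N S T i j \<phi>" "bilin K M N S T i j \<psi>"
    and "graded_module K S" "graded_module K T"
  shows "bilin K M N S T i j (\<lambda>s t. \<phi> s t \<oplus>\<^bsub>M\<^esub> \<psi> s t)"
proof -
  interpret M: module K M by fact
  interpret N: LinearCombinations.submodule K N M by fact
  interpret S: graded_module K S by fact
  interpret T: graded_module K T by fact
  have 1: "(a \<oplus>\<^bsub>M\<^esub> b) \<ominus>\<^bsub>M\<^esub> ((a' \<oplus>\<^bsub>M\<^esub> b') \<oplus>\<^bsub>M\<^esub> (a'' \<oplus>\<^bsub>M\<^esub> b'')) =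
      (a \<ominus>\<^bsub>M\<^esub> (a' \<oplus>\<^bsub>M\<^esub> a'')) \<oplus>\<^bsub>M\<^esub> (b \<ominus>\<^bsub>M\<^esub> (b' \<oplus>\<^bsub>M\<^esub> b''))"
    if "a \<in> carrier M" "b \<in> carrier M" "a' \<in> carrier M" "b' \<in> carrier M" "a'' \<in> carrier M" "b'' \<in> carrier M"
    for a b a' b' a'' b''
    using that by (simp add: a_minus_def M.minus_add M.a_ac)
  have 2: "(a \<oplus>\<^bsub>M\<^esub> b) \<ominus>\<^bsub>M\<^esub> c \<odot>\<^bsub>M\<^esub> (a' \<oplus>\<^bsub>M\<^esub> b') = (a \<ominus>\<^bsub>M\<^esub> c \<odot>\<^bsub>M\<^esub> a') \<oplus>\<^bsub>M\<^esub> (b \<ominus>\<^bsub>M\<^esub> c \<odot>\<^bsub>M\<^esub> b')"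
    if "c \<in> carrier K" "a \<in> carrier M" "b \<in> carrier M" "a' \<in> carrier M" "b' \<in> carrier M" for c a b a' b'
    using that by (simp add: a_minus_def M.minus_add M.smult_r_distr M.a_ac)
  show ?thesis
    using assms(3,4) unfolding bilin_def
    by (simp add: 1 2 S.add_grade T.add_grade S.smult_grade T.smult_grade)
qed

lemma bilin_ksgn:
  assumes "module K M" "LinearCombinations.submodule K N M" "bilin K M N S T i j \<phi>"
    and "graded_module K S" "graded_module K T"
  shows "bilin K M N S T i j (\<lambda>s t. ksgn M n (\<phi> s t))"
proof -
  interpret M: module K M by fact
  interpret S: graded_module K S by fact
  interpret T: graded_module K T by fact
  have 1: "ksgn M n a \<ominus>\<^bsub>M\<^esub> (ksgn M n b \<oplus>\<^bsub>M\<^esub> ksgn M n d) = ksgn M n (a \<ominus>\<^bsub>M\<^esub> (b \<oplus>\<^bsub>M\<^esub> d))"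
    if "a \<in> carrier M" "b \<in> carrier M" "d \<in> carrier M" for a b d
    using that by (simp add: a_minus_def M.minus_add M.ksgn_add M.ksgn_uminus)
  have 2: "ksgn M n a \<ominus>\<^bsub>M\<^esub> ksgn M n b = ksgn M n (a \<ominus>\<^bsub>M\<^esub> b)"
    if "a \<in> carrier M" "b \<in> carrier M" for a b
    using that by (simp add: a_minus_def M.ksgn_add M.ksgn_uminus)
  show ?thesis
    using assms(3) M.submodule_ksgn[OF assms(2)] unfolding bilin_def
    by (simp add: 1 2 S.add_grade T.add_grade S.smult_grade T.smult_grade)
qed

lemma bilin_zero:
  assumes "module K M" "LinearCombinations.submodule K N M"
  shows "bilin K M N S T i j (\<lambda>s t. \<zero>\<^bsub>M\<^esub>)"
proof -
  interpret M: module K M by fact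
  interpret N: LinearCombinations.submodule K N M by fact
  show ?thesis using M.submodule_uminus[OF assms(2) N.zero_closed] by (simp add: bilin_def a_minus_def)
qed

lemma bilinI:
  assumes "module K M"
    and "\<And>t. t \<in> grade T j \<Longrightarrow> (\<lambda>s. \<phi> s t) \<in> module_hom K (S\<lparr>carrier := grade S i\<rparr>) M"
    and "\<And>s. s \<in> grade S i \<Longrightarrow> \<phi> s \<in> module_hom K (T\<lparr>carrier := grade T j\<rparr>) M"
    and "graded_module K S" "graded_module K T"
  shows "bilin K M {\<zero>\<^bsub>M\<^esub>} S T i j \<phi>"
proof -
  interpret M: module K M by fact
  interpret S: graded_module K S by fact
  interpret T: graded_module K T by fact
  show ?thesis
    using assms(2,3) by (auto simp: bilin_def module_hom_def M.minus_eq_zero_iff Pi_def)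
qed

lemma grade_hom_ksgn:
  assumes "module K M" "graded_module K S" "f \<in> module_hom K (S\<lparr>carrier := grade S i\<rparr>) M" "s \<in> grade S i"
  shows "f (ksgn S n s) = ksgn M n (f s)"
proof -
  interpret M: module K M by fact
  interpret S: graded_module K S by fact
  have fs: "f s \<in> carrier M" using module_hom_in[OF assms(3), of s] assms(4) by simp
  have "ksgn S n s = ksgn K n \<one>\<^bsub>K\<^esub> \<odot>\<^bsub>S\<^esub> s" using S.grade_carrier[OF assms(4)] by simp
  then have "f (ksgn S n s) = ksgn K n \<one>\<^bsub>K\<^esub> \<odot>\<^bsub>M\<^esub> f s"
    using module_hom_smult[OF assms(3), of "ksgn K n \<one>\<^bsub>K\<^esub>" s] assms(4) by simp
  then show ?thesis using fs by simp
qed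

section \<open>Tensor products\<close>

locale dg_pair = S: dg_algebra K S + T: dg_algebra K T
  for K :: "'k ring" and S :: "('k, 's) dg" and T :: "('k, 't) dg"
begin

text \<open>The data that exhibit \<^const>\<open>tensor_free\<close> as a twisted monoid algebra: basis, sign, product, unit, degree and
  differential on basis elements.\<close>

definition "tX = {(i, s, j, t). s \<in> grade S i \<and> t \<in> grade T j}"
definition "ts = (\<lambda>(i::int, s::'s, j, t::'t) (i', s'::'s, j'::int, t'::'t). j * i' :: int)"
definition "tm = (\<lambda>(i::int, s, j::int, t) (i', s', j', t'). (i + i', s \<otimes>\<^bsub>S\<^esub> s', j + j', t \<otimes>\<^bsub>T\<^esub> t'))"
definition "te = (0::int, \<one>\<^bsub>S\<^esub>, 0::int, \<one>\<^bsub>T\<^esub>)"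
definition "tp = (\<lambda>(i::int, s::'s, j, t::'t). i + j)"
definition "td = (\<lambda>(i, s, j, t) z.
        bvec K (i + 1, diff S s, j, t) z \<oplus>\<^bsub>K\<^esub> ksgn K i (bvec K (i, s, j + 1, diff T t) z))"

abbreviation "F \<equiv> tensor_free K S T"
abbreviation "Ker \<equiv> tensor_kernel K S T"
abbreviation "TT \<equiv> tensor K S T"

lemma tX_iff [simp]: "(i, s, j, t) \<in> tX \<longleftrightarrow> s \<in> grade S i \<and> t \<in> grade T j"
  by (simp add: tX_def)

lemma F_eq: "F = free_dg K tX (\<lambda>x y z. ksgn K (ts x y) (bvec K (tm x y) z)) te tp td"
proof -
  have "(\<lambda>(i, s, j, t) (i', s', j', t') z. ksgn K (j * i')
      (bvec K (i + i', s \<otimes>\<^bsub>S\<^esub> s', j + j', t \<otimes>\<^bsub>T\<^esub> t') z)) = (\<lambda>x y z. ksgn K (ts x y) (bvec K (tm x y) z))"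
    by (auto simp: fun_eq_iff ts_def tm_def)
  then show ?thesis by (simp add: tensor_free_def tX_def te_def tp_def td_def)
qed

sublocale F: free_algebra K tX ts tm te tp td "tensor_free K S T"
proof (intro free_algebra.intro free_algebra_axioms.intro F_eq)
  show "cring K" by (rule S.R.is_cring)
  have bK: "bvec K w z \<in> carrier K" for w z :: "int \<times> 's \<times> int \<times> 't" by (simp add: bvec_def)
  fix x assume x: "x \<in> tX"
  obtain i s j t where xe: "x = (i, s, j, t)" by (cases x)
  have sub: "fsupp K (td x) \<subseteq> {(i + 1, diff S s, j, t), (i, s, j + 1, diff T t)}"
    by (auto simp: xe td_def fsupp_def bvec_def split: if_splits)
  show "range (td x) \<subseteq> carrier K" by (auto simp: xe td_def bK)
  show "finite (fsupp K (td x))" using sub by (rule finite_subset) simp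
  show "fsupp K (td x) \<subseteq> tX" using sub x S.diff_grade T.diff_grade by (auto simp: xe)
  show "tp y = tp x + 1" if "y \<in> fsupp K (td x)" for y using that sub by (auto simp: xe tp_def)
qed (auto simp: tX_def ts_def tm_def te_def tp_def S.m_assoc T.m_assoc S.mult_grade T.mult_grade
    S.one_grade T.one_grade S.grade_carrier T.grade_carrier algebra_simps)

lemma bvec_in: "s \<in> grade S i \<Longrightarrow> t \<in> grade T j \<Longrightarrow> bvec K (i, s, j, t) \<in> carrier F"
  by (rule F.bvec_F) simp

sublocale FA: pre_dga K "tensor_free K S T"
  by (rule F.F_pre_dga)

lemma rels_F: "tensor_rels K S T \<subseteq> carrier F"
  unfolding tensor_rels_def Let_def
  by (auto intro!: FA.minus_closed FA.M.minus_closed FA.a_closed FA.smult_closed bvec_in S.add_grade T.add_grade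
      S.smult_grade T.smult_grade)

lemma Ker_submodule: "LinearCombinations.submodule K Ker F"
  unfolding tensor_kernel_def by (rule FA.span_is_submodule[OF rels_F])

lemma rels_Ker: "tensor_rels K S T \<subseteq> Ker"
  unfolding tensor_kernel_def by (rule FA.in_own_span[OF rels_F])

lemma Ker_minimal: "LinearCombinations.submodule K N F \<Longrightarrow> tensor_rels K S T \<subseteq> N \<Longrightarrow> Ker \<subseteq> N"
  unfolding tensor_kernel_def by (rule FA.span_is_subset)

lemma Ker_F: "x \<in> Ker \<Longrightarrow> x \<in> carrier F"
  using LinearCombinations.submodule.subset[OF Ker_submodule] by blast

lemma bvec_bilin: "bilin K F Ker S T i j (\<lambda>s t. bvec K (i, s, j, t))"
proof -
  have R: "r \<in> Ker" if "r \<in> tensor_rels K S T" for r using that rels_Ker by blast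
  show ?thesis
    unfolding bilin_def
  proof (intro conjI ballI)
    show "bvec K (i, s, j, t) \<in> carrier F" if "s \<in> grade S i" "t \<in> grade T j" for s t
      by (rule bvec_in[OF that])
  qed (rule R, unfold tensor_rels_def Let_def, blast)+
qed

text \<open>The elements mapped into \<open>N\<close> form a submodule, and bilinearity modulo \<open>N\<close> says exactly that it contains the
  relations. Applied to operators on the free module, this shows that the relations are stable under the DG structure;
  applied with \<open>N = {0}\<close>, it gives the universal property.\<close>

lemma hom_kernel_into:
  assumes M: "module K M" and N: "LinearCombinations.submodule K N M" and h: "h \<in> module_hom K F M"
    and b: "\<And>i j. bilin K M N S T i j (\<lambda>s t. h (bvec K (i, s, j, t)))"
    and x: "x \<in> Ker"
  shows "h x \<in> N"
proof -
  interpret M: module K M by fact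
  interpret N: LinearCombinations.submodule K N M by fact
  interpret h: mod_hom K F M h by (intro mod_homI FA.module_axiom M h)
  have "Ker \<subseteq> {x \<in> carrier F. h x \<in> N}"
  proof (rule Ker_minimal)
    show "LinearCombinations.submodule K {x \<in> carrier F. h x \<in> N} F"
      by (rule LinearCombinations.submodule.intro[OF FA.module_axiom]) auto
    show "tensor_rels K S T \<subseteq> {x \<in> carrier F. h x \<in> N}"
      using rels_F b unfolding tensor_rels_def Let_def bilin_def
      by (auto simp: bvec_in S.add_grade T.add_grade S.smult_grade T.smult_grade)
  qed
  then show ?thesis using x by blast
qed

lemma F_mult_bvec:
  "\<lbrakk>s \<in> grade S i; t \<in> grade T j; s' \<in> grade S i'; t' \<in> grade T j'\<rbrakk> \<Longrightarrow>
    bvec K (i, s, j, t) \<otimes>\<^bsub>F\<^esub> bvec K (i', s', j', t') =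
    ksgn F (j * i') (bvec K (i + i', s \<otimes>\<^bsub>S\<^esub> s', j + j', t \<otimes>\<^bsub>T\<^esub> t'))"
  by (subst F.bvec_mult) (simp_all add: ts_def tm_def)

lemma F_diff_bvec:
  assumes "s \<in> grade S i" "t \<in> grade T j"
  shows "diff F (bvec K (i, s, j, t)) =
    bvec K (i + 1, diff S s, j, t) \<oplus>\<^bsub>F\<^esub> ksgn F i (bvec K (i, s, j + 1, diff T t))"
proof -
  have "diff F (bvec K (i, s, j, t)) = td (i, s, j, t)" by (rule F.F_diff_bvec) (simp add: assms)
  also have "\<dots> = bvec K (i + 1, diff S s, j, t) \<oplus>\<^bsub>F\<^esub> ksgn F i (bvec K (i, s, j + 1, diff T t))"
    unfolding F.F_add td_def using bvec_in T.diff_grade assms by (auto simp: F.F_ksgn)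
  finally show ?thesis .
qed

lemma bilin_cong:
  assumes "\<And>s t. s \<in> grade S i \<Longrightarrow> t \<in> grade T j \<Longrightarrow> \<phi> s t = \<psi> s t" "bilin K M N S T i j \<psi>"
  shows "bilin K M N S T i j \<phi>"
  using assms(2) unfolding bilin_def
  by (simp add: assms(1) S.add_grade T.add_grade S.smult_grade T.smult_grade)

lemma Ker_mult_left:
  assumes f: "f \<in> carrier F" and x: "x \<in> Ker"
  shows "f \<otimes>\<^bsub>F\<^esub> x \<in> Ker"
proof (rule F.hom_into_submodule[OF F.F_module F.F_mult_hom_left[OF Ker_F[OF x]] Ker_submodule _ f])
  fix b assume b: "b \<in> tX"
  obtain i' s' j' t' where be: "b = (i', s', j', t')" by (cases b)
  have st: "s' \<in> grade S i'" "t' \<in> grade T j'" using b be by auto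
  note c = S.grade_carrier[OF st(1)] T.grade_carrier[OF st(2)]
  show "bvec K b \<otimes>\<^bsub>F\<^esub> x \<in> Ker"
  proof (rule hom_kernel_into[OF F.F_module Ker_submodule F.F_mult_hom_right[OF F.bvec_F[OF b]] _ x])
    fix i j
    have "bilin K F Ker S T i j (\<lambda>s t. ksgn F (j' * i) (bvec K (i' + i, s' \<otimes>\<^bsub>S\<^esub> s, j' + j, t' \<otimes>\<^bsub>T\<^esub> t)))"
      using st c S.mult_grade T.mult_grade
      by (intro bilin_ksgn[OF F.F_module Ker_submodule bilin_comp[OF bvec_bilin[of "i' + i" "j' + j"]]])
        (auto simp: S.r_distr T.r_distr S.smult_mult_right T.smult_mult_right S.grade_carrier T.grade_carrier
          intro: S.graded_module_axioms T.graded_module_axioms)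
    then show "bilin K F Ker S T i j (\<lambda>s t. bvec K b \<otimes>\<^bsub>F\<^esub> bvec K (i, s, j, t))"
      by (rule bilin_cong[rotated]) (simp add: be F_mult_bvec st)
  qed
qed

lemma Ker_mult_right:
  assumes f: "f \<in> carrier F" and x: "x \<in> Ker"
  shows "x \<otimes>\<^bsub>F\<^esub> f \<in> Ker"
proof (rule F.hom_into_submodule[OF F.F_module F.F_mult_hom_right[OF Ker_F[OF x]] Ker_submodule _ f])
  fix b assume b: "b \<in> tX"
  obtain i' s' j' t' where be: "b = (i', s', j', t')" by (cases b)
  have st: "s' \<in> grade S i'" "t' \<in> grade T j'" using b be by auto
  note c = S.grade_carrier[OF st(1)] T.grade_carrier[OF st(2)]
  show "x \<otimes>\<^bsub>F\<^esub> bvec K b \<in> Ker"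
  proof (rule hom_kernel_into[OF F.F_module Ker_submodule F.F_mult_hom_left[OF F.bvec_F[OF b]] _ x])
    fix i j
    have "bilin K F Ker S T i j (\<lambda>s t. ksgn F (j * i') (bvec K (i + i', s \<otimes>\<^bsub>S\<^esub> s', j + j', t \<otimes>\<^bsub>T\<^esub> t')))"
      using st c S.mult_grade T.mult_grade
      by (intro bilin_ksgn[OF F.F_module Ker_submodule bilin_comp[OF bvec_bilin[of "i + i'" "j + j'"]]])
        (auto simp: S.l_distr T.l_distr S.smult_mult_left T.smult_mult_left S.grade_carrier T.grade_carrier
          intro: S.graded_module_axioms T.graded_module_axioms)
    then show "bilin K F Ker S T i j (\<lambda>s t. bvec K (i, s, j, t) \<otimes>\<^bsub>F\<^esub> bvec K b)"
      by (rule bilin_cong[rotated]) (simp add: be F_mult_bvec st)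
  qed
qed

lemma Ker_ideal: "ideal Ker F"
proof (rule idealI[OF FA.ring_axioms])
  interpret N: LinearCombinations.submodule K Ker F by (rule Ker_submodule)
  show "subgroup Ker (add_monoid F)"
  proof (rule FA.add.subgroupI)
    show "Ker \<noteq> {}" using N.zero_closed by blast
    show "\<ominus>\<^bsub>F\<^esub> a \<in> Ker" if "a \<in> Ker" for a by (rule FA.submodule_uminus[OF Ker_submodule that])
  qed (use N.subset in auto)
qed (auto intro: Ker_mult_left Ker_mult_right)

sublocale A: alg_ideal K "tensor_free K S T" "tensor_kernel K S T"
  by (intro alg_ideal.intro F.F_pre_dga Ker_ideal)

lemma TT_eq: "TT = dg_quot F Ker"
  by (simp add: tensor_def)

text \<open>The class of a generator; it becomes a pure tensor of homogeneous elements.\<close>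

definition "\<tau> i s j t = Ker +>\<^bsub>F\<^esub> bvec K (i, s, j, t)"

sublocale TM: module K "tensor K S T"
  unfolding TT_eq by (rule A.Q_module)
sublocale TR: ring "tensor K S T"
  unfolding TT_eq by (rule A.Q_ring)

lemma cl_hom: "(\<lambda>x. Ker +>\<^bsub>F\<^esub> x) \<in> module_hom K F TT"
  unfolding TT_eq by (rule A.cl_hom)

lemmas cl_add = module_hom_add[OF cl_hom]
lemmas cl_smult = module_hom_smult[OF cl_hom]
lemmas cl_ksgn = mod_hom.f_ksgn[OF mod_homI[OF F.F_module TM.module_axioms cl_hom]]

lemma tau_closed: "s \<in> grade S i \<Longrightarrow> t \<in> grade T j \<Longrightarrow> \<tau> i s j t \<in> carrier TT"
  unfolding \<tau>_def by (rule module_hom_in[OF cl_hom bvec_in])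

lemma tau_add_left: "s \<in> grade S i \<Longrightarrow> s' \<in> grade S i \<Longrightarrow> t \<in> grade T j \<Longrightarrow>
    \<tau> i (s \<oplus>\<^bsub>S\<^esub> s') j t = \<tau> i s j t \<oplus>\<^bsub>TT\<^esub> \<tau> i s' j t"
  using bvec_bilin[of i j] unfolding \<tau>_def
  by (simp add: cl_add[symmetric] bvec_in A.cl_eq S.add_grade bilin_def)

lemma tau_add_right: "s \<in> grade S i \<Longrightarrow> t \<in> grade T j \<Longrightarrow> t' \<in> grade T j \<Longrightarrow>
    \<tau> i s j (t \<oplus>\<^bsub>T\<^esub> t') = \<tau> i s j t \<oplus>\<^bsub>TT\<^esub> \<tau> i s j t'"
  using bvec_bilin[of i j] unfolding \<tau>_def
  by (simp add: cl_add[symmetric] bvec_in A.cl_eq T.add_grade bilin_def)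

lemma tau_smult_left: "c \<in> carrier K \<Longrightarrow> s \<in> grade S i \<Longrightarrow> t \<in> grade T j \<Longrightarrow>
    \<tau> i (c \<odot>\<^bsub>S\<^esub> s) j t = c \<odot>\<^bsub>TT\<^esub> \<tau> i s j t"
  using bvec_bilin[of i j] unfolding \<tau>_def
  by (simp add: cl_smult[symmetric] bvec_in A.cl_eq S.smult_grade bilin_def)

lemma tau_smult_right: "c \<in> carrier K \<Longrightarrow> s \<in> grade S i \<Longrightarrow> t \<in> grade T j \<Longrightarrow>
    \<tau> i s j (c \<odot>\<^bsub>T\<^esub> t) = c \<odot>\<^bsub>TT\<^esub> \<tau> i s j t"
  using bvec_bilin[of i j] unfolding \<tau>_def
  by (simp add: cl_smult[symmetric] bvec_in A.cl_eq T.smult_grade bilin_def)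

lemma tau_hom_left: "t \<in> grade T j \<Longrightarrow> (\<lambda>s. \<tau> i s j t) \<in> module_hom K (S\<lparr>carrier := grade S i\<rparr>) TT"
  by (rule module_homI) (simp_all add: tau_closed tau_add_left tau_smult_left)

lemma tau_hom_right: "s \<in> grade S i \<Longrightarrow> \<tau> i s j \<in> module_hom K (T\<lparr>carrier := grade T j\<rparr>) TT"
  by (rule module_homI) (simp_all add: tau_closed tau_add_right tau_smult_right)

lemmas tau_ksgn_left = grade_hom_ksgn[OF TM.module_axioms S.graded_module_axioms tau_hom_left]
lemmas tau_ksgn_right = grade_hom_ksgn[OF TM.module_axioms T.graded_module_axioms tau_hom_right]

lemma tau_zero_left: "t \<in> grade T j \<Longrightarrow> \<tau> i \<zero>\<^bsub>S\<^esub> j t = \<zero>\<^bsub>TT\<^esub>"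
  using mod_hom.f0_is_0[OF mod_homI[OF S.grade_module TM.module_axioms tau_hom_left]] by simp

lemma tau_zero_right: "s \<in> grade S i \<Longrightarrow> \<tau> i s j \<zero>\<^bsub>T\<^esub> = \<zero>\<^bsub>TT\<^esub>"
  using mod_hom.f0_is_0[OF mod_homI[OF T.grade_module TM.module_axioms tau_hom_right]] by simp

lemma cl_zero_iff: "x \<in> carrier F \<Longrightarrow> Ker +>\<^bsub>F\<^esub> x = \<zero>\<^bsub>TT\<^esub> \<longleftrightarrow> x \<in> Ker"
  using A.cl_eq_I[of x] A.cl_zero A.Q_zero by (simp add: TT_eq)

lemma cl_mult: "x \<in> carrier F \<Longrightarrow> y \<in> carrier F \<Longrightarrow> Ker +>\<^bsub>F\<^esub> (x \<otimes>\<^bsub>F\<^esub> y) = (Ker +>\<^bsub>F\<^esub> x) \<otimes>\<^bsub>TT\<^esub> (Ker +>\<^bsub>F\<^esub> y)"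
  using A.Q_mult[of x y] by (simp add: TT_eq)

lemma cl_diff_bvec:
  assumes "s \<in> grade S i" "t \<in> grade T j"
  shows "Ker +>\<^bsub>F\<^esub> diff F (bvec K (i, s, j, t)) =
    \<tau> (i + 1) (diff S s) j t \<oplus>\<^bsub>TT\<^esub> ksgn TT i (\<tau> i s (j + 1) (diff T t))"
  using assms S.diff_grade T.diff_grade
  by (simp add: F_diff_bvec cl_add cl_ksgn bvec_in \<tau>_def)

lemma tau_mult:
  assumes "s \<in> grade S i" "t \<in> grade T j" "s' \<in> grade S i'" "t' \<in> grade T j'"
  shows "\<tau> i s j t \<otimes>\<^bsub>TT\<^esub> \<tau> i' s' j' t' =
    ksgn TT (j * i') (\<tau> (i + i') (s \<otimes>\<^bsub>S\<^esub> s') (j + j') (t \<otimes>\<^bsub>T\<^esub> t'))"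
  using assms S.mult_grade T.mult_grade unfolding \<tau>_def
  by (simp add: cl_mult[symmetric] bvec_in F_mult_bvec cl_ksgn)

lemma Ker_diff: "x \<in> Ker \<Longrightarrow> diff F x \<in> Ker"
proof (rule hom_kernel_into[OF F.F_module Ker_submodule FA.diff_linear])
  fix i j
  have 1: "bilin K F Ker S T i j (\<lambda>s t. bvec K (i + 1, diff S s, j, t))"
    by (rule bilin_comp[OF bvec_bilin])
      (auto simp: S.diff_grade S.diff_add S.diff_smult S.grade_carrier)
  have 2: "bilin K F Ker S T i j (\<lambda>s t. bvec K (i, s, j + 1, diff T t))"
    by (rule bilin_comp[OF bvec_bilin])
      (auto simp: T.diff_grade T.diff_add T.diff_smult T.grade_carrier)
  show "bilin K F Ker S T i j (\<lambda>s t. diff F (bvec K (i, s, j, t)))"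
    by (rule bilin_cong[OF F_diff_bvec])
      (auto intro!: bilin_add bilin_ksgn 1 2 F.F_module Ker_submodule S.graded_module_axioms T.graded_module_axioms)
qed

lemma Ker_component: "x \<in> Ker \<Longrightarrow> component F x n \<in> Ker"
proof (rule hom_kernel_into[OF F.F_module Ker_submodule FA.component_hom])
  fix i j
  have c: "component F (bvec K (i, s, j, t)) n = (if i + j = n then bvec K (i, s, j, t) else \<zero>\<^bsub>F\<^esub>)"
    if "s \<in> grade S i" "t \<in> grade T j" for s t
    using FA.component_homog[OF F.bvec_grade[of "(i, s, j, t)"], of n] that by (simp add: tp_def)
  show "bilin K F Ker S T i j (\<lambda>s t. component F (bvec K (i, s, j, t)) n)"
    by (rule bilin_cong[OF c], assumption+, cases "i + j = n")
      (simp_all add: bvec_bilin bilin_zero F.F_module Ker_submodule)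
qed

lemma Ker_diff_diff: "f \<in> carrier F \<Longrightarrow> diff F (diff F f) \<in> Ker"
proof (rule F.hom_into_submodule[OF F.F_module module_hom_comp[OF FA.diff_linear FA.diff_linear] Ker_submodule])
  fix x assume x: "x \<in> tX"
  obtain i s j t where xe: "x = (i, s, j, t)" by (cases x)
  have st: "s \<in> grade S i" "t \<in> grade T j" using x xe by auto
  note ds = S.diff_grade[OF st(1)] and dt = T.diff_grade[OF st(2)]
  have b: "bvec K (i + 1, diff S s, j, t) \<in> carrier F" "bvec K (i, s, j + 1, diff T t) \<in> carrier F"
    using bvec_in st ds dt by auto
  have z: "diff S (diff S s) = \<zero>\<^bsub>S\<^esub>" "diff T (diff T t) = \<zero>\<^bsub>T\<^esub>"
    using st S.diff_diff T.diff_diff S.grade_carrier T.grade_carrier by auto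
  note tc = tau_closed[OF ds dt]
  have e: "diff F (bvec K x) = bvec K (i + 1, diff S s, j, t) \<oplus>\<^bsub>F\<^esub> ksgn F i (bvec K (i, s, j + 1, diff T t))"
    unfolding xe by (rule F_diff_bvec[OF st])
  have "Ker +>\<^bsub>F\<^esub> diff F (diff F (bvec K x)) = ksgn TT (i + 1) (\<tau> (i + 1) (diff S s) (j + 1) (diff T t))
      \<oplus>\<^bsub>TT\<^esub> ksgn TT i (\<tau> (i + 1) (diff S s) (j + 1) (diff T t))"
    using b st ds dt tc
    by (simp add: e FA.diff_add FA.diff_ksgn cl_add cl_ksgn cl_diff_bvec z tau_zero_left tau_zero_right)
  also have "\<dots> = \<zero>\<^bsub>TT\<^esub>" using tc TM.ksgn_succ[OF tc, of "i + 1" i] by (simp add: TM.l_neg)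
  finally show "diff F (diff F (bvec K x)) \<in> Ker"
    using cl_zero_iff F.bvec_F[OF x] by simp
qed

text \<open>The Leibniz rule fails in the free module itself, since a generator with \<open>diff S (s \<otimes> s')\<close> in it is only congruent
  to a sum of two generators. Both sides are linear in each argument, so it suffices to compare their classes on
  generators, where the four terms of the expansion are matched up to sign.\<close>

lemma Ker_leibniz:
  assumes x: "x \<in> grade F n" and y: "y \<in> carrier F"
  shows "diff F (x \<otimes>\<^bsub>F\<^esub> y) \<ominus>\<^bsub>F\<^esub> (diff F x \<otimes>\<^bsub>F\<^esub> y \<oplus>\<^bsub>F\<^esub> ksgn F n (x \<otimes>\<^bsub>F\<^esub> diff F y)) \<in> Ker"
proof -
  have xc: "x \<in> carrier F" using x FA.grade_carrier by auto
  let ?L = "\<lambda>n x y. diff F (x \<otimes>\<^bsub>F\<^esub> y) \<ominus>\<^bsub>F\<^esub> (diff F x \<otimes>\<^bsub>F\<^esub> y \<oplus>\<^bsub>F\<^esub> ksgn F n (x \<otimes>\<^bsub>F\<^esub> diff F y))"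
  have Lx: "(\<lambda>x. ?L n x y) \<in> module_hom K F F" if y: "y \<in> carrier F" for n y
    using y FA.mult_right_hom
    by (intro module_hom_minus2 module_hom_add2 module_hom_ksgn F.F_module
        module_hom_comp[OF FA.mult_right_hom[OF y] FA.diff_linear] module_hom_comp[OF FA.diff_linear FA.mult_right_hom[OF y]]) auto
  have Ly: "(\<lambda>y. ?L n x y) \<in> module_hom K F F" if x: "x \<in> carrier F" for n x
    using x FA.mult_left_hom
    by (intro module_hom_minus2 module_hom_add2 module_hom_ksgn F.F_module
        module_hom_comp[OF FA.mult_left_hom[OF x] FA.diff_linear] module_hom_comp[OF FA.diff_linear FA.mult_left_hom[OF x]]) auto
  have basis: "?L (tp a) (bvec K a) (bvec K b) \<in> Ker" if ab: "a \<in> tX" "b \<in> tX" for a b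
  proof -
    obtain i s j t where ae: "a = (i, s, j, t)" by (cases a)
    obtain i' s' j' t' where be: "b = (i', s', j', t')" by (cases b)
    have st: "s \<in> grade S i" "t \<in> grade T j" "s' \<in> grade S i'" "t' \<in> grade T j'" using ab ae be by auto
    note d = S.diff_grade[OF st(1)] T.diff_grade[OF st(2)] S.diff_grade[OF st(3)] T.diff_grade[OF st(4)]
    note c = S.grade_carrier[OF st(1)] T.grade_carrier[OF st(2)] S.grade_carrier[OF st(3)] T.grade_carrier[OF st(4)]
    note bF = F.bvec_F[OF ab(1)] F.bvec_F[OF ab(2)]
    \<comment> \<open>the four terms of the differential of \<open>(s \<otimes> t) (s' \<otimes> t')\<close>, according to the factor that is differentiated\<close>
    define P where "P = \<tau> (i + i' + 1) (diff S s \<otimes>\<^bsub>S\<^esub> s') (j + j') (t \<otimes>\<^bsub>T\<^esub> t')"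
    define Q where "Q = \<tau> (i + i' + 1) (s \<otimes>\<^bsub>S\<^esub> diff S s') (j + j') (t \<otimes>\<^bsub>T\<^esub> t')"
    define U where "U = \<tau> (i + i') (s \<otimes>\<^bsub>S\<^esub> s') (j + j' + 1) (diff T t \<otimes>\<^bsub>T\<^esub> t')"
    define W where "W = \<tau> (i + i') (s \<otimes>\<^bsub>S\<^esub> s') (j + j' + 1) (t \<otimes>\<^bsub>T\<^esub> diff T t')"
    have g: "diff S s \<otimes>\<^bsub>S\<^esub> s' \<in> grade S (i + i' + 1)" "s \<otimes>\<^bsub>S\<^esub> diff S s' \<in> grade S (i + i' + 1)"
      "diff T t \<otimes>\<^bsub>T\<^esub> t' \<in> grade T (j + j' + 1)" "t \<otimes>\<^bsub>T\<^esub> diff T t' \<in> grade T (j + j' + 1)"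
      "s \<otimes>\<^bsub>S\<^esub> s' \<in> grade S (i + i')" "t \<otimes>\<^bsub>T\<^esub> t' \<in> grade T (j + j')"
      using S.mult_grade[OF d(1) st(3)] S.mult_grade[OF st(1) d(3)] T.mult_grade[OF d(2) st(4)]
        T.mult_grade[OF st(2) d(4)] S.mult_grade[OF st(1,3)] T.mult_grade[OF st(2,4)]
      by (simp_all add: algebra_simps)
    have PQ: "P \<in> carrier TT" "Q \<in> carrier TT" "U \<in> carrier TT" "W \<in> carrier TT"
      unfolding P_def Q_def U_def W_def by (intro tau_closed g)+
    have l: "Ker +>\<^bsub>F\<^esub> diff F (bvec K a \<otimes>\<^bsub>F\<^esub> bvec K b) =
        (ksgn TT (j * i') P \<oplus>\<^bsub>TT\<^esub> ksgn TT (j * i' + i) Q) \<oplus>\<^bsub>TT\<^esub>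
        (ksgn TT (j * i' + (i + i')) U \<oplus>\<^bsub>TT\<^esub> ksgn TT (j * i' + (i + i') + j) W)"
    proof -
      have "Ker +>\<^bsub>F\<^esub> diff F (bvec K a \<otimes>\<^bsub>F\<^esub> bvec K b) = ksgn TT (j * i')
        (\<tau> (i + i' + 1) (diff S (s \<otimes>\<^bsub>S\<^esub> s')) (j + j') (t \<otimes>\<^bsub>T\<^esub> t') \<oplus>\<^bsub>TT\<^esub>
         ksgn TT (i + i') (\<tau> (i + i') (s \<otimes>\<^bsub>S\<^esub> s') (j + j' + 1) (diff T (t \<otimes>\<^bsub>T\<^esub> t'))))"
        using st g by (simp add: ae be F_mult_bvec FA.diff_ksgn cl_ksgn bvec_in cl_diff_bvec)
      also have "\<tau> (i + i' + 1) (diff S (s \<otimes>\<^bsub>S\<^esub> s')) (j + j') (t \<otimes>\<^bsub>T\<^esub> t') = P \<oplus>\<^bsub>TT\<^esub> ksgn TT i Q"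
        using S.leibniz[OF st(1) c(3)] g by (simp add: tau_add_left tau_ksgn_left S.ksgn_grade P_def Q_def)
      also have "\<tau> (i + i') (s \<otimes>\<^bsub>S\<^esub> s') (j + j' + 1) (diff T (t \<otimes>\<^bsub>T\<^esub> t')) = U \<oplus>\<^bsub>TT\<^esub> ksgn TT j W"
        using T.leibniz[OF st(2) c(4)] g by (simp add: tau_add_right tau_ksgn_right T.ksgn_grade U_def W_def)
      finally show ?thesis using PQ by (simp add: TM.ksgn_add add.assoc)
    qed
    have r1: "Ker +>\<^bsub>F\<^esub> (diff F (bvec K a) \<otimes>\<^bsub>F\<^esub> bvec K b) =
        ksgn TT (j * i') P \<oplus>\<^bsub>TT\<^esub> ksgn TT (i + (j + 1) * i') U"
    proof -
      have "(Ker +>\<^bsub>F\<^esub> diff F (bvec K a)) \<otimes>\<^bsub>TT\<^esub> (Ker +>\<^bsub>F\<^esub> bvec K b) =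
        (\<tau> (i + 1) (diff S s) j t \<oplus>\<^bsub>TT\<^esub> ksgn TT i (\<tau> i s (j + 1) (diff T t))) \<otimes>\<^bsub>TT\<^esub> \<tau> i' s' j' t'"
        using st by (simp add: ae be cl_diff_bvec) (simp add: \<tau>_def)
      also have "\<dots> = ksgn TT (j * i') P \<oplus>\<^bsub>TT\<^esub> ksgn TT (i + (j + 1) * i') U"
        using st d g tau_closed
        by (simp add: TR.l_distr tau_mult P_def U_def add.commute add.left_commute)
      finally show ?thesis using bF by (simp add: cl_mult)
    qed
    have r2: "Ker +>\<^bsub>F\<^esub> (bvec K a \<otimes>\<^bsub>F\<^esub> diff F (bvec K b)) =
        ksgn TT (j * (i' + 1)) Q \<oplus>\<^bsub>TT\<^esub> ksgn TT (i' + j * i') W"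
    proof -
      have "(Ker +>\<^bsub>F\<^esub> bvec K a) \<otimes>\<^bsub>TT\<^esub> (Ker +>\<^bsub>F\<^esub> diff F (bvec K b)) =
        \<tau> i s j t \<otimes>\<^bsub>TT\<^esub> (\<tau> (i' + 1) (diff S s') j' t' \<oplus>\<^bsub>TT\<^esub> ksgn TT i' (\<tau> i' s' (j' + 1) (diff T t')))"
        using st by (simp add: ae be cl_diff_bvec) (simp add: \<tau>_def)
      also have "\<dots> = ksgn TT (j * (i' + 1)) Q \<oplus>\<^bsub>TT\<^esub> ksgn TT (i' + j * i') W"
        using st d g tau_closed
        by (simp add: TR.r_distr tau_mult Q_def W_def add.commute add.left_commute)
      finally show ?thesis using bF by (simp add: cl_mult)
    qed
    have signs: "ksgn TT (i + (j + 1) * i') U = ksgn TT (j * i' + (i + i')) U"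
      "ksgn TT (i + j + j * (i' + 1)) Q = ksgn TT (j * i' + i) Q"
      "ksgn TT (i + j + (i' + j * i')) W = ksgn TT (j * i' + (i + i') + j) W"
      by (auto intro!: ksgn_cong)
    have "Ker +>\<^bsub>F\<^esub> diff F (bvec K a \<otimes>\<^bsub>F\<^esub> bvec K b) =
      Ker +>\<^bsub>F\<^esub> (diff F (bvec K a) \<otimes>\<^bsub>F\<^esub> bvec K b \<oplus>\<^bsub>F\<^esub> ksgn F (tp a) (bvec K a \<otimes>\<^bsub>F\<^esub> diff F (bvec K b)))"
    proof -
      have "tp a = i + j" by (simp add: ae tp_def)
      then show ?thesis using bF PQ by (simp add: cl_add cl_ksgn r1 r2 l TM.ksgn_add signs TM.a_ac)
    qed
    then show ?thesis using bF by (subst A.cl_eq[symmetric]) auto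
  qed
  have bx: "?L (tp a) (bvec K a) y \<in> Ker" if a: "a \<in> tX" for a
    using basis[OF a] by (intro F.hom_into_submodule[OF F.F_module Ly Ker_submodule _ y] F.bvec_F a) auto
  show ?thesis
  proof (rule F.hom_into_submodule[OF F.F_module Lx[OF y] Ker_submodule _ xc])
    fix a assume a: "a \<in> fsupp K x" "a \<in> tX"
    then have "tp a = n" using x unfolding F.F_grade by auto
    then show "?L n (bvec K a) y \<in> Ker" using bx[OF a(2)] by simp
  qed
qed

sublocale D: dg_ideal K "tensor_free K S T" "tensor_kernel K S T"
  by (intro dg_ideal.intro A.alg_ideal_axioms dg_ideal_axioms.intro Ker_component Ker_diff Ker_diff_diff Ker_leibniz)

theorem tensor_dg_algebra: "dg_algebra K TT"
  unfolding TT_eq by (rule D.Q_dg_algebra)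

sublocale TD: dg_algebra K "tensor K S T"
  by (rule tensor_dg_algebra)

subsection \<open>Pure tensors\<close>

lemma pure_eq: "pure_tensor K S T s t = gext S TT (\<lambda>i s. gext T TT (\<lambda>j t. \<tau> i s j t) t) s"
  by (simp add: pure_tensor_def gext_def \<tau>_def)

lemma tau_gext_hom:
  assumes t: "t \<in> carrier T"
  shows "(\<lambda>s. gext T TT (\<lambda>j t. \<tau> i s j t) t) \<in> module_hom K (S\<lparr>carrier := grade S i\<rparr>) TT"
  unfolding gext_def
  by (intro module_hom_finsum S.grade_module TM.module_axioms tau_hom_left T.component_grade t)

lemma pure_hom_left: "t \<in> carrier T \<Longrightarrow> (\<lambda>s. pure_tensor K S T s t) \<in> module_hom K S TT"
  unfolding pure_eq by (intro S.gext_hom TM.module_axioms tau_gext_hom)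

lemma pure_hom_right: "s \<in> carrier S \<Longrightarrow> (\<lambda>t. pure_tensor K S T s t) \<in> module_hom K T TT"
  unfolding pure_eq gext_def[of S]
  by (intro module_hom_finsum T.module_axiom TM.module_axioms T.gext_hom tau_hom_right S.component_grade)

lemma pure_homog: "s \<in> grade S i \<Longrightarrow> t \<in> grade T j \<Longrightarrow> pure_tensor K S T s t = \<tau> i s j t"
proof -
  assume s: "s \<in> grade S i" and t: "t \<in> grade T j"
  have "pure_tensor K S T s t = gext T TT (\<lambda>j t. \<tau> i s j t) t"
    unfolding pure_eq by (rule S.gext_homog[OF TM.module_axioms tau_gext_hom s]) (rule T.grade_carrier[OF t])
  also have "\<dots> = \<tau> i s j t"
    by (rule T.gext_homog[OF TM.module_axioms tau_hom_right[OF s] t])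
  finally show ?thesis .
qed

lemma pure_closed: "s \<in> carrier S \<Longrightarrow> t \<in> carrier T \<Longrightarrow> pure_tensor K S T s t \<in> carrier TT"
  by (rule module_hom_in[OF pure_hom_left])

lemma tau_pure: "s \<in> grade S i \<Longrightarrow> t \<in> grade T j \<Longrightarrow> Ker +>\<^bsub>F\<^esub> bvec K (i, s, j, t) = pure_tensor K S T s t"
  by (simp add: pure_homog \<tau>_def)

lemma TT_rep: "z \<in> carrier TT \<Longrightarrow> \<exists>f\<in>carrier F. z = Ker +>\<^bsub>F\<^esub> f"
  using A.Q_carrier by (auto simp: TT_eq)

lemma tensor_hom_eq:
  assumes M: "module K M" and h: "h \<in> module_hom K TT M" "h' \<in> module_hom K TT M"
    and eq: "\<And>i j s t. s \<in> grade S i \<Longrightarrow> t \<in> grade T j \<Longrightarrow> h (pure_tensor K S T s t) = h' (pure_tensor K S T s t)"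
    and z: "z \<in> carrier TT"
  shows "h z = h' z"
proof -
  obtain f where f: "f \<in> carrier F" "z = Ker +>\<^bsub>F\<^esub> f" using TT_rep[OF z] by blast
  have "h (Ker +>\<^bsub>F\<^esub> f) = h' (Ker +>\<^bsub>F\<^esub> f)"
    by (rule F.hom_eq_basis[OF M module_hom_comp[OF cl_hom h(1)] module_hom_comp[OF cl_hom h(2)] _ f(1)])
      (auto simp: tX_def tau_pure eq)
  then show ?thesis using f by simp
qed

lemma tensor_hom_into_submodule:
  assumes M: "module K M" and h: "h \<in> module_hom K TT M" and N: "LinearCombinations.submodule K N M"
    and b: "\<And>i j s t. s \<in> grade S i \<Longrightarrow> t \<in> grade T j \<Longrightarrow> h (pure_tensor K S T s t) \<in> N"
    and z: "z \<in> carrier TT"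
  shows "h z \<in> N"
proof -
  obtain f where f: "f \<in> carrier F" "z = Ker +>\<^bsub>F\<^esub> f" using TT_rep[OF z] by blast
  have "h (Ker +>\<^bsub>F\<^esub> f) \<in> N"
    by (rule F.hom_into_submodule[OF M module_hom_comp[OF cl_hom h] N _ f(1)])
      (auto simp: tX_def tau_pure b)
  then show ?thesis using f by simp
qed

lemma tensor_lift_linear:
  assumes M: "module K M" and b: "\<And>i j. bilin K M {\<zero>\<^bsub>M\<^esub>} S T i j (\<phi> i j)"
  shows "\<exists>h. h \<in> module_hom K TT M \<and>
    (\<forall>i j. \<forall>s\<in>grade S i. \<forall>t\<in>grade T j. h (pure_tensor K S T s t) = \<phi> i j s t)"
proof -
  interpret M: module K M by fact
  let ?\<psi> = "\<lambda>(i, s, j, t). \<phi> i j s t"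
  have \<psi>c: "?\<psi> x \<in> carrier M" if "x \<in> tX" for x
    using that b by (auto simp: tX_def bilin_def)
  have \<psi>b: "lext K M ?\<psi> (bvec K (i, s, j, t)) = \<phi> i j s t" if "s \<in> grade S i" "t \<in> grade T j" for i s j t
    using F.lext_bvec[OF M, of ?\<psi> "(i, s, j, t)"] \<psi>c that by simp
  have h: "lext K M ?\<psi> \<in> module_hom K F M" by (rule F.lext_hom[OF M]) (rule \<psi>c)
  have K0: "lext K M ?\<psi> x \<in> {\<zero>\<^bsub>M\<^esub>}" if "x \<in> Ker" for x
    by (rule hom_kernel_into[OF M zero_submodule[OF M] h _ that]) (rule bilin_cong[OF \<psi>b b], assumption+)
  have "\<exists>g. g \<in> module_hom K TT M \<and> (\<forall>x\<in>carrier F. g (Ker +>\<^bsub>F\<^esub> x) = lext K M ?\<psi> x)"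
    unfolding TT_eq by (rule D.quot_lift_linear[OF M h]) (use K0 in simp)
  then obtain g where "g \<in> module_hom K TT M" "\<And>x. x \<in> carrier F \<Longrightarrow> g (Ker +>\<^bsub>F\<^esub> x) = lext K M ?\<psi> x"
    by blast
  then have "g (pure_tensor K S T s t) = \<phi> i j s t" if "s \<in> grade S i" "t \<in> grade T j" for i j s t
    using bvec_in[OF that] \<psi>b[OF that] tau_pure[OF that] by (metis (no_types))
  then show ?thesis using \<open>g \<in> module_hom K TT M\<close> by (intro exI[of _ g]) simp
qed

lemma pure_grade: "s \<in> grade S i \<Longrightarrow> t \<in> grade T j \<Longrightarrow> pure_tensor K S T s t \<in> grade TT (i + j)"
  using F.bvec_grade[of "(i, s, j, t)"] A.Q_carrier
  by (auto simp: tau_pure[symmetric] TT_eq dg_quot_def tp_def)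

lemma pure_mult:
  assumes "s \<in> carrier S" "t \<in> grade T j" "s' \<in> grade S i'" "t' \<in> carrier T"
  shows "pure_tensor K S T s t \<otimes>\<^bsub>TT\<^esub> pure_tensor K S T s' t' =
    ksgn TT (j * i') (pure_tensor K S T (s \<otimes>\<^bsub>S\<^esub> s') (t \<otimes>\<^bsub>T\<^esub> t'))"
proof -
  note c = T.grade_carrier[OF assms(2)] S.grade_carrier[OF assms(3)]
  have 1: "pure_tensor K S T s t \<otimes>\<^bsub>TT\<^esub> pure_tensor K S T s' t' =
    ksgn TT (j * i') (pure_tensor K S T (s \<otimes>\<^bsub>S\<^esub> s') (t \<otimes>\<^bsub>T\<^esub> t'))" if t': "t' \<in> grade T j'" for t' j'
  proof (rule S.hom_eq_on_carrier[OF _ _ _ assms(1)])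
    note tc = T.grade_carrier[OF t']
    show "(\<lambda>s. pure_tensor K S T s t \<otimes>\<^bsub>TT\<^esub> pure_tensor K S T s' t') \<in> module_hom K S TT"
      by (intro module_hom_comp[OF pure_hom_left TD.mult_right_hom] c pure_closed tc)
    show "(\<lambda>s. ksgn TT (j * i') (pure_tensor K S T (s \<otimes>\<^bsub>S\<^esub> s') (t \<otimes>\<^bsub>T\<^esub> t'))) \<in> module_hom K S TT"
      by (intro module_hom_ksgn TM.module_axioms module_hom_comp[OF S.mult_right_hom pure_hom_left] c T.m_closed tc)
    fix i s assume "s \<in> grade S i"
    then show "pure_tensor K S T s t \<otimes>\<^bsub>TT\<^esub> pure_tensor K S T s' t' =
      ksgn TT (j * i') (pure_tensor K S T (s \<otimes>\<^bsub>S\<^esub> s') (t \<otimes>\<^bsub>T\<^esub> t'))"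
      using assms(2,3) t' by (simp add: pure_homog tau_mult
          pure_homog[OF S.mult_grade[OF _ assms(3)] T.mult_grade[OF assms(2) t']])
  qed
  show ?thesis
  proof (rule T.hom_eq_on_carrier[OF _ _ _ assms(4)])
    show "(\<lambda>t'. pure_tensor K S T s t \<otimes>\<^bsub>TT\<^esub> pure_tensor K S T s' t') \<in> module_hom K T TT"
      by (intro module_hom_comp[OF pure_hom_right TD.mult_left_hom] c pure_closed assms)
    show "(\<lambda>t'. ksgn TT (j * i') (pure_tensor K S T (s \<otimes>\<^bsub>S\<^esub> s') (t \<otimes>\<^bsub>T\<^esub> t'))) \<in> module_hom K T TT"
      by (intro module_hom_ksgn TM.module_axioms module_hom_comp[OF T.mult_left_hom pure_hom_right] c S.m_closed assms)
  qed (rule 1)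
qed

lemma pure_one: "pure_tensor K S T \<one>\<^bsub>S\<^esub> \<one>\<^bsub>T\<^esub> = \<one>\<^bsub>TT\<^esub>"
  using tau_pure[OF S.one_grade T.one_grade] A.Q_one F.F_one by (simp add: TT_eq te_def)

lemma pure_diff:
  assumes "s \<in> grade S i" "t \<in> carrier T"
  shows "diff TT (pure_tensor K S T s t) =
    pure_tensor K S T (diff S s) t \<oplus>\<^bsub>TT\<^esub> ksgn TT i (pure_tensor K S T s (diff T t))"
proof (rule T.hom_eq_on_carrier[OF _ _ _ assms(2)])
  note c = S.grade_carrier[OF assms(1)]
  show "(\<lambda>t. diff TT (pure_tensor K S T s t)) \<in> module_hom K T TT"
    by (rule module_hom_comp[OF pure_hom_right[OF c] TD.diff_linear])
  show "(\<lambda>t. pure_tensor K S T (diff S s) t \<oplus>\<^bsub>TT\<^esub> ksgn TT i (pure_tensor K S T s (diff T t))) \<in> module_hom K T TT"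
    by (intro module_hom_add2 module_hom_ksgn TM.module_axioms pure_hom_right S.diff_closed c
        module_hom_comp[OF T.diff_linear pure_hom_right])
  fix j t assume t: "t \<in> grade T j"
  have "diff TT (pure_tensor K S T s t) = Ker +>\<^bsub>F\<^esub> diff F (bvec K (i, s, j, t))"
    using D.Q_diff[OF bvec_in[OF assms(1) t]] by (simp add: TT_eq tau_pure[OF assms(1) t])
  then show "diff TT (pure_tensor K S T s t) =
    pure_tensor K S T (diff S s) t \<oplus>\<^bsub>TT\<^esub> ksgn TT i (pure_tensor K S T s (diff T t))"
    using cl_diff_bvec[OF assms(1) t] pure_homog[OF S.diff_grade[OF assms(1)] t]
      pure_homog[OF assms(1) T.diff_grade[OF t]] by simp
qed

lemma pure_factor: "s \<in> carrier S \<Longrightarrow> t \<in> carrier T \<Longrightarrow>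
    pure_tensor K S T s \<one>\<^bsub>T\<^esub> \<otimes>\<^bsub>TT\<^esub> pure_tensor K S T \<one>\<^bsub>S\<^esub> t = pure_tensor K S T s t"
  using pure_mult[OF _ T.one_grade S.one_grade, of s t] pure_closed by simp

lemma inl_map: "dga_map K S TT (\<lambda>s. pure_tensor K S T s \<one>\<^bsub>T\<^esub>)"
proof (rule dga_mapI)
  show "(\<lambda>s. pure_tensor K S T s \<one>\<^bsub>T\<^esub>) \<in> module_hom K S TT" by (rule pure_hom_left) simp
  fix x y assume x: "x \<in> carrier S" and y: "y \<in> carrier S"
  show "pure_tensor K S T (x \<otimes>\<^bsub>S\<^esub> y) \<one>\<^bsub>T\<^esub> = pure_tensor K S T x \<one>\<^bsub>T\<^esub> \<otimes>\<^bsub>TT\<^esub> pure_tensor K S T y \<one>\<^bsub>T\<^esub>"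
  proof (rule S.hom_eq_on_carrier[OF _ _ _ y])
    show "(\<lambda>y. pure_tensor K S T (x \<otimes>\<^bsub>S\<^esub> y) \<one>\<^bsub>T\<^esub>) \<in> module_hom K S TT"
      by (rule module_hom_comp[OF S.mult_left_hom[OF x] pure_hom_left]) simp
    show "(\<lambda>y. pure_tensor K S T x \<one>\<^bsub>T\<^esub> \<otimes>\<^bsub>TT\<^esub> pure_tensor K S T y \<one>\<^bsub>T\<^esub>) \<in> module_hom K S TT"
      by (rule module_hom_comp[OF pure_hom_left TD.mult_left_hom]) (simp_all add: pure_closed x)
    fix i y assume y: "y \<in> grade S i"
    then show "pure_tensor K S T (x \<otimes>\<^bsub>S\<^esub> y) \<one>\<^bsub>T\<^esub> = pure_tensor K S T x \<one>\<^bsub>T\<^esub> \<otimes>\<^bsub>TT\<^esub> pure_tensor K S T y \<one>\<^bsub>T\<^esub>"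
      using pure_mult[OF x T.one_grade y, of "\<one>\<^bsub>T\<^esub>"] by simp
  qed
next
  fix x assume x: "x \<in> carrier S"
  show "pure_tensor K S T (diff S x) \<one>\<^bsub>T\<^esub> = diff TT (pure_tensor K S T x \<one>\<^bsub>T\<^esub>)"
  proof (rule S.hom_eq_on_carrier[OF _ _ _ x])
    show "(\<lambda>x. pure_tensor K S T (diff S x) \<one>\<^bsub>T\<^esub>) \<in> module_hom K S TT"
      by (rule module_hom_comp[OF S.diff_linear pure_hom_left]) simp
    show "(\<lambda>x. diff TT (pure_tensor K S T x \<one>\<^bsub>T\<^esub>)) \<in> module_hom K S TT"
      by (rule module_hom_comp[OF pure_hom_left TD.diff_linear]) simp
    fix i x assume x: "x \<in> grade S i"
    have "pure_tensor K S T x \<zero>\<^bsub>T\<^esub> = \<zero>\<^bsub>TT\<^esub>"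
      using pure_homog[OF x T.zero_grade[of 0]] tau_zero_right[OF x] by simp
    then show "pure_tensor K S T (diff S x) \<one>\<^bsub>T\<^esub> = diff TT (pure_tensor K S T x \<one>\<^bsub>T\<^esub>)"
      using pure_diff[OF x T.one_closed] T.diff_one S.grade_carrier[OF x] pure_closed by simp
  qed
qed (use pure_grade[OF _ T.one_grade] in \<open>auto simp: pure_one\<close>)

lemma inr_map: "dga_map K T TT (\<lambda>t. pure_tensor K S T \<one>\<^bsub>S\<^esub> t)"
proof (rule dga_mapI)
  show "(\<lambda>t. pure_tensor K S T \<one>\<^bsub>S\<^esub> t) \<in> module_hom K T TT" by (rule pure_hom_right) simp
  fix x y assume x: "x \<in> carrier T" and y: "y \<in> carrier T"
  show "pure_tensor K S T \<one>\<^bsub>S\<^esub> (x \<otimes>\<^bsub>T\<^esub> y) = pure_tensor K S T \<one>\<^bsub>S\<^esub> x \<otimes>\<^bsub>TT\<^esub> pure_tensor K S T \<one>\<^bsub>S\<^esub> y"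
  proof (rule T.hom_eq_on_carrier[OF _ _ _ x])
    show "(\<lambda>x. pure_tensor K S T \<one>\<^bsub>S\<^esub> (x \<otimes>\<^bsub>T\<^esub> y)) \<in> module_hom K T TT"
      by (rule module_hom_comp[OF T.mult_right_hom[OF y] pure_hom_right]) simp
    show "(\<lambda>x. pure_tensor K S T \<one>\<^bsub>S\<^esub> x \<otimes>\<^bsub>TT\<^esub> pure_tensor K S T \<one>\<^bsub>S\<^esub> y) \<in> module_hom K T TT"
      by (rule module_hom_comp[OF pure_hom_right TD.mult_right_hom]) (simp_all add: pure_closed y)
    fix i x assume x: "x \<in> grade T i"
    then show "pure_tensor K S T \<one>\<^bsub>S\<^esub> (x \<otimes>\<^bsub>T\<^esub> y) = pure_tensor K S T \<one>\<^bsub>S\<^esub> x \<otimes>\<^bsub>TT\<^esub> pure_tensor K S T \<one>\<^bsub>S\<^esub> y"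
      using pure_mult[OF S.one_closed x S.one_grade y] by simp
  qed
next
  fix x assume x: "x \<in> carrier T"
  have "pure_tensor K S T \<zero>\<^bsub>S\<^esub> x = \<zero>\<^bsub>TT\<^esub>"
    using mod_hom.f0_is_0[OF mod_homI[OF S.module_axiom TM.module_axioms pure_hom_left[OF x]]] .
  then show "pure_tensor K S T \<one>\<^bsub>S\<^esub> (diff T x) = diff TT (pure_tensor K S T \<one>\<^bsub>S\<^esub> x)"
    using pure_diff[OF S.one_grade x] S.diff_one pure_closed x by simp
qed (use pure_grade[OF S.one_grade] in \<open>auto simp: pure_one\<close>)

text \<open>Two morphisms whose images commute in the graded sense define a morphism on the tensor product. The commutation is
  what makes \<open>f s \<otimes> g t\<close> multiplicative for the product with Koszul signs.\<close>

theorem tensor_lift: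
  assumes B: "dg_algebra K B" and f: "dga_map K S B f" and g: "dga_map K T B g"
    and comm: "\<And>i j s t. s \<in> grade S i \<Longrightarrow> t \<in> grade T j \<Longrightarrow> g t \<otimes>\<^bsub>B\<^esub> f s = ksgn B (j * i) (f s \<otimes>\<^bsub>B\<^esub> g t)"
  shows "\<exists>h. dga_map K TT B h \<and> (\<forall>s\<in>carrier S. \<forall>t\<in>carrier T. h (pure_tensor K S T s t) = f s \<otimes>\<^bsub>B\<^esub> g t)"
proof -
  interpret B: dg_algebra K B by fact
  note fc = dga_map_closed[OF f] and gc = dga_map_closed[OF g]
  let ?\<phi> = "\<lambda>(i::int, s, j::int, t). f s \<otimes>\<^bsub>B\<^esub> g t"
  have \<phi>c: "?\<phi> x \<in> carrier B" if "x \<in> tX" for x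
    using that fc gc S.grade_carrier T.grade_carrier by (auto simp: tX_def)
  have \<phi>b: "lext K B ?\<phi> (bvec K (i, s, j, t)) = f s \<otimes>\<^bsub>B\<^esub> g t" if "s \<in> grade S i" "t \<in> grade T j" for i s j t
    using F.lext_bvec[OF B.module_axiom, of ?\<phi> "(i, s, j, t)"] \<phi>c that by simp
  have lh: "mod_hom K F B (lext K B ?\<phi>)"
    by (intro mod_homI F.F_module B.module_axiom F.lext_hom \<phi>c)
  have F_map: "dga_map K F B (lext K B ?\<phi>)"
  proof (rule F.lext_dga_map[OF B.pre_dga])
    show "?\<phi> x \<in> grade B (tp x)" if "x \<in> tX" for x
      using that B.mult_grade dga_map_grade[OF f] dga_map_grade[OF g] by (auto simp: tX_def tp_def)
    show "?\<phi> te = \<one>\<^bsub>B\<^esub>" by (simp add: te_def dga_map_one[OF f] dga_map_one[OF g])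
  next
    fix x y assume xy: "x \<in> tX" "y \<in> tX"
    obtain i s j t where xe: "x = (i, s, j, t)" by (cases x)
    obtain i' s' j' t' where ye: "y = (i', s', j', t')" by (cases y)
    have st: "s \<in> grade S i" "t \<in> grade T j" "s' \<in> grade S i'" "t' \<in> grade T j'" using xy xe ye by auto
    note c = S.grade_carrier[OF st(1)] T.grade_carrier[OF st(2)] S.grade_carrier[OF st(3)] T.grade_carrier[OF st(4)]
    have "f s \<otimes>\<^bsub>B\<^esub> g t \<otimes>\<^bsub>B\<^esub> (f s' \<otimes>\<^bsub>B\<^esub> g t') = f s \<otimes>\<^bsub>B\<^esub> (g t \<otimes>\<^bsub>B\<^esub> f s') \<otimes>\<^bsub>B\<^esub> g t'"
      using c fc gc by (simp add: B.m_assoc)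
    also have "\<dots> = ksgn B (j * i') (f s \<otimes>\<^bsub>B\<^esub> f s' \<otimes>\<^bsub>B\<^esub> (g t \<otimes>\<^bsub>B\<^esub> g t'))"
      using c fc gc by (simp add: comm[OF st(3,2)] B.m_assoc)
    finally show "?\<phi> x \<otimes>\<^bsub>B\<^esub> ?\<phi> y = ksgn B (ts x y) (?\<phi> (tm x y))"
      using c by (simp add: xe ye ts_def tm_def dga_map_mult[OF f] dga_map_mult[OF g])
  next
    fix x assume x: "x \<in> tX"
    obtain i s j t where xe: "x = (i, s, j, t)" by (cases x)
    have st: "s \<in> grade S i" "t \<in> grade T j" using x xe by auto
    note c = S.grade_carrier[OF st(1)] T.grade_carrier[OF st(2)]
    note d = S.diff_grade[OF st(1)] T.diff_grade[OF st(2)]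
    have "td x = diff F (bvec K x)" using F.F_diff_bvec[OF x] by simp
    also have "\<dots> = bvec K (i + 1, diff S s, j, t) \<oplus>\<^bsub>F\<^esub> ksgn F i (bvec K (i, s, j + 1, diff T t))"
      using F_diff_bvec[OF st] by (simp add: xe)
    finally have "lext K B ?\<phi> (td x) = f (diff S s) \<otimes>\<^bsub>B\<^esub> g t \<oplus>\<^bsub>B\<^esub> ksgn B i (f s \<otimes>\<^bsub>B\<^esub> g (diff T t))"
      using st d bvec_in
      by (simp add: module_hom_add[OF mod_hom.f_hom[OF lh]] mod_hom.f_ksgn[OF lh] \<phi>b FA.ksgn_closed)
    also have "\<dots> = diff B (f s \<otimes>\<^bsub>B\<^esub> g t)"
      using B.leibniz[OF dga_map_grade[OF f st(1)] gc[OF c(2)]] c by (simp add: dga_map_diff[OF f] dga_map_diff[OF g])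
    finally show "lext K B ?\<phi> (td x) = diff B (?\<phi> x)" by (simp add: xe)
  qed
  have bl: "bilin K B {\<zero>\<^bsub>B\<^esub>} S T i j (\<lambda>s t. f s \<otimes>\<^bsub>B\<^esub> g t)" for i j
    using fc gc S.grade_carrier T.grade_carrier
    by (intro bilinI B.module_axiom S.graded_module_axioms T.graded_module_axioms module_homI)
      (auto simp: dga_map_add[OF f] dga_map_add[OF g] dga_map_smult[OF f] dga_map_smult[OF g]
        B.l_distr B.r_distr B.smult_mult_left B.smult_mult_right)
  have K0: "lext K B ?\<phi> x \<in> {\<zero>\<^bsub>B\<^esub>}" if "x \<in> Ker" for x
    by (rule hom_kernel_into[OF B.module_axiom zero_submodule[OF B.module_axiom] mod_hom.f_hom[OF lh] _ that])
      (rule bilin_cong[OF \<phi>b bl], assumption+)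
  have "\<exists>h. dga_map K TT B h \<and> (\<forall>x\<in>carrier F. h (Ker +>\<^bsub>F\<^esub> x) = lext K B ?\<phi> x)"
    unfolding TT_eq by (rule D.quot_lift[OF B.pre_dga F_map]) (use K0 in simp)
  then obtain h where h: "dga_map K TT B h" "\<And>x. x \<in> carrier F \<Longrightarrow> h (Ker +>\<^bsub>F\<^esub> x) = lext K B ?\<phi> x"
    by blast
  have hh: "h (pure_tensor K S T s t) = f s \<otimes>\<^bsub>B\<^esub> g t" if "s \<in> grade S i" "t \<in> grade T j" for s t i j
    using h(2)[OF bvec_in[OF that]] \<phi>b that by (simp add: tau_pure)
  have "h (pure_tensor K S T s t) = f s \<otimes>\<^bsub>B\<^esub> g t" if s: "s \<in> carrier S" and t: "t \<in> carrier T" for s t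
  proof (rule S.hom_eq_on_carrier[OF module_hom_comp[OF pure_hom_left[OF t] dga_map_hom[OF h(1)]]
      module_hom_comp[OF dga_map_hom[OF f] B.mult_right_hom[OF gc[OF t]]] _ s])
    fix i s assume s: "s \<in> grade S i"
    note sc = S.grade_carrier[OF s]
    show "h (pure_tensor K S T s t) = f s \<otimes>\<^bsub>B\<^esub> g t"
      by (rule T.hom_eq_on_carrier[OF module_hom_comp[OF pure_hom_right[OF sc] dga_map_hom[OF h(1)]]
            module_hom_comp[OF dga_map_hom[OF g] B.mult_left_hom[OF fc[OF sc]]] hh[OF s] t])
  qed
  then show ?thesis using h(1) by blast
qed

end

lemma dga_hom_tensor_eqI:
  assumes "dg_algebra K S" "dg_algebra K T" "dg_algebra K B"
    and h: "h \<in> dga_hom K (tensor K S T) B" "h' \<in> dga_hom K (tensor K S T) B"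
    and eq: "\<And>s t. s \<in> carrier S \<Longrightarrow> t \<in> carrier T \<Longrightarrow> h (pure_tensor K S T s t) = h' (pure_tensor K S T s t)"
  shows "h = h'"
proof -
  interpret dg_pair K S T by (intro dg_pair.intro assms)
  interpret B: dg_algebra K B by fact
  show ?thesis
  proof (rule dga_hom_eqI[OF h])
    fix z assume z: "z \<in> carrier TT"
    show "h z = h' z"
      by (rule tensor_hom_eq[OF B.module_axiom dga_map_hom[OF dga_hom_map[OF h(1)]] dga_map_hom[OF dga_hom_map[OF h(2)]] _ z])
        (rule eq[OF S.grade_carrier T.grade_carrier])
  qed
qed

lemma tensor_map_hom:
  assumes "dg_algebra K S" "dg_algebra K S'" "dg_algebra K T" and v: "dga_map K S S' v"
  shows "tensor_map K T S S' v \<in> dga_hom K (tensor K S T) (tensor K S' T)"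
    and "\<And>s t. s \<in> carrier S \<Longrightarrow> t \<in> carrier T \<Longrightarrow>
      tensor_map K T S S' v (pure_tensor K S T s t) = pure_tensor K S' T (v s) t"
proof -
  interpret P: dg_pair K S T by (intro dg_pair.intro assms)
  interpret P': dg_pair K S' T by (intro dg_pair.intro assms)
  let ?P = "\<lambda>h. h \<in> dga_hom K (tensor K S T) (tensor K S' T) \<and>
     (\<forall>s\<in>carrier S. \<forall>t\<in>carrier T. h (pure_tensor K S T s t) = pure_tensor K S' T (v s) t)"
  note vc = dga_map_closed[OF v]
  have "\<exists>h. dga_map K P.TT P'.TT h \<and> (\<forall>s\<in>carrier S. \<forall>t\<in>carrier T. h (pure_tensor K S T s t) =
      pure_tensor K S' T (v s) \<one>\<^bsub>T\<^esub> \<otimes>\<^bsub>P'.TT\<^esub> pure_tensor K S' T \<one>\<^bsub>S'\<^esub> t)"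
  proof (rule P.tensor_lift[OF P'.tensor_dg_algebra dga_map_comp[OF v P'.inl_map] P'.inr_map])
    fix i j s t assume s: "s \<in> grade S i" and t: "t \<in> grade T j"
    note sc = P.S.grade_carrier[OF s] and tc = P.T.grade_carrier[OF t]
    show "pure_tensor K S' T \<one>\<^bsub>S'\<^esub> t \<otimes>\<^bsub>P'.TT\<^esub> pure_tensor K S' T (v s) \<one>\<^bsub>T\<^esub> =
      ksgn P'.TT (j * i) (pure_tensor K S' T (v s) \<one>\<^bsub>T\<^esub> \<otimes>\<^bsub>P'.TT\<^esub> pure_tensor K S' T \<one>\<^bsub>S'\<^esub> t)"
      using P'.pure_mult[OF P'.S.one_closed t dga_map_grade[OF v s] P.T.one_closed] P'.pure_factor[OF vc[OF sc] tc] sc tc vc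
      by simp
  qed
  then obtain h where h: "dga_map K P.TT P'.TT h"
    "\<And>s t. s \<in> carrier S \<Longrightarrow> t \<in> carrier T \<Longrightarrow> h (pure_tensor K S T s t) = pure_tensor K S' T (v s) t"
    using vc P'.pure_factor by auto
  have "?P (restrict h (carrier P.TT))"
    using h P.pure_closed by (auto intro: restrict_dga_hom[OF P.TD.pre_dga])
  then have "\<exists>!h. ?P h"
  proof (intro ex_ex1I)
    fix h h' assume "?P h" "?P h'"
    then show "h = h'"
      by (intro dga_hom_tensor_eqI[OF assms(1,3) P'.tensor_dg_algebra]) simp_all
  qed blast
  from theI'[OF this] have "?P (tensor_map K T S S' v)" unfolding tensor_map_def .
  then show "tensor_map K T S S' v \<in> dga_hom K (tensor K S T) (tensor K S' T)"
    and "\<And>s t. s \<in> carrier S \<Longrightarrow> t \<in> carrier T \<Longrightarrow>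
      tensor_map K T S S' v (pure_tensor K S T s t) = pure_tensor K S' T (v s) t" by auto
qed

section \<open>Coproducts\<close>

text \<open>A morphism that kills the generators of an ideal kills the ideal.\<close>

lemma dga_map_kernel_ideal:
  assumes "pre_dga K A" "pre_dga K B" "dga_map K A B f"
  shows "ideal {x \<in> carrier A. f x = \<zero>\<^bsub>B\<^esub>} A"
proof -
  interpret A: pre_dga K A by fact
  interpret B: pre_dga K B by fact
  interpret f: mod_hom K A B f by (intro mod_homI A.module_axiom B.module_axiom dga_map_hom assms)
  note m = dga_map_mult[OF assms(3)] and c = dga_map_closed[OF assms(3)]
  show ?thesis
  proof (rule idealI[OF A.ring_axioms])
    show "subgroup {x \<in> carrier A. f x = \<zero>\<^bsub>B\<^esub>} (add_monoid A)"
      using A.zero_closed by (intro A.add.subgroupI) (auto simp: B.M.minus_equality intro!: exI[of _ "\<zero>\<^bsub>A\<^esub>"])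
  qed (auto simp: m c)
qed

lemma word_deg_simps [simp]:
  "word_deg [] = 0" "word_deg (a # w) = fst a + word_deg w" "word_deg (u @ v) = word_deg u + word_deg v"
  by (simp_all add: word_deg_def)

locale dg_coprod = A: dg_algebra K A + B: dg_algebra K B
  for K :: "'k ring" and A :: "('k, 'a) dg" and B :: "('k, 'b) dg"
begin

definition "letters = {(i, Inl x) | i x. x \<in> grade A i} \<union> {(i, Inr y) | i y. y \<in> grade B i}"
definition dletter :: "int \<times> ('a + 'b) \<Rightarrow> int \<times> ('a + 'b)" where
  "dletter a = (fst a + 1, map_sum (diff A) (diff B) (snd a))"
definition wdiff :: "('a, 'b) word \<Rightarrow> ('a, 'b) word \<Rightarrow> 'k" where
  "wdiff w z = (\<Oplus>\<^bsub>K\<^esub>p\<in>{..<length w}. ksgn K (word_deg (take p w)) (bvec K (w[p := dletter (w ! p)]) z))"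

abbreviation "F \<equiv> coprod_free K A B"
abbreviation "Ker \<equiv> coprod_kernel K A B"
abbreviation "P \<equiv> coprod K A B"

lemma dletter_in: "a \<in> letters \<Longrightarrow> dletter a \<in> letters"
  using A.diff_grade B.diff_grade by (auto simp: letters_def dletter_def)

lemma word_deg_update:
  "p < length w \<Longrightarrow> word_deg (w[p := dletter (w ! p)]) = word_deg w + 1"
  by (induction w arbitrary: p) (auto simp: dletter_def nth_Cons split: nat.splits)

lemma update_in: "w \<in> lists letters \<Longrightarrow> p < length w \<Longrightarrow> w[p := dletter (w ! p)] \<in> lists letters"
  using set_update_subset_insert[of w p "dletter (w ! p)"] dletter_in[of "w ! p"] nth_mem[of p w]
  unfolding lists_eq_set by blast

sublocale F: free_algebra K "lists letters" "\<lambda>_ _. 0" "(@)" "[]" word_deg wdiff "coprod_free K A B"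
proof (intro free_algebra.intro free_algebra_axioms.intro)
  show "cring K" by (rule A.R.is_cring)
  show "F = free_dg K (lists letters) (\<lambda>x y z. ksgn K 0 (bvec K (x @ y) z)) [] word_deg wdiff"
    by (simp add: coprod_free_def letters_def wdiff_def[abs_def] dletter_def)
  have bK: "bvec K w z \<in> carrier K" for w z :: "('a, 'b) word" by (simp add: bvec_def)
  fix w assume w: "w \<in> lists letters"
  let ?S = "(\<lambda>p. w[p := dletter (w ! p)]) ` {..<length w}"
  have "wdiff w z = \<zero>\<^bsub>K\<^esub>" if "z \<notin> ?S" for z
    unfolding wdiff_def using that by (intro A.R.finsum_all0) (auto simp: bvec_def)
  then have sub: "fsupp K (wdiff w) \<subseteq> ?S" by (auto simp: fsupp_def)
  show "range (wdiff w) \<subseteq> carrier K" by (auto simp: wdiff_def bK intro!: A.R.finsum_closed)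
  show "finite (fsupp K (wdiff w))" using sub by (rule finite_subset) simp
  show "fsupp K (wdiff w) \<subseteq> lists letters" using sub update_in[OF w] by auto
  show "word_deg y = word_deg w + 1" if "y \<in> fsupp K (wdiff w)" for y
    using that sub word_deg_update by auto
qed auto

sublocale FA: pre_dga K "coprod_free K A B"
  by (rule F.F_pre_dga)

lemma bvec_append: "u \<in> lists letters \<Longrightarrow> v \<in> lists letters \<Longrightarrow> bvec K u \<otimes>\<^bsub>F\<^esub> bvec K v = bvec K (u @ v)"
  by (simp add: F.bvec_mult)

lemma bvec_F: "w \<in> lists letters \<Longrightarrow> bvec K w \<in> carrier F"
  by (rule F.bvec_F)

lemma bvec_Cons: "a \<in> letters \<Longrightarrow> w \<in> lists letters \<Longrightarrow> bvec K (a # w) = bvec K [a] \<otimes>\<^bsub>F\<^esub> bvec K w"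
  by (simp add: bvec_append)

lemma wdiff_finsum:
  assumes "w \<in> lists letters"
  shows "wdiff w = (\<Oplus>\<^bsub>F\<^esub>p\<in>{..<length w}. ksgn F (word_deg (take p w)) (bvec K (w[p := dletter (w ! p)])))"
proof
  fix z
  have c: "bvec K (w[p := dletter (w ! p)]) \<in> carrier F" if "p < length w" for p
    by (rule bvec_F[OF update_in[OF assms that]])
  show "wdiff w z = (\<Oplus>\<^bsub>F\<^esub>p\<in>{..<length w}. ksgn F (word_deg (take p w)) (bvec K (w[p := dletter (w ! p)]))) z"
    unfolding wdiff_def
    by (subst F.F_finsum) (auto simp: F.F_ksgn c F.F_in[OF c] intro!: A.R.finsum_cong')
qed

lemma wdiff_F: "w \<in> lists letters \<Longrightarrow> wdiff w \<in> carrier F"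
  by (rule F.delta_F)

lemma wdiff_Nil: "wdiff [] = \<zero>\<^bsub>F\<^esub>"
  by (simp add: wdiff_finsum)

lemma wdiff_Cons:
  assumes a: "a \<in> letters" and w: "w \<in> lists letters"
  shows "wdiff (a # w) = bvec K (dletter a # w) \<oplus>\<^bsub>F\<^esub> ksgn F (fst a) (bvec K [a] \<otimes>\<^bsub>F\<^esub> wdiff w)"
proof -
  \<comment> \<open>split off the position of the first letter\<close>
  let ?t = "\<lambda>p. ksgn F (word_deg (take p (a # w))) (bvec K ((a # w)[p := dletter ((a # w) ! p)]))"
  have aw: "a # w \<in> lists letters" using a w by simp
  have tc: "?t p \<in> carrier F" if "p < length (a # w)" for p
    using update_in[OF aw that] bvec_F by (intro FA.ksgn_closed) auto
  have set: "{..<length (a # w)} = insert 0 (Suc ` {..<length w})"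
    by (auto simp: image_iff less_Suc_eq_0_disj)
  have "wdiff (a # w) = (\<Oplus>\<^bsub>F\<^esub>p\<in>insert 0 (Suc ` {..<length w}). ?t p)"
    unfolding wdiff_finsum[OF aw] set ..
  also have "\<dots> = ?t 0 \<oplus>\<^bsub>F\<^esub> (\<Oplus>\<^bsub>F\<^esub>p\<in>Suc ` {..<length w}. ?t p)"
    using tc[of 0] tc by (intro FA.finsum_insert) (auto simp del: list_update.simps)
  also have "(\<Oplus>\<^bsub>F\<^esub>p\<in>Suc ` {..<length w}. ?t p) = (\<Oplus>\<^bsub>F\<^esub>p\<in>{..<length w}. ?t (Suc p))"
    using tc by (intro FA.finsum_reindex) auto
  also have "\<dots> = (\<Oplus>\<^bsub>F\<^esub>p\<in>{..<length w}. ksgn F (fst a) (bvec K [a] \<otimes>\<^bsub>F\<^esub>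
      ksgn F (word_deg (take p w)) (bvec K (w[p := dletter (w ! p)]))))"
  proof (rule FA.finsum_cong')
    fix p assume "p \<in> {..<length w}"
    then have u: "w[p := dletter (w ! p)] \<in> lists letters" using update_in[OF w] by auto
    have "bvec K (a # w[p := dletter (w ! p)]) = bvec K [a] \<otimes>\<^bsub>F\<^esub> bvec K (w[p := dletter (w ! p)])"
      by (rule bvec_Cons[OF a u])
    then show "?t (Suc p) = ksgn F (fst a) (bvec K [a] \<otimes>\<^bsub>F\<^esub>
      ksgn F (word_deg (take p w)) (bvec K (w[p := dletter (w ! p)])))"
      using u a bvec_F by simp
  qed (use a update_in[OF w] bvec_F in \<open>auto intro!: FA.ksgn_closed FA.m_closed\<close>)
  also have "\<dots> = ksgn F (fst a) (bvec K [a] \<otimes>\<^bsub>F\<^esub> wdiff w)"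
  proof -
    have "(\<lambda>x. ksgn F (fst a) (bvec K [a] \<otimes>\<^bsub>F\<^esub> x)) \<in> module_hom K F F"
      using a bvec_F by (intro module_hom_ksgn FA.module_axiom FA.mult_left_hom) auto
    note fs = mod_hom.f_finsum[OF mod_homI[OF FA.module_axiom FA.module_axiom this]]
    show ?thesis unfolding wdiff_finsum[OF w]
      by (rule fs[symmetric]) (use update_in[OF w] bvec_F in auto)
  qed
  finally show ?thesis by simp
qed

lemma diff_bvec: "w \<in> lists letters \<Longrightarrow> diff F (bvec K w) = wdiff w"
  by (rule F.F_diff_bvec)

lemma wdiff_append:
  assumes "u \<in> lists letters" "v \<in> lists letters"
  shows "wdiff (u @ v) = wdiff u \<otimes>\<^bsub>F\<^esub> bvec K v \<oplus>\<^bsub>F\<^esub> ksgn F (word_deg u) (bvec K u \<otimes>\<^bsub>F\<^esub> wdiff v)"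
  using assms(1)
proof (induction u)
  case Nil
  then show ?case using assms(2) bvec_F wdiff_F F.F_one FA.l_one by (simp add: wdiff_Nil flip: F.F_one)
next
  case (Cons a u)
  note a = Cons(1) and u = Cons(2)
  have c: "bvec K [a] \<in> carrier F" "bvec K u \<in> carrier F" "bvec K v \<in> carrier F" "wdiff u \<in> carrier F" "wdiff v \<in> carrier F"
    "bvec K (dletter a # u) \<in> carrier F"
    using a u assms(2) bvec_F wdiff_F dletter_in by auto
  have 1: "bvec K (dletter a # u @ v) = bvec K (dletter a # u) \<otimes>\<^bsub>F\<^esub> bvec K v"
    using a u assms(2) dletter_in bvec_append[of "dletter a # u" v] by auto
  have 2: "bvec K (a # u) = bvec K [a] \<otimes>\<^bsub>F\<^esub> bvec K u" by (rule bvec_Cons[OF a u])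
  have "wdiff ((a # u) @ v) = bvec K (dletter a # u) \<otimes>\<^bsub>F\<^esub> bvec K v \<oplus>\<^bsub>F\<^esub> ksgn F (fst a) (bvec K [a] \<otimes>\<^bsub>F\<^esub>
     (wdiff u \<otimes>\<^bsub>F\<^esub> bvec K v \<oplus>\<^bsub>F\<^esub> ksgn F (word_deg u) (bvec K u \<otimes>\<^bsub>F\<^esub> wdiff v)))"
    using wdiff_Cons[of a "u @ v"] a u assms(2) Cons.IH 1 by simp
  also have "\<dots> = wdiff (a # u) \<otimes>\<^bsub>F\<^esub> bvec K v \<oplus>\<^bsub>F\<^esub> ksgn F (word_deg (a # u)) (bvec K (a # u) \<otimes>\<^bsub>F\<^esub> wdiff v)"
    using c by (simp add: wdiff_Cons[OF a u] 2 FA.l_distr FA.r_distr FA.ksgn_add FA.m_assoc FA.a_assoc)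
  finally show ?case .
qed

lemma F_leibniz:
  assumes x: "x \<in> grade F n" and y: "y \<in> carrier F"
  shows "diff F (x \<otimes>\<^bsub>F\<^esub> y) = diff F x \<otimes>\<^bsub>F\<^esub> y \<oplus>\<^bsub>F\<^esub> ksgn F n (x \<otimes>\<^bsub>F\<^esub> diff F y)"
proof -
  have xc: "x \<in> carrier F" using x FA.grade_carrier by auto
  let ?L = "\<lambda>n x y. diff F (x \<otimes>\<^bsub>F\<^esub> y) \<ominus>\<^bsub>F\<^esub> (diff F x \<otimes>\<^bsub>F\<^esub> y \<oplus>\<^bsub>F\<^esub> ksgn F n (x \<otimes>\<^bsub>F\<^esub> diff F y))"
  have Lx: "(\<lambda>x. ?L n x y) \<in> module_hom K F F" if y: "y \<in> carrier F" for n y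
    using y FA.mult_right_hom
    by (intro module_hom_minus2 module_hom_add2 module_hom_ksgn F.F_module
        module_hom_comp[OF FA.mult_right_hom[OF y] FA.diff_linear] module_hom_comp[OF FA.diff_linear FA.mult_right_hom[OF y]]) auto
  have Ly: "(\<lambda>y. ?L n x y) \<in> module_hom K F F" if x: "x \<in> carrier F" for n x
    using x FA.mult_left_hom
    by (intro module_hom_minus2 module_hom_add2 module_hom_ksgn F.F_module
        module_hom_comp[OF FA.mult_left_hom[OF x] FA.diff_linear] module_hom_comp[OF FA.diff_linear FA.mult_left_hom[OF x]]) auto
  note Z = zero_submodule[OF FA.module_axiom]
  have basis: "?L (word_deg u) (bvec K u) (bvec K v) \<in> {\<zero>\<^bsub>F\<^esub>}" if "u \<in> lists letters" "v \<in> lists letters" for u v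
    using that wdiff_append[OF that] bvec_F wdiff_F
    by (simp add: bvec_append diff_bvec FA.M.minus_eq_zero_iff)
  have bx: "?L (word_deg u) (bvec K u) y \<in> {\<zero>\<^bsub>F\<^esub>}" if u: "u \<in> lists letters" for u
    using basis[OF u] by (intro F.hom_into_submodule[OF F.F_module Ly Z _ y] bvec_F u) auto
  have "?L n x y \<in> {\<zero>\<^bsub>F\<^esub>}"
  proof (rule F.hom_into_submodule[OF F.F_module Lx[OF y] Z _ xc])
    fix u assume u: "u \<in> fsupp K x" "u \<in> lists letters"
    then have "word_deg u = n" using x unfolding F.F_grade by auto
    then show "?L n (bvec K u) y \<in> {\<zero>\<^bsub>F\<^esub>}" using bx[OF u(2)] by simp
  qed
  then show ?thesis using xc y by (simp add: FA.M.minus_eq_zero_iff)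
qed

text \<open>The mixed terms cancel, so the square of the operator is a derivation. Hence it maps the
  whole free algebra into the ideal of relations once it does so on letters.\<close>

lemma F_diff_diff_mult:
  assumes x: "x \<in> grade F n" and y: "y \<in> carrier F"
  shows "diff F (diff F (x \<otimes>\<^bsub>F\<^esub> y)) = diff F (diff F x) \<otimes>\<^bsub>F\<^esub> y \<oplus>\<^bsub>F\<^esub> x \<otimes>\<^bsub>F\<^esub> diff F (diff F y)"
proof -
  have xc: "x \<in> carrier F" using x FA.grade_carrier by auto
  have c: "diff F x \<otimes>\<^bsub>F\<^esub> diff F y \<in> carrier F" using xc y by simp
  have "ksgn F (n + 1) (diff F x \<otimes>\<^bsub>F\<^esub> diff F y) \<oplus>\<^bsub>F\<^esub> ksgn F n (diff F x \<otimes>\<^bsub>F\<^esub> diff F y) = \<zero>\<^bsub>F\<^esub>"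
    using FA.ksgn_succ[OF c, of "n + 1" n] c by (simp add: FA.l_neg)
  moreover have "diff F (diff F (x \<otimes>\<^bsub>F\<^esub> y)) = diff F (diff F x) \<otimes>\<^bsub>F\<^esub> y \<oplus>\<^bsub>F\<^esub>
    (ksgn F (n + 1) (diff F x \<otimes>\<^bsub>F\<^esub> diff F y) \<oplus>\<^bsub>F\<^esub> ksgn F n (diff F x \<otimes>\<^bsub>F\<^esub> diff F y)) \<oplus>\<^bsub>F\<^esub> x \<otimes>\<^bsub>F\<^esub> diff F (diff F y)"
    using xc y F_leibniz[OF x y] F_leibniz[OF FA.diff_grade[OF x] y] F_leibniz[OF x FA.diff_closed[OF y]]
    by (simp add: FA.diff_add FA.diff_ksgn FA.ksgn_add FA.a_assoc)
  ultimately show ?thesis using xc y by simp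
qed

subsection \<open>Relations\<close>

lemma letter_rels_cases:
  assumes "r \<in> letter_rels K F C l"
  obtains
    (add) i x y where "r = bvec K [l i (x \<oplus>\<^bsub>C\<^esub> y)] \<ominus>\<^bsub>F\<^esub> (bvec K [l i x] \<oplus>\<^bsub>F\<^esub> bvec K [l i y])"
      "x \<in> grade C i" "y \<in> grade C i"
  | (smult) c i x where "r = bvec K [l i (c \<odot>\<^bsub>C\<^esub> x)] \<ominus>\<^bsub>F\<^esub> c \<odot>\<^bsub>F\<^esub> bvec K [l i x]"
      "c \<in> carrier K" "x \<in> grade C i"
  | (mult) i j x y where "r = bvec K [l (i + j) (x \<otimes>\<^bsub>C\<^esub> y)] \<ominus>\<^bsub>F\<^esub> bvec K [l i x, l j y]"
      "x \<in> grade C i" "y \<in> grade C j"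
  | (one) "r = bvec K [l 0 \<one>\<^bsub>C\<^esub>] \<ominus>\<^bsub>F\<^esub> bvec K []"
  using assms unfolding letter_rels_def
  by (elim UnE CollectE exE conjE singletonE)
    ((rule that(1), assumption, assumption, assumption) | (rule that(2), assumption, assumption, assumption)
      | (rule that(3), assumption, assumption, assumption) | (rule that(4), assumption))+

lemma letter_rels_F:
  assumes "dg_algebra K C" "\<And>i x. x \<in> grade C i \<Longrightarrow> l i x \<in> letters"
  shows "letter_rels K F C l \<subseteq> carrier F"
proof -
  interpret C: dg_algebra K C by fact
  have lb: "bvec K [l i x] \<in> carrier F" if "x \<in> grade C i" for i x
    using assms(2)[OF that] by (intro bvec_F) simp
  have lb2: "bvec K [l i x, l j y] \<in> carrier F" if "x \<in> grade C i" "y \<in> grade C j" for i x j y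
    using assms(2)[OF that(1)] assms(2)[OF that(2)] by (intro bvec_F) simp
  have lb0: "bvec K [] \<in> carrier F" by (intro bvec_F) simp
  show ?thesis
    unfolding letter_rels_def using C.one_grade
    by (auto intro!: FA.minus_closed FA.M.minus_closed FA.a_closed FA.smult_closed lb lb2 lb0
        C.add_grade C.smult_grade C.mult_grade)
qed

definition "rels = letter_rels K F A (\<lambda>i x. (i, Inl x)) \<union> letter_rels K F B (\<lambda>i y. (i, Inr y))"

lemma rels_F: "rels \<subseteq> carrier F"
  unfolding rels_def
  using letter_rels_F[OF A.dg_algebra_axioms, of "\<lambda>i x. (i, Inl x)"] letter_rels_F[OF B.dg_algebra_axioms, of "\<lambda>i x. (i, Inr x)"]
  by (auto simp: letters_def)

lemma Ker_eq: "Ker = Idl\<^bsub>F\<^esub> rels"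
  by (simp add: coprod_kernel_def rels_def Let_def)

lemma Ker_ideal: "ideal Ker F"
  unfolding Ker_eq by (rule FA.genideal_ideal[OF rels_F])

lemma rels_Ker: "rels \<subseteq> Ker"
  unfolding Ker_eq by (rule FA.genideal_self[OF rels_F])

sublocale I: alg_ideal K "coprod_free K A B" "coprod_kernel K A B"
  by (intro alg_ideal.intro F.F_pre_dga Ker_ideal)

sublocale PM: module K "coprod K A B"
  unfolding coprod_def by (rule I.Q_module)
sublocale PR: ring "coprod K A B"
  unfolding coprod_def by (rule I.Q_ring)

lemma cl_hom: "I.cl \<in> module_hom K F P"
  unfolding coprod_def by (rule I.cl_hom)

lemmas cl_add = module_hom_add[OF cl_hom]
lemmas cl_smult = module_hom_smult[OF cl_hom]
lemmas cl_closed = module_hom_in[OF cl_hom]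
lemmas cl_ksgn = mod_hom.f_ksgn[OF mod_homI[OF F.F_module PM.module_axioms cl_hom]]
lemmas cl_minus = mod_hom.f_minus[OF mod_homI[OF F.F_module PM.module_axioms cl_hom]]

lemma cl_mult: "x \<in> carrier F \<Longrightarrow> y \<in> carrier F \<Longrightarrow> I.cl (x \<otimes>\<^bsub>F\<^esub> y) = I.cl x \<otimes>\<^bsub>P\<^esub> I.cl y"
  by (simp add: coprod_def)

lemma cl_one: "I.cl (bvec K []) = \<one>\<^bsub>P\<^esub>"
  using I.Q_one F.F_one by (simp add: coprod_def)

lemma cl_zero_iff: "x \<in> carrier F \<Longrightarrow> I.cl x = \<zero>\<^bsub>P\<^esub> \<longleftrightarrow> x \<in> Ker"
  using I.cl_eq_I[of x] I.cl_zero I.Q_zero by (simp add: coprod_def)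

end

text \<open>One of the two factors \<open>C\<close> together with its letters. It is instantiated for both factors, so that the relations and
  the inclusions need to be treated only once.\<close>

locale coprod_letters = dg_coprod K A B + C: dg_algebra K C
  for K :: "'k ring" and A :: "('k, 'a) dg" and B :: "('k, 'b) dg" and C :: "('k, 'c) dg" +
  fixes l :: "int \<Rightarrow> 'c \<Rightarrow> int \<times> ('a + 'b)"
  assumes l_letter: "x \<in> grade C i \<Longrightarrow> l i x \<in> letters"
    and fst_l: "fst (l i x) = i"
    and dletter_l: "dletter (l i x) = l (i + 1) (diff C x)"
    and l_rels: "letter_rels K F C l \<subseteq> rels"
begin

definition "lam i x = I.cl (bvec K [l i x])"

lemma lw: "x \<in> grade C i \<Longrightarrow> [l i x] \<in> lists letters"
  using l_letter by simp

lemma lb: "x \<in> grade C i \<Longrightarrow> bvec K [l i x] \<in> carrier F"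
  using lw bvec_F by blast

lemma lam_closed: "x \<in> grade C i \<Longrightarrow> lam i x \<in> carrier P"
  unfolding lam_def by (intro cl_closed lb)

lemma rel_cl:
  assumes "a \<ominus>\<^bsub>F\<^esub> b \<in> letter_rels K F C l" "a \<in> carrier F" "b \<in> carrier F"
  shows "I.cl a = I.cl b"
proof -
  have "a \<ominus>\<^bsub>F\<^esub> b \<in> Ker" using assms(1) l_rels rels_Ker by blast
  then show ?thesis using I.cl_eq[OF assms(2,3)] by simp
qed

lemma lam_add:
  assumes "x \<in> grade C i" "y \<in> grade C i"
  shows "lam i (x \<oplus>\<^bsub>C\<^esub> y) = lam i x \<oplus>\<^bsub>P\<^esub> lam i y"
proof -
  have "I.cl (bvec K [l i (x \<oplus>\<^bsub>C\<^esub> y)]) = I.cl (bvec K [l i x] \<oplus>\<^bsub>F\<^esub> bvec K [l i y])"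
  proof (rule rel_cl)
    show "bvec K [l i (x \<oplus>\<^bsub>C\<^esub> y)] \<ominus>\<^bsub>F\<^esub> (bvec K [l i x] \<oplus>\<^bsub>F\<^esub> bvec K [l i y]) \<in> letter_rels K F C l"
      unfolding letter_rels_def by (rule UnI1, rule UnI1, rule UnI1) (use assms in blast)
  qed (intro FA.a_closed lb C.add_grade assms)+
  then show ?thesis using assms lb by (simp add: lam_def cl_add)
qed

lemma lam_smult:
  assumes "c \<in> carrier K" "x \<in> grade C i"
  shows "lam i (c \<odot>\<^bsub>C\<^esub> x) = c \<odot>\<^bsub>P\<^esub> lam i x"
proof -
  have "I.cl (bvec K [l i (c \<odot>\<^bsub>C\<^esub> x)]) = I.cl (c \<odot>\<^bsub>F\<^esub> bvec K [l i x])"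
  proof (rule rel_cl)
    show "bvec K [l i (c \<odot>\<^bsub>C\<^esub> x)] \<ominus>\<^bsub>F\<^esub> c \<odot>\<^bsub>F\<^esub> bvec K [l i x] \<in> letter_rels K F C l"
      unfolding letter_rels_def by (rule UnI1, rule UnI1, rule UnI2) (use assms in blast)
  qed (intro FA.smult_closed lb C.smult_grade assms)+
  then show ?thesis using assms lb by (simp add: lam_def cl_smult)
qed

lemma lam_mult:
  assumes "x \<in> grade C i" "y \<in> grade C j"
  shows "lam (i + j) (x \<otimes>\<^bsub>C\<^esub> y) = lam i x \<otimes>\<^bsub>P\<^esub> lam j y"
proof -
  have "I.cl (bvec K [l (i + j) (x \<otimes>\<^bsub>C\<^esub> y)]) = I.cl (bvec K [l i x, l j y])"
  proof (rule rel_cl)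
    show "bvec K [l (i + j) (x \<otimes>\<^bsub>C\<^esub> y)] \<ominus>\<^bsub>F\<^esub> bvec K [l i x, l j y] \<in> letter_rels K F C l"
      unfolding letter_rels_def by (rule UnI1, rule UnI2) (use assms in blast)
    show "bvec K [l i x, l j y] \<in> carrier F"
      using l_letter[OF assms(1)] l_letter[OF assms(2)] by (intro bvec_F) simp
  qed (rule lb[OF C.mult_grade[OF assms]])
  moreover have "bvec K [l i x, l j y] = bvec K [l i x] \<otimes>\<^bsub>F\<^esub> bvec K [l j y]"
    using assms l_letter by (intro bvec_Cons) auto
  ultimately show ?thesis using assms lb by (simp add: lam_def cl_mult)
qed

lemma lam_one: "lam 0 \<one>\<^bsub>C\<^esub> = \<one>\<^bsub>P\<^esub>"
proof -
  have "I.cl (bvec K [l 0 \<one>\<^bsub>C\<^esub>]) = I.cl (bvec K [])"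
    using C.one_grade by (intro rel_cl bvec_F lb) (auto simp: letter_rels_def)
  then show ?thesis by (simp add: lam_def cl_one)
qed

lemma lam_hom: "lam i \<in> module_hom K (C\<lparr>carrier := grade C i\<rparr>) P"
  by (rule module_homI) (simp_all add: lam_closed lam_add lam_smult)

lemmas lam_ksgn = grade_hom_ksgn[OF PM.module_axioms C.graded_module_axioms lam_hom]

lemma lam_zero: "lam i \<zero>\<^bsub>C\<^esub> = \<zero>\<^bsub>P\<^esub>"
  using mod_hom.f0_is_0[OF mod_homI[OF C.grade_module PM.module_axioms lam_hom]] by simp

lemma diff_letter: "x \<in> grade C i \<Longrightarrow> diff F (bvec K [l i x]) = bvec K [l (i + 1) (diff C x)]"
  using wdiff_Cons[OF l_letter, of x i "[]"] lb[of "diff C x" "i + 1"] C.diff_grade lb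
  by (simp add: diff_bvec[OF lw] dletter_l wdiff_Nil)

lemma cl_diff_letter: "x \<in> grade C i \<Longrightarrow> I.cl (diff F (bvec K [l i x])) = lam (i + 1) (diff C x)"
  by (simp add: diff_letter lam_def)

lemma letter_diff_diff: "x \<in> grade C i \<Longrightarrow> diff F (diff F (bvec K [l i x])) \<in> Ker"
proof -
  assume x: "x \<in> grade C i"
  have "I.cl (diff F (diff F (bvec K [l i x]))) = lam (i + 1 + 1) \<zero>\<^bsub>C\<^esub>"
    using x C.diff_grade[OF x] C.diff_diff[OF C.grade_carrier[OF x]]
    by (simp add: diff_letter cl_diff_letter lam_def)
  then show ?thesis using lb[OF x] by (simp add: lam_zero cl_zero_iff)
qed

lemma rel_homog:
  assumes "g \<in> letter_rels K F C l"
  shows "(\<exists>n. g \<in> grade F n) \<and> diff F g \<in> Ker"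
proof -
  have bg: "bvec K [l i x] \<in> grade F i" if "x \<in> grade C i" for i x
    using F.bvec_grade[OF lw[OF that]] by (simp add: fst_l)
  have bg2: "bvec K [l i x, l j y] \<in> grade F (i + j)" if "x \<in> grade C i" "y \<in> grade C j" for i x j y
    using F.bvec_grade[of "[l i x, l j y]"] l_letter that by (simp add: fst_l)
  from assms show ?thesis
  proof (cases rule: letter_rels_cases)
    case (add i x y)
    note d = C.diff_grade[OF add(2)] C.diff_grade[OF add(3)]
    have xy: "x \<oplus>\<^bsub>C\<^esub> y \<in> grade C i" using add C.add_grade by auto
    have "g \<in> grade F i" unfolding add(1) by (intro FA.minus_grade FA.add_grade bg xy add)
    moreover have "I.cl (diff F g) = \<zero>\<^bsub>P\<^esub>"
      unfolding add(1) using add(2,3) xy d lb C.grade_carrier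
      by (simp add: mod_hom.f_minus[OF FA.diff_mod_hom] FA.diff_add cl_minus cl_add cl_diff_letter C.diff_add
          lam_add PM.minus_eq_zero_iff lam_closed)
    moreover have "g \<in> carrier F" using calculation(1) FA.grade_carrier by blast
    ultimately show ?thesis using cl_zero_iff by auto
  next
    case (smult c i x)
    note d = C.diff_grade[OF smult(3)]
    have cx: "c \<odot>\<^bsub>C\<^esub> x \<in> grade C i" using smult C.smult_grade by auto
    have "g \<in> grade F i" unfolding smult(1) by (intro FA.minus_grade FA.smult_grade bg cx smult)
    moreover have "I.cl (diff F g) = \<zero>\<^bsub>P\<^esub>"
      unfolding smult(1) using smult(2,3) cx d lb C.grade_carrier
      by (simp add: mod_hom.f_minus[OF FA.diff_mod_hom] FA.diff_smult cl_minus cl_smult cl_diff_letter C.diff_smult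
          lam_smult PM.minus_eq_zero_iff lam_closed)
    moreover have "g \<in> carrier F" using calculation(1) FA.grade_carrier by blast
    ultimately show ?thesis using cl_zero_iff by auto
  next
    case (mult i j x y)
    note d = C.diff_grade[OF mult(2)] C.diff_grade[OF mult(3)]
    note c = C.grade_carrier[OF mult(2)] C.grade_carrier[OF mult(3)]
    have xy: "x \<otimes>\<^bsub>C\<^esub> y \<in> grade C (i + j)" using mult C.mult_grade by auto
    have m: "diff C x \<otimes>\<^bsub>C\<^esub> y \<in> grade C (i + j + 1)" "x \<otimes>\<^bsub>C\<^esub> diff C y \<in> grade C (i + j + 1)"
      using C.mult_grade[OF d(1) mult(3)] C.mult_grade[OF mult(2) d(2)] by (simp_all add: algebra_simps)
    have lm: "lam (i + j + 1) (diff C x \<otimes>\<^bsub>C\<^esub> y) = lam (i + 1) (diff C x) \<otimes>\<^bsub>P\<^esub> lam j y"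
      "lam (i + j + 1) (x \<otimes>\<^bsub>C\<^esub> diff C y) = lam i x \<otimes>\<^bsub>P\<^esub> lam (j + 1) (diff C y)"
      using lam_mult[OF d(1) mult(3)] lam_mult[OF mult(2) d(2)] by (simp_all add: algebra_simps)
    have b: "bvec K [l i x, l j y] = bvec K [l i x] \<otimes>\<^bsub>F\<^esub> bvec K [l j y]"
      using mult l_letter by (intro bvec_Cons) auto
    have "g \<in> grade F (i + j)" unfolding mult(1) by (intro FA.minus_grade bg bg2 xy mult)
    moreover have E: "I.cl (diff F (bvec K [l (i + j) (x \<otimes>\<^bsub>C\<^esub> y)])) = I.cl (diff F (bvec K [l i x, l j y]))"
    proof -
      have "I.cl (diff F (bvec K [l (i + j) (x \<otimes>\<^bsub>C\<^esub> y)])) =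
        lam (i + 1) (diff C x) \<otimes>\<^bsub>P\<^esub> lam j y \<oplus>\<^bsub>P\<^esub> ksgn P i (lam i x \<otimes>\<^bsub>P\<^esub> lam (j + 1) (diff C y))"
        using m by (simp add: cl_diff_letter[OF xy] C.leibniz[OF mult(2) c(2)] lam_add C.ksgn_grade lam_ksgn lm)
      also have "\<dots> = I.cl (diff F (bvec K [l i x, l j y]))"
        using mult(2,3) d lb unfolding b F_leibniz[OF bg[OF mult(2)] lb[OF mult(3)]]
        by (simp add: cl_add cl_ksgn cl_mult cl_diff_letter) (simp add: lam_def)
      finally show ?thesis .
    qed
    moreover have "I.cl (diff F g) = \<zero>\<^bsub>P\<^esub>"
    proof -
      have w2: "bvec K [l i x, l j y] \<in> carrier F" using mult l_letter by (intro bvec_F) auto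
      have "I.cl (diff F g) = I.cl (diff F (bvec K [l (i + j) (x \<otimes>\<^bsub>C\<^esub> y)])) \<ominus>\<^bsub>P\<^esub> I.cl (diff F (bvec K [l i x, l j y]))"
        unfolding mult(1) using lb[OF xy] w2 by (simp add: mod_hom.f_minus[OF FA.diff_mod_hom] cl_minus)
      then show ?thesis
        unfolding E using cl_closed[OF FA.diff_closed[OF w2]] by (simp add: PM.minus_eq_zero_iff)
    qed
    moreover have "g \<in> carrier F" using calculation(1) FA.grade_carrier by blast
    ultimately show ?thesis using cl_zero_iff by auto
  next
    case one
    have bn: "bvec K [] \<in> grade F 0" using F.bvec_grade[of "[]"] by simp
    have "g \<in> grade F 0" unfolding one using C.one_grade bn by (intro FA.minus_grade bg)
    moreover have "I.cl (diff F g) = \<zero>\<^bsub>P\<^esub>"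
      unfolding one using C.one_grade lb[OF C.one_grade] bvec_F[of "[]"] C.diff_one
      by (simp add: mod_hom.f_minus[OF FA.diff_mod_hom] cl_minus cl_diff_letter lam_zero diff_bvec wdiff_Nil
          mod_hom.f0_is_0[OF mod_homI[OF F.F_module PM.module_axioms cl_hom]] PM.minus_eq_zero_iff)
    moreover have "g \<in> carrier F" using calculation(1) FA.grade_carrier by blast
    ultimately show ?thesis using cl_zero_iff by auto
  qed
qed

end

context dg_coprod
begin

lemma letters_A: "coprod_letters K A B A (\<lambda>i x. (i, Inl x))"
proof (intro coprod_letters.intro coprod_letters_axioms.intro dg_coprod_axioms A.dg_algebra_axioms)
  show "letter_rels K F A (\<lambda>i x. (i, Inl x)) \<subseteq> rels" unfolding rels_def by (rule Un_upper1)
qed (auto simp: letters_def dletter_def)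

lemma letters_B: "coprod_letters K A B B (\<lambda>i x. (i, Inr x))"
proof (intro coprod_letters.intro coprod_letters_axioms.intro dg_coprod_axioms B.dg_algebra_axioms)
  show "letter_rels K F B (\<lambda>i x. (i, Inr x)) \<subseteq> rels" unfolding rels_def by (rule Un_upper2)
qed (auto simp: letters_def dletter_def)

interpretation LA: coprod_letters K A B A "\<lambda>i x. (i, Inl x)"
  by (rule letters_A)

interpretation LB: coprod_letters K A B B "\<lambda>i x. (i, Inr x)"
  by (rule letters_B)

lemma diff_diff_Ker:
  assumes f: "f \<in> carrier F"
  shows "diff F (diff F f) \<in> Ker"
proof (rule F.hom_into_submodule[OF F.F_module module_hom_comp[OF FA.diff_linear FA.diff_linear] _ _ f])
  show "LinearCombinations.submodule K Ker F"
    using I.a_Hcarr I.a_closed I.smult_I additive_subgroup.zero_closed[OF I.is_additive_subgroup]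
    by (intro LinearCombinations.submodule.intro FA.module_axiom) auto
  fix w :: "('a, 'b) word" assume "w \<in> lists letters"
  then show "diff F (diff F (bvec K w)) \<in> Ker"
  proof (induction w)
    case Nil
    then show ?case
      using additive_subgroup.zero_closed[OF I.is_additive_subgroup] by (simp add: diff_bvec wdiff_Nil FA.diff_zero)
  next
    case (Cons a w)
    have ba: "bvec K [a] \<in> grade F (fst a)" using F.bvec_grade[of "[a]"] Cons(1) by simp
    have aK: "diff F (diff F (bvec K [a])) \<in> Ker"
      using Cons(1) LA.letter_diff_diff LB.letter_diff_diff by (auto simp: letters_def)
    show ?case
      unfolding bvec_Cons[OF Cons(1,2)] F_diff_diff_mult[OF ba bvec_F[OF Cons(2)]]
      using aK Cons.IH FA.grade_carrier[OF ba] bvec_F[OF Cons(2)]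
      by (intro I.a_closed I.I_r_closed I.I_l_closed)
  qed
qed

lemma rels_component_diff:
  assumes "g \<in> rels"
  shows "component F g i \<in> Idl\<^bsub>F\<^esub> rels \<and> diff F (component F g i) \<in> Idl\<^bsub>F\<^esub> rels"
proof -
  have 0: "\<zero>\<^bsub>F\<^esub> \<in> Ker" by (rule additive_subgroup.zero_closed[OF I.is_additive_subgroup])
  have "(\<exists>n. g \<in> grade F n) \<and> diff F g \<in> Ker"
    using assms LA.rel_homog LB.rel_homog unfolding rels_def by blast
  moreover have "g \<in> Ker" using assms rels_Ker by blast
  ultimately show ?thesis
    unfolding Ker_eq[symmetric] using 0 by (auto simp: FA.component_homog FA.diff_zero)
qed

sublocale D: dg_ideal K "coprod_free K A B" "coprod_kernel K A B"
proof (intro dg_ideal.intro I.alg_ideal_axioms dg_ideal_axioms.intro)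
  show "component F x i \<in> Ker" if "x \<in> Ker" for x i
    using FA.generated_ideal_component_diff(1)[OF F_leibniz rels_F rels_component_diff] that unfolding Ker_eq by blast
  show "diff F x \<in> Ker" if "x \<in> Ker" for x
    using FA.generated_ideal_component_diff(2)[OF F_leibniz rels_F rels_component_diff] that unfolding Ker_eq by blast
  show "diff F (diff F x) \<in> Ker" if "x \<in> carrier F" for x
    by (rule diff_diff_Ker[OF that])
  show "diff F (x \<otimes>\<^bsub>F\<^esub> y) \<ominus>\<^bsub>F\<^esub> (diff F x \<otimes>\<^bsub>F\<^esub> y \<oplus>\<^bsub>F\<^esub> ksgn F i (x \<otimes>\<^bsub>F\<^esub> diff F y)) \<in> Ker"
    if "x \<in> grade F i" "y \<in> carrier F" for x y i
  proof -
    have "diff F x \<otimes>\<^bsub>F\<^esub> y \<oplus>\<^bsub>F\<^esub> ksgn F i (x \<otimes>\<^bsub>F\<^esub> diff F y) \<in> carrier F"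
      using that FA.grade_carrier[OF that(1)] by auto
    then show ?thesis
      unfolding F_leibniz[OF that] using additive_subgroup.zero_closed[OF I.is_additive_subgroup]
      by (simp add: FA.M.minus_eq_zero_iff[THEN iffD2])
  qed
qed

theorem coprod_dg_algebra: "dg_algebra K P"
  unfolding coprod_def by (rule D.Q_dg_algebra)

sublocale PD: dg_algebra K "coprod K A B"
  by (rule coprod_dg_algebra)

end

context coprod_letters
begin

lemma inclusion_map: "dga_map K C P (gext C P lam)"
proof -
  have h: "gext C P lam \<in> module_hom K C P" by (rule C.gext_hom[OF PM.module_axioms lam_hom])
  have v: "gext C P lam x = lam i x" if "x \<in> grade C i" for x i
    by (rule C.gext_homog[OF PM.module_axioms lam_hom that])
  note hc = module_hom_in[OF h]
  have m1: "gext C P lam (x \<otimes>\<^bsub>C\<^esub> y) = gext C P lam x \<otimes>\<^bsub>P\<^esub> gext C P lam y"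
    if x: "x \<in> grade C i" and y: "y \<in> carrier C" for x y i
  proof (rule C.hom_eq_on_carrier[OF _ _ _ y])
    note xc = C.grade_carrier[OF x]
    show "(\<lambda>y. gext C P lam (x \<otimes>\<^bsub>C\<^esub> y)) \<in> module_hom K C P"
      by (rule module_hom_comp[OF C.mult_left_hom[OF xc] h])
    show "(\<lambda>y. gext C P lam x \<otimes>\<^bsub>P\<^esub> gext C P lam y) \<in> module_hom K C P"
      by (rule module_hom_comp[OF h PD.mult_left_hom[OF hc[OF xc]]])
    fix j y assume y: "y \<in> grade C j"
    show "gext C P lam (x \<otimes>\<^bsub>C\<^esub> y) = gext C P lam x \<otimes>\<^bsub>P\<^esub> gext C P lam y"
      using v[OF x] v[OF y] v[OF C.mult_grade[OF x y]] lam_mult[OF x y] by simp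
  qed
  show ?thesis
  proof (rule dga_mapI[OF h])
    show "gext C P lam (x \<otimes>\<^bsub>C\<^esub> y) = gext C P lam x \<otimes>\<^bsub>P\<^esub> gext C P lam y"
      if x: "x \<in> carrier C" and y: "y \<in> carrier C" for x y
      by (rule C.hom_eq_on_carrier[OF module_hom_comp[OF C.mult_right_hom[OF y] h]
            module_hom_comp[OF h PD.mult_right_hom[OF hc[OF y]]] m1[OF _ y] x])
    show "gext C P lam \<one>\<^bsub>C\<^esub> = \<one>\<^bsub>P\<^esub>" using v[OF C.one_grade] lam_one by simp
    show "gext C P lam x \<in> grade P i" if x: "x \<in> grade C i" for x i
    proof -
      have "bvec K [l i x] \<in> grade F i" using F.bvec_grade[OF lw[OF x]] by (simp add: fst_l)
      then show ?thesis unfolding v[OF x] lam_def using I.Q_grade[of i] by (auto simp: coprod_def)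
    qed
    show "gext C P lam (diff C x) = diff P (gext C P lam x)" if x: "x \<in> carrier C" for x
    proof (rule C.hom_eq_on_carrier[OF module_hom_comp[OF C.diff_linear h] module_hom_comp[OF h PD.diff_linear] _ x])
      fix i x assume x: "x \<in> grade C i"
      show "gext C P lam (diff C x) = diff P (gext C P lam x)"
        unfolding v[OF x] v[OF C.diff_grade[OF x]] using cl_diff_letter[OF x] D.Q_diff[OF lb[OF x]]
        by (simp add: lam_def coprod_def)
    qed
  qed
qed

lemma inclusion_homog: "x \<in> grade C i \<Longrightarrow> gext C P lam x = I.cl (bvec K [l i x])"
  using C.gext_homog[OF PM.module_axioms lam_hom] by (simp add: lam_def)

end

context dg_coprod
begin

interpretation LA: coprod_letters K A B A "\<lambda>i x. (i, Inl x)"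
  by (rule letters_A)

interpretation LB: coprod_letters K A B B "\<lambda>i x. (i, Inr x)"
  by (rule letters_B)

lemma inl_eq: "coprod_inl K A B x = gext A P LA.lam x"
  by (simp add: coprod_inl_def gext_def LA.lam_def)

lemma inr_eq: "coprod_inr K A B x = gext B P LB.lam x"
  by (simp add: coprod_inr_def gext_def LB.lam_def)

lemma inl_map: "dga_map K A P (coprod_inl K A B)"
  unfolding inl_eq[abs_def] by (rule LA.inclusion_map)

lemma inr_map: "dga_map K B P (coprod_inr K A B)"
  unfolding inr_eq[abs_def] by (rule LB.inclusion_map)

lemma inl_homog: "x \<in> grade A i \<Longrightarrow> coprod_inl K A B x = I.cl (bvec K [(i, Inl x)])"
  unfolding inl_eq by (rule LA.inclusion_homog)

lemma inr_homog: "x \<in> grade B i \<Longrightarrow> coprod_inr K A B x = I.cl (bvec K [(i, Inr x)])"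
  unfolding inr_eq by (rule LB.inclusion_homog)

text \<open>Letters generate the free algebra multiplicatively, and their classes are the images of homogeneous elements of
  the two factors.\<close>

lemma coprod_map_eq:
  assumes Z: "pre_dga K Z" and h: "dga_map K P Z h" "dga_map K P Z h'"
    and l: "\<And>x. x \<in> carrier A \<Longrightarrow> h (coprod_inl K A B x) = h' (coprod_inl K A B x)"
    and r: "\<And>y. y \<in> carrier B \<Longrightarrow> h (coprod_inr K A B y) = h' (coprod_inr K A B y)"
    and z: "z \<in> carrier P"
  shows "h z = h' z"
proof -
  interpret Z: pre_dga K Z by fact
  obtain f where f: "f \<in> carrier F" "z = I.cl f" using z I.Q_carrier by (auto simp: coprod_def)
  have letter: "h (I.cl (bvec K [a])) = h' (I.cl (bvec K [a]))" if "a \<in> letters" for a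
  proof -
    have "h (I.cl (bvec K [(i, Inl x)])) = h' (I.cl (bvec K [(i, Inl x)]))" if "x \<in> grade A i" for i x
      using l[OF A.grade_carrier[OF that]] by (simp only: inl_homog[OF that])
    moreover have "h (I.cl (bvec K [(i, Inr x)])) = h' (I.cl (bvec K [(i, Inr x)]))" if "x \<in> grade B i" for i x
      using r[OF B.grade_carrier[OF that]] by (simp only: inr_homog[OF that])
    ultimately show ?thesis using that unfolding letters_def by blast
  qed
  have word: "h (I.cl (bvec K w)) = h' (I.cl (bvec K w))" if "w \<in> lists letters" for w
    using that
  proof (induction w)
    case Nil
    show ?case by (simp add: cl_one dga_map_one[OF h(1)] dga_map_one[OF h(2)])
  next
    case (Cons a w)
    have "[a] \<in> lists letters" using Cons(1) by simp
    note c = cl_closed[OF bvec_F[OF this]] cl_closed[OF bvec_F[OF Cons(2)]]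
    have "I.cl (bvec K (a # w)) = I.cl (bvec K [a]) \<otimes>\<^bsub>P\<^esub> I.cl (bvec K w)"
      using Cons(1,2) by (simp add: bvec_Cons[of a w] cl_mult bvec_F)
    then show ?case
      using Cons.IH letter[OF Cons(1)] c by (simp add: dga_map_mult[OF h(1)] dga_map_mult[OF h(2)])
  qed
  have "h (I.cl f) = h' (I.cl f)"
    by (rule F.hom_eq_basis[OF Z.module_axiom module_hom_comp[OF cl_hom dga_map_hom[OF h(1)]]
          module_hom_comp[OF cl_hom dga_map_hom[OF h(2)]] word f(1)])
  then show ?thesis using f by simp
qed

lemma letter_rels_vanish:
  assumes Z: "dg_algebra K Z" and h: "dga_map K F Z h" and C: "dg_algebra K C" and k: "dga_map K C Z k"
    and lk: "\<And>i x. x \<in> grade C i \<Longrightarrow> l i x \<in> letters \<and> h (bvec K [l i x]) = k x"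
    and r: "r \<in> letter_rels K F C l"
  shows "h r = \<zero>\<^bsub>Z\<^esub>"
proof -
  interpret C: dg_algebra K C by fact
  interpret Z: dg_algebra K Z by fact
  have hm: "mod_hom K F Z h" by (intro mod_homI F.F_module Z.module_axiom dga_map_hom h)
  have b1: "bvec K [l i x] \<in> carrier F" "h (bvec K [l i x]) = k x" if "x \<in> grade C i" for i x
    using lk[OF that] bvec_F[of "[l i x]"] by auto
  have b2: "bvec K [l i x, l j y] = bvec K [l i x] \<otimes>\<^bsub>F\<^esub> bvec K [l j y]"
    if "x \<in> grade C i" "y \<in> grade C j" for i x j y
    using lk[OF that(1)] lk[OF that(2)] by (intro bvec_Cons) auto
  have b0: "bvec K [] \<in> carrier F" "h (bvec K []) = \<one>\<^bsub>Z\<^esub>"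
    using dga_map_one[OF h] bvec_F[of "[]"] by (auto simp: F.F_one)
  note kc = dga_map_closed[OF k] and g = C.add_grade C.smult_grade C.mult_grade C.one_grade C.grade_carrier
  from r show ?thesis
  proof (cases rule: letter_rels_cases)
    case (add i x y)
    then show ?thesis using b1[OF add(2)] b1[OF add(3)] b1[OF C.add_grade[OF add(2,3)]] g kc
      by (simp add: mod_hom.f_minus[OF hm] dga_map_add[OF h] dga_map_add[OF k] Z.M.minus_eq_zero_iff)
  next
    case (smult c i x)
    then show ?thesis using b1[OF smult(3)] b1[OF C.smult_grade[OF smult(2,3)]] g kc
      by (simp add: mod_hom.f_minus[OF hm] dga_map_smult[OF h] dga_map_smult[OF k] Z.M.minus_eq_zero_iff)
  next
    case (mult i j x y)
    then show ?thesis using b1[OF mult(2)] b1[OF mult(3)] b1[OF C.mult_grade[OF mult(2,3)]] g kc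
      by (simp add: b2 mod_hom.f_minus[OF hm] dga_map_mult[OF h] dga_map_mult[OF k] Z.M.minus_eq_zero_iff)
  next
    case one
    then show ?thesis using b1[OF C.one_grade] b0
      by (simp add: mod_hom.f_minus[OF hm] dga_map_one[OF k] Z.M.minus_eq_zero_iff)
  qed
qed

text \<open>On words the morphism is the product of the images of the letters. The Leibniz rule in the target shows that it is
  compatible with the differential.\<close>

theorem coprod_lift:
  assumes Z: "dg_algebra K Z" and f: "dga_map K A Z f" and g: "dga_map K B Z g"
  shows "\<exists>h. dga_map K P Z h \<and> (\<forall>x\<in>carrier A. h (coprod_inl K A B x) = f x) \<and>
    (\<forall>y\<in>carrier B. h (coprod_inr K A B y) = g y)"
proof -
  interpret Z: dg_algebra K Z by fact
  define ev where "ev a = (case snd a of Inl x \<Rightarrow> f x | Inr y \<Rightarrow> g y)" for a :: "int \<times> ('a + 'b)"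
  define \<phi> where "\<phi> w = foldr (\<lambda>a r. ev a \<otimes>\<^bsub>Z\<^esub> r) w \<one>\<^bsub>Z\<^esub>" for w
  have \<phi>_simps: "\<phi> [] = \<one>\<^bsub>Z\<^esub>" "\<phi> (a # w) = ev a \<otimes>\<^bsub>Z\<^esub> \<phi> w" for a w by (simp_all add: \<phi>_def)
  have ev_grade: "ev a \<in> grade Z (fst a)" if "a \<in> letters" for a
    using that dga_map_grade[OF f] dga_map_grade[OF g] by (auto simp: letters_def ev_def)
  have ev_c: "ev a \<in> carrier Z" if "a \<in> letters" for a using ev_grade[OF that] Z.grade_carrier by auto
  have ev_d: "ev (dletter a) = diff Z (ev a)" if "a \<in> letters" for a
    using that dga_map_diff[OF f] dga_map_diff[OF g] A.grade_carrier B.grade_carrier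
    by (auto simp: letters_def ev_def dletter_def)
  have \<phi>_grade: "\<phi> w \<in> grade Z (word_deg w)" if "w \<in> lists letters" for w
    using that by (induction w) (auto simp: \<phi>_simps Z.one_grade intro: Z.mult_grade ev_grade)
  have \<phi>_c: "\<phi> w \<in> carrier Z" if "w \<in> lists letters" for w using \<phi>_grade[OF that] Z.grade_carrier by auto
  have \<phi>_app: "\<phi> u \<otimes>\<^bsub>Z\<^esub> \<phi> v = ksgn Z 0 (\<phi> (u @ v))" if "u \<in> lists letters" "v \<in> lists letters" for u v
    using that(1) by (induction u) (auto simp: \<phi>_simps \<phi>_c that Z.m_assoc ev_c)
  have \<phi>b: "lext K Z \<phi> (bvec K w) = \<phi> w" if "w \<in> lists letters" for w
    by (rule F.lext_bvec[OF Z.module_axiom \<phi>_c that])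
  have lh: "mod_hom K F Z (lext K Z \<phi>)"
    by (intro mod_homI F.F_module Z.module_axiom F.lext_hom \<phi>_c)
  have F_map: "dga_map K F Z (lext K Z \<phi>)"
  proof (rule F.lext_dga_map[OF Z.pre_dga \<phi>_grade \<phi>_app \<phi>_simps(1)])
    fix w assume "w \<in> lists letters"
    then show "lext K Z \<phi> (wdiff w) = diff Z (\<phi> w)"
    proof (induction w)
      case Nil
      show ?case using mod_hom.f0_is_0[OF lh] by (simp add: wdiff_Nil \<phi>_simps Z.diff_one)
    next
      case (Cons a w)
      have a1: "[a] \<in> lists letters" "dletter a # w \<in> lists letters" using Cons(1,2) dletter_in by auto
      have c: "bvec K [a] \<in> carrier F" "wdiff w \<in> carrier F" "bvec K (dletter a # w) \<in> carrier F"
        using bvec_F a1 wdiff_F Cons(2) by auto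
      have "lext K Z \<phi> (wdiff (a # w)) = \<phi> (dletter a # w) \<oplus>\<^bsub>Z\<^esub> ksgn Z (fst a) (\<phi> [a] \<otimes>\<^bsub>Z\<^esub> lext K Z \<phi> (wdiff w))"
        using c unfolding wdiff_Cons[OF Cons(1,2)]
        by (simp add: module_hom_add[OF mod_hom.f_hom[OF lh]] mod_hom.f_ksgn[OF lh] \<phi>b[OF a1(2)]
            F.lext_mult_bvec[OF Z.pre_dga \<phi>_c \<phi>_app a1(1)])
      also have "\<dots> = diff Z (\<phi> (a # w))"
        using Z.leibniz[OF ev_grade[OF Cons(1)] \<phi>_c[OF Cons(2)]] Cons.IH ev_c[OF Cons(1)] ev_d[OF Cons(1)]
        by (simp add: \<phi>_simps)
      finally show ?case .
    qed
  qed
  have lb: "h (bvec K [a]) = ev a" if "a \<in> letters" "h = lext K Z \<phi>" for a h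
    using that \<phi>b[of "[a]"] ev_c by (simp add: \<phi>_simps)
  have "rels \<subseteq> {x \<in> carrier F. lext K Z \<phi> x = \<zero>\<^bsub>Z\<^esub>}"
  proof
    fix x assume x: "x \<in> rels"
    have "lext K Z \<phi> x = \<zero>\<^bsub>Z\<^esub>" if "x \<in> letter_rels K F A (\<lambda>i x. (i, Inl x))"
      by (rule letter_rels_vanish[OF Z.dg_algebra_axioms F_map A.dg_algebra_axioms f _ that])
        (use lb[OF _ refl] in \<open>auto simp: letters_def ev_def\<close>)
    moreover have "lext K Z \<phi> x = \<zero>\<^bsub>Z\<^esub>" if "x \<in> letter_rels K F B (\<lambda>i x. (i, Inr x))"
      by (rule letter_rels_vanish[OF Z.dg_algebra_axioms F_map B.dg_algebra_axioms g _ that])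
        (use lb[OF _ refl] in \<open>auto simp: letters_def ev_def\<close>)
    ultimately show "x \<in> {x \<in> carrier F. lext K Z \<phi> x = \<zero>\<^bsub>Z\<^esub>}"
      using x rels_F unfolding rels_def by blast
  qed
  from FA.genideal_minimal[OF dga_map_kernel_ideal[OF F.F_pre_dga Z.pre_dga F_map] this]
  have K0: "lext K Z \<phi> x = \<zero>\<^bsub>Z\<^esub>" if "x \<in> Ker" for x using that unfolding Ker_eq by blast
  have "\<exists>h. dga_map K P Z h \<and> (\<forall>x\<in>carrier F. h (I.cl x) = lext K Z \<phi> x)"
    unfolding coprod_def by (rule D.quot_lift[OF Z.pre_dga F_map K0])
  then obtain h where h: "dga_map K P Z h" "\<And>x. x \<in> carrier F \<Longrightarrow> h (I.cl x) = lext K Z \<phi> x" by blast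
  have letter: "h (I.cl (bvec K [a])) = ev a" if "a \<in> letters" for a
    using that h(2)[OF bvec_F, of "[a]"] \<phi>b[of "[a]"] ev_c by (simp add: \<phi>_simps)
  have hl: "h (coprod_inl K A B x) = f x" if x: "x \<in> carrier A" for x
  proof (rule A.hom_eq_on_carrier[OF module_hom_comp[OF dga_map_hom[OF inl_map] dga_map_hom[OF h(1)]] dga_map_hom[OF f] _ x])
    fix i x assume x: "x \<in> grade A i"
    then have "(i, Inl x) \<in> letters" by (auto simp: letters_def)
    then show "h (coprod_inl K A B x) = f x" using letter[of "(i, Inl x)"] inl_homog[OF x] by (simp add: ev_def)
  qed
  have hr: "h (coprod_inr K A B y) = g y" if y: "y \<in> carrier B" for y
  proof (rule B.hom_eq_on_carrier[OF module_hom_comp[OF dga_map_hom[OF inr_map] dga_map_hom[OF h(1)]] dga_map_hom[OF g] _ y])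
    fix i y assume y: "y \<in> grade B i"
    then have "(i, Inr y) \<in> letters" by (auto simp: letters_def)
    then show "h (coprod_inr K A B y) = g y" using letter[of "(i, Inr y)"] inr_homog[OF y] by (simp add: ev_def)
  qed
  show ?thesis using h(1) hl hr by blast
qed

end

section \<open>Graded commutators\<close>

context dg_algebra
begin

text \<open>The graded commutator of elements of degrees \<open>i\<close> and \<open>j\<close>, as a bilinear map on the whole algebra.\<close>

definition "comm_homog i j x y = x \<otimes> y \<ominus> ksgn A (i * j) (y \<otimes> x)"

lemma gcommutator_gext:
  "gcommutator A x y = gext A A (\<lambda>i x. gext A A (\<lambda>j y. comm_homog i j x y) y) x"
  by (simp add: gcommutator_def gext_def comm_homog_def)

lemma comm_homog_right: "x \<in> carrier A \<Longrightarrow> comm_homog i j x \<in> module_hom K (A\<lparr>carrier := grade A j\<rparr>) A"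
  unfolding comm_homog_def using grade_carrier
  by (intro module_hom_minus2 module_hom_ksgn module_axiom module_homI)
    (auto simp: l_distr r_distr smult_mult_left smult_mult_right)

lemma comm_homog_left: "y \<in> carrier A \<Longrightarrow> (\<lambda>x. comm_homog i j x y) \<in> module_hom K (A\<lparr>carrier := grade A i\<rparr>) A"
  unfolding comm_homog_def using grade_carrier
  by (intro module_hom_minus2 module_hom_ksgn module_axiom module_homI)
    (auto simp: l_distr r_distr smult_mult_left smult_mult_right)

lemma gcommutator_inner_hom:
  assumes y: "y \<in> carrier A"
  shows "(\<lambda>x. gext A A (\<lambda>j y. comm_homog i j x y) y) \<in> module_hom K (A\<lparr>carrier := grade A i\<rparr>) A"
  unfolding gext_def by (intro module_hom_finsum grade_module module_axiom comm_homog_left component_closed y)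

lemma gcommutator_left_hom: "y \<in> carrier A \<Longrightarrow> (\<lambda>x. gcommutator A x y) \<in> module_hom K A A"
  unfolding gcommutator_gext by (intro gext_hom module_axiom gcommutator_inner_hom)

lemma gcommutator_right_hom: "x \<in> carrier A \<Longrightarrow> (\<lambda>y. gcommutator A x y) \<in> module_hom K A A"
  unfolding gcommutator_gext gext_def[of A A "\<lambda>i x. gext A A (\<lambda>j y. comm_homog i j x y) _"]
  by (intro module_hom_finsum module_axiom gext_hom comm_homog_right component_closed)

lemma gcommutator_homog:
  assumes x: "x \<in> grade A i" and y: "y \<in> grade A j"
  shows "gcommutator A x y = x \<otimes> y \<ominus> ksgn A (i * j) (y \<otimes> x)"
proof -
  have "gcommutator A x y = gext A A (\<lambda>j y. comm_homog i j x y) y"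
    unfolding gcommutator_gext
    by (rule gext_homog[OF module_axiom gcommutator_inner_hom[OF grade_carrier[OF y]] x])
  also have "\<dots> = comm_homog i j x y"
    by (rule gext_homog[OF module_axiom comm_homog_right[OF grade_carrier[OF x]] y])
  finally show ?thesis by (simp add: comm_homog_def)
qed

lemma gcommutator_closed: "x \<in> carrier A \<Longrightarrow> y \<in> carrier A \<Longrightarrow> gcommutator A x y \<in> carrier A"
  by (rule module_hom_in[OF gcommutator_left_hom])

lemma gcommutator_grade: "x \<in> grade A i \<Longrightarrow> y \<in> grade A j \<Longrightarrow> gcommutator A x y \<in> grade A (i + j)"
  using mult_grade[of x i y j] mult_grade[of y j x i] by (auto simp: gcommutator_homog add.commute)

lemma gcommutator_component:
  assumes x: "x \<in> carrier A" and y: "y \<in> grade A j"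
  shows "component A (gcommutator A x y) (i + j) = gcommutator A (component A x i) y"
proof (rule hom_eq_on_carrier[OF module_hom_comp[OF gcommutator_left_hom component_hom]
      module_hom_comp[OF component_hom gcommutator_left_hom] _ x])
  fix k x assume x: "x \<in> grade A k"
  have "gcommutator A \<zero> y = \<zero>"
    using mod_hom.f0_is_0[OF mod_homI[OF module_axiom module_axiom gcommutator_left_hom[OF grade_carrier[OF y]]]] .
  then show "component A (gcommutator A x y) (i + j) = gcommutator A (component A x i) y"
    using component_homog[OF gcommutator_grade[OF x y]] component_homog[OF x] by auto
qed (use y grade_carrier in auto)

lemma gcommutator_homog_zero_iff:
  assumes "x \<in> grade A i" "y \<in> grade A j"
  shows "gcommutator A x y = \<zero> \<longleftrightarrow> x \<otimes> y = ksgn A (i * j) (y \<otimes> x)"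
  using assms grade_carrier by (simp add: gcommutator_homog minus_eq_zero_iff)

end

section \<open>Graded centralizers\<close>

locale graded_subalgebra = dg_algebra K P
  for K :: "'k ring" and P :: "('k, 'a) dg" (structure) +
  fixes C :: "'a set"
  assumes C_carrier: "C \<subseteq> carrier P"
    and C_add: "x \<in> C \<Longrightarrow> y \<in> C \<Longrightarrow> x \<oplus> y \<in> C"
    and C_smult: "c \<in> carrier K \<Longrightarrow> x \<in> C \<Longrightarrow> c \<odot> x \<in> C"
    and C_one: "\<one> \<in> C"
    and C_mult: "x \<in> C \<Longrightarrow> y \<in> C \<Longrightarrow> x \<otimes> y \<in> C"
    and C_diff: "x \<in> C \<Longrightarrow> diff P x \<in> C"
    and C_component: "x \<in> C \<Longrightarrow> component P x i \<in> C"
begin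

definition "sub = P\<lparr>carrier := C, grade := (\<lambda>n. grade P n \<inter> C)\<rparr>"

lemma sub_simps [simp]:
  "carrier sub = C" "x \<otimes>\<^bsub>sub\<^esub> y = x \<otimes> y" "x \<oplus>\<^bsub>sub\<^esub> y = x \<oplus> y" "\<one>\<^bsub>sub\<^esub> = \<one>" "\<zero>\<^bsub>sub\<^esub> = \<zero>"
  "c \<odot>\<^bsub>sub\<^esub> x = c \<odot> x" "grade sub n = grade P n \<inter> C" "diff sub = diff P"
  by (simp_all add: sub_def)

lemma C_in: "x \<in> C \<Longrightarrow> x \<in> carrier P"
  using C_carrier by blast

lemma C_zero: "\<zero> \<in> C"
  using C_smult[OF _ C_one, of "\<zero>\<^bsub>K\<^esub>"] by simp

lemma C_submodule: "LinearCombinations.submodule K C P"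
  by (rule LinearCombinations.submodule.intro[OF module_axiom C_carrier C_add C_zero C_smult])

lemma C_uminus: "x \<in> C \<Longrightarrow> \<ominus> x \<in> C"
  by (rule submodule_uminus[OF C_submodule])

lemma sub_module: "module K sub"
proof (rule moduleI)
  show "abelian_group sub"
  proof (rule abelian_groupI)
    show "\<exists>y\<in>carrier sub. y \<oplus>\<^bsub>sub\<^esub> x = \<zero>\<^bsub>sub\<^esub>" if "x \<in> carrier sub" for x
      using that C_uminus C_in by (intro bexI[of _ "\<ominus> x"]) (auto simp: l_neg)
  qed (auto simp: C_zero C_add C_in a_ac)
qed (auto simp: R.is_cring C_smult C_in smult_l_distr smult_r_distr smult_assoc1)

lemma sub_ring: "ring sub"
proof (rule ringI)
  show "abelian_group sub" using sub_module by (rule module.axioms)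
  show "Group.monoid sub" by (rule monoidI) (auto simp: C_one C_mult C_in m_assoc)
qed (auto simp: C_in l_distr r_distr)

lemma incl_hom: "(\<lambda>x. x) \<in> module_hom K sub P"
  by (rule module_homI) (auto simp: C_in)

lemma sub_finsum: "(\<And>i. i \<in> N \<Longrightarrow> f i \<in> C) \<Longrightarrow> (\<Oplus>\<^bsub>sub\<^esub>i\<in>N. f i) = (\<Oplus>i\<in>N. f i)"
  by (rule mod_hom.f_finsum[OF mod_homI[OF sub_module module_axiom incl_hom]]) auto

lemma sub_ksgn: "x \<in> C \<Longrightarrow> ksgn sub n x = ksgn P n x"
  using mod_hom.f_ksgn[OF mod_homI[OF sub_module module_axiom incl_hom]] by simp

lemma sub_graded: "graded_module K sub"
proof (rule graded_moduleI[OF sub_module])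
  show "LinearCombinations.submodule K (grade sub i) sub" for i
    by (rule LinearCombinations.submodule.intro[OF sub_module]) (auto simp: C_zero C_add C_smult add_grade smult_grade)
  show "\<exists>N f. finite N \<and> (\<forall>i\<in>N. f i \<in> grade sub i) \<and> x = (\<Oplus>\<^bsub>sub\<^esub>i\<in>N. f i)" if "x \<in> carrier sub" for x
    using that C_in C_component sub_finsum[of "gsupp P x" "component P x"] component_sum[of x]
    by (intro exI[of _ "gsupp P x"] exI[of _ "component P x"]) (auto simp: component_grade)
  fix N f i
  assume N: "finite N" and f: "\<And>i. i \<in> N \<Longrightarrow> f i \<in> grade sub i"
    and 0: "(\<Oplus>\<^bsub>sub\<^esub>i\<in>N. f i) = \<zero>\<^bsub>sub\<^esub>" and i: "i \<in> N"
  have "(\<Oplus>i\<in>N. f i) = \<zero>" using 0 f sub_finsum[of N f] by auto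
  then show "f i = \<zero>\<^bsub>sub\<^esub>" using component_eqI[OF N, of f i] f i by auto
qed

theorem sub_dg_algebra: "dg_algebra K sub"
proof (rule pre_dga.dg_algebraI)
  show "pre_dga K sub"
  proof (intro pre_dga.intro pre_dga_axioms.intro sub_graded sub_ring)
    show "diff sub \<in> module_hom K sub sub" by (rule module_homI) (auto simp: C_diff C_in diff_add diff_smult)
  qed (use one_grade mult_grade diff_grade in \<open>auto simp: C_in C_one C_mult C_diff smult_mult_left smult_mult_right\<close>)
  show "diff sub (x \<otimes>\<^bsub>sub\<^esub> y) = diff sub x \<otimes>\<^bsub>sub\<^esub> y \<oplus>\<^bsub>sub\<^esub> ksgn sub i (x \<otimes>\<^bsub>sub\<^esub> diff sub y)"
    if "x \<in> grade sub i" "y \<in> carrier sub" for x y i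
    using that leibniz[of x i y] C_in by (simp add: sub_ksgn C_mult C_diff)
qed (auto simp: diff_diff C_in)

lemma incl_map: "dga_map K sub P (\<lambda>x. x)"
  by (rule dga_mapI) (auto simp: incl_hom)

end

text \<open>A DG algebra \<open>P\<close> with a morphism \<open>\<eta>\<close> from \<open>E\<close>, and the graded centralizer of the image of \<open>E\<close> in \<open>P\<close>.\<close>

locale dga_over = P: dg_algebra K P + E: dg_algebra K E
  for K :: "'k ring" and P :: "('k, 'a) dg" and E :: "('k, 'e) dg" +
  fixes \<eta> :: "'e \<Rightarrow> 'a"
  assumes \<eta>: "dga_map K E P \<eta>"
begin

definition "cent = {w \<in> carrier P. \<forall>m\<in>carrier E. gcommutator P w (\<eta> m) = \<zero>\<^bsub>P\<^esub>}"

lemma eta_closed: "m \<in> carrier E \<Longrightarrow> \<eta> m \<in> carrier P"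
  by (rule dga_map_closed[OF \<eta>])

lemma eta_grade: "m \<in> grade E j \<Longrightarrow> \<eta> m \<in> grade P j"
  by (rule dga_map_grade[OF \<eta>])

lemma cent_commute: "w \<in> cent \<Longrightarrow> w \<in> grade P i \<Longrightarrow> m \<in> grade E j \<Longrightarrow> w \<otimes>\<^bsub>P\<^esub> \<eta> m = ksgn P (i * j) (\<eta> m \<otimes>\<^bsub>P\<^esub> w)"
  using P.gcommutator_homog_zero_iff[of w i "\<eta> m" j] eta_grade E.grade_carrier by (simp add: cent_def)

lemma cent_homogI:
  assumes w: "w \<in> grade P i" and c: "\<And>j m. m \<in> grade E j \<Longrightarrow> w \<otimes>\<^bsub>P\<^esub> \<eta> m = ksgn P (i * j) (\<eta> m \<otimes>\<^bsub>P\<^esub> w)"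
  shows "w \<in> cent"
proof -
  have "gcommutator P w (\<eta> m) = \<zero>\<^bsub>P\<^esub>" if m: "m \<in> carrier E" for m
  proof (rule E.hom_eq_on_carrier[OF _ _ _ m])
    show "(\<lambda>m. gcommutator P w (\<eta> m)) \<in> module_hom K E P"
      by (rule module_hom_comp[OF dga_map_hom[OF \<eta>] P.gcommutator_right_hom[OF P.grade_carrier[OF w]]])
    show "(\<lambda>m. \<zero>\<^bsub>P\<^esub>) \<in> module_hom K E P" by (rule module_homI) auto
    show "gcommutator P w (\<eta> m) = \<zero>\<^bsub>P\<^esub>" if "m \<in> grade E j" for j m
      using P.gcommutator_homog_zero_iff[OF w eta_grade[OF that]] c[OF that] by simp
  qed
  then show ?thesis using P.grade_carrier[OF w] by (simp add: cent_def)
qed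

lemma cent_carrier: "cent \<subseteq> carrier P"
  by (auto simp: cent_def)

lemma cent_add: "x \<in> cent \<Longrightarrow> y \<in> cent \<Longrightarrow> x \<oplus>\<^bsub>P\<^esub> y \<in> cent"
  using eta_closed by (auto simp: cent_def module_hom_add[OF P.gcommutator_left_hom])

lemma cent_smult: "c \<in> carrier K \<Longrightarrow> x \<in> cent \<Longrightarrow> c \<odot>\<^bsub>P\<^esub> x \<in> cent"
  using eta_closed by (auto simp: cent_def module_hom_smult[OF P.gcommutator_left_hom])

text \<open>\<open>E\<close> is spanned by homogeneous elements, and the commutator with such an element shifts degrees; so the
  components of a commutator are the commutators of the components.\<close>

lemma cent_component:
  assumes "w \<in> cent"
  shows "component P w i \<in> cent"
proof (rule cent_homogI)
  have wc: "w \<in> carrier P" using assms cent_carrier by blast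
  show wi: "component P w i \<in> grade P i" by (rule P.component_grade[OF wc])
  fix j m assume m: "m \<in> grade E j"
  have "gcommutator P (component P w i) (\<eta> m) = \<zero>\<^bsub>P\<^esub>"
    using P.gcommutator_component[OF wc eta_grade[OF m], of i] assms E.grade_carrier[OF m] by (simp add: cent_def)
  then show "component P w i \<otimes>\<^bsub>P\<^esub> \<eta> m = ksgn P (i * j) (\<eta> m \<otimes>\<^bsub>P\<^esub> component P w i)"
    using P.gcommutator_homog_zero_iff[OF wi eta_grade[OF m]] by simp
qed

lemma cent_submodule: "LinearCombinations.submodule K cent P"
proof (rule LinearCombinations.submodule.intro[OF P.module_axiom cent_carrier cent_add _ cent_smult])
  show "\<zero>\<^bsub>P\<^esub> \<in> cent"
    using mod_hom.f0_is_0[OF mod_homI[OF P.module_axiom P.module_axiom P.gcommutator_left_hom[OF eta_closed]]]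
    by (auto simp: cent_def)
qed

text \<open>The components of an element of the centralizer lie in the centralizer, so only homogeneous elements need
  to be considered.\<close>

lemma cent_hom_stable:
  assumes h: "h \<in> module_hom K P P"
    and hom: "\<And>i x. x \<in> cent \<Longrightarrow> x \<in> grade P i \<Longrightarrow> h x \<in> cent" and x: "x \<in> cent"
  shows "h x \<in> cent"
proof -
  have xc: "x \<in> carrier P" using x cent_carrier by blast
  interpret N: LinearCombinations.submodule K cent P by (rule cent_submodule)
  have "h x = (\<Oplus>\<^bsub>P\<^esub>i\<in>gsupp P x. h (component P x i))"
    using mod_hom.f_finsum[OF mod_homI[OF P.module_axiom P.module_axiom h], of "component P x" "gsupp P x"]
      P.component_sum[OF xc] xc by auto
  moreover have "(\<Oplus>\<^bsub>P\<^esub>i\<in>J. h (component P x i)) \<in> cent" for J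
  proof (induction J rule: infinite_finite_induct)
    case (insert i J)
    have "h (component P x j) \<in> cent" for j
      by (rule hom[OF cent_component[OF x] P.component_grade[OF xc]])
    then show ?case using insert cent_carrier by (subst P.M.finsum_insert) auto
  qed (auto simp: P.M.finsum_infinite)
  ultimately show ?thesis by simp
qed

lemma cent_mult:
  assumes x: "x \<in> cent" and y: "y \<in> cent"
  shows "x \<otimes>\<^bsub>P\<^esub> y \<in> cent"
proof -
  have homog: "x \<otimes>\<^bsub>P\<^esub> y \<in> cent" if "x \<in> cent" "x \<in> grade P i" "y \<in> cent" "y \<in> grade P k" for x y i k
  proof (rule cent_homogI[OF P.mult_grade[OF that(2,4)]])
    fix j m assume m: "m \<in> grade E j"
    have c: "x \<in> carrier P" "y \<in> carrier P" "\<eta> m \<in> carrier P"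
      using that cent_carrier eta_closed E.grade_carrier[OF m] by auto
    have "x \<otimes>\<^bsub>P\<^esub> y \<otimes>\<^bsub>P\<^esub> \<eta> m = ksgn P (k * j) ((x \<otimes>\<^bsub>P\<^esub> \<eta> m) \<otimes>\<^bsub>P\<^esub> y)"
      using c cent_commute[OF that(3,4) m] by (simp add: P.m_assoc)
    also have "\<dots> = ksgn P (k * j + i * j) (\<eta> m \<otimes>\<^bsub>P\<^esub> (x \<otimes>\<^bsub>P\<^esub> y))"
      using c cent_commute[OF that(1,2) m] by (simp add: P.m_assoc)
    finally show "x \<otimes>\<^bsub>P\<^esub> y \<otimes>\<^bsub>P\<^esub> \<eta> m = ksgn P ((i + k) * j) (\<eta> m \<otimes>\<^bsub>P\<^esub> (x \<otimes>\<^bsub>P\<^esub> y))"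
      by (simp add: algebra_simps)
  qed
  have xc: "x \<in> carrier P" and yc: "y \<in> carrier P" using x y cent_carrier by auto
  have "x \<otimes>\<^bsub>P\<^esub> y \<in> cent" if "x \<in> cent" "x \<in> grade P i" for x i
    using homog[OF that] P.grade_carrier[OF that(2)] by (intro cent_hom_stable[OF P.mult_left_hom _ y]) auto
  then show ?thesis by (intro cent_hom_stable[OF P.mult_right_hom[OF yc] _ x])
qed

lemma cent_diff:
  assumes x: "x \<in> cent"
  shows "diff P x \<in> cent"
proof (rule cent_hom_stable[OF P.diff_linear _ x])
  fix i x assume x: "x \<in> cent" "x \<in> grade P i"
  show "diff P x \<in> cent"
  proof (rule cent_homogI[OF P.diff_grade[OF x(2)]])
    fix j m assume m: "m \<in> grade E j"
    have c: "x \<in> carrier P" "\<eta> m \<in> carrier P" using x cent_carrier eta_closed E.grade_carrier[OF m] by auto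
    have dm: "diff P (\<eta> m) = \<eta> (diff E m)" using dga_map_diff[OF \<eta> E.grade_carrier[OF m]] by simp
    have s: "ksgn P (i + i * (j + 1)) z = ksgn P (i * j) z" for z by (rule ksgn_cong) auto
    have "diff P (x \<otimes>\<^bsub>P\<^esub> \<eta> m) = diff P (ksgn P (i * j) (\<eta> m \<otimes>\<^bsub>P\<^esub> x))"
      using cent_commute[OF x m] by simp
    then have "diff P x \<otimes>\<^bsub>P\<^esub> \<eta> m \<oplus>\<^bsub>P\<^esub> ksgn P i (x \<otimes>\<^bsub>P\<^esub> diff P (\<eta> m)) =
      ksgn P (i * j) (diff P (\<eta> m) \<otimes>\<^bsub>P\<^esub> x) \<oplus>\<^bsub>P\<^esub> ksgn P (i * j + j) (\<eta> m \<otimes>\<^bsub>P\<^esub> diff P x)"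
      using P.leibniz[OF x(2) c(2)] P.leibniz[OF eta_grade[OF m] c(1)] c by (simp add: P.diff_ksgn P.ksgn_add)
    also have "x \<otimes>\<^bsub>P\<^esub> diff P (\<eta> m) = ksgn P (i * (j + 1)) (diff P (\<eta> m) \<otimes>\<^bsub>P\<^esub> x)"
      unfolding dm by (rule cent_commute[OF x E.diff_grade[OF m]])
    finally have "diff P x \<otimes>\<^bsub>P\<^esub> \<eta> m \<oplus>\<^bsub>P\<^esub> ksgn P (i * j) (diff P (\<eta> m) \<otimes>\<^bsub>P\<^esub> x) =
      ksgn P (i * j + j) (\<eta> m \<otimes>\<^bsub>P\<^esub> diff P x) \<oplus>\<^bsub>P\<^esub> ksgn P (i * j) (diff P (\<eta> m) \<otimes>\<^bsub>P\<^esub> x)"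
      using c s by (simp add: P.a_comm)
    then have "diff P x \<otimes>\<^bsub>P\<^esub> \<eta> m = ksgn P (i * j + j) (\<eta> m \<otimes>\<^bsub>P\<^esub> diff P x)"
      using c by (simp add: P.M.add.right_cancel)
    then show "diff P x \<otimes>\<^bsub>P\<^esub> \<eta> m = ksgn P ((i + 1) * j) (\<eta> m \<otimes>\<^bsub>P\<^esub> diff P x)"
      by (simp add: algebra_simps)
  qed
qed

lemma cent_one: "\<one>\<^bsub>P\<^esub> \<in> cent"
  using eta_closed E.grade_carrier by (intro cent_homogI[OF P.one_grade]) simp

sublocale C: graded_subalgebra K P cent
  by (intro graded_subalgebra.intro graded_subalgebra_axioms.intro P.dg_algebra_axioms cent_carrier cent_add cent_smult
      cent_one cent_mult cent_diff cent_component)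

end

section \<open>Abelianization\<close>

context dg_algebra
begin

definition "comms = {gcommutator A x y | x y. x \<in> carrier A \<and> y \<in> carrier A}"

lemma comms_carrier: "comms \<subseteq> carrier A"
  using gcommutator_closed by (auto simp: comms_def)

lemma commutator_ideal_eq: "commutator_ideal A = Idl comms"
  by (simp add: commutator_ideal_def comms_def)

lemma commutator_ideal: "ideal (commutator_ideal A) A"
  unfolding commutator_ideal_eq by (rule genideal_ideal[OF comms_carrier])

lemma gcommutator_in: "x \<in> carrier A \<Longrightarrow> y \<in> carrier A \<Longrightarrow> gcommutator A x y \<in> commutator_ideal A"
  unfolding commutator_ideal_eq using genideal_self[OF comms_carrier] by (auto simp: comms_def)

lemma diff_gcommutator:
  assumes x: "x \<in> grade A i" and y: "y \<in> grade A j"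
  shows "diff A (gcommutator A x y) = gcommutator A (diff A x) y \<oplus> ksgn A i (gcommutator A x (diff A y))"
proof -
  note c = grade_carrier[OF x] grade_carrier[OF y]
  have s: "ksgn A (i * j + j) (y \<otimes> diff A x) = ksgn A ((i + 1) * j) (y \<otimes> diff A x)"
    "ksgn A (i + i * (j + 1)) (diff A y \<otimes> x) = ksgn A (i * j) (diff A y \<otimes> x)"
    by (auto intro!: ksgn_cong)
  show ?thesis
    unfolding gcommutator_homog[OF x y] gcommutator_homog[OF diff_grade[OF x] y] gcommutator_homog[OF x diff_grade[OF y]]
    using c by (simp add: mod_hom.f_minus[OF diff_mod_hom] diff_ksgn leibniz[OF x] leibniz[OF y] ksgn_add)
      (simp add: a_minus_def minus_add ksgn_add ksgn_uminus s a_ac)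
qed

text \<open>The commutators in the definition of the ideal have arbitrary arguments. By bilinearity they are sums of commutators of
  homogeneous elements, whose differentials are again sums of commutators.\<close>

lemma comms_component_diff:
  assumes "g \<in> comms"
  shows "component A g n \<in> Idl comms \<and> diff A (component A g n) \<in> Idl comms"
proof -
  interpret I: ideal "commutator_ideal A" A by (rule commutator_ideal)
  have 0: "\<zero> \<in> commutator_ideal A" by (rule additive_subgroup.zero_closed[OF I.is_additive_subgroup])
  have sg: "ksgn A n z \<in> commutator_ideal A" if "z \<in> commutator_ideal A" for n z
    using that by (auto simp: ksgn_def)
  let ?Q = "\<lambda>g. component A g n \<in> commutator_ideal A \<and> diff A (component A g n) \<in> commutator_ideal A"
  obtain x y where xy: "x \<in> carrier A" "y \<in> carrier A" "g = gcommutator A x y"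
    using assms by (auto simp: comms_def)
  have homog: "?Q (gcommutator A x y)" if x: "x \<in> grade A i" and y: "y \<in> grade A j" for x y i j
  proof -
    have "gcommutator A x y \<in> commutator_ideal A" "diff A (gcommutator A x y) \<in> commutator_ideal A"
      unfolding diff_gcommutator[OF x y]
      using gcommutator_in grade_carrier[OF x] grade_carrier[OF y] diff_closed by (auto intro!: I.a_closed sg)
    then show ?thesis using component_homog[OF gcommutator_grade[OF x y]] 0 diff_zero by auto
  qed
  have Q_add: "?Q (g \<oplus> g')" if "?Q g" "?Q g'" "g \<in> carrier A" "g' \<in> carrier A" for g g'
    using that by (auto simp: component_add diff_add)
  have r: "?Q (gcommutator A x y)" if x: "x \<in> grade A i" and y: "y \<in> carrier A" for x y i
    using y
  proof (induction rule: graded_induct)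
    case (add y y')
    then show ?case
      using Q_add[OF add(3,4)] gcommutator_closed grade_carrier[OF x]
      by (simp add: module_hom_add[OF gcommutator_right_hom])
  qed (rule homog[OF x])
  have "?Q (gcommutator A x y)"
    using xy(1)
  proof (induction rule: graded_induct)
    case (add x x')
    then show ?case
      using Q_add[OF add(3,4)] gcommutator_closed xy(2)
      by (simp add: module_hom_add[OF gcommutator_left_hom])
  qed (rule r[OF _ xy(2)])
  then show ?thesis using xy(3) by (simp add: commutator_ideal_eq)
qed

lemma commutator_dg_ideal: "dg_ideal K A (commutator_ideal A)"
proof (intro dg_ideal.intro alg_ideal.intro pre_dga commutator_ideal dg_ideal_axioms.intro)
  interpret I: ideal "commutator_ideal A" A by (rule commutator_ideal)
  have 0: "\<zero> \<in> commutator_ideal A" by (rule additive_subgroup.zero_closed[OF I.is_additive_subgroup])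
  show "component A x i \<in> commutator_ideal A" if "x \<in> commutator_ideal A" for x i
    using generated_ideal_component_diff(1)[OF leibniz comms_carrier comms_component_diff] that
    unfolding commutator_ideal_eq by blast
  show "diff A x \<in> commutator_ideal A" if "x \<in> commutator_ideal A" for x
    using generated_ideal_component_diff(2)[OF leibniz comms_carrier comms_component_diff] that
    unfolding commutator_ideal_eq by blast
  show "diff A (diff A x) \<in> commutator_ideal A" if "x \<in> carrier A" for x
    using diff_diff[OF that] 0 by simp
  show "diff A (x \<otimes> y) \<ominus> (diff A x \<otimes> y \<oplus> ksgn A i (x \<otimes> diff A y)) \<in> commutator_ideal A"
    if "x \<in> grade A i" "y \<in> carrier A" for x y i
  proof -
    have "diff A x \<otimes> y \<oplus> ksgn A i (x \<otimes> diff A y) \<in> carrier A"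
      using that grade_carrier[OF that(1)] by auto
    then show ?thesis
      unfolding leibniz[OF that] using 0 by (simp add: minus_eq_zero_iff[THEN iffD2])
  qed
qed

interpretation Ab: dg_ideal K A "commutator_ideal A"
  by (rule commutator_dg_ideal)

lemma abelianization_eq: "abelianization A = Ab.Q"
  by (simp add: abelianization_def)

lemma ab_proj_eq: "ab_proj A = Ab.cl"
  by (simp add: ab_proj_def fun_eq_iff)

lemma ab_proj_map: "dga_map K A (abelianization A) (ab_proj A)"
  unfolding abelianization_eq ab_proj_eq by (rule Ab.cl_map)

lemma abelianization_carrier: "carrier (abelianization A) = ab_proj A ` carrier A"
  unfolding abelianization_eq ab_proj_eq by (rule Ab.Q_carrier)

theorem abelianization_comm_dg_algebra: "comm_dg_algebra K (abelianization A)"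
proof (intro comm_dg_algebra.intro comm_dg_algebra_axioms.intro)
  show D: "dg_algebra K (abelianization A)" unfolding abelianization_eq by (rule Ab.Q_dg_algebra)
  interpret Q: dg_algebra K "abelianization A" by (rule D)
  fix X Y i j assume "X \<in> grade (abelianization A) i" "Y \<in> grade (abelianization A) j"
  then obtain x y where x: "x \<in> grade A i" "X = Ab.cl x" and y: "y \<in> grade A j" "Y = Ab.cl y"
    unfolding abelianization_eq Ab.Q_grade by auto
  note c = grade_carrier[OF x(1)] grade_carrier[OF y(1)]
  have "Ab.cl (x \<otimes> y) = Ab.cl (ksgn A (i * j) (y \<otimes> x))"
    using gcommutator_in[OF c] gcommutator_homog[OF x(1) y(1)] c by (simp add: Ab.cl_eq)
  then show "X \<otimes>\<^bsub>abelianization A\<^esub> Y = ksgn (abelianization A) (i * j) (Y \<otimes>\<^bsub>abelianization A\<^esub> X)"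
    using c mod_hom.f_ksgn[OF Ab.cl_mod_hom] by (simp add: abelianization_eq x(2) y(2))
qed

theorem abelianization_lift:
  assumes B: "comm_dg_algebra K B" and f: "dga_map K A B f"
  shows "\<exists>h. dga_map K (abelianization A) B h \<and> (\<forall>x\<in>carrier A. h (ab_proj A x) = f x)"
  unfolding abelianization_eq ab_proj_eq
proof (rule Ab.quot_lift[OF _ f])
  interpret B: comm_dg_algebra K B by fact
  interpret f: mod_hom K A B f by (intro mod_homI module_axiom B.module_axiom dga_map_hom f)
  show pB: "pre_dga K B" by (rule B.pre_dga)
  note fc = dga_map_closed[OF f]
  have homog: "f (gcommutator A x y) = \<zero>\<^bsub>B\<^esub>" if x: "x \<in> grade A i" and y: "y \<in> grade A j" for x y i j
    using grade_carrier[OF x] grade_carrier[OF y] fc B.graded_comm[OF dga_map_grade[OF f x] dga_map_grade[OF f y]]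
    by (simp add: gcommutator_homog[OF x y] dga_map_mult[OF f] f.f_ksgn B.minus_eq_zero_iff)
  have z: "(\<lambda>_. \<zero>\<^bsub>B\<^esub>) \<in> module_hom K A B" by (rule module_homI) auto
  have r: "f (gcommutator A x y) = \<zero>\<^bsub>B\<^esub>" if x: "x \<in> grade A i" and y: "y \<in> carrier A" for x y i
    by (rule hom_eq_on_carrier[OF module_hom_comp[OF gcommutator_right_hom[OF grade_carrier[OF x]] f.f_hom] z homog[OF x] y])
  have "f (gcommutator A x y) = \<zero>\<^bsub>B\<^esub>" if x: "x \<in> carrier A" and y: "y \<in> carrier A" for x y
    by (rule hom_eq_on_carrier[OF module_hom_comp[OF gcommutator_left_hom[OF y] f.f_hom] z r[OF _ y] x])
  then have "comms \<subseteq> {x \<in> carrier A. f x = \<zero>\<^bsub>B\<^esub>}"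
    using gcommutator_closed by (auto simp: comms_def)
  from genideal_minimal[OF dga_map_kernel_ideal[OF pre_dga pB f] this]
  show "f x = \<zero>\<^bsub>B\<^esub>" if "x \<in> commutator_ideal A" for x
    using that unfolding commutator_ideal_eq by blast
qed

end

section \<open>The endomorphism algebra of a complex\<close>

lemma module_hom_restrict:
  assumes "module K A" "f \<in> module_hom K A M"
  shows "restrict f (carrier A) \<in> module_hom K A M"
proof -
  interpret A: module K A by fact
  show ?thesis
    by (rule module_homI) (simp_all add: module_hom_in[OF assms(2)] module_hom_add[OF assms(2)] module_hom_smult[OF assms(2)])
qed

context cochain_complex
begin

abbreviation "EE \<equiv> End_dg K V"

lemma diff_V_closed: "v \<in> carrier V \<Longrightarrow> diff V v \<in> carrier V"
  by (rule module_hom_in[OF diff_linear])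

lemma ksgn_grade_hom: "ksgn V n \<in> module_hom K (V\<lparr>carrier := grade V i\<rparr>) V"
  using grade_carrier by (intro module_homI) (auto simp: ksgn_add)

lemma parity_eq: "parity V = gext V V (\<lambda>i. ksgn V i)"
  by (simp add: parity_def gext_def fun_eq_iff)

lemma parity_hom: "parity V \<in> module_hom K V V"
  unfolding parity_eq by (rule gext_hom[OF module_axiom ksgn_grade_hom])

lemma parity_homog: "v \<in> grade V i \<Longrightarrow> parity V v = ksgn V i v"
  unfolding parity_eq by (rule gext_homog[OF module_axiom ksgn_grade_hom])

lemma parity_closed: "v \<in> carrier V \<Longrightarrow> parity V v \<in> carrier V"
  by (rule module_hom_in[OF parity_hom])

lemma End_partD:
  assumes "\<phi> \<in> End_part K V n"
  shows "\<phi> \<in> module_hom K V V" "\<phi> \<in> extensional (carrier V)" "v \<in> grade V i \<Longrightarrow> \<phi> v \<in> grade V (i + n)"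
  using assms by (auto simp: End_part_def)

lemma End_partI:
  assumes "f \<in> module_hom K V V" "\<And>i v. v \<in> grade V i \<Longrightarrow> f v \<in> grade V (i + n)"
  shows "restrict f (carrier V) \<in> End_part K V n"
  using assms module_hom_restrict[OF module_axiom assms(1)] grade_carrier by (auto simp: End_part_def)

lemma zero_hom: "(\<lambda>v. \<zero>) \<in> module_hom K V V"
  by (rule module_homI) auto

lemma End_part_zero: "(\<lambda>v\<in>carrier V. \<zero>) \<in> End_part K V n"
  by (rule End_partI[OF zero_hom]) auto

lemma End_part_add: "\<phi> \<in> End_part K V n \<Longrightarrow> \<psi> \<in> End_part K V n \<Longrightarrow> (\<lambda>v\<in>carrier V. \<phi> v \<oplus> \<psi> v) \<in> End_part K V n"
  by (intro End_partI module_hom_add2 module_axiom) (auto dest: End_partD intro: add_grade)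

lemma End_part_smult: "c \<in> carrier K \<Longrightarrow> \<phi> \<in> End_part K V n \<Longrightarrow> (\<lambda>v\<in>carrier V. c \<odot> \<phi> v) \<in> End_part K V n"
  by (intro End_partI module_hom_smult2 module_axiom) (auto dest: End_partD intro: smult_grade)

lemma E_simps:
  "mult EE \<phi> \<psi> = compose (carrier V) \<phi> \<psi>" "\<one>\<^bsub>EE\<^esub> = (\<lambda>v\<in>carrier V. v)" "\<zero>\<^bsub>EE\<^esub> = (\<lambda>v\<in>carrier V. \<zero>)"
  "\<phi> \<oplus>\<^bsub>EE\<^esub> \<psi> = (\<lambda>v\<in>carrier V. \<phi> v \<oplus> \<psi> v)" "c \<odot>\<^bsub>EE\<^esub> \<phi> = (\<lambda>v\<in>carrier V. c \<odot> \<phi> v)"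
  "grade EE = End_part K V"
  "diff EE \<phi> = (\<lambda>v\<in>carrier V. diff V (\<phi> v) \<ominus> parity V (\<phi> (parity V (diff V v))))"
  by (simp_all add: End_dg_def)

lemma E_carrier: "carrier EE = {\<phi>. \<exists>N \<psi>. finite N \<and> (\<forall>n\<in>N. \<psi> n \<in> End_part K V n) \<and>
    \<phi> = (\<lambda>v\<in>carrier V. \<Oplus>n\<in>N. \<psi> n v)}"
  by (simp add: End_dg_def)

lemma E_hom: "\<phi> \<in> carrier EE \<Longrightarrow> \<phi> \<in> module_hom K V V"
  unfolding E_carrier
  by (auto intro!: module_hom_restrict module_hom_finsum module_axiom dest: End_partD)

lemma E_ext: "\<phi> \<in> carrier EE \<Longrightarrow> \<phi> \<in> extensional (carrier V)"
  unfolding E_carrier by auto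

lemma E_app: "\<phi> \<in> carrier EE \<Longrightarrow> v \<in> carrier V \<Longrightarrow> \<phi> v \<in> carrier V"
  by (rule module_hom_in[OF E_hom])

lemma E_eqI:
  "\<phi> \<in> extensional (carrier V) \<Longrightarrow> \<psi> \<in> extensional (carrier V) \<Longrightarrow> (\<And>v. v \<in> carrier V \<Longrightarrow> \<phi> v = \<psi> v) \<Longrightarrow> \<phi> = \<psi>"
  by (rule extensionalityI)

lemma part_E: "\<phi> \<in> End_part K V n \<Longrightarrow> \<phi> \<in> carrier EE"
proof -
  assume p: "\<phi> \<in> End_part K V n"
  have "\<phi> = (\<lambda>v\<in>carrier V. \<Oplus>i\<in>{n}. \<phi> v)"
    using End_partD(2)[OF p] module_hom_in[OF End_partD(1)[OF p]] by (intro E_eqI) auto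
  then show ?thesis unfolding E_carrier using p by (auto intro!: exI[of _ "{n}"] exI[of _ "\<lambda>_. \<phi>"])
qed

lemma E_add_closed:
  assumes "\<phi> \<in> carrier EE" "\<psi> \<in> carrier EE"
  shows "(\<lambda>v\<in>carrier V. \<phi> v \<oplus> \<psi> v) \<in> carrier EE"
proof -
  obtain N f where f: "finite N" "\<And>n. n \<in> N \<Longrightarrow> f n \<in> End_part K V n" "\<phi> = (\<lambda>v\<in>carrier V. \<Oplus>n\<in>N. f n v)"
    using assms(1) unfolding E_carrier by blast
  obtain M g where g: "finite M" "\<And>n. n \<in> M \<Longrightarrow> g n \<in> End_part K V n" "\<psi> = (\<lambda>v\<in>carrier V. \<Oplus>n\<in>M. g n v)"
    using assms(2) unfolding E_carrier by blast
  define f' where "f' n = (if n \<in> N then f n else (\<lambda>v\<in>carrier V. \<zero>))" for n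
  define g' where "g' n = (if n \<in> M then g n else (\<lambda>v\<in>carrier V. \<zero>))" for n
  have f': "f' n \<in> End_part K V n" and g': "g' n \<in> End_part K V n" for n
    using f(2) g(2) End_part_zero by (auto simp: f'_def g'_def)
  have c: "f' n v \<in> carrier V" "g' n v \<in> carrier V" if "v \<in> carrier V" for n v
    using module_hom_in[OF End_partD(1)[OF f'] that] module_hom_in[OF End_partD(1)[OF g'] that] by auto
  have "(\<lambda>v\<in>carrier V. \<phi> v \<oplus> \<psi> v) = (\<lambda>v\<in>carrier V. \<Oplus>n\<in>N \<union> M. (\<lambda>v\<in>carrier V. f' n v \<oplus> g' n v) v)"
  proof (rule E_eqI)
    fix v assume v: "v \<in> carrier V"
    have "(\<Oplus>n\<in>N. f n v) = (\<Oplus>n\<in>N \<union> M. f' n v)"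
      using f(1) g(1) c(1)[OF v] v by (intro add.finprod_mono_neutral_cong_left) (auto simp: f'_def)
    moreover have "(\<Oplus>n\<in>M. g n v) = (\<Oplus>n\<in>N \<union> M. g' n v)"
      using f(1) g(1) c(2)[OF v] v by (intro add.finprod_mono_neutral_cong_left) (auto simp: g'_def)
    ultimately show "(\<lambda>v\<in>carrier V. \<phi> v \<oplus> \<psi> v) v = (\<lambda>v\<in>carrier V. \<Oplus>n\<in>N \<union> M. (\<lambda>v\<in>carrier V. f' n v \<oplus> g' n v) v) v"
      using v c[OF v] by (simp add: f(3) g(3) finsum_addf)
  qed auto
  then show ?thesis
    unfolding E_carrier using f(1) g(1) End_part_add[OF f' g']
    by (intro CollectI exI[of _ "N \<union> M"] exI[of _ "\<lambda>n. \<lambda>v\<in>carrier V. f' n v \<oplus> g' n v"]) simp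
qed

lemma E_smult_closed:
  assumes "c \<in> carrier K" "\<phi> \<in> carrier EE"
  shows "(\<lambda>v\<in>carrier V. c \<odot> \<phi> v) \<in> carrier EE"
proof -
  obtain N f where f: "finite N" "\<And>n. n \<in> N \<Longrightarrow> f n \<in> End_part K V n" "\<phi> = (\<lambda>v\<in>carrier V. \<Oplus>n\<in>N. f n v)"
    using assms(2) unfolding E_carrier by blast
  have fc: "f n v \<in> carrier V" if "n \<in> N" "v \<in> carrier V" for n v
    by (rule module_hom_in[OF End_partD(1)[OF f(2)[OF that(1)]] that(2)])
  have "(\<lambda>v\<in>carrier V. c \<odot> \<phi> v) = (\<lambda>v\<in>carrier V. \<Oplus>n\<in>N. (\<lambda>v\<in>carrier V. c \<odot> f n v) v)"
  proof (rule E_eqI)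
    fix v assume v: "v \<in> carrier V"
    then show "(\<lambda>v\<in>carrier V. c \<odot> \<phi> v) v = (\<lambda>v\<in>carrier V. \<Oplus>n\<in>N. (\<lambda>v\<in>carrier V. c \<odot> f n v) v) v"
      using finsum_smult_ldistr[OF f(1) assms(1), of "\<lambda>n. f n v"] fc by (auto simp: f(3))
  qed auto
  then show ?thesis
    unfolding E_carrier using f(1) End_part_smult[OF assms(1) f(2)]
    by (intro CollectI exI[of _ N] exI[of _ "\<lambda>n. \<lambda>v\<in>carrier V. c \<odot> f n v"]) simp
qed

lemma E_module: "module K EE"
proof (rule moduleI)
  have zc: "\<zero>\<^bsub>EE\<^esub> \<in> carrier EE" using part_E[OF End_part_zero] by (simp add: E_simps)
  show "abelian_group EE"
  proof (rule abelian_groupI)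
    fix \<phi> assume \<phi>: "\<phi> \<in> carrier EE"
    have "(\<ominus>\<^bsub>K\<^esub> \<one>\<^bsub>K\<^esub>) \<odot>\<^bsub>EE\<^esub> \<phi> \<oplus>\<^bsub>EE\<^esub> \<phi> = \<zero>\<^bsub>EE\<^esub>"
    proof (rule E_eqI)
      fix v assume v: "v \<in> carrier V"
      have "\<ominus>\<^bsub>K\<^esub> \<one>\<^bsub>K\<^esub> \<odot> \<phi> v = \<ominus> \<phi> v" using E_app[OF \<phi> v] by (subst smult_l_minus) simp_all
      then show "((\<ominus>\<^bsub>K\<^esub> \<one>\<^bsub>K\<^esub>) \<odot>\<^bsub>EE\<^esub> \<phi> \<oplus>\<^bsub>EE\<^esub> \<phi>) v = \<zero>\<^bsub>EE\<^esub> v"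
        using v M.l_neg[OF E_app[OF \<phi> v]] by (simp add: E_simps)
    qed (simp_all add: E_simps)
    moreover have "(\<ominus>\<^bsub>K\<^esub> \<one>\<^bsub>K\<^esub>) \<odot>\<^bsub>EE\<^esub> \<phi> \<in> carrier EE"
      using E_smult_closed[OF _ \<phi>, of "\<ominus>\<^bsub>K\<^esub> \<one>\<^bsub>K\<^esub>"] by (simp add: E_simps)
    ultimately show "\<exists>\<psi>\<in>carrier EE. \<psi> \<oplus>\<^bsub>EE\<^esub> \<phi> = \<zero>\<^bsub>EE\<^esub>" by blast
    show "\<zero>\<^bsub>EE\<^esub> \<oplus>\<^bsub>EE\<^esub> \<phi> = \<phi>"
      using E_app[OF \<phi>] E_ext[OF \<phi>] by (intro E_eqI) (auto simp: E_simps)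
  next
    fix \<phi> \<psi> \<chi> assume c: "\<phi> \<in> carrier EE" "\<psi> \<in> carrier EE" "\<chi> \<in> carrier EE"
    show "\<phi> \<oplus>\<^bsub>EE\<^esub> \<psi> \<oplus>\<^bsub>EE\<^esub> \<chi> = \<phi> \<oplus>\<^bsub>EE\<^esub> (\<psi> \<oplus>\<^bsub>EE\<^esub> \<chi>)"
      using E_app[OF c(1)] E_app[OF c(2)] E_app[OF c(3)] by (intro E_eqI) (auto simp: E_simps a_assoc)
  next
    fix \<phi> \<psi> assume c: "\<phi> \<in> carrier EE" "\<psi> \<in> carrier EE"
    show "\<phi> \<oplus>\<^bsub>EE\<^esub> \<psi> \<in> carrier EE" using E_add_closed[OF c] by (simp add: E_simps)
    show "\<phi> \<oplus>\<^bsub>EE\<^esub> \<psi> = \<psi> \<oplus>\<^bsub>EE\<^esub> \<phi>"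
      using E_app[OF c(1)] E_app[OF c(2)] by (intro E_eqI) (auto simp: E_simps a_comm)
  qed (rule zc)
next
  fix a b \<phi> assume c: "a \<in> carrier K" "b \<in> carrier K" "\<phi> \<in> carrier EE"
  show "(a \<oplus>\<^bsub>K\<^esub> b) \<odot>\<^bsub>EE\<^esub> \<phi> = a \<odot>\<^bsub>EE\<^esub> \<phi> \<oplus>\<^bsub>EE\<^esub> b \<odot>\<^bsub>EE\<^esub> \<phi>"
    using c(1,2) E_app[OF c(3)] by (intro E_eqI) (auto simp: E_simps smult_l_distr)
  show "(a \<otimes>\<^bsub>K\<^esub> b) \<odot>\<^bsub>EE\<^esub> \<phi> = a \<odot>\<^bsub>EE\<^esub> (b \<odot>\<^bsub>EE\<^esub> \<phi>)"
    using c(1,2) E_app[OF c(3)] by (intro E_eqI) (auto simp: E_simps smult_assoc1)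
next
  fix a \<phi> \<psi> assume c: "a \<in> carrier K" "\<phi> \<in> carrier EE" "\<psi> \<in> carrier EE"
  show "a \<odot>\<^bsub>EE\<^esub> (\<phi> \<oplus>\<^bsub>EE\<^esub> \<psi>) = a \<odot>\<^bsub>EE\<^esub> \<phi> \<oplus>\<^bsub>EE\<^esub> a \<odot>\<^bsub>EE\<^esub> \<psi>"
    using c(1) E_app[OF c(2)] E_app[OF c(3)] by (intro E_eqI) (auto simp: E_simps smult_r_distr)
next
  fix \<phi> assume c: "\<phi> \<in> carrier EE"
  show "\<one>\<^bsub>K\<^esub> \<odot>\<^bsub>EE\<^esub> \<phi> = \<phi>"
    using E_app[OF c] E_ext[OF c] by (intro E_eqI) (auto simp: E_simps)
next
  show "a \<odot>\<^bsub>EE\<^esub> \<phi> \<in> carrier EE" if "a \<in> carrier K" "\<phi> \<in> carrier EE" for a \<phi>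
    using E_smult_closed[OF that] by (simp add: E_simps)
qed (rule R.is_cring)

lemma E_finsum:
  assumes "\<And>i. i \<in> I \<Longrightarrow> g i \<in> carrier EE" and v: "v \<in> carrier V"
  shows "(\<Oplus>\<^bsub>EE\<^esub>i\<in>I. g i) v = (\<Oplus>i\<in>I. g i v)"
proof -
  interpret E: module K EE by (rule E_module)
  have "(\<lambda>\<phi>. \<phi> v) \<in> module_hom K EE V"
    using v by (intro module_homI) (simp_all add: E_app E_simps)
  then show ?thesis
    by (rule mod_hom.f_finsum[OF mod_homI[OF E_module module_axiom]]) (use assms(1) in auto)
qed

lemma E_decomp:
  assumes "\<phi> \<in> carrier EE"
  shows "\<exists>N f. finite N \<and> (\<forall>n\<in>N. f n \<in> End_part K V n) \<and> \<phi> = (\<Oplus>\<^bsub>EE\<^esub>n\<in>N. f n)"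
proof -
  interpret E: module K EE by (rule E_module)
  obtain N f where f: "finite N" "\<And>n. n \<in> N \<Longrightarrow> f n \<in> End_part K V n" "\<phi> = (\<lambda>v\<in>carrier V. \<Oplus>n\<in>N. f n v)"
    using assms unfolding E_carrier by blast
  have fE: "f n \<in> carrier EE" if "n \<in> N" for n by (rule part_E[OF f(2)[OF that]])
  have "\<phi> = (\<Oplus>\<^bsub>EE\<^esub>n\<in>N. f n)"
  proof (rule E_eqI)
    show "(\<Oplus>\<^bsub>EE\<^esub>n\<in>N. f n) \<in> extensional (carrier V)" using fE by (intro E_ext E.finsum_closed) auto
    show "\<phi> v = (\<Oplus>\<^bsub>EE\<^esub>n\<in>N. f n) v" if "v \<in> carrier V" for v
      using E_finsum[of N f v, OF fE that] that by (simp add: f(3))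
  qed (simp add: f(3))
  then show ?thesis using f(1,2) by (intro exI[of _ N] exI[of _ f]) simp
qed

lemma E_graded: "graded_module K EE"
proof (rule graded_moduleI[OF E_module])
  interpret E: module K EE by (rule E_module)
  show "LinearCombinations.submodule K (grade EE i) EE" for i
    by (rule LinearCombinations.submodule.intro[OF E_module])
      (auto simp: E_simps End_part_zero End_part_add End_part_smult part_E)
  show "\<exists>N f. finite N \<and> (\<forall>i\<in>N. f i \<in> grade EE i) \<and> \<phi> = (\<Oplus>\<^bsub>EE\<^esub>i\<in>N. f i)" if "\<phi> \<in> carrier EE" for \<phi>
    using E_decomp[OF that] by (simp add: E_simps)
  fix N f i
  assume N: "finite N" and f: "\<And>i. i \<in> N \<Longrightarrow> f i \<in> grade EE i"
    and 0: "(\<Oplus>\<^bsub>EE\<^esub>i\<in>N. f i) = \<zero>\<^bsub>EE\<^esub>" and i: "i \<in> N"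
  have fp: "f j \<in> End_part K V j" if "j \<in> N" for j using f[OF that] by (simp add: E_simps)
  have fE: "f j \<in> carrier EE" if "j \<in> N" for j by (rule part_E[OF fp[OF that]])
  have hz: "f i v = \<zero>" if v: "v \<in> grade V k" for v k
  proof -
    have vc: "v \<in> carrier V" by (rule grade_carrier[OF v])
    have fin: "finite ((+) k ` N)" using N by simp
    have g: "f (j - k) v \<in> grade V j" if "j \<in> (+) k ` N" for j
      using that End_partD(3)[OF fp v] by auto
    have "(\<Oplus>j\<in>(+) k ` N. f (j - k) v) = (\<Oplus>j\<in>N. f j v)"
      using E_app[OF fE vc] by (subst finsum_reindex) auto
    also have "\<dots> = \<zero>" using E_finsum[of N f v, OF fE vc] 0 vc by (simp add: E_simps)
    finally have 1: "(\<Oplus>j\<in>(+) k ` N. f (j - k) v) = \<zero>" .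
    have "component V (\<Oplus>j\<in>(+) k ` N. f (j - k) v) (k + i) = (if k + i \<in> (+) k ` N then f (k + i - k) v else \<zero>)"
      by (rule component_eqI[OF fin g])
    then show ?thesis using i unfolding 1 by simp
  qed
  have "f i v = \<zero>" if v: "v \<in> carrier V" for v
    by (rule hom_eq_on_carrier[OF E_hom[OF fE[OF i]] zero_hom hz v])
  then show "f i = \<zero>\<^bsub>EE\<^esub>"
    using E_ext[OF fE[OF i]] by (intro E_eqI) (auto simp: E_simps)
qed

lemma compose_part:
  assumes "\<phi> \<in> End_part K V n" "\<psi> \<in> End_part K V m"
  shows "compose (carrier V) \<phi> \<psi> \<in> End_part K V (n + m)"
proof -
  have "\<phi> (\<psi> v) \<in> grade V (i + (n + m))" if "v \<in> grade V i" for v i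
    using End_partD(3)[OF assms(1) End_partD(3)[OF assms(2) that]] by (simp add: algebra_simps)
  then show ?thesis
    unfolding compose_def
    by (intro End_partI module_hom_comp[OF End_partD(1)[OF assms(2)] End_partD(1)[OF assms(1)]])
qed

lemma compose_E:
  assumes "\<phi> \<in> carrier EE" "\<psi> \<in> carrier EE"
  shows "compose (carrier V) \<phi> \<psi> \<in> carrier EE"
  using assms(1)
proof (induction rule: graded_module.graded_induct[OF E_graded, consumes 1, case_names homog add])
  interpret E: graded_module K EE by (rule E_graded)
  case (homog n \<phi>)
  show ?case
    using assms(2)
  proof (induction rule: E.graded_induct)
    case (homog m \<psi>)
    then show ?case using compose_part[of \<phi> n \<psi> m] \<open>\<phi> \<in> grade EE n\<close> part_E by (simp add: E_simps)
  next
    case (add \<psi> \<psi>')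
    have "compose (carrier V) \<phi> (\<psi> \<oplus>\<^bsub>EE\<^esub> \<psi>') = compose (carrier V) \<phi> \<psi> \<oplus>\<^bsub>EE\<^esub> compose (carrier V) \<phi> \<psi>'"
      using module_hom_add[OF E_hom[OF E.grade_carrier[OF homog]]] E_app[OF add(1)] E_app[OF add(2)]
      by (intro E_eqI) (auto simp: E_simps compose_def)
    then show ?case using add by simp
  qed
next
  interpret E: graded_module K EE by (rule E_graded)
  case (add \<phi> \<phi>')
  have "compose (carrier V) (\<phi> \<oplus>\<^bsub>EE\<^esub> \<phi>') \<psi> = compose (carrier V) \<phi> \<psi> \<oplus>\<^bsub>EE\<^esub> compose (carrier V) \<phi>' \<psi>"
    using E_app[OF assms(2)] by (intro E_eqI) (auto simp: E_simps compose_def)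
  then show ?case using add by simp
qed

lemma E_ring: "ring EE"
proof (rule ringI)
  interpret E: graded_module K EE by (rule E_graded)
  show "abelian_group EE" by unfold_locales
  have one: "\<one>\<^bsub>EE\<^esub> \<in> carrier EE"
    using End_partI[of "\<lambda>v. v" 0] by (intro part_E[of _ 0]) (auto simp: E_simps module_hom_def)
  show "Group.monoid EE"
  proof (rule monoidI)
    show "\<phi> \<otimes>\<^bsub>EE\<^esub> \<psi> \<otimes>\<^bsub>EE\<^esub> \<chi> = \<phi> \<otimes>\<^bsub>EE\<^esub> (\<psi> \<otimes>\<^bsub>EE\<^esub> \<chi>)"
      if "\<phi> \<in> carrier EE" "\<psi> \<in> carrier EE" "\<chi> \<in> carrier EE" for \<phi> \<psi> \<chi>
      using E_app[OF that(3)] by (intro E_eqI) (auto simp: E_simps compose_def)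
    show "\<one>\<^bsub>EE\<^esub> \<otimes>\<^bsub>EE\<^esub> \<phi> = \<phi>" if "\<phi> \<in> carrier EE" for \<phi>
      using E_app[OF that] E_ext[OF that] by (intro E_eqI) (simp_all add: E_simps compose_def)
    show "\<phi> \<otimes>\<^bsub>EE\<^esub> \<one>\<^bsub>EE\<^esub> = \<phi>" if "\<phi> \<in> carrier EE" for \<phi>
      using E_app[OF that] E_ext[OF that] by (intro E_eqI) (simp_all add: E_simps compose_def)
  qed (use one compose_E in \<open>auto simp: E_simps\<close>)
  fix \<phi> \<psi> \<chi> assume c: "\<phi> \<in> carrier EE" "\<psi> \<in> carrier EE" "\<chi> \<in> carrier EE"
  show "(\<phi> \<oplus>\<^bsub>EE\<^esub> \<psi>) \<otimes>\<^bsub>EE\<^esub> \<chi> = \<phi> \<otimes>\<^bsub>EE\<^esub> \<chi> \<oplus>\<^bsub>EE\<^esub> \<psi> \<otimes>\<^bsub>EE\<^esub> \<chi>"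
    using E_app[OF c(3)] by (intro E_eqI) (auto simp: E_simps compose_def)
  show "\<chi> \<otimes>\<^bsub>EE\<^esub> (\<phi> \<oplus>\<^bsub>EE\<^esub> \<psi>) = \<chi> \<otimes>\<^bsub>EE\<^esub> \<phi> \<oplus>\<^bsub>EE\<^esub> \<chi> \<otimes>\<^bsub>EE\<^esub> \<psi>"
    using E_app[OF c(1)] E_app[OF c(2)] module_hom_add[OF E_hom[OF c(3)]] by (intro E_eqI) (auto simp: E_simps compose_def)
qed

text \<open>The two parities in the definition of the differential contribute the degrees \<open>i + 1\<close> of \<open>diff V v\<close> and \<open>i + 1 + n\<close>
  of its image, which add up to \<open>n\<close> modulo 2.\<close>

lemma E_diff_homog:
  assumes \<phi>: "\<phi> \<in> End_part K V n" and v: "v \<in> carrier V"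
  shows "diff EE \<phi> v = diff V (\<phi> v) \<ominus> ksgn V n (\<phi> (diff V v))"
proof -
  note h = End_partD(1)[OF \<phi>]
  have "diff V (\<phi> v) \<ominus> parity V (\<phi> (parity V (diff V v))) = diff V (\<phi> v) \<ominus> ksgn V n (\<phi> (diff V v))"
  proof (rule hom_eq_on_carrier[OF _ _ _ v])
    show "(\<lambda>v. diff V (\<phi> v) \<ominus> parity V (\<phi> (parity V (diff V v)))) \<in> module_hom K V V"
      by (intro module_hom_minus2 module_axiom module_hom_comp[OF h diff_linear]
          module_hom_comp[OF module_hom_comp[OF module_hom_comp[OF diff_linear parity_hom] h] parity_hom])
    show "(\<lambda>v. diff V (\<phi> v) \<ominus> ksgn V n (\<phi> (diff V v))) \<in> module_hom K V V"
      by (intro module_hom_minus2 module_hom_ksgn module_axiom module_hom_comp[OF h diff_linear] module_hom_comp[OF diff_linear h])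
    fix i v assume v: "v \<in> grade V i"
    note dv = diff_grade[OF v] and fdv = End_partD(3)[OF \<phi> diff_grade[OF v]]
    have "parity V (\<phi> (parity V (diff V v))) = ksgn V (i + 1 + (i + 1 + n)) (\<phi> (diff V v))"
      using mod_hom.f_ksgn[OF mod_homI[OF module_axiom module_axiom h] grade_carrier[OF dv]]
        mod_hom.f_ksgn[OF mod_homI[OF module_axiom module_axiom parity_hom] grade_carrier[OF fdv]]
        grade_carrier[OF fdv]
      by (simp add: parity_homog[OF dv] parity_homog[OF fdv])
    then show "diff V (\<phi> v) \<ominus> parity V (\<phi> (parity V (diff V v))) = diff V (\<phi> v) \<ominus> ksgn V n (\<phi> (diff V v))"
      using ksgn_cong[of "i + 1 + (i + 1 + n)" n V] by simp
  qed
  then show ?thesis using v by (simp add: E_simps)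
qed

lemma E_diff_part:
  assumes \<phi>: "\<phi> \<in> End_part K V n"
  shows "diff EE \<phi> \<in> End_part K V (n + 1)"
proof -
  note h = End_partD(1)[OF \<phi>]
  have "diff EE \<phi> = (\<lambda>v\<in>carrier V. diff V (\<phi> v) \<ominus> ksgn V n (\<phi> (diff V v)))"
    using E_diff_homog[OF \<phi>] by (intro E_eqI) (auto simp: E_simps(7))
  moreover have "(\<lambda>v\<in>carrier V. diff V (\<phi> v) \<ominus> ksgn V n (\<phi> (diff V v))) \<in> End_part K V (n + 1)"
  proof (rule End_partI)
    show "(\<lambda>v. diff V (\<phi> v) \<ominus> ksgn V n (\<phi> (diff V v))) \<in> module_hom K V V"
      by (intro module_hom_minus2 module_hom_ksgn module_axiom module_hom_comp[OF h diff_linear] module_hom_comp[OF diff_linear h])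
    fix i v assume v: "v \<in> grade V i"
    show "diff V (\<phi> v) \<ominus> ksgn V n (\<phi> (diff V v)) \<in> grade V (i + (n + 1))"
      using diff_grade[OF End_partD(3)[OF \<phi> v]] End_partD(3)[OF \<phi> diff_grade[OF v]]
      by (intro minus_grade ksgn_grade) (simp_all add: algebra_simps)
  qed
  ultimately show ?thesis by simp
qed

lemma E_diff_hom: "diff EE \<in> module_hom K EE EE"
proof (rule module_homI)
  interpret E: graded_module K EE by (rule E_graded)
  have lin: "(\<lambda>\<phi>. diff V (\<phi> v) \<ominus> parity V (\<phi> (parity V (diff V v)))) \<in> module_hom K EE V" if v: "v \<in> carrier V" for v
  proof -
    have ev: "(\<lambda>\<phi>. \<phi> w) \<in> module_hom K EE V" if "w \<in> carrier V" for w
      using that by (intro module_homI) (simp_all add: E_app E_simps)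
    show ?thesis
      using v by (intro module_hom_minus2 module_axiom module_hom_comp[OF ev diff_linear] module_hom_comp[OF ev parity_hom]
          parity_closed diff_V_closed)
  qed
  show add: "diff EE (\<phi> \<oplus>\<^bsub>EE\<^esub> \<psi>) = diff EE \<phi> \<oplus>\<^bsub>EE\<^esub> diff EE \<psi>" if "\<phi> \<in> carrier EE" "\<psi> \<in> carrier EE" for \<phi> \<psi>
    using module_hom_add[OF lin that] by (intro E_eqI) (auto simp: E_simps)
  show "diff EE (c \<odot>\<^bsub>EE\<^esub> \<phi>) = c \<odot>\<^bsub>EE\<^esub> diff EE \<phi>" if "c \<in> carrier K" "\<phi> \<in> carrier EE" for c \<phi>
    using module_hom_smult[OF lin that] by (intro E_eqI) (auto simp: E_simps)
  show "diff EE \<phi> \<in> carrier EE" if "\<phi> \<in> carrier EE" for \<phi>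
    using that
  proof (induction rule: E.graded_induct)
    case (homog n \<phi>)
    then show ?case using part_E[OF E_diff_part] by (simp add: E_simps(6))
  qed (simp add: add)
qed

lemma E_pre_dga: "pre_dga K EE"
proof (intro pre_dga.intro pre_dga_axioms.intro E_graded E_ring E_diff_hom)
  interpret E: graded_module K EE by (rule E_graded)
  show "\<one>\<^bsub>EE\<^esub> \<in> grade EE 0"
    using End_partI[of "\<lambda>v. v" 0] by (auto simp: E_simps module_hom_def)
  show "c \<odot>\<^bsub>EE\<^esub> \<phi> \<otimes>\<^bsub>EE\<^esub> \<psi> = c \<odot>\<^bsub>EE\<^esub> (\<phi> \<otimes>\<^bsub>EE\<^esub> \<psi>)" if "c \<in> carrier K" "\<phi> \<in> carrier EE" "\<psi> \<in> carrier EE" for c \<phi> \<psi>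
    using that(1) E_app[OF that(2)] E_app[OF that(3)] by (intro E_eqI) (auto simp: E_simps compose_def)
  show "\<phi> \<otimes>\<^bsub>EE\<^esub> (c \<odot>\<^bsub>EE\<^esub> \<psi>) = c \<odot>\<^bsub>EE\<^esub> (\<phi> \<otimes>\<^bsub>EE\<^esub> \<psi>)" if "c \<in> carrier K" "\<phi> \<in> carrier EE" "\<psi> \<in> carrier EE" for c \<phi> \<psi>
    using that(1) E_app[OF that(3)] module_hom_smult[OF E_hom[OF that(2)]] by (intro E_eqI) (auto simp: E_simps compose_def)
qed (simp_all add: E_simps(1,6) compose_part E_diff_part)

theorem E_dg_algebra: "dg_algebra K EE"
proof (rule pre_dga.dg_algebraI[OF E_pre_dga])
  interpret E: pre_dga K EE by (rule E_pre_dga)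
  note dhom = mod_homI[OF module_axiom module_axiom diff_linear]
  have hm: "mod_hom K V V \<phi>" if "\<phi> \<in> carrier EE" for \<phi> by (intro mod_homI module_axiom E_hom that)
  show "diff EE (diff EE \<phi>) = \<zero>\<^bsub>EE\<^esub>" if "\<phi> \<in> carrier EE" for \<phi>
  proof (rule E.hom_eq_on_carrier[OF module_hom_comp[OF E_diff_hom E_diff_hom] _ _ that])
    show "(\<lambda>\<phi>. \<zero>\<^bsub>EE\<^esub>) \<in> module_hom K EE EE" by (rule module_homI) auto
    fix n \<phi> assume "\<phi> \<in> grade EE n"
    then have \<phi>: "\<phi> \<in> End_part K V n" by (simp add: E_simps)
    note \<phi>c = part_E[OF \<phi>] and d = E_diff_part[OF \<phi>]
    show "diff EE (diff EE \<phi>) = \<zero>\<^bsub>EE\<^esub>"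
    proof (rule E_eqI)
      fix v assume v: "v \<in> carrier V"
      have c: "diff V v \<in> carrier V" "\<phi> v \<in> carrier V" "diff V (\<phi> v) \<in> carrier V" "\<phi> (diff V v) \<in> carrier V"
        "diff V (\<phi> (diff V v)) \<in> carrier V"
        using v diff_V_closed E_app[OF \<phi>c] by auto
      have 0: "\<phi> \<zero> = \<zero>" by (rule mod_hom.f0_is_0[OF hm[OF \<phi>c]])
      have mz: "\<ominus> \<zero> = \<zero>" using ksgn_zero[of 1] by (simp add: ksgn_def)
      have e1: "diff V (diff EE \<phi> v) = \<ominus> ksgn V n (diff V (\<phi> (diff V v)))"
        using c v by (simp add: E_diff_homog[OF \<phi>] mod_hom.f_minus[OF dhom] mod_hom.f_ksgn[OF dhom] diff_diff)
          (simp add: a_minus_def)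
      have e2: "diff EE \<phi> (diff V v) = diff V (\<phi> (diff V v))"
        using c v by (simp add: E_diff_homog[OF \<phi>] diff_diff 0) (simp add: a_minus_def mz)
      have e3: "ksgn V (n + 1) (diff V (\<phi> (diff V v))) = \<ominus> ksgn V n (diff V (\<phi> (diff V v)))"
        by (rule ksgn_succ[OF c(5)]) auto
      show "diff EE (diff EE \<phi>) v = \<zero>\<^bsub>EE\<^esub> v"
        using c v M.minus_eq_zero_iff unfolding E_diff_homog[OF d v] e1 e2 e3 by (simp add: E_simps(3))
    qed (auto simp: E_simps(3,7))
  qed
  fix n \<phi> \<psi> assume "\<phi> \<in> grade EE n" and \<psi>: "\<psi> \<in> carrier EE"
  then have \<phi>: "\<phi> \<in> End_part K V n" by (simp add: E_simps)
  note \<phi>c = part_E[OF \<phi>]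
  show "diff EE (\<phi> \<otimes>\<^bsub>EE\<^esub> \<psi>) = diff EE \<phi> \<otimes>\<^bsub>EE\<^esub> \<psi> \<oplus>\<^bsub>EE\<^esub> ksgn EE n (\<phi> \<otimes>\<^bsub>EE\<^esub> diff EE \<psi>)"
  proof (rule E.hom_eq_on_carrier[OF _ _ _ \<psi>])
    show "(\<lambda>\<psi>. diff EE (\<phi> \<otimes>\<^bsub>EE\<^esub> \<psi>)) \<in> module_hom K EE EE"
      by (rule module_hom_comp[OF E.mult_left_hom[OF \<phi>c] E_diff_hom])
    show "(\<lambda>\<psi>. diff EE \<phi> \<otimes>\<^bsub>EE\<^esub> \<psi> \<oplus>\<^bsub>EE\<^esub> ksgn EE n (\<phi> \<otimes>\<^bsub>EE\<^esub> diff EE \<psi>)) \<in> module_hom K EE EE"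
      using \<phi>c by (intro module_hom_add2 module_hom_ksgn E_module E.mult_left_hom module_hom_comp[OF E_diff_hom E.mult_left_hom]) auto
    fix m \<psi> assume "\<psi> \<in> grade EE m"
    then have \<psi>: "\<psi> \<in> End_part K V m" by (simp add: E_simps)
    note \<psi>c = part_E[OF \<psi>]
    have ks: "ksgn EE k \<chi> v = ksgn V k (\<chi> v)" if "\<chi> \<in> carrier EE" "v \<in> carrier V" for k \<chi> v
    proof -
      have ev: "(\<lambda>\<phi>. \<phi> v) \<in> module_hom K EE V"
        using that(2) by (intro module_homI) (simp_all add: E_app E_simps)
      show ?thesis by (rule mod_hom.f_ksgn[OF mod_homI[OF E_module module_axiom ev] that(1)])
    qed
    show "diff EE (\<phi> \<otimes>\<^bsub>EE\<^esub> \<psi>) = diff EE \<phi> \<otimes>\<^bsub>EE\<^esub> \<psi> \<oplus>\<^bsub>EE\<^esub> ksgn EE n (\<phi> \<otimes>\<^bsub>EE\<^esub> diff EE \<psi>)"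
    proof (rule E_eqI)
      fix v assume v: "v \<in> carrier V"
      note dE = E.diff_closed[OF \<psi>c]
      have c: "\<psi> v \<in> carrier V" "diff V v \<in> carrier V" "diff V (\<psi> v) \<in> carrier V" "\<psi> (diff V v) \<in> carrier V"
        "\<phi> (\<psi> v) \<in> carrier V" "\<phi> (diff V (\<psi> v)) \<in> carrier V" "\<phi> (\<psi> (diff V v)) \<in> carrier V" "diff V (\<phi> (\<psi> v)) \<in> carrier V"
        "diff EE \<psi> v \<in> carrier V"
        using v diff_V_closed E_app[OF \<phi>c] E_app[OF \<psi>c] E_app[OF dE] by auto
      have l: "diff EE (\<phi> \<otimes>\<^bsub>EE\<^esub> \<psi>) v = diff V (\<phi> (\<psi> v)) \<ominus> ksgn V (n + m) (\<phi> (\<psi> (diff V v)))"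
        using v c E_diff_homog[OF compose_part[OF \<phi> \<psi>] v] by (simp add: E_simps(1) compose_def)
      have "(diff EE \<phi> \<otimes>\<^bsub>EE\<^esub> \<psi> \<oplus>\<^bsub>EE\<^esub> ksgn EE n (\<phi> \<otimes>\<^bsub>EE\<^esub> diff EE \<psi>)) v =
        diff EE \<phi> (\<psi> v) \<oplus> ksgn V n (\<phi> (diff EE \<psi> v))"
        using v ks[OF E.m_closed[OF \<phi>c dE] v] by (simp add: E_simps(1,4) compose_def)
      also have "\<dots> = (diff V (\<phi> (\<psi> v)) \<ominus> ksgn V n (\<phi> (diff V (\<psi> v)))) \<oplus>
        (ksgn V n (\<phi> (diff V (\<psi> v))) \<ominus> ksgn V (n + m) (\<phi> (\<psi> (diff V v))))"
        using c v by (simp add: E_diff_homog[OF \<phi>] E_diff_homog[OF \<psi>] mod_hom.f_minus[OF hm[OF \<phi>c]]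
            mod_hom.f_ksgn[OF hm[OF \<phi>c]]) (simp add: a_minus_def ksgn_add ksgn_uminus)
      also have "\<dots> = diff V (\<phi> (\<psi> v)) \<ominus> ksgn V (n + m) (\<phi> (\<psi> (diff V v)))"
        using c by (simp add: a_minus_def a_assoc) (simp add: a_assoc[symmetric] l_neg)
      finally show "diff EE (\<phi> \<otimes>\<^bsub>EE\<^esub> \<psi>) v = (diff EE \<phi> \<otimes>\<^bsub>EE\<^esub> \<psi> \<oplus>\<^bsub>EE\<^esub> ksgn EE n (\<phi> \<otimes>\<^bsub>EE\<^esub> diff EE \<psi>)) v"
        using l by simp
    qed (auto simp: E_simps(4,7))
  qed
qed

end

section \<open>Matrix units\<close>

text \<open>Homogeneous matrix units in \<open>E\<close>, where \<open>deg a\<close> is the degree of the basis vector \<open>a\<close>. The corner condition says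
  that \<open>e a a \<cdot> E \<cdot> e b b\<close> is one-dimensional. The functional \<open>\<epsilon>\<close> is needed to see that \<open>S \<rightarrow> S \<otimes> E\<close> is injective;
  it exists because the index set is nonempty.\<close>

locale matrix_units = E: dg_algebra K E
  for K :: "'k ring" and E :: "('k, 'e) dg" +
  fixes I :: "'x set" and deg :: "'x \<Rightarrow> int" and e :: "'x \<Rightarrow> 'x \<Rightarrow> 'e" and \<epsilon> :: "'e \<Rightarrow> 'k"
  assumes finite_I: "finite I" and I_nonempty: "I \<noteq> {}"
    and e_grade: "a \<in> I \<Longrightarrow> b \<in> I \<Longrightarrow> e a b \<in> grade E (deg a - deg b)"
    and e_mult: "a \<in> I \<Longrightarrow> b \<in> I \<Longrightarrow> c \<in> I \<Longrightarrow> d \<in> I \<Longrightarrow> e a b \<otimes>\<^bsub>E\<^esub> e c d = (if b = c then e a d else \<zero>\<^bsub>E\<^esub>)"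
    and e_one: "(\<Oplus>\<^bsub>E\<^esub>a\<in>I. e a a) = \<one>\<^bsub>E\<^esub>"
    and e_corner: "m \<in> carrier E \<Longrightarrow> a \<in> I \<Longrightarrow> b \<in> I \<Longrightarrow> \<exists>k\<in>carrier K. e a a \<otimes>\<^bsub>E\<^esub> m \<otimes>\<^bsub>E\<^esub> e b b = k \<odot>\<^bsub>E\<^esub> e a b"
    and functional: "m \<in> carrier E \<Longrightarrow> \<epsilon> m \<in> carrier K"
      "m \<in> carrier E \<Longrightarrow> m' \<in> carrier E \<Longrightarrow> \<epsilon> (m \<oplus>\<^bsub>E\<^esub> m') = \<epsilon> m \<oplus>\<^bsub>K\<^esub> \<epsilon> m'"
      "k \<in> carrier K \<Longrightarrow> m \<in> carrier E \<Longrightarrow> \<epsilon> (k \<odot>\<^bsub>E\<^esub> m) = k \<otimes>\<^bsub>K\<^esub> \<epsilon> m"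
      "\<epsilon> \<one>\<^bsub>E\<^esub> = \<one>\<^bsub>K\<^esub>"

text \<open>The coordinate functionals of a finite basis.\<close>

lemma (in vectorspace) finite_basis_coordinates:
  assumes "finite \<beta>" "basis \<beta>"
  shows "\<exists>c. (\<forall>b\<in>\<beta>. \<forall>v\<in>carrier V. c b v \<in> carrier K) \<and>
    (\<forall>b\<in>\<beta>. \<forall>v\<in>carrier V. \<forall>w\<in>carrier V. c b (v \<oplus>\<^bsub>V\<^esub> w) = c b v \<oplus>\<^bsub>K\<^esub> c b w) \<and>
    (\<forall>b\<in>\<beta>. \<forall>k\<in>carrier K. \<forall>v\<in>carrier V. c b (k \<odot>\<^bsub>V\<^esub> v) = k \<otimes>\<^bsub>K\<^esub> c b v) \<and>
    (\<forall>v\<in>carrier V. v = (\<Oplus>\<^bsub>V\<^esub>b\<in>\<beta>. c b v \<odot>\<^bsub>V\<^esub> b)) \<and>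
    (\<forall>b\<in>\<beta>. \<forall>b'\<in>\<beta>. c b b' = (if b = b' then \<one>\<^bsub>K\<^esub> else \<zero>\<^bsub>K\<^esub>))"
proof -
  have \<beta>V: "\<beta> \<subseteq> carrier V" using assms(2) by (simp add: basis_def)
  have uni: "\<exists>!a. a \<in> \<beta> \<rightarrow>\<^sub>E carrier K \<and> lincomb a \<beta> = v" if "v \<in> carrier V" for v
    using basis_criterion[OF assms(1) \<beta>V] assms(2) that by blast
  define co where "co v = (THE a. a \<in> \<beta> \<rightarrow>\<^sub>E carrier K \<and> lincomb a \<beta> = v)" for v
  have co: "co v \<in> \<beta> \<rightarrow>\<^sub>E carrier K" "lincomb (co v) \<beta> = v" if "v \<in> carrier V" for v
    using theI'[OF uni[OF that]] unfolding co_def by auto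
  have coI: "co v b = a b" if "v \<in> carrier V" "a \<in> \<beta> \<rightarrow> carrier K" "lincomb a \<beta> = v" "b \<in> \<beta>" for v a b
  proof -
    have "restrict a \<beta> \<in> \<beta> \<rightarrow>\<^sub>E carrier K" using that(2) by auto
    moreover have "lincomb (restrict a \<beta>) \<beta> = v"
      using that(2,3) \<beta>V by (subst lincomb_cong[of _ \<beta> _ a]) auto
    ultimately have "co v = restrict a \<beta>" using uni[OF that(1)] co[OF that(1)] by blast
    then show ?thesis using that(4) by simp
  qed
  have coP: "co v \<in> \<beta> \<rightarrow> carrier K" if "v \<in> carrier V" for v using co(1)[OF that] by auto
  have "co (v \<oplus>\<^bsub>V\<^esub> w) b = co v b \<oplus>\<^bsub>K\<^esub> co w b" if "v \<in> carrier V" "w \<in> carrier V" "b \<in> \<beta>" for v w b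
    using lincomb_sum[OF assms(1) \<beta>V coP[OF that(1)] coP[OF that(2)]] co(2)[OF that(1)] co(2)[OF that(2)]
      coP[OF that(1)] coP[OF that(2)] that
    by (intro coI) auto
  moreover have "co (k \<odot>\<^bsub>V\<^esub> v) b = k \<otimes>\<^bsub>K\<^esub> co v b" if "k \<in> carrier K" "v \<in> carrier V" "b \<in> \<beta>" for k v b
    using lincomb_smult[OF \<beta>V coP[OF that(2)] that(1)] co(2)[OF that(2)] coP[OF that(2)] that
    by (intro coI) auto
  moreover have "co b' b = (if b = b' then \<one>\<^bsub>K\<^esub> else \<zero>\<^bsub>K\<^esub>)" if "b \<in> \<beta>" "b' \<in> \<beta>" for b b'
  proof (rule coI[OF _ _ _ that(1)])
    have "lincomb (\<lambda>b. if b = b' then \<one>\<^bsub>K\<^esub> else \<zero>\<^bsub>K\<^esub>) \<beta> = (\<Oplus>\<^bsub>V\<^esub>b\<in>\<beta>. if b' = b then b else \<zero>\<^bsub>V\<^esub>)"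
      unfolding lincomb_def using \<beta>V by (intro M.finsum_cong') auto
    also have "\<dots> = b'" using assms(1) that(2) \<beta>V by (subst M.add.finprod_singleton) auto
    finally show "lincomb (\<lambda>b. if b = b' then \<one>\<^bsub>K\<^esub> else \<zero>\<^bsub>K\<^esub>) \<beta> = b'" .
  qed (use that \<beta>V in auto)
  moreover have "v = (\<Oplus>\<^bsub>V\<^esub>b\<in>\<beta>. co v b \<odot>\<^bsub>V\<^esub> b)" if "v \<in> carrier V" for v
    using co(2)[OF that] by (simp add: lincomb_def)
  ultimately show ?thesis
    using coP by (intro exI[of _ "\<lambda>b v. co v b"]) (simp add: Pi_iff)
qed

lemma (in graded_module) grade_finsum:
  assumes "\<And>b. b \<in> N \<Longrightarrow> f b \<in> grade V i"
  shows "(\<Oplus>\<^bsub>V\<lparr>carrier := grade V i\<rparr>\<^esub>b\<in>N. f b) = (\<Oplus>b\<in>N. f b)"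
proof -
  have "(\<lambda>v. v) \<in> module_hom K (V\<lparr>carrier := grade V i\<rparr>) V"
    using grade_carrier by (intro module_homI) auto
  then show ?thesis
    by (rule mod_hom.f_finsum[OF mod_homI[OF grade_module module_axiom]]) (use assms in auto)
qed

text \<open>The index set consists of the pairs of a degree and a basis vector of that degree.\<close>

theorem (in cochain_complex) End_matrix_units:
  assumes K: "field K" and fd: "total_fin_dim K V" and nz: "carrier V \<noteq> {\<zero>}"
  shows "\<exists>(I :: (int \<times> 'a) set) e \<epsilon>. matrix_units K (End_dg K V) I fst e \<epsilon>"
proof -
  let ?G = "\<lambda>i. V\<lparr>carrier := grade V i\<rparr>"
  have vs: "vectorspace K (?G i)" for i by (intro vectorspace.intro grade_module K)
  have "\<exists>\<beta>. finite \<beta> \<and> vectorspace.basis K (?G i) \<beta>" for i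
    using vectorspace.finite_basis_exists[OF vs] fd by (simp add: total_fin_dim_def)
  then obtain \<beta> where \<beta>: "\<And>i. finite (\<beta> i)" "\<And>i. vectorspace.basis K (?G i) (\<beta> i)" by metis
  note coords = vectorspace.finite_basis_coordinates[OF vs \<beta>]
  define C where "C i cc \<longleftrightarrow> (\<forall>b\<in>\<beta> i. \<forall>v\<in>carrier (?G i). cc b v \<in> carrier K) \<and>
    (\<forall>b\<in>\<beta> i. \<forall>v\<in>carrier (?G i). \<forall>w\<in>carrier (?G i). cc b (v \<oplus>\<^bsub>?G i\<^esub> w) = cc b v \<oplus>\<^bsub>K\<^esub> cc b w) \<and>
    (\<forall>b\<in>\<beta> i. \<forall>k\<in>carrier K. \<forall>v\<in>carrier (?G i). cc b (k \<odot>\<^bsub>?G i\<^esub> v) = k \<otimes>\<^bsub>K\<^esub> cc b v) \<and>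
    (\<forall>v\<in>carrier (?G i). v = (\<Oplus>\<^bsub>?G i\<^esub>b\<in>\<beta> i. cc b v \<odot>\<^bsub>?G i\<^esub> b)) \<and>
    (\<forall>b\<in>\<beta> i. \<forall>b'\<in>\<beta> i. cc b b' = (if b = b' then \<one>\<^bsub>K\<^esub> else \<zero>\<^bsub>K\<^esub>))" for i cc
  have "\<exists>cc. C i cc" for i unfolding C_def by (rule coords)
  then obtain c where "\<And>i. C i (c i)" by metis
  then have c: "\<And>i. (\<forall>b\<in>\<beta> i. \<forall>v\<in>carrier (?G i). c i b v \<in> carrier K) \<and>
    (\<forall>b\<in>\<beta> i. \<forall>v\<in>carrier (?G i). \<forall>w\<in>carrier (?G i). c i b (v \<oplus>\<^bsub>?G i\<^esub> w) = c i b v \<oplus>\<^bsub>K\<^esub> c i b w) \<and>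
    (\<forall>b\<in>\<beta> i. \<forall>k\<in>carrier K. \<forall>v\<in>carrier (?G i). c i b (k \<odot>\<^bsub>?G i\<^esub> v) = k \<otimes>\<^bsub>K\<^esub> c i b v) \<and>
    (\<forall>v\<in>carrier (?G i). v = (\<Oplus>\<^bsub>?G i\<^esub>b\<in>\<beta> i. c i b v \<odot>\<^bsub>?G i\<^esub> b)) \<and>
    (\<forall>b\<in>\<beta> i. \<forall>b'\<in>\<beta> i. c i b b' = (if b = b' then \<one>\<^bsub>K\<^esub> else \<zero>\<^bsub>K\<^esub>))"
    unfolding C_def .
  have \<beta>V: "b \<in> grade V i" if "b \<in> \<beta> i" for b i
    using \<beta>(2)[of i] that vectorspace.basis_def[OF vs, of i "\<beta> i"] by auto
  have \<beta>C: "b \<in> carrier V" if "b \<in> \<beta> i" for b i by (rule grade_carrier[OF \<beta>V[OF that]])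
  have c_in: "c i b v \<in> carrier K" if "b \<in> \<beta> i" "v \<in> grade V i" for i b v using c[of i] that by simp
  have c_add: "c i b (v \<oplus> w) = c i b v \<oplus>\<^bsub>K\<^esub> c i b w" if "b \<in> \<beta> i" "v \<in> grade V i" "w \<in> grade V i" for i b v w
    using c[of i] that by simp
  have c_smult: "c i b (k \<odot> v) = k \<otimes>\<^bsub>K\<^esub> c i b v" if "b \<in> \<beta> i" "k \<in> carrier K" "v \<in> grade V i" for i b k v
    using c[of i] that by simp
  have c_delta: "c i b b' = (if b = b' then \<one>\<^bsub>K\<^esub> else \<zero>\<^bsub>K\<^esub>)" if "b \<in> \<beta> i" "b' \<in> \<beta> i" for i b b'
    using c[of i] that by simp
  have c_sum: "(\<Oplus>b\<in>\<beta> i. c i b v \<odot> b) = v" if "v \<in> grade V i" for i v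
  proof -
    have "\<forall>v\<in>carrier (?G i). v = (\<Oplus>\<^bsub>?G i\<^esub>b\<in>\<beta> i. c i b v \<odot>\<^bsub>?G i\<^esub> b)" using c[of i] by blast
    from bspec[OF this, of v] that have "v = (\<Oplus>\<^bsub>?G i\<^esub>b\<in>\<beta> i. c i b v \<odot>\<^bsub>?G i\<^esub> b)" by simp
    also have "\<dots> = (\<Oplus>b\<in>\<beta> i. c i b v \<odot> b)"
      using grade_finsum[of "\<beta> i" "\<lambda>b. c i b v \<odot> b" i] \<beta>V c_in that smult_grade by simp
    finally show ?thesis by simp
  qed
  have c_zero: "c i b \<zero> = \<zero>\<^bsub>K\<^esub>" if "b \<in> \<beta> i" for i b
    using c_smult[OF that R.zero_closed zero_grade] c_in[OF that zero_grade] by simp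
  define S where "S = {i. grade V i \<noteq> {\<zero>}}"
  define I where "I = Sigma S \<beta>"
  \<comment> \<open>the coordinate functional of the basis vector \<open>snd x\<close>, extended by zero to the other degrees\<close>
  define \<gamma> where "\<gamma> x v = c (fst x) (snd x) (component V v (fst x))" for x :: "int \<times> 'a" and v
  have I: "x \<in> I \<Longrightarrow> snd x \<in> \<beta> (fst x)" "x \<in> I \<Longrightarrow> snd x \<in> grade V (fst x)" "x \<in> I \<Longrightarrow> snd x \<in> carrier V" for x
    using \<beta>V \<beta>C by (auto simp: I_def)
  have finI: "finite I" using fd \<beta>(1) by (auto simp: I_def S_def total_fin_dim_def)
  have \<gamma>_in: "\<gamma> x v \<in> carrier K" if "x \<in> I" "v \<in> carrier V" for x v
    unfolding \<gamma>_def by (rule c_in[OF I(1)[OF that(1)] component_grade[OF that(2)]])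
  have \<gamma>_add: "\<gamma> x (v \<oplus> w) = \<gamma> x v \<oplus>\<^bsub>K\<^esub> \<gamma> x w" if "x \<in> I" "v \<in> carrier V" "w \<in> carrier V" for x v w
    using c_add[OF I(1)[OF that(1)] component_grade[OF that(2)] component_grade[OF that(3)]] that
    by (simp add: \<gamma>_def component_add)
  have \<gamma>_smult: "\<gamma> x (k \<odot> v) = k \<otimes>\<^bsub>K\<^esub> \<gamma> x v" if "x \<in> I" "k \<in> carrier K" "v \<in> carrier V" for x k v
    using c_smult[OF I(1)[OF that(1)] that(2) component_grade[OF that(3)]] that by (simp add: \<gamma>_def component_smult)
  have \<gamma>_homog: "\<gamma> x v = (if j = fst x then c (fst x) (snd x) v else \<zero>\<^bsub>K\<^esub>)" if "x \<in> I" "v \<in> grade V j" for x v j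
    using component_homog[OF that(2)] c_zero[OF I(1)[OF that(1)]] by (simp add: \<gamma>_def)
  have \<gamma>_delta: "\<gamma> x (snd y) = (if x = y then \<one>\<^bsub>K\<^esub> else \<zero>\<^bsub>K\<^esub>)" if "x \<in> I" "y \<in> I" for x y
    using \<gamma>_homog[OF that(1) I(2)[OF that(2)]] c_delta[of "snd x" "fst x" "snd y"] I(1)[OF that(1)] I(1)[OF that(2)]
    by (auto simp: prod_eq_iff)
  have term_hom: "(\<lambda>v. \<gamma> x v \<odot> w) \<in> module_hom K V V" if "x \<in> I" "w \<in> carrier V" for x w
    using that \<gamma>_in[OF that(1)] by (intro module_homI) (simp_all add: \<gamma>_add \<gamma>_smult smult_l_distr smult_assoc1)
  have \<gamma>_sum: "(\<Oplus>x\<in>I. \<gamma> x v \<odot> snd x) = v" if v: "v \<in> carrier V" for v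
  proof (rule hom_eq_on_carrier[OF _ _ _ v])
    show H: "(\<lambda>v. \<Oplus>x\<in>I. \<gamma> x v \<odot> snd x) \<in> module_hom K V V"
      using I(3) by (intro module_hom_finsum module_axiom term_hom)
    show "(\<lambda>v. v) \<in> module_hom K V V" by (rule module_homI) auto
    fix j v assume v: "v \<in> grade V j"
    note vc = grade_carrier[OF v]
    show "(\<Oplus>x\<in>I. \<gamma> x v \<odot> snd x) = v"
    proof (cases "j \<in> S")
      case True
      have "(\<Oplus>x\<in>Pair j ` \<beta> j. \<gamma> x v \<odot> snd x) = (\<Oplus>x\<in>I. \<gamma> x v \<odot> snd x)"
      proof (rule add.finprod_mono_neutral_cong_left[OF finI])
        show "Pair j ` \<beta> j \<subseteq> I" using True by (auto simp: I_def)
        show "\<gamma> x v \<odot> snd x = \<zero>" if x: "x \<in> I - Pair j ` \<beta> j" for x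
        proof -
          have "fst x \<noteq> j" using x by (auto simp: I_def)
          then show ?thesis using x \<gamma>_homog[of x v j] v I(3) by auto
        qed
      qed (use \<gamma>_in vc I(3) in auto)
      moreover have "(\<Oplus>x\<in>Pair j ` \<beta> j. \<gamma> x v \<odot> snd x) = (\<Oplus>b\<in>\<beta> j. \<gamma> (j, b) v \<odot> snd (j, b))"
      proof (rule finsum_reindex)
        show "(\<lambda>x. \<gamma> x v \<odot> snd x) \<in> Pair j ` \<beta> j \<rightarrow> carrier V"
          using \<gamma>_in[OF _ vc] True \<beta>C by (auto simp: I_def)
      qed (auto simp: inj_on_def)
      moreover have "(\<Oplus>b\<in>\<beta> j. \<gamma> (j, b) v \<odot> snd (j, b)) = (\<Oplus>b\<in>\<beta> j. c j b v \<odot> b)"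
        using c_in[OF _ v] \<beta>C component_homog[OF v] by (intro finsum_cong') (auto simp: \<gamma>_def)
      ultimately show ?thesis using c_sum[OF v] by simp
    next
      case False
      then have "v = \<zero>" using v by (auto simp: S_def)
      then show ?thesis using mod_hom.f0_is_0[OF mod_homI[OF module_axiom module_axiom H]] by simp
    qed
  qed
  have neI: "I \<noteq> {}"
  proof
    assume "I = {}"
    then have "v = \<zero>" if "v \<in> carrier V" for v using \<gamma>_sum[OF that] by simp
    then show False using nz M.zero_closed by blast
  qed
  \<comment> \<open>maps \<open>snd y\<close> to \<open>snd x\<close> and all other basis vectors to zero\<close>
  define e where "e x y = (\<lambda>v\<in>carrier V. \<gamma> y v \<odot> snd x)" for x y :: "int \<times> 'a"
  have e_part: "e x y \<in> End_part K V (fst x - fst y)" if "x \<in> I" "y \<in> I" for x y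
    unfolding e_def
  proof (rule End_partI[OF term_hom[OF that(2) I(3)[OF that(1)]]])
    fix i v assume v: "v \<in> grade V i"
    show "\<gamma> y v \<odot> snd x \<in> grade V (i + (fst x - fst y))"
    proof (cases "i = fst y")
      case True
      then show ?thesis using smult_grade[OF \<gamma>_in[OF that(2) grade_carrier[OF v]] I(2)[OF that(1)]] by simp
    next
      case False
      then show ?thesis using \<gamma>_homog[OF that(2) v] I(3)[OF that(1)] by simp
    qed
  qed
  have e_E: "e x y \<in> carrier EE" if "x \<in> I" "y \<in> I" for x y by (rule part_E[OF e_part[OF that]])
  have e_app: "e x y v = \<gamma> y v \<odot> snd x" if "v \<in> carrier V" for x y v using that by (simp add: e_def)
  interpret E: dg_algebra K EE by (rule E_dg_algebra)
  obtain x0 where x0: "x0 \<in> I" using neI by blast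
  \<comment> \<open>a diagonal matrix coefficient; on the identity it is \<open>1\<close>\<close>
  define \<epsilon> where "\<epsilon> m = \<gamma> x0 (m (snd x0))" for m :: "'a \<Rightarrow> 'a"
  have "matrix_units K EE I fst e \<epsilon>"
  proof (intro matrix_units.intro matrix_units_axioms.intro E_dg_algebra finI neI)
    show "e a b \<in> grade EE (fst a - fst b)" if "a \<in> I" "b \<in> I" for a b
      using e_part[OF that] by (simp add: E_simps)
    show "e a b \<otimes>\<^bsub>EE\<^esub> e x y = (if b = x then e a y else \<zero>\<^bsub>EE\<^esub>)" if ab: "a \<in> I" "b \<in> I" "x \<in> I" "y \<in> I" for a b x y
    proof (rule E_eqI)
      fix v assume v: "v \<in> carrier V"
      have "\<gamma> b (\<gamma> y v \<odot> snd x) = \<gamma> y v \<otimes>\<^bsub>K\<^esub> (if b = x then \<one>\<^bsub>K\<^esub> else \<zero>\<^bsub>K\<^esub>)"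
        using \<gamma>_smult[OF ab(2) \<gamma>_in[OF ab(4) v] I(3)[OF ab(3)]] \<gamma>_delta[OF ab(2,3)] by simp
      then show "(e a b \<otimes>\<^bsub>EE\<^esub> e x y) v = (if b = x then e a y else \<zero>\<^bsub>EE\<^esub>) v"
        using v \<gamma>_in[OF ab(4) v] I(3) ab by (simp add: E_simps(1,3) compose_def e_app)
    next
      show "e a b \<otimes>\<^bsub>EE\<^esub> e x y \<in> extensional (carrier V)"
        by (rule E_ext[OF E.m_closed[OF e_E[OF ab(1,2)] e_E[OF ab(3,4)]]])
      show "(if b = x then e a y else \<zero>\<^bsub>EE\<^esub>) \<in> extensional (carrier V)"
        using E_ext[OF e_E[OF ab(1,4)]] E_ext[OF E.zero_closed] by simp
    qed
    have one_E: "(\<Oplus>\<^bsub>EE\<^esub>a\<in>I. e a a) \<in> carrier EE" using e_E by (intro E.finsum_closed) auto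
    show "(\<Oplus>\<^bsub>EE\<^esub>a\<in>I. e a a) = \<one>\<^bsub>EE\<^esub>"
    proof (rule E_eqI[OF E_ext[OF one_E]])
      fix v assume v: "v \<in> carrier V"
      have "(\<Oplus>\<^bsub>EE\<^esub>a\<in>I. e a a) v = (\<Oplus>a\<in>I. e a a v)"
        by (rule E_finsum[OF _ v]) (use e_E in auto)
      also have "\<dots> = v" using \<gamma>_sum[OF v] v by (simp add: e_app)
      finally show "(\<Oplus>\<^bsub>EE\<^esub>a\<in>I. e a a) v = \<one>\<^bsub>EE\<^esub> v" using v by (simp add: E_simps(2))
    qed (simp add: E_simps(2))
    show "\<exists>k\<in>carrier K. e a a \<otimes>\<^bsub>EE\<^esub> m \<otimes>\<^bsub>EE\<^esub> e b b = k \<odot>\<^bsub>EE\<^esub> e a b"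
      if m: "m \<in> carrier EE" and ab: "a \<in> I" "b \<in> I" for m a b
    proof (rule bexI)
      show k: "\<gamma> a (m (snd b)) \<in> carrier K" by (rule \<gamma>_in[OF ab(1) E_app[OF m I(3)[OF ab(2)]]])
      show "e a a \<otimes>\<^bsub>EE\<^esub> m \<otimes>\<^bsub>EE\<^esub> e b b = \<gamma> a (m (snd b)) \<odot>\<^bsub>EE\<^esub> e a b"
      proof (rule E_eqI)
        fix v assume v: "v \<in> carrier V"
        note g = \<gamma>_in[OF ab(2) v] and mb = E_app[OF m I(3)[OF ab(2)]]
        have "m (\<gamma> b v \<odot> snd b) = \<gamma> b v \<odot> m (snd b)"
          by (rule module_hom_smult[OF E_hom[OF m] g I(3)[OF ab(2)]])
        then have "(e a a \<otimes>\<^bsub>EE\<^esub> m \<otimes>\<^bsub>EE\<^esub> e b b) v = (\<gamma> b v \<otimes>\<^bsub>K\<^esub> \<gamma> a (m (snd b))) \<odot> snd a"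
          using v g mb I(3)[OF ab(2)] \<gamma>_smult[OF ab(1) g mb] by (simp add: E_simps(1) compose_def e_app)
        also have "\<dots> = \<gamma> a (m (snd b)) \<odot> (\<gamma> b v \<odot> snd a)"
          using g k I(3)[OF ab(1)] by (simp add: R.m_comm[OF g k] smult_assoc1)
        finally show "(e a a \<otimes>\<^bsub>EE\<^esub> m \<otimes>\<^bsub>EE\<^esub> e b b) v = (\<gamma> a (m (snd b)) \<odot>\<^bsub>EE\<^esub> e a b) v"
          using v by (simp add: E_simps(5) e_app)
      next
        show "e a a \<otimes>\<^bsub>EE\<^esub> m \<otimes>\<^bsub>EE\<^esub> e b b \<in> extensional (carrier V)"
          by (rule E_ext[OF E.m_closed[OF E.m_closed[OF e_E[OF ab(1,1)] m] e_E[OF ab(2,2)]]])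
        show "\<gamma> a (m (snd b)) \<odot>\<^bsub>EE\<^esub> e a b \<in> extensional (carrier V)"
          by (rule E_ext[OF E.smult_closed[OF k e_E[OF ab]]])
      qed
    qed
    note s0 = I(3)[OF x0]
    show "\<epsilon> m \<in> carrier K" if "m \<in> carrier EE" for m
      unfolding \<epsilon>_def by (rule \<gamma>_in[OF x0 E_app[OF that s0]])
    show "\<epsilon> (m \<oplus>\<^bsub>EE\<^esub> m') = \<epsilon> m \<oplus>\<^bsub>K\<^esub> \<epsilon> m'" if "m \<in> carrier EE" "m' \<in> carrier EE" for m m'
      using \<gamma>_add[OF x0 E_app[OF that(1) s0] E_app[OF that(2) s0]] s0 by (simp add: \<epsilon>_def E_simps(4))
    show "\<epsilon> (k \<odot>\<^bsub>EE\<^esub> m) = k \<otimes>\<^bsub>K\<^esub> \<epsilon> m" if "k \<in> carrier K" "m \<in> carrier EE" for k m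
      using \<gamma>_smult[OF x0 that(1) E_app[OF that(2) s0]] s0 by (simp add: \<epsilon>_def E_simps(5))
    show "\<epsilon> \<one>\<^bsub>EE\<^esub> = \<one>\<^bsub>K\<^esub>" using \<gamma>_delta[OF x0 x0] s0 by (simp add: \<epsilon>_def E_simps(2))
  qed
  then show ?thesis by (intro exI)
qed

section \<open>Algebras over a matrix algebra\<close>

lemma (in ring) finsum_single:
  assumes "finite I" "i \<in> I" "f i \<in> carrier R" "\<And>j. j \<in> I \<Longrightarrow> j \<noteq> i \<Longrightarrow> f j = \<zero>"
  shows "(\<Oplus>j\<in>I. f j) = f i"
proof -
  have "(\<Oplus>j\<in>I. f j) = (\<Oplus>j\<in>I. if i = j then f i else \<zero>)"
    using assms by (intro finsum_cong') auto
  then show ?thesis using add.finprod_singleton[OF assms(2,1), of "\<lambda>_. f i"] assms(3) by simp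
qed

context matrix_units
begin

lemma e_closed: "a \<in> I \<Longrightarrow> b \<in> I \<Longrightarrow> e a b \<in> carrier E"
  by (rule E.grade_carrier[OF e_grade])

text \<open>Multiply \<open>m\<close> by \<open>1 = \<Sum> e x x\<close> on both sides and use the corner condition.\<close>

lemma unit_expansion:
  assumes m: "m \<in> carrier E"
  shows "\<exists>k. (\<forall>x\<in>I. \<forall>y\<in>I. k x y \<in> carrier K) \<and> m = (\<Oplus>\<^bsub>E\<^esub>x\<in>I. \<Oplus>\<^bsub>E\<^esub>y\<in>I. k x y \<odot>\<^bsub>E\<^esub> e x y)"
proof -
  obtain k where k: "\<And>x y. x \<in> I \<Longrightarrow> y \<in> I \<Longrightarrow> k x y \<in> carrier K"
      "\<And>x y. x \<in> I \<Longrightarrow> y \<in> I \<Longrightarrow> e x x \<otimes>\<^bsub>E\<^esub> m \<otimes>\<^bsub>E\<^esub> e y y = k x y \<odot>\<^bsub>E\<^esub> e x y"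
    using e_corner[OF m] by metis
  have c: "e x x \<in> carrier E" if "x \<in> I" for x by (rule e_closed[OF that that])
  have "m = (\<Oplus>\<^bsub>E\<^esub>x\<in>I. e x x) \<otimes>\<^bsub>E\<^esub> m" using m e_one by simp
  also have "\<dots> = (\<Oplus>\<^bsub>E\<^esub>x\<in>I. e x x \<otimes>\<^bsub>E\<^esub> m)" using c by (intro E.finsum_ldistr finite_I m) auto
  also have "\<dots> = (\<Oplus>\<^bsub>E\<^esub>x\<in>I. \<Oplus>\<^bsub>E\<^esub>y\<in>I. k x y \<odot>\<^bsub>E\<^esub> e x y)"
  proof (rule E.finsum_cong')
    fix x assume x: "x \<in> I"
    have xm: "e x x \<otimes>\<^bsub>E\<^esub> m \<in> carrier E" using c[OF x] m by simp
    have "e x x \<otimes>\<^bsub>E\<^esub> m = e x x \<otimes>\<^bsub>E\<^esub> m \<otimes>\<^bsub>E\<^esub> (\<Oplus>\<^bsub>E\<^esub>y\<in>I. e y y)" using xm e_one by simp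
    also have "\<dots> = (\<Oplus>\<^bsub>E\<^esub>y\<in>I. e x x \<otimes>\<^bsub>E\<^esub> m \<otimes>\<^bsub>E\<^esub> e y y)" using c by (intro E.finsum_rdistr finite_I xm) auto
    also have "\<dots> = (\<Oplus>\<^bsub>E\<^esub>y\<in>I. k x y \<odot>\<^bsub>E\<^esub> e x y)"
      using k x e_closed by (intro E.finsum_cong') (simp_all add: Pi_def)
    finally show "e x x \<otimes>\<^bsub>E\<^esub> m = (\<Oplus>\<^bsub>E\<^esub>y\<in>I. k x y \<odot>\<^bsub>E\<^esub> e x y)" .
  next
    show "(\<lambda>x. \<Oplus>\<^bsub>E\<^esub>y\<in>I. k x y \<odot>\<^bsub>E\<^esub> e x y) \<in> I \<rightarrow> carrier E"
      using k(1) e_closed by (intro Pi_I E.finsum_closed) simp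
  qed simp
  finally show ?thesis using k(1) by blast
qed

lemma hom_into_units:
  assumes M: "module K M" and h: "h \<in> module_hom K E M" and N: "LinearCombinations.submodule K N M"
    and b: "\<And>x y. x \<in> I \<Longrightarrow> y \<in> I \<Longrightarrow> h (e x y) \<in> N" and m: "m \<in> carrier E"
  shows "h m \<in> N"
proof -
  interpret M: module K M by fact
  interpret N: LinearCombinations.submodule K N M by fact
  interpret H: mod_hom K E M h by (rule mod_homI[OF E.module_axiom M h])
  obtain k where k: "\<And>x y. x \<in> I \<Longrightarrow> y \<in> I \<Longrightarrow> k x y \<in> carrier K"
    and me: "m = (\<Oplus>\<^bsub>E\<^esub>x\<in>I. \<Oplus>\<^bsub>E\<^esub>y\<in>I. k x y \<odot>\<^bsub>E\<^esub> e x y)" using unit_expansion[OF m] by blast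
  have sum: "(\<Oplus>\<^bsub>M\<^esub>x\<in>J. f x) \<in> N" if "\<And>x. x \<in> J \<Longrightarrow> f x \<in> N" for J and f :: "'x \<Rightarrow> _"
    using that
  proof (induction J rule: infinite_finite_induct)
    case (insert x F)
    have "f i \<in> N" if "i \<in> insert x F" for i using insert that by blast
    then have "f x \<in> carrier M" "f \<in> F \<rightarrow> carrier M" "f x \<in> N" "(\<Oplus>\<^bsub>M\<^esub>x\<in>F. f x) \<in> N"
      using insert(3) N.subset by auto
    then show ?case using insert(1,2) by (simp add: N.m_closed)
  qed (auto simp: M.finsum_infinite)
  have c: "k x y \<odot>\<^bsub>E\<^esub> e x y \<in> carrier E" if "x \<in> I" "y \<in> I" for x y using k e_closed that by simp
  have "h m = (\<Oplus>\<^bsub>M\<^esub>x\<in>I. h (\<Oplus>\<^bsub>E\<^esub>y\<in>I. k x y \<odot>\<^bsub>E\<^esub> e x y))"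
    unfolding me using c by (intro H.f_finsum Pi_I E.finsum_closed) auto
  also have "\<dots> \<in> N"
  proof (rule sum)
    fix x assume x: "x \<in> I"
    have "h (\<Oplus>\<^bsub>E\<^esub>y\<in>I. k x y \<odot>\<^bsub>E\<^esub> e x y) = (\<Oplus>\<^bsub>M\<^esub>y\<in>I. h (k x y \<odot>\<^bsub>E\<^esub> e x y))"
      using c x by (intro H.f_finsum Pi_I) auto
    also have "\<dots> \<in> N"
      using k b e_closed x by (intro sum) (simp add: module_hom_smult[OF h] N.smult_closed)
    finally show "h (\<Oplus>\<^bsub>E\<^esub>y\<in>I. k x y \<odot>\<^bsub>E\<^esub> e x y) \<in> N" .
  qed
  finally show ?thesis .
qed

lemma hom_eq_units:
  assumes M: "module K M" and h: "h \<in> module_hom K E M" "h' \<in> module_hom K E M"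
    and eq: "\<And>x y. x \<in> I \<Longrightarrow> y \<in> I \<Longrightarrow> h (e x y) = h' (e x y)" and m: "m \<in> carrier E"
  shows "h m = h' m"
proof -
  interpret M: module K M by fact
  note z = zero_submodule[OF M]
  have "h m \<ominus>\<^bsub>M\<^esub> h' m \<in> {\<zero>\<^bsub>M\<^esub>}"
    using module_hom_in[OF h(1) e_closed] module_hom_in[OF h(2) e_closed] eq
    by (intro hom_into_units[OF M module_hom_minus2[OF M h] z _ m]) (simp add: M.minus_eq_zero_iff)
  then show ?thesis using module_hom_in[OF h(1) m] module_hom_in[OF h(2) m] by (simp add: M.minus_eq_zero_iff)
qed

end

text \<open>\<open>E\<close> has matrix units and maps to \<open>P\<close>. The purpose of what follows is to show that \<open>P\<close> is the tensor product of the
  centralizer with \<open>E\<close>.\<close>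

locale matrix_units_over = dga_over K P E \<eta> + U: matrix_units K E I deg e \<epsilon>
  for K :: "'k ring" and P :: "('k, 'a) dg" and E :: "('k, 'e) dg" and \<eta> :: "'e \<Rightarrow> 'a"
    and I :: "'x set" and deg :: "'x \<Rightarrow> int" and e :: "'x \<Rightarrow> 'x \<Rightarrow> 'e" and \<epsilon> :: "'e \<Rightarrow> 'k"
begin

definition "u a b = \<eta> (e a b)"

lemma u_grade: "a \<in> I \<Longrightarrow> b \<in> I \<Longrightarrow> u a b \<in> grade P (deg a - deg b)"
  unfolding u_def by (rule eta_grade[OF U.e_grade])

lemma u_closed [simp]: "a \<in> I \<Longrightarrow> b \<in> I \<Longrightarrow> u a b \<in> carrier P"
  by (rule P.grade_carrier[OF u_grade])

lemma eta_zero: "\<eta> \<zero>\<^bsub>E\<^esub> = \<zero>\<^bsub>P\<^esub>"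
  by (rule mod_hom.f0_is_0[OF mod_homI[OF E.module_axiom P.module_axiom dga_map_hom[OF \<eta>]]])

lemma u_mult: "a \<in> I \<Longrightarrow> b \<in> I \<Longrightarrow> c \<in> I \<Longrightarrow> d \<in> I \<Longrightarrow> u a b \<otimes>\<^bsub>P\<^esub> u c d = (if b = c then u a d else \<zero>\<^bsub>P\<^esub>)"
  unfolding u_def by (simp add: dga_map_mult[OF \<eta>, symmetric] U.e_closed U.e_mult eta_zero)

lemma u_one: "(\<Oplus>\<^bsub>P\<^esub>a\<in>I. u a a) = \<one>\<^bsub>P\<^esub>"
  using mod_hom.f_finsum[OF mod_homI[OF E.module_axiom P.module_axiom dga_map_hom[OF \<eta>]], of "\<lambda>a. e a a" I]
    U.e_closed U.e_one dga_map_one[OF \<eta>] by (simp add: u_def Pi_def)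

text \<open>The coordinate of \<open>w\<close> (of degree \<open>n\<close>) at the matrix unit \<open>e a b\<close>. Without signs the sum of the \<open>e c a \<cdot> w \<cdot> e b c\<close>
  commutes with all matrix units. The summand for \<open>c\<close> is reached from the one for \<open>a\<close> by moving \<open>e c a\<close>, of
  degree \<open>deg c - deg a\<close>, past an element of degree \<open>n + deg b - deg a\<close>; this is the sign that makes the sum
  commute in the graded sense. The summand \<open>c = a\<close> carries no sign.\<close>

definition "psi n a b w = (\<Oplus>\<^bsub>P\<^esub>c\<in>I. ksgn P ((n + deg a + deg b) * (deg c + deg a)) (u c a \<otimes>\<^bsub>P\<^esub> w \<otimes>\<^bsub>P\<^esub> u b c))"

lemma psi_term_hom: "x \<in> carrier P \<Longrightarrow> y \<in> carrier P \<Longrightarrow> (\<lambda>w. ksgn P n (x \<otimes>\<^bsub>P\<^esub> w \<otimes>\<^bsub>P\<^esub> y)) \<in> module_hom K P P"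
  by (intro module_hom_ksgn P.module_axiom module_hom_comp[OF P.mult_left_hom P.mult_right_hom])

lemma psi_hom: "a \<in> I \<Longrightarrow> b \<in> I \<Longrightarrow> psi n a b \<in> module_hom K P P"
  unfolding psi_def[abs_def] by (intro module_hom_finsum P.module_axiom psi_term_hom u_closed)

lemma psi_grade:
  assumes "a \<in> I" "b \<in> I" "w \<in> grade P n"
  shows "psi n a b w \<in> grade P (n + deg b - deg a)"
  unfolding psi_def
proof (intro P.finsum_grade P.ksgn_grade)
  fix c assume c: "c \<in> I"
  have "deg c - deg a + n + (deg b - deg c) = n + deg b - deg a" by simp
  then show "u c a \<otimes>\<^bsub>P\<^esub> w \<otimes>\<^bsub>P\<^esub> u b c \<in> grade P (n + deg b - deg a)"
    using P.mult_grade[OF P.mult_grade[OF u_grade[OF c assms(1)] assms(3)] u_grade[OF assms(2) c]] by simp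
qed

text \<open>Multiplying by a matrix unit on either side leaves a single summand, \<open>c = x\<close> here and \<open>c = y\<close> in the next
  lemma. The two results differ only by their signs.\<close>

lemma psi_mult_u:
  assumes I: "a \<in> I" "b \<in> I" "x \<in> I" "y \<in> I" and w: "w \<in> carrier P"
  shows "psi n a b w \<otimes>\<^bsub>P\<^esub> u x y = ksgn P ((n + deg a + deg b) * (deg x + deg a)) (u x a \<otimes>\<^bsub>P\<^esub> w \<otimes>\<^bsub>P\<^esub> u b y)"
proof -
  let ?t = "\<lambda>c. ksgn P ((n + deg a + deg b) * (deg c + deg a)) (u c a \<otimes>\<^bsub>P\<^esub> w \<otimes>\<^bsub>P\<^esub> u b c)"
  have tc: "?t c \<in> carrier P" if "c \<in> I" for c using that I w by simp
  have "psi n a b w \<otimes>\<^bsub>P\<^esub> u x y = (\<Oplus>\<^bsub>P\<^esub>c\<in>I. ?t c \<otimes>\<^bsub>P\<^esub> u x y)"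
    unfolding psi_def using tc I by (intro P.finsum_ldistr U.finite_I u_closed) auto
  also have "\<dots> = ?t x \<otimes>\<^bsub>P\<^esub> u x y"
    using I w by (intro P.finsum_single[OF U.finite_I I(3)]) (simp_all add: P.m_assoc u_mult)
  also have "\<dots> = ksgn P ((n + deg a + deg b) * (deg x + deg a)) (u x a \<otimes>\<^bsub>P\<^esub> w \<otimes>\<^bsub>P\<^esub> u b y)"
    using I w by (simp add: P.m_assoc u_mult)
  finally show ?thesis .
qed

lemma u_mult_psi:
  assumes I: "a \<in> I" "b \<in> I" "x \<in> I" "y \<in> I" and w: "w \<in> carrier P"
  shows "u x y \<otimes>\<^bsub>P\<^esub> psi n a b w = ksgn P ((n + deg a + deg b) * (deg y + deg a)) (u x a \<otimes>\<^bsub>P\<^esub> w \<otimes>\<^bsub>P\<^esub> u b y)"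
proof -
  let ?t = "\<lambda>c. ksgn P ((n + deg a + deg b) * (deg c + deg a)) (u c a \<otimes>\<^bsub>P\<^esub> w \<otimes>\<^bsub>P\<^esub> u b c)"
  have tc: "?t c \<in> carrier P" if "c \<in> I" for c using that I w by simp
  have ut: "u x y \<otimes>\<^bsub>P\<^esub> ?t c = (if y = c then ksgn P ((n + deg a + deg b) * (deg c + deg a)) (u x a \<otimes>\<^bsub>P\<^esub> w \<otimes>\<^bsub>P\<^esub> u b c) else \<zero>\<^bsub>P\<^esub>)"
    if c: "c \<in> I" for c
  proof -
    have "u x y \<otimes>\<^bsub>P\<^esub> ?t c = ksgn P ((n + deg a + deg b) * (deg c + deg a)) ((u x y \<otimes>\<^bsub>P\<^esub> u c a) \<otimes>\<^bsub>P\<^esub> w \<otimes>\<^bsub>P\<^esub> u b c)"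
      using c I w by (simp add: P.m_assoc)
    then show ?thesis using u_mult[OF I(3,4) c I(1)] c I w by simp
  qed
  have "u x y \<otimes>\<^bsub>P\<^esub> psi n a b w = (\<Oplus>\<^bsub>P\<^esub>c\<in>I. u x y \<otimes>\<^bsub>P\<^esub> ?t c)"
    unfolding psi_def using tc I by (intro P.finsum_rdistr U.finite_I u_closed) auto
  also have "\<dots> = u x y \<otimes>\<^bsub>P\<^esub> ?t y"
    using I w tc ut by (intro P.finsum_single[OF U.finite_I I(4)]) auto
  also have "\<dots> = ksgn P ((n + deg a + deg b) * (deg y + deg a)) (u x a \<otimes>\<^bsub>P\<^esub> w \<otimes>\<^bsub>P\<^esub> u b y)"
    using ut[OF I(4)] by simp
  finally show ?thesis .
qed

lemma psi_cent:
  assumes I: "a \<in> I" "b \<in> I" and w: "w \<in> grade P n"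
  shows "psi n a b w \<in> cent"
proof -
  note wc = P.grade_carrier[OF w] and g = psi_grade[OF I w]
  note gc = P.grade_carrier[OF g]
  have "gcommutator P (psi n a b w) (\<eta> m) = \<zero>\<^bsub>P\<^esub>" if m: "m \<in> carrier E" for m
  proof (rule U.hom_eq_units[OF P.module_axiom _ _ _ m])
    show "(\<lambda>m. gcommutator P (psi n a b w) (\<eta> m)) \<in> module_hom K E P"
      by (rule module_hom_comp[OF dga_map_hom[OF \<eta>] P.gcommutator_right_hom[OF gc]])
    show "(\<lambda>m. \<zero>\<^bsub>P\<^esub>) \<in> module_hom K E P" by (rule module_homI) auto
    fix x y assume xy: "x \<in> I" "y \<in> I"
    have "ksgn P ((n + deg a + deg b) * (deg x + deg a)) (u x a \<otimes>\<^bsub>P\<^esub> w \<otimes>\<^bsub>P\<^esub> u b y) =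
      ksgn P ((n + deg b - deg a) * (deg x - deg y) + (n + deg a + deg b) * (deg y + deg a)) (u x a \<otimes>\<^bsub>P\<^esub> w \<otimes>\<^bsub>P\<^esub> u b y)"
      by (rule ksgn_cong) auto
    then have "psi n a b w \<otimes>\<^bsub>P\<^esub> u x y = ksgn P ((n + deg b - deg a) * (deg x - deg y)) (u x y \<otimes>\<^bsub>P\<^esub> psi n a b w)"
      using psi_mult_u[OF I xy wc, of n] u_mult_psi[OF I xy wc, of n] I xy wc by simp
    then show "gcommutator P (psi n a b w) (\<eta> (e x y)) = \<zero>\<^bsub>P\<^esub>"
      using P.gcommutator_homog_zero_iff[OF g u_grade[OF xy]] by (simp add: u_def)
  qed
  then show ?thesis using gc by (simp add: cent_def)
qed

text \<open>Only the summand \<open>c = a\<close> of the coordinate survives multiplication by \<open>e a b\<close>, and it gives \<open>e a a \<cdot> w \<cdot> e b b\<close>.\<close>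

lemma psi_reconstruct:
  assumes w: "w \<in> carrier P"
  shows "(\<Oplus>\<^bsub>P\<^esub>a\<in>I. \<Oplus>\<^bsub>P\<^esub>b\<in>I. psi n a b w \<otimes>\<^bsub>P\<^esub> u a b) = w"
proof -
  have ab: "psi n a b w \<otimes>\<^bsub>P\<^esub> u a b = u a a \<otimes>\<^bsub>P\<^esub> w \<otimes>\<^bsub>P\<^esub> u b b" if "a \<in> I" "b \<in> I" for a b
    by (simp add: psi_mult_u[OF that that w])
  have "(\<Oplus>\<^bsub>P\<^esub>a\<in>I. \<Oplus>\<^bsub>P\<^esub>b\<in>I. psi n a b w \<otimes>\<^bsub>P\<^esub> u a b) = (\<Oplus>\<^bsub>P\<^esub>a\<in>I. u a a \<otimes>\<^bsub>P\<^esub> w)"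
  proof (rule P.finsum_cong')
    fix a assume a: "a \<in> I"
    have "(\<Oplus>\<^bsub>P\<^esub>b\<in>I. psi n a b w \<otimes>\<^bsub>P\<^esub> u a b) = (\<Oplus>\<^bsub>P\<^esub>b\<in>I. u a a \<otimes>\<^bsub>P\<^esub> w \<otimes>\<^bsub>P\<^esub> u b b)"
      using a w ab by (intro P.finsum_cong') simp_all
    also have "\<dots> = u a a \<otimes>\<^bsub>P\<^esub> w \<otimes>\<^bsub>P\<^esub> (\<Oplus>\<^bsub>P\<^esub>b\<in>I. u b b)"
      using a w by (intro P.finsum_rdistr[symmetric] U.finite_I) auto
    also have "\<dots> = u a a \<otimes>\<^bsub>P\<^esub> w" using a w by (simp add: u_one)
    finally show "(\<Oplus>\<^bsub>P\<^esub>b\<in>I. psi n a b w \<otimes>\<^bsub>P\<^esub> u a b) = u a a \<otimes>\<^bsub>P\<^esub> w" .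
  qed (use w in auto)
  also have "\<dots> = (\<Oplus>\<^bsub>P\<^esub>a\<in>I. u a a) \<otimes>\<^bsub>P\<^esub> w" using w by (intro P.finsum_ldistr[symmetric] U.finite_I) auto
  finally show ?thesis using w by (simp add: u_one)
qed

text \<open>The coordinates of \<open>w \<cdot> e x y\<close> for \<open>w\<close> in the centralizer: moving \<open>w\<close> to the left produces a sign that
  cancels the one in the definition of the coordinate, and the matrix units multiply to zero or, for \<open>a = x\<close> and \<open>b = y\<close>, to
  \<open>e c c\<close>, whose sum over \<open>c\<close> is \<open>1\<close>.\<close>

lemma psi_coefficient:
  assumes I: "a \<in> I" "b \<in> I" "x \<in> I" "y \<in> I" and w: "w \<in> cent" "w \<in> grade P q"
  shows "psi (q + (deg x - deg y)) a b (w \<otimes>\<^bsub>P\<^esub> u x y) = (if a = x \<and> b = y then w else \<zero>\<^bsub>P\<^esub>)"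
proof -
  note wc = P.grade_carrier[OF w(2)]
  let ?N = "q + (deg x - deg y) + deg a + deg b"
  have t: "u c a \<otimes>\<^bsub>P\<^esub> (w \<otimes>\<^bsub>P\<^esub> u x y) \<otimes>\<^bsub>P\<^esub> u b c = (if a = x \<and> b = y then ksgn P (q * (deg c - deg a)) (w \<otimes>\<^bsub>P\<^esub> u c c) else \<zero>\<^bsub>P\<^esub>)"
    if c: "c \<in> I" for c
  proof -
    have "w \<otimes>\<^bsub>P\<^esub> u c a = ksgn P (q * (deg c - deg a)) (u c a \<otimes>\<^bsub>P\<^esub> w)"
      using cent_commute[OF w U.e_grade[OF c I(1)]] by (simp add: u_def)
    then have uw: "u c a \<otimes>\<^bsub>P\<^esub> w = ksgn P (q * (deg c - deg a)) (w \<otimes>\<^bsub>P\<^esub> u c a)"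
      using c I wc by simp
    have "u c a \<otimes>\<^bsub>P\<^esub> (w \<otimes>\<^bsub>P\<^esub> u x y) \<otimes>\<^bsub>P\<^esub> u b c = (u c a \<otimes>\<^bsub>P\<^esub> w) \<otimes>\<^bsub>P\<^esub> (u x y \<otimes>\<^bsub>P\<^esub> u b c)"
      using c I wc by (simp add: P.m_assoc)
    also have "\<dots> = ksgn P (q * (deg c - deg a)) (w \<otimes>\<^bsub>P\<^esub> (u c a \<otimes>\<^bsub>P\<^esub> (u x y \<otimes>\<^bsub>P\<^esub> u b c)))"
      unfolding uw using c I wc by (simp add: P.m_assoc)
    also have "u c a \<otimes>\<^bsub>P\<^esub> (u x y \<otimes>\<^bsub>P\<^esub> u b c) = (if a = x \<and> b = y then u c c else \<zero>\<^bsub>P\<^esub>)"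
      using c I by (simp add: u_mult)
    finally show ?thesis using wc by simp
  qed
  show ?thesis
  proof (cases "a = x \<and> b = y")
    case True
    have "psi (q + (deg x - deg y)) a b (w \<otimes>\<^bsub>P\<^esub> u x y) = (\<Oplus>\<^bsub>P\<^esub>c\<in>I. w \<otimes>\<^bsub>P\<^esub> u c c)"
      unfolding psi_def
    proof (rule P.finsum_cong')
      fix c assume c: "c \<in> I"
      have "ksgn P (?N * (deg c + deg a) + q * (deg c - deg a)) (w \<otimes>\<^bsub>P\<^esub> u c c) = ksgn P 0 (w \<otimes>\<^bsub>P\<^esub> u c c)"
        using True by (intro ksgn_cong) auto
      then show "ksgn P (?N * (deg c + deg a)) (u c a \<otimes>\<^bsub>P\<^esub> (w \<otimes>\<^bsub>P\<^esub> u x y) \<otimes>\<^bsub>P\<^esub> u b c) = w \<otimes>\<^bsub>P\<^esub> u c c"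
        unfolding t[OF c] using True c wc by simp
    qed (use wc in auto)
    also have "\<dots> = w \<otimes>\<^bsub>P\<^esub> (\<Oplus>\<^bsub>P\<^esub>c\<in>I. u c c)" using wc by (intro P.finsum_rdistr[symmetric] U.finite_I) auto
    finally show ?thesis using True wc by (simp add: u_one)
  next
    case False
    have "psi (q + (deg x - deg y)) a b (w \<otimes>\<^bsub>P\<^esub> u x y) = (\<Oplus>\<^bsub>P\<^esub>c\<in>I. \<zero>\<^bsub>P\<^esub>)"
      unfolding psi_def
    proof (rule P.finsum_cong')
      fix c assume c: "c \<in> I"
      show "ksgn P (?N * (deg c + deg a)) (u c a \<otimes>\<^bsub>P\<^esub> (w \<otimes>\<^bsub>P\<^esub> u x y) \<otimes>\<^bsub>P\<^esub> u b c) = \<zero>\<^bsub>P\<^esub>"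
        unfolding t[OF c] using False by auto
    qed auto
    then show ?thesis using False by auto
  qed
qed

lemma psi_fixes_cent:
  assumes a: "a \<in> I" and w: "w \<in> cent" "w \<in> grade P n"
  shows "psi n a a w = w"
proof -
  note wc = P.grade_carrier[OF w(2)]
  have co: "psi n a a (w \<otimes>\<^bsub>P\<^esub> u x x) = (if a = x then w else \<zero>\<^bsub>P\<^esub>)" if "x \<in> I" for x
    using psi_coefficient[OF a a that that w] by simp
  have "w = (\<Oplus>\<^bsub>P\<^esub>x\<in>I. w \<otimes>\<^bsub>P\<^esub> u x x)"
    using wc P.finsum_rdistr[OF U.finite_I wc, of "\<lambda>x. u x x"] u_one by simp
  then have "psi n a a w = psi n a a (\<Oplus>\<^bsub>P\<^esub>x\<in>I. w \<otimes>\<^bsub>P\<^esub> u x x)" by simp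
  also have "\<dots> = (\<Oplus>\<^bsub>P\<^esub>x\<in>I. psi n a a (w \<otimes>\<^bsub>P\<^esub> u x x))"
    using wc by (intro mod_hom.f_finsum[OF mod_homI[OF P.module_axiom P.module_axiom psi_hom[OF a a]]]) auto
  also have "\<dots> = psi n a a (w \<otimes>\<^bsub>P\<^esub> u a a)"
    using co a wc by (intro P.finsum_single U.finite_I) simp_all
  also have "\<dots> = w" using co[OF a] by simp
  finally show ?thesis .
qed

sublocale T: dg_pair K C.sub E
  by (intro dg_pair.intro C.sub_dg_algebra E.dg_algebra_axioms)

abbreviation "TC \<equiv> tensor K C.sub E"

text \<open>The inverse sends \<open>w\<close> to the sum of \<open>psi a b w \<otimes> e a b\<close>. That it is a one-sided inverse on each side is
  \<open>psi_reconstruct\<close> and \<open>psi_coefficient\<close>; being the inverse of a morphism, it is a morphism.\<close>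

theorem tensor_cent_iso:
  "\<exists>\<kappa> \<rho>. dga_map K TC P \<kappa> \<and> dga_map K P TC \<rho> \<and>
    (\<forall>c\<in>cent. \<forall>m\<in>carrier E. \<kappa> (pure_tensor K C.sub E c m) = c \<otimes>\<^bsub>P\<^esub> \<eta> m) \<and>
    (\<forall>z\<in>carrier TC. \<rho> (\<kappa> z) = z) \<and> (\<forall>w\<in>carrier P. \<kappa> (\<rho> w) = w)"
proof -
  have "\<eta> t \<otimes>\<^bsub>P\<^esub> s = ksgn P (j * i) (s \<otimes>\<^bsub>P\<^esub> \<eta> t)" if "s \<in> grade C.sub i" "t \<in> grade E j" for s t i j
  proof -
    have s: "s \<in> cent" "s \<in> grade P i" using that(1) by auto
    note c = P.grade_carrier[OF s(2)] P.grade_carrier[OF eta_grade[OF that(2)]]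
    have "ksgn P (j * i + i * j) (\<eta> t \<otimes>\<^bsub>P\<^esub> s) = ksgn P 0 (\<eta> t \<otimes>\<^bsub>P\<^esub> s)" by (rule ksgn_cong) simp
    then show ?thesis using cent_commute[OF s that(2)] c by simp
  qed
  from T.tensor_lift[OF P.dg_algebra_axioms C.incl_map \<eta> this]
  obtain \<kappa> where \<kappa>: "dga_map K TC P \<kappa>"
    and \<kappa>p: "\<And>c m. c \<in> cent \<Longrightarrow> m \<in> carrier E \<Longrightarrow> \<kappa> (pure_tensor K C.sub E c m) = c \<otimes>\<^bsub>P\<^esub> \<eta> m" by auto
  define L where "L n w = (\<Oplus>\<^bsub>TC\<^esub>a\<in>I. \<Oplus>\<^bsub>TC\<^esub>b\<in>I. pure_tensor K C.sub E (psi n a b w) (e a b))" for n w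
  let ?Gn = "\<lambda>n. P\<lparr>carrier := grade P n\<rparr>"
  have pn: "psi n a b \<in> module_hom K (?Gn n) C.sub" if "a \<in> I" "b \<in> I" for n a b
    using psi_cent[OF that] P.grade_carrier module_hom_add[OF psi_hom[OF that]] module_hom_smult[OF psi_hom[OF that]]
    by (intro module_homI) simp_all
  have Lh: "L n \<in> module_hom K (?Gn n) TC" for n
    unfolding L_def
    by (intro module_hom_finsum P.grade_module T.TM.module_axioms module_hom_comp[OF pn T.pure_hom_left] U.e_closed)
  define \<rho> where "\<rho> = gext P TC L"
  have \<rho>h: "\<rho> \<in> module_hom K P TC" unfolding \<rho>_def by (rule P.gext_hom[OF T.TM.module_axioms Lh])
  have \<rho>L: "\<rho> w = L n w" if "w \<in> grade P n" for w n
    unfolding \<rho>_def by (rule P.gext_homog[OF T.TM.module_axioms Lh that])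
  interpret KH: mod_hom K TC P \<kappa> by (rule mod_homI[OF T.TM.module_axioms P.module_axiom dga_map_hom[OF \<kappa>]])
  have \<kappa>\<rho>: "\<kappa> (\<rho> w) = w" if w: "w \<in> carrier P" for w
  proof (rule P.hom_eq_on_carrier[OF module_hom_comp[OF \<rho>h dga_map_hom[OF \<kappa>]] _ _ w])
    show "(\<lambda>w. w) \<in> module_hom K P P" by (rule module_homI) auto
    fix n w assume w: "w \<in> grade P n"
    have pc: "pure_tensor K C.sub E (psi n a b w) (e a b) \<in> carrier TC" if "a \<in> I" "b \<in> I" for a b
      using psi_cent[OF that w] by (intro T.pure_closed U.e_closed that) simp
    have "\<kappa> (\<rho> w) = (\<Oplus>\<^bsub>P\<^esub>a\<in>I. \<kappa> (\<Oplus>\<^bsub>TC\<^esub>b\<in>I. pure_tensor K C.sub E (psi n a b w) (e a b)))"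
      unfolding \<rho>L[OF w] L_def using pc by (intro KH.f_finsum Pi_I T.TM.finsum_closed) auto
    also have "\<dots> = (\<Oplus>\<^bsub>P\<^esub>a\<in>I. \<Oplus>\<^bsub>P\<^esub>b\<in>I. psi n a b w \<otimes>\<^bsub>P\<^esub> u a b)"
    proof (rule P.finsum_cong')
      fix a assume a: "a \<in> I"
      have "\<kappa> (\<Oplus>\<^bsub>TC\<^esub>b\<in>I. pure_tensor K C.sub E (psi n a b w) (e a b)) =
        (\<Oplus>\<^bsub>P\<^esub>b\<in>I. \<kappa> (pure_tensor K C.sub E (psi n a b w) (e a b)))"
        using pc[OF a] by (intro KH.f_finsum) auto
      also have "\<dots> = (\<Oplus>\<^bsub>P\<^esub>b\<in>I. psi n a b w \<otimes>\<^bsub>P\<^esub> u a b)"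
        using psi_cent[OF a _ w] C.C_in[OF psi_cent[OF a _ w]] \<kappa>p U.e_closed[OF a] u_closed[OF a]
        by (intro P.finsum_cong') (simp_all add: u_def)
      finally show "\<kappa> (\<Oplus>\<^bsub>TC\<^esub>b\<in>I. pure_tensor K C.sub E (psi n a b w) (e a b)) = (\<Oplus>\<^bsub>P\<^esub>b\<in>I. psi n a b w \<otimes>\<^bsub>P\<^esub> u a b)" .
    next
      show "(\<lambda>a. \<Oplus>\<^bsub>P\<^esub>b\<in>I. psi n a b w \<otimes>\<^bsub>P\<^esub> u a b) \<in> I \<rightarrow> carrier P"
        using C.C_in[OF psi_cent[OF _ _ w]] by (intro Pi_I P.finsum_closed) simp
    qed simp
    also have "\<dots> = w" by (rule psi_reconstruct[OF P.grade_carrier[OF w]])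
    finally show "\<kappa> (\<rho> w) = w" .
  qed
  have \<rho>\<kappa>: "\<rho> (\<kappa> z) = z" if z: "z \<in> carrier TC" for z
  proof (rule T.tensor_hom_eq[OF T.TM.module_axioms module_hom_comp[OF dga_map_hom[OF \<kappa>] \<rho>h] _ _ z])
    show "(\<lambda>z. z) \<in> module_hom K TC TC" by (rule module_homI) auto
    fix i j c m assume "c \<in> grade C.sub i" and m: "m \<in> grade E j"
    then have c: "c \<in> cent" "c \<in> grade P i" by auto
    note cc = P.grade_carrier[OF c(2)]
    have "\<rho> (c \<otimes>\<^bsub>P\<^esub> \<eta> m) = pure_tensor K C.sub E c m"
    proof (rule U.hom_eq_units[OF T.TM.module_axioms _ _ _ E.grade_carrier[OF m]])
      show "(\<lambda>m. \<rho> (c \<otimes>\<^bsub>P\<^esub> \<eta> m)) \<in> module_hom K E TC"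
        by (rule module_hom_comp[OF module_hom_comp[OF dga_map_hom[OF \<eta>] P.mult_left_hom[OF cc]] \<rho>h])
      show "pure_tensor K C.sub E c \<in> module_hom K E TC" by (rule T.pure_hom_right) (simp add: c)
      fix x y assume xy: "x \<in> I" "y \<in> I"
      have cs: "c \<in> carrier C.sub" "\<zero>\<^bsub>P\<^esub> \<in> carrier C.sub" using c C.C_zero by auto
      have pz: "pure_tensor K C.sub E \<zero>\<^bsub>P\<^esub> m = \<zero>\<^bsub>TC\<^esub>" if "m \<in> carrier E" for m
        using mod_hom.f0_is_0[OF mod_homI[OF T.S.module_axiom T.TM.module_axioms T.pure_hom_left[OF that]]] by simp
      have ps: "pure_tensor K C.sub E (psi (i + (deg x - deg y)) a b (c \<otimes>\<^bsub>P\<^esub> u x y)) (e a b) =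
        (if a = x \<and> b = y then pure_tensor K C.sub E c (e x y) else \<zero>\<^bsub>TC\<^esub>)" if "a \<in> I" "b \<in> I" for a b
        using psi_coefficient[OF that xy c] pz[OF U.e_closed[OF that]] by auto
      have pc: "pure_tensor K C.sub E c (e x y) \<in> carrier TC" by (rule T.pure_closed[OF cs(1) U.e_closed[OF xy]])
      have in1: "(\<Oplus>\<^bsub>TC\<^esub>b\<in>I. if a = x \<and> b = y then pure_tensor K C.sub E c (e x y) else \<zero>\<^bsub>TC\<^esub>) =
        (if a = x then pure_tensor K C.sub E c (e x y) else \<zero>\<^bsub>TC\<^esub>)" for a
        using T.TR.finsum_single[OF U.finite_I xy(2), of "\<lambda>b. if a = x \<and> b = y then pure_tensor K C.sub E c (e x y) else \<zero>\<^bsub>TC\<^esub>"] pc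
        by simp
      have "\<rho> (c \<otimes>\<^bsub>P\<^esub> \<eta> (e x y)) = L (i + (deg x - deg y)) (c \<otimes>\<^bsub>P\<^esub> u x y)"
        unfolding u_def by (rule \<rho>L[OF P.mult_grade[OF c(2) eta_grade[OF U.e_grade[OF xy]]]])
      also have "\<dots> = (\<Oplus>\<^bsub>TC\<^esub>a\<in>I. \<Oplus>\<^bsub>TC\<^esub>b\<in>I. if a = x \<and> b = y then pure_tensor K C.sub E c (e x y) else \<zero>\<^bsub>TC\<^esub>)"
        unfolding L_def using ps pc
        by (intro T.TM.finsum_cong' Pi_I T.TM.finsum_closed) auto
      also have "\<dots> = pure_tensor K C.sub E c (e x y)"
        unfolding in1
        using T.TR.finsum_single[OF U.finite_I xy(1), of "\<lambda>a. if a = x then pure_tensor K C.sub E c (e x y) else \<zero>\<^bsub>TC\<^esub>"] pc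
        by simp
      finally show "\<rho> (c \<otimes>\<^bsub>P\<^esub> \<eta> (e x y)) = pure_tensor K C.sub E c (e x y)" .
    qed
    then show "\<rho> (\<kappa> (pure_tensor K C.sub E c m)) = pure_tensor K C.sub E c m"
      using \<kappa>p[OF c(1) E.grade_carrier[OF m]] by simp
  qed
  have "dga_map K P TC \<rho>"
    by (rule dga_map_inverse[OF T.TD.pre_dga P.pre_dga \<kappa> module_hom_in[OF \<rho>h] \<rho>\<kappa> \<kappa>\<rho>])
  then show ?thesis using \<kappa> \<kappa>p \<kappa>\<rho> \<rho>\<kappa> by (intro exI[of _ \<kappa>] exI[of _ \<rho>]) simp
qed

end

section \<open>The centralizer in a tensor product\<close>

locale matrix_tensor = dg_pair K S E + U: matrix_units K E I deg e \<epsilon>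
  for K :: "'k ring" and S :: "('k, 's) dg" and E :: "('k, 'e) dg"
    and I :: "'x set" and deg :: "'x \<Rightarrow> int" and e :: "'x \<Rightarrow> 'x \<Rightarrow> 'e" and \<epsilon> :: "'e \<Rightarrow> 'k"
begin

sublocale O: matrix_units_over K "tensor K S E" E "\<lambda>m. pure_tensor K S E \<one>\<^bsub>S\<^esub> m" I deg e \<epsilon>
  by (intro matrix_units_over.intro dga_over.intro dga_over_axioms.intro tensor_dg_algebra T.dg_algebra_axioms inr_map
      U.matrix_units_axioms)

abbreviation "in1 s \<equiv> pure_tensor K S E s \<one>\<^bsub>E\<^esub>"

lemma in1_grade: "s \<in> grade S i \<Longrightarrow> in1 s \<in> grade TT i"
  by (rule dga_map_grade[OF inl_map])

lemma in1_cent_homog: "s \<in> grade S i \<Longrightarrow> in1 s \<in> O.cent"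
proof (rule O.cent_homogI[OF in1_grade])
  fix j m assume s: "s \<in> grade S i" and m: "m \<in> grade E j"
  note c = S.grade_carrier[OF s] T.grade_carrier[OF m]
  have "pure_tensor K S E \<one>\<^bsub>S\<^esub> m \<otimes>\<^bsub>TT\<^esub> in1 s = ksgn TT (j * i) (pure_tensor K S E s m)"
    using pure_mult[OF _ m s T.one_closed, of "\<one>\<^bsub>S\<^esub>"] c by simp
  moreover have "ksgn TT (i * j + j * i) (pure_tensor K S E s m) = ksgn TT 0 (pure_tensor K S E s m)"
    by (rule ksgn_cong) simp
  ultimately show "in1 s \<otimes>\<^bsub>TT\<^esub> pure_tensor K S E \<one>\<^bsub>S\<^esub> m = ksgn TT (i * j) (pure_tensor K S E \<one>\<^bsub>S\<^esub> m \<otimes>\<^bsub>TT\<^esub> in1 s)"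
    using c pure_closed[OF c] by (simp add: pure_factor)
qed

lemma in1_image_submodule: "LinearCombinations.submodule K (in1 ` carrier S) TT"
proof (rule LinearCombinations.submodule.intro[OF TM.module_axioms])
  note h = pure_hom_left[OF T.one_closed]
  show "in1 ` carrier S \<subseteq> carrier TT" by (auto simp: pure_closed)
  show "\<zero>\<^bsub>TT\<^esub> \<in> in1 ` carrier S"
    using mod_hom.f0_is_0[OF mod_homI[OF S.module_axiom TM.module_axioms h]] by (intro image_eqI[of _ _ "\<zero>\<^bsub>S\<^esub>"]) simp_all
  fix v w assume "v \<in> in1 ` carrier S" "w \<in> in1 ` carrier S"
  then show "v \<oplus>\<^bsub>TT\<^esub> w \<in> in1 ` carrier S" by (auto simp: module_hom_add[OF h, symmetric])
next
  note h = pure_hom_left[OF T.one_closed]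
  fix c v assume "c \<in> carrier K" "v \<in> in1 ` carrier S"
  then show "c \<odot>\<^bsub>TT\<^esub> v \<in> in1 ` carrier S" by (auto simp: module_hom_smult[OF h, symmetric])
qed

lemma in1_cent: "s \<in> carrier S \<Longrightarrow> in1 s \<in> O.cent"
proof (induction rule: S.graded_induct)
  case (homog i x)
  then show ?case by (rule in1_cent_homog)
next
  case (add x y)
  then show ?case using O.cent_add module_hom_add[OF pure_hom_left[OF T.one_closed] add(1,2)] by simp
qed

text \<open>Apply \<open>id \<otimes> \<epsilon>\<close>.\<close>

lemma in1_inj:
  assumes "s \<in> carrier S" "s' \<in> carrier S" "in1 s = in1 s'"
  shows "s = s'"
proof -
  have "bilin K S {\<zero>\<^bsub>S\<^esub>} S E i j (\<lambda>s m. \<epsilon> m \<odot>\<^bsub>S\<^esub> s)" for i j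
  proof (rule bilinI[OF S.module_axiom _ _ S.graded_module_axioms T.graded_module_axioms])
    show "(\<lambda>s. \<epsilon> t \<odot>\<^bsub>S\<^esub> s) \<in> module_hom K (S\<lparr>carrier := grade S i\<rparr>) S" if "t \<in> grade E j" for t
      using U.functional(1)[OF T.grade_carrier[OF that]] S.grade_carrier
      by (intro module_homI) (simp_all add: S.smult_r_distr S.smult_assoc1[symmetric] S.R.m_comm)
    show "(\<lambda>m. \<epsilon> m \<odot>\<^bsub>S\<^esub> s) \<in> module_hom K (E\<lparr>carrier := grade E j\<rparr>) S" if "s \<in> grade S i" for s
      using U.functional T.grade_carrier S.grade_carrier[OF that]
      by (intro module_homI) (simp_all add: S.smult_l_distr S.smult_assoc1)
  qed
  from tensor_lift_linear[OF S.module_axiom this] obtain h where h: "h \<in> module_hom K TT S"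
    and hp: "\<And>i j s t. s \<in> grade S i \<Longrightarrow> t \<in> grade E j \<Longrightarrow> h (pure_tensor K S E s t) = \<epsilon> t \<odot>\<^bsub>S\<^esub> s" by blast
  have "h (in1 s) = s" if s: "s \<in> carrier S" for s
  proof (rule S.hom_eq_on_carrier[OF module_hom_comp[OF pure_hom_left[OF T.one_closed] h] _ _ s])
    show "(\<lambda>s. s) \<in> module_hom K S S" by (rule module_homI) auto
    show "h (in1 x) = x" if "x \<in> grade S i" for i x
      using hp[OF that T.one_grade] U.functional(4) S.grade_carrier[OF that] by simp
  qed
  then show ?thesis using assms by metis
qed

text \<open>On \<open>s \<otimes> e x y = (s \<otimes> 1) (1 \<otimes> e x y)\<close> the coordinates at \<open>e a a\<close> are \<open>s \<otimes> 1\<close> or zero, and such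
  elements span \<open>S \<otimes> E\<close>.\<close>

lemma psi_image:
  assumes a: "a \<in> I" and z: "z \<in> carrier TT"
  shows "gext TT TT (\<lambda>n. O.psi n a a) z \<in> in1 ` carrier S"
proof -
  have ph: "O.psi n a a \<in> module_hom K (TT\<lparr>carrier := grade TT n\<rparr>) TT" for n
    using module_hom_in[OF O.psi_hom[OF a a]] module_hom_add[OF O.psi_hom[OF a a]] module_hom_smult[OF O.psi_hom[OF a a]] TD.grade_carrier
    by (intro module_homI) simp_all
  have H: "gext TT TT (\<lambda>n. O.psi n a a) \<in> module_hom K TT TT"
    by (rule TD.gext_hom[OF TM.module_axioms ph])
  show ?thesis
  proof (rule tensor_hom_into_submodule[OF TM.module_axioms H in1_image_submodule _ z])
    fix i j s t assume s: "s \<in> grade S i" and t: "t \<in> grade E j"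
    note sc = S.grade_carrier[OF s]
    show "gext TT TT (\<lambda>n. O.psi n a a) (pure_tensor K S E s t) \<in> in1 ` carrier S"
    proof (rule U.hom_into_units[OF TM.module_axioms module_hom_comp[OF pure_hom_right[OF sc] H] in1_image_submodule _ T.grade_carrier[OF t]])
      fix x y assume xy: "x \<in> I" "y \<in> I"
      have f: "in1 s \<otimes>\<^bsub>TT\<^esub> O.u x y = pure_tensor K S E s (e x y)"
        using pure_factor[OF sc U.e_closed[OF xy]] by (simp add: O.u_def)
      have "gext TT TT (\<lambda>n. O.psi n a a) (pure_tensor K S E s (e x y)) =
          O.psi (i + (deg x - deg y)) a a (in1 s \<otimes>\<^bsub>TT\<^esub> O.u x y)"
        unfolding f by (rule TD.gext_homog[OF TM.module_axioms ph pure_grade[OF s U.e_grade[OF xy]]])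
      also have "\<dots> = (if a = x \<and> a = y then in1 s else \<zero>\<^bsub>TT\<^esub>)"
        by (rule O.psi_coefficient[OF a a xy in1_cent[OF sc] in1_grade[OF s]])
      also have "\<dots> \<in> in1 ` carrier S"
        using sc in1_image_submodule by (simp add: LinearCombinations.submodule.zero_closed)
      finally show "gext TT TT (\<lambda>n. O.psi n a a) (pure_tensor K S E s (e x y)) \<in> in1 ` carrier S" .
    qed
  qed
qed

text \<open>An element of the centralizer equals each of its diagonal coordinates, and these lie in \<open>S \<otimes> 1\<close>.\<close>

theorem tensor_cent: "O.cent = in1 ` carrier S"
proof
  show "in1 ` carrier S \<subseteq> O.cent" using in1_cent by blast
  show "O.cent \<subseteq> in1 ` carrier S"
  proof
    fix w assume w: "w \<in> O.cent"
    have wc: "w \<in> carrier TT" using w O.cent_carrier by blast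
    obtain a where a: "a \<in> I" using U.I_nonempty by blast
    have "gext TT TT (\<lambda>n. O.psi n a a) w = (\<Oplus>\<^bsub>TT\<^esub>i\<in>gsupp TT w. component TT w i)"
      unfolding gext_def
      by (rule TM.finsum_cong') (use wc O.psi_fixes_cent[OF a O.cent_component[OF w] TD.component_grade[OF wc]] in auto)
    also have "\<dots> = w" by (rule TD.component_sum[OF wc])
    finally show "w \<in> in1 ` carrier S" using psi_image[OF a wc] by simp
  qed
qed

theorem factor_through_in1:
  assumes A: "dg_algebra K A" and h: "dga_map K A TT h" and hc: "\<And>x. x \<in> carrier A \<Longrightarrow> h x \<in> O.cent"
  shows "\<exists>g. dga_map K A S g \<and> (\<forall>x\<in>carrier A. in1 (g x) = h x)"
proof -
  interpret A: dg_algebra K A by fact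
  let ?i = "inv_into (carrier S) in1"
  have im: "dga_map K S O.C.sub in1"
  proof (rule dga_mapI)
    show "in1 \<in> module_hom K S O.C.sub"
      using module_hom_add[OF dga_map_hom[OF inl_map]] module_hom_smult[OF dga_map_hom[OF inl_map]] in1_cent
      by (intro module_homI) simp_all
  qed (simp_all add: dga_map_mult[OF inl_map] dga_map_one[OF inl_map] dga_map_diff[OF inl_map] in1_grade in1_cent_homog)
  have inv: "?i y \<in> carrier S" "in1 (?i y) = y" if y: "y \<in> carrier O.C.sub" for y
  proof -
    have "y \<in> in1 ` carrier S" using y by (simp add: tensor_cent[symmetric])
    then show "?i y \<in> carrier S" "in1 (?i y) = y" by (rule inv_into_into, rule f_inv_into_f)
  qed
  have i: "dga_map K O.C.sub S ?i"
  proof (rule dga_map_inverse[OF S.pre_dga dg_algebra.pre_dga[OF O.C.sub_dg_algebra] im inv(1) _ inv(2)])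
    show "?i (in1 x) = x" if x: "x \<in> carrier S" for x
      using in1_inj inv[of "in1 x"] in1_cent[OF x] x by simp
  qed
  have h': "dga_map K A O.C.sub h"
  proof (rule dga_mapI)
    show "h \<in> module_hom K A O.C.sub"
      using module_hom_add[OF dga_map_hom[OF h]] module_hom_smult[OF dga_map_hom[OF h]] hc
      by (intro module_homI) simp_all
  qed (use dga_map_grade[OF h] hc A.grade_carrier in \<open>simp_all add: dga_map_mult[OF h] dga_map_one[OF h] dga_map_diff[OF h]\<close>)
  have "dga_map K A S (\<lambda>x. ?i (h x))" by (rule dga_map_comp[OF h' i])
  moreover have "in1 (?i (h x)) = h x" if "x \<in> carrier A" for x using inv(2) hc[OF that] by simp
  ultimately show ?thesis by (intro exI[of _ "\<lambda>x. ?i (h x)"]) simp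
qed

end

section \<open>The root algebra\<close>

lemma dga_map_gcommutator:
  assumes A: "dg_algebra K A" and B: "dg_algebra K B" and f: "dga_map K A B f"
    and x: "x \<in> carrier A" and y: "y \<in> carrier A"
  shows "f (gcommutator A x y) = gcommutator B (f x) (f y)"
proof -
  interpret A: dg_algebra K A by fact
  interpret B: dg_algebra K B by fact
  note h = dga_map_hom[OF f] and c = dga_map_closed[OF f]
  have 1: "f (gcommutator A x y) = gcommutator B (f x) (f y)" if x: "x \<in> grade A i" and y: "y \<in> grade A j" for x y i j
  proof -
    note xy = A.grade_carrier[OF x] A.grade_carrier[OF y]
    have "f (gcommutator A x y) = f (x \<otimes>\<^bsub>A\<^esub> y) \<ominus>\<^bsub>B\<^esub> f (ksgn A (i * j) (y \<otimes>\<^bsub>A\<^esub> x))"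
      unfolding A.gcommutator_homog[OF x y]
      using xy by (intro mod_hom.f_minus[OF mod_homI[OF A.module_axiom B.module_axiom h]]) auto
    also have "f (ksgn A (i * j) (y \<otimes>\<^bsub>A\<^esub> x)) = ksgn B (i * j) (f (y \<otimes>\<^bsub>A\<^esub> x))"
      using xy by (intro mod_hom.f_ksgn[OF mod_homI[OF A.module_axiom B.module_axiom h]]) auto
    finally show ?thesis
      using xy by (simp add: B.gcommutator_homog[OF dga_map_grade[OF f x] dga_map_grade[OF f y]] dga_map_mult[OF f])
  qed
  have 2: "f (gcommutator A x y) = gcommutator B (f x) (f y)" if x: "x \<in> grade A i" for x i
    by (rule A.hom_eq_on_carrier[OF module_hom_comp[OF A.gcommutator_right_hom[OF A.grade_carrier[OF x]] h]
        module_hom_comp[OF h B.gcommutator_right_hom[OF c[OF A.grade_carrier[OF x]]]] 1[OF x] y])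
  show ?thesis
    by (rule A.hom_eq_on_carrier[OF module_hom_comp[OF A.gcommutator_left_hom[OF y] h]
        module_hom_comp[OF h B.gcommutator_left_hom[OF c[OF y]]] 2 x])
qed

text \<open>A morphism of algebras under \<open>E\<close> maps commutators with elements of \<open>E\<close> to such commutators, hence centralizer to
  centralizer.\<close>

lemma dga_over_cent_map:
  assumes P: "dga_over K P E \<eta>" and P': "dga_over K P' E \<eta>'" and h: "dga_map K P P' h"
    and c: "\<And>m. m \<in> carrier E \<Longrightarrow> h (\<eta> m) = \<eta>' m" and w: "w \<in> dga_over.cent P E \<eta>"
  shows "h w \<in> dga_over.cent P' E \<eta>'"
proof -
  interpret P: dga_over K P E \<eta> by fact
  interpret P': dga_over K P' E \<eta>' by fact
  have wc: "w \<in> carrier P" using w P.cent_carrier by blast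
  have "gcommutator P' (h w) (\<eta>' m) = \<zero>\<^bsub>P'\<^esub>" if m: "m \<in> carrier E" for m
  proof -
    have "gcommutator P' (h w) (\<eta>' m) = h (gcommutator P w (\<eta> m))"
      using dga_map_gcommutator[OF P.P.dg_algebra_axioms P'.P.dg_algebra_axioms h wc P.eta_closed[OF m]] c[OF m] by simp
    also have "\<dots> = h \<zero>\<^bsub>P\<^esub>" using w m by (simp add: P.cent_def)
    also have "\<dots> = \<zero>\<^bsub>P'\<^esub>" by (rule mod_hom.f0_is_0[OF mod_homI[OF P.P.module_axiom P'.P.module_axiom dga_map_hom[OF h]]])
    finally show ?thesis .
  qed
  then show ?thesis using dga_map_closed[OF h wc] by (simp add: P'.cent_def)
qed

lemma coprod_map_hom:
  assumes A: "dg_algebra K A" and A': "dg_algebra K A'" and B: "dg_algebra K B" and u: "dga_map K A A' u"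
  shows "coprod_map K B A A' u \<in> dga_hom K (coprod K A B) (coprod K A' B)"
    and "\<And>x. x \<in> carrier A \<Longrightarrow> coprod_map K B A A' u (coprod_inl K A B x) = coprod_inl K A' B (u x)"
    and "\<And>y. y \<in> carrier B \<Longrightarrow> coprod_map K B A A' u (coprod_inr K A B y) = coprod_inr K A' B y"
proof -
  interpret P: dg_coprod K A B by (intro dg_coprod.intro assms)
  interpret P': dg_coprod K A' B by (intro dg_coprod.intro assms)
  let ?Q = "\<lambda>h. h \<in> dga_hom K (coprod K A B) (coprod K A' B) \<and>
     (\<forall>x\<in>carrier A. h (coprod_inl K A B x) = coprod_inl K A' B (u x)) \<and>
     (\<forall>y\<in>carrier B. h (coprod_inr K A B y) = coprod_inr K A' B y)"
  obtain h where h: "dga_map K (coprod K A B) (coprod K A' B) h"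
      "\<And>x. x \<in> carrier A \<Longrightarrow> h (coprod_inl K A B x) = coprod_inl K A' B (u x)"
      "\<And>y. y \<in> carrier B \<Longrightarrow> h (coprod_inr K A B y) = coprod_inr K A' B y"
    using P.coprod_lift[OF P'.coprod_dg_algebra dga_map_comp[OF u P'.inl_map] P'.inr_map] by blast
  let ?r = "restrict h (carrier (coprod K A B))"
  have "?Q ?r"
    using h restrict_dga_hom[OF P.PD.pre_dga h(1)] dga_map_closed[OF P.inl_map] dga_map_closed[OF P.inr_map] by simp
  moreover have "h' = ?r" if h': "?Q h'" for h'
  proof (rule dga_hom_eqI)
    show "h' \<in> dga_hom K (coprod K A B) (coprod K A' B)" using h' by blast
    show r: "?r \<in> dga_hom K (coprod K A B) (coprod K A' B)" by (rule restrict_dga_hom[OF P.PD.pre_dga h(1)])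
    show "h' z = ?r z" if "z \<in> carrier (coprod K A B)" for z
      by (rule P.coprod_map_eq[OF P'.PD.pre_dga dga_hom_map dga_hom_map[OF r] _ _ that])
        (use h' h dga_map_closed[OF P.inl_map] dga_map_closed[OF P.inr_map] in auto)
  qed
  ultimately have "?Q (THE h. ?Q h)" by (rule theI)
  then show "coprod_map K B A A' u \<in> dga_hom K (coprod K A B) (coprod K A' B)"
    "\<And>x. x \<in> carrier A \<Longrightarrow> coprod_map K B A A' u (coprod_inl K A B x) = coprod_inl K A' B (u x)"
    "\<And>y. y \<in> carrier B \<Longrightarrow> coprod_map K B A A' u (coprod_inr K A B y) = coprod_inr K A' B y"
    by (simp_all add: coprod_map_def)
qed

locale root_algebra = V: cochain_complex K V + R: dg_algebra K R
  for K :: "'k ring" and V :: "('k, 'v) dg" and R :: "('k, 'r) dg" +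
  assumes K_field: "field K" and V_fin_dim: "total_fin_dim K V" and V_nonzero: "carrier V \<noteq> {\<zero>\<^bsub>V\<^esub>}"
begin

abbreviation "E \<equiv> End_dg K V"
abbreviation "P \<equiv> coprod K R E"
abbreviation "inl \<equiv> coprod_inl K R E"
abbreviation "inr \<equiv> coprod_inr K R E"
abbreviation "root \<equiv> dg_root K V R"

sublocale E: dg_algebra K "End_dg K V"
  by (rule V.E_dg_algebra)

sublocale CP: dg_coprod K R "End_dg K V"
  by (intro dg_coprod.intro R.dg_algebra_axioms E.dg_algebra_axioms)

sublocale O: dga_over K "coprod K R (End_dg K V)" "End_dg K V" "coprod_inr K R (End_dg K V)"
  by (intro dga_over.intro dga_over_axioms.intro CP.coprod_dg_algebra E.dg_algebra_axioms CP.inr_map)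

lemma root_eq: "root = O.C.sub"
  unfolding O.C.sub_def by (simp add: dg_root_def Let_def O.cent_def)

lemma root_carrier: "carrier root = O.cent"
  by (simp add: root_eq)

theorem root_dg_algebra: "dg_algebra K root"
  unfolding root_eq by (rule O.C.sub_dg_algebra)

lemma root_P: "w \<in> carrier root \<Longrightarrow> w \<in> carrier P"
  unfolding root_eq by (simp add: O.C.C_in)

lemma root_incl: "dga_map K root P (\<lambda>w. w)"
  unfolding root_eq by (rule O.C.incl_map)

lemma root_one: "\<one>\<^bsub>root\<^esub> = \<one>\<^bsub>P\<^esub>"
  by (simp add: root_eq)

lemma matrix_units_exist: "\<exists>(I :: (int \<times> 'v) set) e \<epsilon>. matrix_units K E I fst e \<epsilon>"
  by (rule V.End_matrix_units[OF K_field V_fin_dim V_nonzero])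

theorem root_tensor_iso:
  "\<exists>\<kappa> \<rho>. dga_map K (tensor K root E) P \<kappa> \<and> dga_map K P (tensor K root E) \<rho> \<and>
    (\<forall>c\<in>carrier root. \<forall>m\<in>carrier E. \<kappa> (pure_tensor K root E c m) = c \<otimes>\<^bsub>P\<^esub> inr m) \<and>
    (\<forall>z\<in>carrier (tensor K root E). \<rho> (\<kappa> z) = z) \<and> (\<forall>w\<in>carrier P. \<kappa> (\<rho> w) = w)"
proof -
  obtain I :: "(int \<times> 'v) set" and e \<epsilon> where M: "matrix_units K E I fst e \<epsilon>" using matrix_units_exist by (elim exE)
  interpret W: matrix_units_over K "coprod K R (End_dg K V)" "End_dg K V" "coprod_inr K R (End_dg K V)" I fst e \<epsilon>
    by (intro matrix_units_over.intro O.dga_over_axioms M)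
  show ?thesis using W.tensor_cent_iso unfolding root_eq O.C.sub_simps(1) .
qed

text \<open>The property by which the extension in the definition of the canonical map is characterized.\<close>

definition "ext_prop S f h \<longleftrightarrow> h \<in> dga_hom K P (tensor K S E) \<and>
  (\<forall>w\<in>carrier root. h w = pure_tensor K S E (f w) \<one>\<^bsub>E\<^esub>) \<and>
  (\<forall>m\<in>carrier E. h (inr m) = pure_tensor K S E \<one>\<^bsub>S\<^esub> m)"

lemma root_ext_The: "root_ext K V R S f = (THE h. ext_prop S f h)"
  by (simp add: root_ext_def ext_prop_def Let_def)

text \<open>The extension is \<open>f \<otimes> id\<close>, transported along the isomorphism of \<open>R * E\<close> with the root algebra tensor \<open>E\<close>.\<close>

lemma ext_prop_exists:
  assumes S: "dg_algebra K S" and f: "dga_map K root S f"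
  shows "\<exists>h. ext_prop S f h"
proof -
  obtain \<kappa> \<rho> where \<kappa>: "dga_map K (tensor K root E) P \<kappa>" and \<rho>: "dga_map K P (tensor K root E) \<rho>"
    and \<kappa>p: "\<forall>c\<in>carrier root. \<forall>m\<in>carrier E. \<kappa> (pure_tensor K root E c m) = c \<otimes>\<^bsub>P\<^esub> inr m"
    and \<rho>\<kappa>: "\<forall>z\<in>carrier (tensor K root E). \<rho> (\<kappa> z) = z"
    using root_tensor_iso by (elim exE conjE) (rule that)
  interpret T: dg_pair K root E by (intro dg_pair.intro root_dg_algebra E.dg_algebra_axioms)
  note t = tensor_map_hom[OF root_dg_algebra S E.dg_algebra_axioms f]
  let ?t = "tensor_map K E root S f"
  let ?h = "restrict (\<lambda>w. ?t (\<rho> w)) (carrier P)"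
  have \<rho>p: "\<rho> (c \<otimes>\<^bsub>P\<^esub> inr m) = pure_tensor K root E c m" if "c \<in> carrier root" "m \<in> carrier E" for c m
    using \<rho>\<kappa> T.pure_closed[OF that] \<kappa>p that by (metis (no_types))
  have "ext_prop S f ?h"
    unfolding ext_prop_def
  proof (intro conjI ballI)
    show "?h \<in> dga_hom K P (tensor K S E)"
      by (rule restrict_dga_hom[OF CP.PD.pre_dga dga_map_comp[OF \<rho> dga_hom_map[OF t(1)]]])
    show "?h w = pure_tensor K S E (f w) \<one>\<^bsub>E\<^esub>" if w: "w \<in> carrier root" for w
    proof -
      have "w \<otimes>\<^bsub>P\<^esub> inr \<one>\<^bsub>E\<^esub> = w" using root_P[OF w] dga_map_one[OF CP.inr_map] by simp
      then show ?thesis using \<rho>p[OF w E.one_closed] t(2)[OF w E.one_closed] root_P[OF w] by simp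
    qed
    show "?h (inr m) = pure_tensor K S E \<one>\<^bsub>S\<^esub> m" if m: "m \<in> carrier E" for m
    proof -
      note mc = dga_map_closed[OF CP.inr_map m]
      have "\<one>\<^bsub>root\<^esub> \<otimes>\<^bsub>P\<^esub> inr m = inr m" using mc by (simp add: root_one)
      then show ?thesis using \<rho>p[OF T.S.one_closed m] t(2)[OF T.S.one_closed m] mc dga_map_one[OF f] by simp
    qed
  qed
  then show ?thesis by blast
qed

text \<open>Products of elements of the root algebra with elements of \<open>E\<close> span \<open>R * E\<close>.\<close>

lemma ext_prop_unique:
  assumes S: "dg_algebra K S" and h: "ext_prop S f h" and h': "ext_prop S f h'"
  shows "h = h'"
proof -
  obtain \<kappa> \<rho> where \<kappa>: "dga_map K (tensor K root E) P \<kappa>" and \<rho>: "dga_map K P (tensor K root E) \<rho>"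
    and \<kappa>p: "\<forall>c\<in>carrier root. \<forall>m\<in>carrier E. \<kappa> (pure_tensor K root E c m) = c \<otimes>\<^bsub>P\<^esub> inr m"
    and \<kappa>\<rho>: "\<forall>w\<in>carrier P. \<kappa> (\<rho> w) = w"
    using root_tensor_iso by (elim exE conjE) (rule that)
  interpret T: dg_pair K root E by (intro dg_pair.intro root_dg_algebra E.dg_algebra_axioms)
  interpret TS: dg_pair K S E by (intro dg_pair.intro S E.dg_algebra_axioms)
  have hm: "h \<in> dga_hom K P (tensor K S E)" "h' \<in> dga_hom K P (tensor K S E)"
    using h h' by (simp_all add: ext_prop_def)
  note d = dga_hom_map[OF hm(1)] dga_hom_map[OF hm(2)]
  show ?thesis
  proof (rule dga_hom_eqI[OF hm])
    fix w assume w: "w \<in> carrier P"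
    have "h (\<kappa> (\<rho> w)) = h' (\<kappa> (\<rho> w))"
    proof (rule T.tensor_hom_eq[OF TS.TM.module_axioms dga_map_hom[OF dga_map_comp[OF \<kappa> d(1)]]
          dga_map_hom[OF dga_map_comp[OF \<kappa> d(2)]] _ dga_map_closed[OF \<rho> w]])
      fix i j c m assume cm: "c \<in> grade root i" "m \<in> grade E j"
      note c = T.S.grade_carrier[OF cm(1)] and m = E.grade_carrier[OF cm(2)]
      show "h (\<kappa> (pure_tensor K root E c m)) = h' (\<kappa> (pure_tensor K root E c m))"
        using h h' c m root_P[OF c] dga_map_closed[OF CP.inr_map m]
        by (simp add: \<kappa>p dga_map_mult[OF d(1)] dga_map_mult[OF d(2)] ext_prop_def)
    qed
    then show "h w = h' w" using \<kappa>\<rho> w by simp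
  qed
qed

lemma root_ext_eqI: "dg_algebra K S \<Longrightarrow> ext_prop S f h \<Longrightarrow> root_ext K V R S f = h"
  unfolding root_ext_The by (rule the_equality) (auto intro: ext_prop_unique)

lemma root_ext_prop: "dg_algebra K S \<Longrightarrow> dga_map K root S f \<Longrightarrow> ext_prop S f (root_ext K V R S f)"
  using ext_prop_exists[of S f] root_ext_eqI[of S f] by auto

lemma root_adj_hom:
  assumes S: "dg_algebra K S" and f: "dga_map K root S f"
  shows "root_adj K V R S f \<in> dga_hom K R (tensor K S E)"
proof -
  have "root_ext K V R S f \<in> dga_hom K P (tensor K S E)" using root_ext_prop[OF S f] by (simp add: ext_prop_def)
  from restrict_dga_hom[OF R.pre_dga dga_map_comp[OF CP.inl_map dga_hom_map[OF this]]]
  show ?thesis by (simp add: root_adj_def compose_def)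
qed

lemma root_adj_app: "x \<in> carrier R \<Longrightarrow> root_adj K V R S f x = root_ext K V R S f (inl x)"
  by (simp add: root_adj_def compose_def)

text \<open>Injectivity uses that \<open>R\<close> and \<open>E\<close> generate \<open>R * E\<close>; for surjectivity the morphism given by \<open>g\<close> and \<open>1 \<otimes> id\<close> is
  restricted to the root algebra, where it has values in the centralizer \<open>S \<otimes> 1\<close>.\<close>

theorem root_adj_bij:
  assumes S: "dg_algebra K S"
  shows "bij_betw (root_adj K V R S) (dga_hom K root S) (dga_hom K R (tensor K S E))"
proof -
  obtain I :: "(int \<times> 'v) set" and e \<epsilon> where M: "matrix_units K E I fst e \<epsilon>" using matrix_units_exist by (elim exE)
  interpret W: matrix_tensor K S "End_dg K V" I fst e \<epsilon>
    by (intro matrix_tensor.intro dg_pair.intro S E.dg_algebra_axioms M)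
  show ?thesis
    unfolding bij_betw_def
  proof (intro conjI inj_onI equalityI subsetI)
    fix f f' assume f: "f \<in> dga_hom K root S" and f': "f' \<in> dga_hom K root S"
      and eq: "root_adj K V R S f = root_adj K V R S f'"
    note x = root_ext_prop[OF S dga_hom_map[OF f]] root_ext_prop[OF S dga_hom_map[OF f']]
    show "f = f'"
    proof (rule dga_hom_eqI[OF f f'])
      fix w assume w: "w \<in> carrier root"
      have "root_ext K V R S f w = root_ext K V R S f' w"
      proof (rule CP.coprod_map_eq[OF W.TD.pre_dga _ _ _ _ root_P[OF w]])
        show "root_ext K V R S f (inl y) = root_ext K V R S f' (inl y)" if "y \<in> carrier R" for y
          using fun_cong[OF eq, of y] by (simp add: root_adj_app that)
      qed (use x in \<open>simp_all add: ext_prop_def dga_hom_map\<close>)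
      then have "pure_tensor K S E (f w) \<one>\<^bsub>E\<^esub> = pure_tensor K S E (f' w) \<one>\<^bsub>E\<^esub>" using x w by (simp add: ext_prop_def)
      then show "f w = f' w"
        by (rule W.in1_inj[OF dga_map_closed[OF dga_hom_map[OF f] w] dga_map_closed[OF dga_hom_map[OF f'] w]])
    qed
  next
    fix g assume "g \<in> root_adj K V R S ` dga_hom K root S"
    then show "g \<in> dga_hom K R (tensor K S E)" using root_adj_hom[OF S dga_hom_map] by blast
  next
    fix g assume g: "g \<in> dga_hom K R (tensor K S E)"
    obtain h where h: "dga_map K P (tensor K S E) h" "\<And>x. x \<in> carrier R \<Longrightarrow> h (inl x) = g x"
        "\<And>m. m \<in> carrier E \<Longrightarrow> h (inr m) = pure_tensor K S E \<one>\<^bsub>S\<^esub> m"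
      using CP.coprod_lift[OF W.tensor_dg_algebra dga_hom_map[OF g] W.inr_map] by blast
    have hc: "h w \<in> W.O.cent" if "w \<in> carrier root" for w
      using dga_over_cent_map[OF O.dga_over_axioms W.O.dga_over_axioms h(1,3)] that by (simp add: root_carrier)
    obtain f where f: "dga_map K root S f" "\<And>w. w \<in> carrier root \<Longrightarrow> pure_tensor K S E (f w) \<one>\<^bsub>E\<^esub> = h w"
      using W.factor_through_in1[OF root_dg_algebra dga_map_comp[OF root_incl h(1)] hc] by blast
    let ?f = "restrict f (carrier root)" and ?h = "restrict h (carrier P)"
    have fh: "?f \<in> dga_hom K root S"
      by (rule restrict_dga_hom[OF dg_algebra.pre_dga[OF root_dg_algebra] f(1)])
    have "ext_prop S ?f ?h"
      using restrict_dga_hom[OF CP.PD.pre_dga h(1)] f(2) h(3) root_P dga_map_closed[OF CP.inr_map]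
      by (simp add: ext_prop_def)
    then have e: "root_ext K V R S ?f = ?h" by (rule root_ext_eqI[OF S])
    have "root_adj K V R S ?f = g"
    proof (rule dga_hom_eqI[OF root_adj_hom[OF S dga_hom_map[OF fh]] g])
      fix x assume x: "x \<in> carrier R"
      show "root_adj K V R S ?f x = g x"
        using dga_map_closed[OF CP.inl_map x] h(2)[OF x] by (simp add: root_adj_app[OF x] e)
    qed
    then show "g \<in> root_adj K V R S ` dga_hom K root S" using fh by blast
  qed
qed

end

section \<open>Naturality\<close>

locale root_algebra_map = A: root_algebra K V R' + B: root_algebra K V R
  for K :: "'k ring" and V :: "('k, 'v) dg" and R' :: "('k, 'r2) dg" and R :: "('k, 'r) dg" +
  fixes u :: "'r2 \<Rightarrow> 'r"
  assumes u: "dga_map K R' R u"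
begin

lemmas cm = coprod_map_hom[OF A.R.dg_algebra_axioms B.R.dg_algebra_axioms A.E.dg_algebra_axioms u]

lemma root_map_app: "w \<in> carrier A.root \<Longrightarrow> root_map K V R' R u w = coprod_map K A.E R' R u w"
  by (simp add: root_map_def)

lemma root_map_closed: "w \<in> carrier A.root \<Longrightarrow> root_map K V R' R u w \<in> carrier B.root"
  using dga_over_cent_map[OF A.O.dga_over_axioms B.O.dga_over_axioms dga_hom_map[OF cm(1)] cm(3)]
  by (simp add: root_map_app A.root_carrier B.root_carrier)

lemma root_map_map: "dga_map K A.root B.root (root_map K V R' R u)"
proof (rule dga_map_cong[OF dg_algebra.pre_dga[OF A.root_dg_algebra] _ root_map_app])
  note c = dga_map_comp[OF A.root_incl dga_hom_map[OF cm(1)]]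
  have cl: "coprod_map K A.E R' R u w \<in> B.O.cent" if "w \<in> carrier A.root" for w
    using root_map_closed[OF that] by (simp add: root_map_app[OF that] B.root_carrier)
  interpret AR: dg_algebra K A.root by (rule A.root_dg_algebra)
  show "dga_map K A.root B.root (coprod_map K A.E R' R u)"
  proof (rule dga_mapI)
    show "coprod_map K A.E R' R u \<in> module_hom K A.root B.root"
      using module_hom_add[OF dga_map_hom[OF c]] module_hom_smult[OF dga_map_hom[OF c]] cl
      by (intro module_homI) (simp_all add: B.root_eq)
  qed (use dga_map_mult[OF c] dga_map_one[OF c] dga_map_diff[OF c] dga_map_grade[OF c] cl AR.grade_carrier
      in \<open>simp_all add: B.root_eq\<close>)
qed

theorem root_adj_natural:
  assumes S: "dg_algebra K S" and S': "dg_algebra K S'" and v: "v \<in> dga_hom K S S'" and f: "f \<in> dga_hom K B.root S"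
  shows "root_adj K V R' S' (compose (carrier A.root) (v \<circ> f) (root_map K V R' R u)) =
    compose (carrier R') (tensor_map K A.E S S' v \<circ> root_adj K V R S f) u"
proof -
  let ?f = "compose (carrier A.root) (v \<circ> f) (root_map K V R' R u)"
  let ?cm = "coprod_map K A.E R' R u" and ?t = "tensor_map K A.E S S' v" and ?x = "root_ext K V R S f"
  note t = tensor_map_hom[OF S S' A.E.dg_algebra_axioms dga_hom_map[OF v]]
  interpret S: dg_algebra K S by fact
  have x: "B.ext_prop S f ?x" by (rule B.root_ext_prop[OF S dga_hom_map[OF f]])
  then have xh: "?x \<in> dga_hom K B.P (tensor K S A.E)" by (simp add: B.ext_prop_def)
  \<comment> \<open>the extension of the left hand side, by uniqueness\<close>
  let ?h = "restrict (\<lambda>w. ?t (?x (?cm w))) (carrier A.P)"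
  have "A.ext_prop S' ?f ?h"
    unfolding A.ext_prop_def
  proof (intro conjI ballI)
    show "?h \<in> dga_hom K A.P (tensor K S' A.E)"
      by (rule restrict_dga_hom[OF A.CP.PD.pre_dga dga_map_comp[OF dga_hom_map[OF cm(1)]
              dga_map_comp[OF dga_hom_map[OF xh] dga_hom_map[OF t(1)]]]])
    show "?h w = pure_tensor K S' A.E (?f w) \<one>\<^bsub>A.E\<^esub>" if w: "w \<in> carrier A.root" for w
    proof -
      have c: "?cm w \<in> carrier B.root" using root_map_closed[OF w] by (simp add: root_map_app[OF w])
      then have "?x (?cm w) = pure_tensor K S A.E (f (?cm w)) \<one>\<^bsub>A.E\<^esub>" using x by (simp add: B.ext_prop_def)
      then show ?thesis using t(2)[OF dga_map_closed[OF dga_hom_map[OF f] c] A.E.one_closed] w A.root_P[OF w]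
        by (simp add: compose_def root_map_app[OF w])
    qed
    show "?h (A.inr m) = pure_tensor K S' A.E \<one>\<^bsub>S'\<^esub> m" if m: "m \<in> carrier A.E" for m
      using x m t(2)[OF S.one_closed m] dga_map_one[OF dga_hom_map[OF v]] dga_map_closed[OF A.CP.inr_map m]
      by (simp add: cm(3) B.ext_prop_def)
  qed
  then have e: "root_ext K V R' S' ?f = ?h" by (rule A.root_ext_eqI[OF S'])
  show ?thesis
  proof
    fix x
    show "root_adj K V R' S' ?f x = compose (carrier R') (?t \<circ> root_adj K V R S f) u x"
    proof (cases "x \<in> carrier R'")
      case True
      have "root_adj K V R' S' ?f x = ?t (?x (B.inl (u x)))"
        unfolding A.root_adj_app[OF True] e using dga_map_closed[OF A.CP.inl_map True] True by (simp add: cm(2))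
      then show ?thesis using True dga_map_closed[OF u True] by (simp add: compose_def B.root_adj_app)
    next
      case False
      then show ?thesis by (simp add: root_adj_def compose_def)
    qed
  qed
qed

end

section \<open>The abelianized root algebra\<close>

text \<open>The universal property of the abelianization, for the extensional maps of \<^const>\<open>dga_hom\<close>.\<close>

lemma (in dg_algebra) abelianization_adj_bij:
  assumes B: "comm_dg_algebra K B"
  shows "bij_betw (\<lambda>h. compose (carrier A) h (ab_proj A)) (dga_hom K (abelianization A) B) (dga_hom K A B)"
  unfolding bij_betw_def
proof (intro conjI inj_onI equalityI subsetI)
  fix h h' assume h: "h \<in> dga_hom K (abelianization A) B" "h' \<in> dga_hom K (abelianization A) B"
    and eq: "compose (carrier A) h (ab_proj A) = compose (carrier A) h' (ab_proj A)"
  show "h = h'"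
  proof (rule dga_hom_eqI[OF h])
    fix y assume "y \<in> carrier (abelianization A)"
    then obtain x where x: "x \<in> carrier A" "y = ab_proj A x" by (auto simp: abelianization_carrier)
    then show "h y = h' y" using fun_cong[OF eq, of x] by (simp add: compose_def)
  qed
next
  fix f assume "f \<in> (\<lambda>h. compose (carrier A) h (ab_proj A)) ` dga_hom K (abelianization A) B"
  then obtain h where h: "h \<in> dga_hom K (abelianization A) B" "f = compose (carrier A) h (ab_proj A)" by blast
  show "f \<in> dga_hom K A B"
    using restrict_dga_hom[OF pre_dga dga_map_comp[OF ab_proj_map dga_hom_map[OF h(1)]]] by (simp add: h(2) compose_def)
next
  fix f assume f: "f \<in> dga_hom K A B"
  have pd: "pre_dga K (abelianization A)"
    using abelianization_comm_dg_algebra by (intro dg_algebra.pre_dga comm_dg_algebra.axioms)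
  obtain h where h: "dga_map K (abelianization A) B h" "\<And>x. x \<in> carrier A \<Longrightarrow> h (ab_proj A x) = f x"
    using abelianization_lift[OF B dga_hom_map[OF f]] by blast
  let ?h = "restrict h (carrier (abelianization A))"
  have "compose (carrier A) ?h (ab_proj A) = f"
    using f h(2) abelianization_carrier by (auto simp: compose_def fun_eq_iff dga_hom_iff extensional_def)
  then show "f \<in> (\<lambda>h. compose (carrier A) h (ab_proj A)) ` dga_hom K (abelianization A) B"
    using restrict_dga_hom[OF pd h(1)] by blast
qed

context root_algebra
begin

theorem rep_comm_dg_algebra: "comm_dg_algebra K (dg_rep K V R)"
  unfolding dg_rep_def by (rule dg_algebra.abelianization_comm_dg_algebra[OF root_dg_algebra])

theorem rep_adj_bij:
  assumes B: "comm_dg_algebra K B"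
  shows "bij_betw (rep_adj K V R B) (dga_hom K (dg_rep K V R) B) (dga_hom K R (tensor K B E))"
proof -
  have "rep_adj K V R B = root_adj K V R B \<circ> (\<lambda>h. compose (carrier root) h (ab_proj root))"
    by (simp add: fun_eq_iff rep_adj_def)
  then show ?thesis
    using bij_betw_trans[OF dg_algebra.abelianization_adj_bij[OF root_dg_algebra B]
        root_adj_bij[OF comm_dg_algebra.axioms(1)[OF B]]] by (simp add: dg_rep_def)
qed

end

context root_algebra_map
begin

lemma rep_map_app:
  shows "rep_map K V R' R u \<in> dga_hom K (dg_rep K V R') (dg_rep K V R)"
    and "\<And>w. w \<in> carrier A.root \<Longrightarrow> rep_map K V R' R u (ab_proj A.root w) = ab_proj B.root (root_map K V R' R u w)"
proof -
  interpret AR: dg_algebra K A.root by (rule A.root_dg_algebra)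
  interpret BR: dg_algebra K B.root by (rule B.root_dg_algebra)
  let ?Q = "\<lambda>h. h \<in> dga_hom K (dg_rep K V R') (dg_rep K V R) \<and>
     (\<forall>w\<in>carrier A.root. h (ab_proj A.root w) = ab_proj B.root (root_map K V R' R u w))"
  obtain h where h: "dga_map K (dg_rep K V R') (dg_rep K V R) h"
    "\<And>w. w \<in> carrier A.root \<Longrightarrow> h (ab_proj A.root w) = ab_proj B.root (root_map K V R' R u w)"
    using AR.abelianization_lift[OF BR.abelianization_comm_dg_algebra dga_map_comp[OF root_map_map BR.ab_proj_map]]
    unfolding dg_rep_def by blast
  have car: "carrier (dg_rep K V R') = ab_proj A.root ` carrier A.root"
    unfolding dg_rep_def by (rule AR.abelianization_carrier)
  let ?r = "restrict h (carrier (dg_rep K V R'))"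
  have r: "?r \<in> dga_hom K (dg_rep K V R') (dg_rep K V R)"
    by (rule restrict_dga_hom[OF dg_algebra.pre_dga[OF comm_dg_algebra.axioms(1)[OF A.rep_comm_dg_algebra]] h(1)])
  have "?Q ?r" using r h(2) by (simp add: car)
  moreover have "h' = ?r" if h': "?Q h'" for h'
  proof (rule dga_hom_eqI[OF _ r])
    show "h' \<in> dga_hom K (dg_rep K V R') (dg_rep K V R)" using h' by blast
    fix y assume y: "y \<in> carrier (dg_rep K V R')"
    then obtain w where "w \<in> carrier A.root" "y = ab_proj A.root w" by (auto simp: car)
    then show "h' y = ?r y" using h' h(2) y by simp
  qed
  ultimately have "?Q (THE h. ?Q h)" by (rule theI)
  then show "rep_map K V R' R u \<in> dga_hom K (dg_rep K V R') (dg_rep K V R)"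
    "\<And>w. w \<in> carrier A.root \<Longrightarrow> rep_map K V R' R u (ab_proj A.root w) = ab_proj B.root (root_map K V R' R u w)"
    by (simp_all add: rep_map_def)
qed

theorem rep_adj_natural:
  assumes S: "comm_dg_algebra K S" and S': "comm_dg_algebra K S'" and v: "v \<in> dga_hom K S S'"
    and h: "h \<in> dga_hom K (dg_rep K V R) S"
  shows "rep_adj K V R' S' (compose (carrier (dg_rep K V R')) (v \<circ> h) (rep_map K V R' R u)) =
    compose (carrier R') (tensor_map K A.E S S' v \<circ> rep_adj K V R S h) u"
proof -
  interpret AR: dg_algebra K A.root by (rule A.root_dg_algebra)
  interpret BR: dg_algebra K B.root by (rule B.root_dg_algebra)
  let ?f = "compose (carrier B.root) h (ab_proj B.root)"
  have f: "?f \<in> dga_hom K B.root S"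
    using bij_betw_apply[OF BR.abelianization_adj_bij[OF S]] h by (simp add: dg_rep_def)
  have car: "ab_proj A.root w \<in> carrier (dg_rep K V R')" if "w \<in> carrier A.root" for w
    using that unfolding dg_rep_def AR.abelianization_carrier by blast
  have "compose (carrier A.root) (compose (carrier (dg_rep K V R')) (v \<circ> h) (rep_map K V R' R u)) (ab_proj A.root) =
    compose (carrier A.root) (v \<circ> ?f) (root_map K V R' R u)"
    using car root_map_closed rep_map_app(2) by (auto simp: compose_def fun_eq_iff)
  then show ?thesis
    using root_adj_natural[OF comm_dg_algebra.axioms(1)[OF S] comm_dg_algebra.axioms(1)[OF S'] v f]
    by (simp add: rep_adj_def)
qed

end

section \<open>The two adjunctions\<close>

theorem lemma1:
  fixes K :: "'k ring" and V :: "('k, 'v) dg"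
    and R :: "('k, 'r) dg" and R' :: "('k, 'r2) dg"
    and S :: "('k, 's) dg" and S' :: "('k, 's2) dg"
    and B :: "('k, 'b) dg" and B' :: "('k, 'b2) dg"
  assumes "field K"
    and "cochain_complex K V" and "total_fin_dim K V" and "carrier V \<noteq> {\<zero>\<^bsub>V\<^esub>}"
    and "dg_algebra K R" and "dg_algebra K R'"
    and "dg_algebra K S" and "dg_algebra K S'"
    and "comm_dg_algebra K B" and "comm_dg_algebra K B'"
  shows
    "(dg_algebra K (dg_root K V R) \<and> dg_algebra K (tensor K S (End_dg K V)) \<and>
      bij_betw (root_adj K V R S)
        (dga_hom K (dg_root K V R) S) (dga_hom K R (tensor K S (End_dg K V))) \<and>
      (\<forall>u\<in>dga_hom K R' R. \<forall>v\<in>dga_hom K S S'. \<forall>f\<in>dga_hom K (dg_root K V R) S.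
        root_adj K V R' S' (compose (carrier (dg_root K V R')) (v \<circ> f) (root_map K V R' R u)) =
        compose (carrier R') (tensor_map K (End_dg K V) S S' v \<circ> root_adj K V R S f) u)) \<and>
     (comm_dg_algebra K (dg_rep K V R) \<and> dg_algebra K (tensor K B (End_dg K V)) \<and>
      bij_betw (rep_adj K V R B)
        (dga_hom K (dg_rep K V R) B) (dga_hom K R (tensor K B (End_dg K V))) \<and>
      (\<forall>u\<in>dga_hom K R' R. \<forall>v\<in>dga_hom K B B'. \<forall>h\<in>dga_hom K (dg_rep K V R) B.
        rep_adj K V R' B' (compose (carrier (dg_rep K V R')) (v \<circ> h) (rep_map K V R' R u)) =
        compose (carrier R') (tensor_map K (End_dg K V) B B' v \<circ> rep_adj K V R B h) u))"
proof -
  interpret R: root_algebra K V R by (intro root_algebra.intro root_algebra_axioms.intro assms)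
  interpret R': root_algebra K V R' by (intro root_algebra.intro root_algebra_axioms.intro assms)
  have BB: "dg_algebra K B" "dg_algebra K B'" using assms(9,10) by (simp_all add: comm_dg_algebra.axioms(1))
  have T: "dg_algebra K (tensor K S (End_dg K V))" "dg_algebra K (tensor K B (End_dg K V))"
    using assms(7) BB(1) R.E.dg_algebra_axioms by (simp_all add: dg_pair.tensor_dg_algebra dg_pair.intro)
  have m: "root_algebra_map K V R' R u" if "u \<in> dga_hom K R' R" for u
    by (intro root_algebra_map.intro R'.root_algebra_axioms R.root_algebra_axioms root_algebra_map_axioms.intro
        dga_hom_map[OF that])
  show ?thesis
  proof (intro conjI ballI)
    show "dg_algebra K (dg_root K V R)" by (rule R.root_dg_algebra)
    show "dg_algebra K (tensor K S (End_dg K V))" "dg_algebra K (tensor K B (End_dg K V))" by (rule T)+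
    show "bij_betw (root_adj K V R S) (dga_hom K (dg_root K V R) S) (dga_hom K R (tensor K S (End_dg K V)))"
      by (rule R.root_adj_bij[OF assms(7)])
    show "comm_dg_algebra K (dg_rep K V R)" by (rule R.rep_comm_dg_algebra)
    show "bij_betw (rep_adj K V R B) (dga_hom K (dg_rep K V R) B) (dga_hom K R (tensor K B (End_dg K V)))"
      by (rule R.rep_adj_bij[OF assms(9)])
  next
    fix u v f assume "u \<in> dga_hom K R' R" "v \<in> dga_hom K S S'" "f \<in> dga_hom K (dg_root K V R) S"
    then show "root_adj K V R' S' (compose (carrier (dg_root K V R')) (v \<circ> f) (root_map K V R' R u)) =
        compose (carrier R') (tensor_map K (End_dg K V) S S' v \<circ> root_adj K V R S f) u"
      by (intro root_algebra_map.root_adj_natural[OF m assms(7,8)])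
  next
    fix u v h assume "u \<in> dga_hom K R' R" "v \<in> dga_hom K B B'" "h \<in> dga_hom K (dg_rep K V R) B"
    then show "rep_adj K V R' B' (compose (carrier (dg_rep K V R')) (v \<circ> h) (rep_map K V R' R u)) =
        compose (carrier R') (tensor_map K (End_dg K V) B B' v \<circ> rep_adj K V R B h) u"
      by (intro root_algebra_map.rep_adj_natural[OF m assms(9,10)])
  qed
qed

end
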